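(* Let $\alpha<\omega_1$ be a countable ordinal. For a Banach space $X$ with separable dual, the following are equivalent: (i) $X$ has Szlenk index at most $\omega^{\alpha\omega}$. (ii) $X$ satisfies subsequential $T_{\alpha,c}$-upper tree estimates for some $c\in(0,1)$. (iii) $X$ embeds (isomorphically) into a Banach space $Z$ with an FDD $(E_i)$ which satisfies subsequential $T_{\alpha,c}$-upper block estimates in $Z$ for some $c\in(0,1)$.
   Context: Szlenk index. For a Banach space $X$ with separable dual, $\varepsilon>0$ and a $w^*$-compact $K\subset X^*$ let $K'_\varepsilon$ be the set of $x^*\in K$ such that $\operatorname{diam}(U\cap K)>\varepsilon$ (norm diameter) for every $w^*$-neighbourhood $U$ of $x^*$. Put $K^{(0)}_\varepsilon=B_{X^*}$ (the closed unit ball of $X^*$), $K^{(\beta+1)}_\varepsilon=(K^{(\beta)}_\varepsilon)'_\varepsilon$, and $K^{(\beta)}_\varepsilon=\bigcap_{\gamma<\beta}K^{(\gamma)}_\varepsilon$ for limit $\beta$. The Szlenk index of $X$ is $\sup_{\varepsilon>0}\min\{\beta: K^{(\beta)}_\varepsilon=\emptyset\}$. Exponents such as $\omega^{\alpha\omega}$ are ordinal exponentiation with $\alpha\omega=\alpha\cdot\omega$ the ordinal product. Tsirelson spaces. The Schreier families $\mathcal S_\alpha$, $\alpha<\omega_1$, of finite subsets of $\mathbb N$ are: $\mathcal S_0=\{\emptyset\}\cup\{\{n\}:n\in\mathbb N\}$; $\mathcal S_{\alpha+1}=\{\emptyset\}\cup\{\bigcup_{i=1}^nE_i: n\le\min E_1,\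 E_1<\dots<E_n,\ \emptyset\ne E_i\in\mathcal S_\alpha\}$; for limit $\alpha$, with a fixed sequence $\alpha_n\nearrow\alpha$, $\mathcal S_\alpha=\{\emptyset\}\cup\{E:\exists n\le\min E,\ E\in\mathcal S_{\alpha_n}\}$. For $c\in(0,1)$, $T_{\alpha,c}$ (the Tsirelson space of order $\alpha$ and parameter $c$) is the completion of $c_{00}$ (finitely supported scalar sequences) under the unique norm satisfying $$\|x\|=\max\Big\{\|x\|_\infty,\ \sup c\sum_{i=1}^n\|A_ix\|\Big\},$$ where the supremum is over all $n\in\mathbb N$ and finite nonempty sets $A_1<\dots<A_n$ in $\mathbb N$ with $\{\min A_1,\dots,\min A_n\}\in\mathcal S_\alpha$, and $A_ix$ is the restriction of $x$ to $A_i$. "$T_{\alpha,c}$-upper estimates" means $V$-upper estimates (defined next) with $V=(v_i)$ the unit vector basis of $T_{\alpha,c}$. Upper estimates. A sequence $(x_i)$ is $C$-dominated by $(y_i)$ if $\|\sum a_ix_i\|\le C\|\sum a_iy_i\|$ for all finitely supported scalars $(a_i)$. An FDD of $Z$ is a sequence $(E_i)$ of finite-dimensional subspaces such that every $z\in Z$ has a unique expansion $z=\sum z_i$, $z_i\in E_i$; $\mathrm{supp}_E(z)=\{i:z_i\ne0\}$; a block sequence is a sequence of nonzero finitely supported vectors with $\max\mathrm{supp}_E(z_i)<\min\mathrm{supp}_E(z_{i+1})$. $(E_i)$ satisfies subsequential $V$-upper block estimates in $Z$ if there is $C\ge1$ such that every normalized block sequence $(z_i)$ of $(E_i)$ is $C$-dominated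 by $(v_{m_i})$, $m_i=\min\mathrm{supp}_E(z_i)$. Let $T_\infty^{\mathrm{even}}=\{(n_1,\dots,n_{2\ell}): n_1<\dots<n_{2\ell}\text{ in }\mathbb N,\ \ell\in\mathbb N\}$. A weakly null even tree in $X$ is a family $(x_\beta)_{\beta\in T_\infty^{\mathrm{even}}}$ of norm-one vectors in $X$ such that all nodes $(x_{(n_1,\dots,n_{2\ell-1},k)})_{k=n_{2\ell-1}+1}^\infty$ are weakly null. $X$ satisfies subsequential $V$-upper tree estimates if there is $C\ge1$ such that for every weakly null even tree in $X$ there are $n_1<n_2<\cdots$ such that $(x_{(n_1,\dots,n_{2\ell})})_{\ell=1}^\infty$ is $C$-dominated by $(v_{n_{2\ell-1}})_{\ell=1}^\infty$.
   Formalization: For α = 0 the implication (ii)⇒(i) is dropped, as it is false there: ω^{0·ω} = 1 and T_{0,c} is c_0, so X = c_0 satisfies (ii) and (iii) but not (i); (i)⇒(ii) and (ii)⇔(iii) are kept for all α, and the full equivalence holds for all α ≥ 1. *)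

theory Defs
  imports "HOL-Analysis.Analysis" "HOL-Library.Countable_Set_Type"
begin

section \<open>Countable ordinals\<close>

text \<open>The elements of the initial well-order of type \<open>\<omega>\<^sub>1\<close>, i.e. the ordinals \<open>\<alpha> < \<omega>\<^sub>1\<close>.\<close>

typedef ctbl_ord = "Field (cardSuc natLeq)"
  using Field_cardSuc_not_empty[OF natLeq_Card_order] by blast

lemma cardSuc_natLeq_wo: "Well_order (cardSuc natLeq)"
  by (rule cardSuc_Well_order[OF natLeq_Card_order])

instantiation ctbl_ord :: wellorder
begin

definition less_eq_ctbl_ord :: "ctbl_ord \<Rightarrow> ctbl_ord \<Rightarrow> bool" where
  "(x :: ctbl_ord) \<le> y \<longleftrightarrow> (Rep_ctbl_ord x, Rep_ctbl_ord y) \<in> cardSuc natLeq"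

definition less_ctbl_ord :: "ctbl_ord \<Rightarrow> ctbl_ord \<Rightarrow> bool" where
  "(x :: ctbl_ord) < y \<longleftrightarrow> x \<le> y \<and> x \<noteq> y"

instance
proof
  let ?r = "cardSuc natLeq"
  note wo = cardSuc_natLeq_wo[unfolded well_order_on_def linear_order_on_def
      partial_order_on_def preorder_on_def]
  fix x y z :: ctbl_ord
  show "x \<le> x"
    using wo Rep_ctbl_ord[of x] by (auto simp: less_eq_ctbl_ord_def refl_on_def)
  show trans: "x \<le> y \<Longrightarrow> y \<le> z \<Longrightarrow> x \<le> z"
    using wo by (auto simp: less_eq_ctbl_ord_def trans_def)
  show anti: "x \<le> y \<Longrightarrow> y \<le> x \<Longrightarrow> x = y"
    using wo Rep_ctbl_ord_inject[of x y] by (simp add: less_eq_ctbl_ord_def antisym_def)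
  show "(x < y) = (x \<le> y \<and> \<not> y \<le> x)"
    using anti \<open>x \<le> x\<close> by (auto simp: less_ctbl_ord_def)
  show "x \<le> y \<or> y \<le> x"
    using wo Rep_ctbl_ord[of x] Rep_ctbl_ord[of y] \<open>x \<le> x\<close>
    by (cases "x = y") (auto simp: less_eq_ctbl_ord_def total_on_def Rep_ctbl_ord_inject)
next
  fix P :: "ctbl_ord \<Rightarrow> bool" and a
  assume step: "\<And>x. (\<And>y. y < x \<Longrightarrow> P y) \<Longrightarrow> P x"
  have "wf (cardSuc natLeq - Id)"
    using cardSuc_natLeq_wo by (simp add: well_order_on_def)
  then have "wf (inv_image (cardSuc natLeq - Id) Rep_ctbl_ord)"
    by (rule wf_inv_image)
  then show "P a"
  proof (induction a)
    case (less x)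
    show ?case
    proof (rule step)
      fix y assume "y < x"
      then show "P y"
        by (intro less)
          (auto simp: less_ctbl_ord_def less_eq_ctbl_ord_def inv_image_def Rep_ctbl_ord_inject)
    qed
  qed
qed

end

lemma countable_lessThan_ctbl_ord:
  includes cardinal_syntax
  shows "countable {..<b :: ctbl_ord}"
proof -
  let ?r = "cardSuc natLeq"
  have co: "Card_order ?r" by (rule cardSuc_Card_order[OF natLeq_Card_order])
  have "|underS ?r (Rep_ctbl_ord b)| <o ?r"
    by (rule card_of_underS[OF co Rep_ctbl_ord])
  then have "|underS ?r (Rep_ctbl_ord b)| \<le>o natLeq"
    using cardSuc_ordLeq_ordLess[OF natLeq_Card_order card_of_Card_order] by blast
  then have c: "countable (underS ?r (Rep_ctbl_ord b))"
    by (simp add: countable_card_le_natLeq)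
  have "Rep_ctbl_ord ` {..<b} \<subseteq> underS ?r (Rep_ctbl_ord b)"
    by (auto simp: underS_def less_ctbl_ord_def less_eq_ctbl_ord_def Rep_ctbl_ord_inject)
  then have "countable (Rep_ctbl_ord ` {..<b})" using c countable_subset by blast
  then show ?thesis
    by (rule countable_image_inj_on) (auto simp: inj_on_def Rep_ctbl_ord_inject)
qed

lemma uncountable_ctbl_ord:
  includes cardinal_syntax
  shows "uncountable (UNIV :: ctbl_ord set)"
proof
  let ?r = "cardSuc natLeq"
  assume "countable (UNIV :: ctbl_ord set)"
  then have "countable (range Rep_ctbl_ord)" by simp
  then have "countable (Field ?r)"
    using type_definition.Rep_range[OF type_definition_ctbl_ord] by simp
  then have "|Field ?r| \<le>o natLeq" by (simp add: countable_card_le_natLeq)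
  moreover have "?r =o |Field ?r|"
    using card_of_Field_ordIso[OF cardSuc_Card_order[OF natLeq_Card_order]] ordIso_symmetric by blast
  ultimately have "?r \<le>o natLeq" using ordIso_ordLeq_trans by blast
  then show False
    using cardSuc_greater[OF natLeq_Card_order] not_ordLeq_ordLess by blast
qed

lemma countable_bounded_ctbl_ord:
  assumes "countable (A :: ctbl_ord set)"
  shows "\<exists>b. \<forall>a\<in>A. a < b"
proof (rule ccontr)
  assume "\<not> ?thesis"
  then have "\<exists>a\<in>A. b \<le> a" for b
    by (meson not_le)
  then have "UNIV = (\<Union>a\<in>A. insert a {..<a})"
    unfolding order_le_less by blast
  moreover have "countable (\<Union>a\<in>A. insert a {..<a})"
    using assms countable_lessThan_ctbl_ord by auto
  ultimately show False using uncountable_ctbl_ord by simp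
qed

definition is_osup :: "ctbl_ord set \<Rightarrow> ctbl_ord \<Rightarrow> bool" where
  "is_osup A s \<longleftrightarrow> (\<forall>a\<in>A. a \<le> s) \<and> (\<forall>t. (\<forall>a\<in>A. a \<le> t) \<longrightarrow> s \<le> t)"

definition osup :: "ctbl_ord set \<Rightarrow> ctbl_ord" where
  "osup A = (LEAST s. \<forall>a\<in>A. a \<le> s)"

lemma is_osup_osup:
  assumes "countable A"
  shows "is_osup A (osup A)"
proof -
  obtain b where "\<forall>a\<in>A. a \<le> b"
    using countable_bounded_ctbl_ord[OF assms] by (meson less_imp_le)
  then show ?thesis
    unfolding is_osup_def osup_def
    using LeastI[of "\<lambda>s. \<forall>a\<in>A. a \<le> s" b] Least_le[of "\<lambda>s. \<forall>a\<in>A. a \<le> s"] by blast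
qed

definition osuc :: "ctbl_ord \<Rightarrow> ctbl_ord" where
  "osuc b = (LEAST d. b < d)"

lemma less_osuc: "b < osuc b"
proof -
  obtain d where "b < d" using countable_bounded_ctbl_ord[of "{b}"] by auto
  then show ?thesis unfolding osuc_def by (rule LeastI)
qed

lemma less_osuc_iff: "d < osuc b \<longleftrightarrow> d \<le> b"
proof
  show "d < osuc b \<Longrightarrow> d \<le> b"
    using not_less_Least[of d "\<lambda>d. b < d"] unfolding osuc_def by simp
  show "d \<le> b \<Longrightarrow> d < osuc b"
    by (rule le_less_trans[OF _ less_osuc])
qed

lemma osuc_inject: "osuc b = osuc d \<longleftrightarrow> b = d"
proof
  assume "osuc b = osuc d"
  then have "b < osuc d" "d < osuc b" using less_osuc[of b] less_osuc[of d] by simp_all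
  then show "b = d" by (simp add: less_osuc_iff)
qed simp

instantiation ctbl_ord :: zero
begin
definition zero_ctbl_ord :: ctbl_ord where "(0 :: ctbl_ord) = (LEAST b. True)"
instance ..
end

lemma zero_le_ctbl_ord: "0 \<le> (b :: ctbl_ord)"
  unfolding zero_ctbl_ord_def by (rule Least_le) simp

lemma osuc_neq_0: "osuc b \<noteq> 0"
  using less_osuc[of b] zero_le_ctbl_ord[of b] by auto

definition is_limit :: "ctbl_ord \<Rightarrow> bool" where
  "is_limit b \<longleftrightarrow> b \<noteq> 0 \<and> (\<forall>d. b \<noteq> osuc d)"

text \<open>Transfinite recursion with initial value \<open>z\<close>, successor step \<open>s\<close> and limit step \<open>l\<close>. The
  tests \<open>d < b\<close> are only needed for termination; see the three equations below.\<close>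

function ord_rec ::
  "'r \<Rightarrow> (ctbl_ord \<Rightarrow> 'r \<Rightarrow> 'r) \<Rightarrow> (ctbl_ord \<Rightarrow> (ctbl_ord \<Rightarrow> 'r) \<Rightarrow> 'r) \<Rightarrow> ctbl_ord \<Rightarrow> 'r" where
  "ord_rec z s l b =
     (if b = 0 then z
      else if \<exists>d<b. b = osuc d
        then let d = (THE d. d < b \<and> b = osuc d) in s d (if d < b then ord_rec z s l d else undefined)
      else l b (\<lambda>d. if d < b then ord_rec z s l d else undefined))"
  by auto

termination
proof (relation "inv_image {(x, y). x < y} (\<lambda>(z, s, l, b). b)")
  show "wf (inv_image {(x :: ctbl_ord, y). x < y} (\<lambda>(z :: 'r, s :: ctbl_ord \<Rightarrow> 'r \<Rightarrow> 'r,
      l :: ctbl_ord \<Rightarrow> (ctbl_ord \<Rightarrow> 'r) \<Rightarrow> 'r, b). b))"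
    by (rule wf_inv_image[OF wellorder_class.wf])
qed (simp_all add: inv_image_def)

declare ord_rec.simps [simp del]

lemma ord_rec_0: "ord_rec z s l 0 = z"
  by (simp add: ord_rec.simps)

lemma ord_rec_osuc: "ord_rec z s l (osuc b) = s b (ord_rec z s l b)"
proof -
  have "(THE d. d < osuc b \<and> osuc b = osuc d) = b"
    by (rule the_equality) (auto simp: osuc_inject less_osuc)
  moreover have "\<exists>d<osuc b. osuc b = osuc d"
    using less_osuc by blast
  ultimately show ?thesis
    by (simp only: ord_rec.simps[of z s l "osuc b"] osuc_neq_0 less_osuc Let_def if_True if_False)
qed

lemma ord_rec_limit:
  "is_limit b \<Longrightarrow> ord_rec z s l b = l b (\<lambda>d. if d < b then ord_rec z s l d else undefined)"
  by (simp add: ord_rec.simps[of z s l b] is_limit_def)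

instantiation ctbl_ord :: "{one, plus, times}"
begin
definition one_ctbl_ord :: ctbl_ord where "(1 :: ctbl_ord) = osuc 0"
definition plus_ctbl_ord :: "ctbl_ord \<Rightarrow> ctbl_ord \<Rightarrow> ctbl_ord" where
  "(a :: ctbl_ord) + b = ord_rec a (\<lambda>_. osuc) (\<lambda>b f. osup (f ` {..<b})) b"
definition times_ctbl_ord :: "ctbl_ord \<Rightarrow> ctbl_ord \<Rightarrow> ctbl_ord" where
  "(a :: ctbl_ord) * b = ord_rec 0 (\<lambda>_ x. x + a) (\<lambda>b f. osup (f ` {..<b})) b"
instance ..
end

text \<open>Ordinal exponentiation, for a nonzero base.\<close>

definition oexp :: "ctbl_ord \<Rightarrow> ctbl_ord \<Rightarrow> ctbl_ord" where
  "oexp a b = ord_rec 1 (\<lambda>_ x. x * a) (\<lambda>b f. osup (f ` {..<b})) b"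

definition omega :: ctbl_ord where
  "omega = (LEAST b. is_limit b)"


section \<open>The Szlenk index\<close>

text \<open>On the dual \<open>'a \<Rightarrow>\<^sub>L real\<close> the library's strong operator topology (pointwise convergence)
  is the weak-star topology.\<close>

abbreviation weak_star :: "('a::real_normed_vector \<Rightarrow>\<^sub>L real) topology" where
  "weak_star \<equiv> strong_operator_topology"

definition szlenk_step ::
  "real \<Rightarrow> ('a::real_normed_vector \<Rightarrow>\<^sub>L real) set \<Rightarrow> ('a \<Rightarrow>\<^sub>L real) set" where
  "szlenk_step \<epsilon> K = {f \<in> K. \<forall>U. openin weak_star U \<and> f \<in> U \<longrightarrow> \<epsilon> < diameter (U \<inter> K)}"

definition szlenk_derived :: "real \<Rightarrow> ctbl_ord \<Rightarrow> ('a::real_normed_vector \<Rightarrow>\<^sub>L real) set" where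
  "szlenk_derived \<epsilon> = ord_rec (cball 0 1) (\<lambda>_. szlenk_step \<epsilon>) (\<lambda>b K. \<Inter>d\<in>{..<b}. K d)"

text \<open>\<open>\<sigma> = sup\<^bsub>\<epsilon>>0\<^esub> min {\<beta>. K\<^sup>\<beta>\<^sub>\<epsilon> = \<emptyset>}\<close>, the minima and the supremum being required to
  exist among the countable ordinals. A relation rather than a function, so that no value is invented
  for a space whose index is not countable.\<close>

definition has_szlenk_index :: "'a::real_normed_vector itself \<Rightarrow> ctbl_ord \<Rightarrow> bool" where
  "has_szlenk_index X \<sigma> \<longleftrightarrow>
     (\<exists>m :: real \<Rightarrow> ctbl_ord.
        (\<forall>\<epsilon>>0. szlenk_derived \<epsilon> (m \<epsilon>) = ({} :: ('a \<Rightarrow>\<^sub>L real) set) \<and>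
                (\<forall>b. szlenk_derived \<epsilon> b = ({} :: ('a \<Rightarrow>\<^sub>L real) set) \<longrightarrow> m \<epsilon> \<le> b)) \<and>
        is_osup (m ` {0<..}) \<sigma>)"


section \<open>Schreier families and Tsirelson spaces\<close>

text \<open>Throughout, the index set \<open>\<nat> = {1, 2, \<dots>}\<close> is rendered as \<open>{1..} :: nat set\<close>; sequences
  are functions on \<open>nat\<close> whose value at \<open>0\<close> is irrelevant or fixed to be zero.\<close>

definition successive :: "nat \<Rightarrow> (nat \<Rightarrow> nat set) \<Rightarrow> bool" where
  "successive n A \<longleftrightarrow>
     (\<forall>i\<in>{1..n}. finite (A i) \<and> A i \<noteq> {} \<and> A i \<subseteq> {1..}) \<and>
     (\<forall>i\<in>{1..n}. \<forall>j\<in>{1..n}. i < j \<longrightarrow> (\<forall>a\<in>A i. \<forall>b\<in>A j. a < b))"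

text \<open>The choice of a sequence \<open>\<xi>\<^sub>n \<nearrow> \<xi>\<close> for each limit ordinal \<open>\<xi>\<close>.\<close>

definition approximating :: "(ctbl_ord \<Rightarrow> nat \<Rightarrow> ctbl_ord) \<Rightarrow> bool" where
  "approximating s \<longleftrightarrow>
     (\<forall>\<xi>. is_limit \<xi> \<longrightarrow> strict_mono_on {1..} (s \<xi>) \<and> is_osup (s \<xi> ` {1..}) \<xi>)"

definition Schreier :: "(ctbl_ord \<Rightarrow> nat \<Rightarrow> ctbl_ord) \<Rightarrow> ctbl_ord \<Rightarrow> nat set set" where
  "Schreier s = ord_rec
     ({{}} \<union> {{n} | n. 1 \<le> n})
     (\<lambda>_ S. {{}} \<union> {(\<Union>i\<in>{1..n}. E i) | n E.
         1 \<le> n \<and> successive n E \<and> n \<le> Min (E 1) \<and> (\<forall>i\<in>{1..n}. E i \<in> S)})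
     (\<lambda>\<xi> S. {{}} \<union> {E. finite E \<and> E \<noteq> {} \<and> (\<exists>n\<in>{1..}. n \<le> Min E \<and> E \<in> S (s \<xi> n))})"

definition c00 :: "(nat \<Rightarrow> real) set" where
  "c00 = {x. x 0 = 0 \<and> finite {k. x k \<noteq> 0}}"

definition restr :: "nat set \<Rightarrow> (nat \<Rightarrow> real) \<Rightarrow> nat \<Rightarrow> real" where
  "restr A x = (\<lambda>k. if k \<in> A then x k else 0)"

definition norm_on_c00 :: "((nat \<Rightarrow> real) \<Rightarrow> real) \<Rightarrow> bool" where
  "norm_on_c00 N \<longleftrightarrow>
     (\<forall>x\<in>c00. 0 \<le> N x \<and> (N x = 0 \<longleftrightarrow> x = (\<lambda>_. 0))) \<and>
     (\<forall>x\<in>c00. \<forall>a. N (\<lambda>k. a * x k) = \<bar>a\<bar> * N x) \<and>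
     (\<forall>x\<in>c00. \<forall>y\<in>c00. N (\<lambda>k. x k + y k) \<le> N x + N y)"

text \<open>For a norm \<open>N\<close> both suprema below are over nonempty bounded sets of reals.\<close>

definition Tsirelson_equation ::
  "nat set set \<Rightarrow> real \<Rightarrow> ((nat \<Rightarrow> real) \<Rightarrow> real) \<Rightarrow> bool" where
  "Tsirelson_equation S c N \<longleftrightarrow>
     (\<forall>x\<in>c00. N x = max (SUP k. \<bar>x k\<bar>)
        (Sup {c * (\<Sum>i=1..n. N (restr (A i) x)) | n A.
                1 \<le> n \<and> successive n A \<and> (\<lambda>i. Min (A i)) ` {1..n} \<in> S}))"

text \<open>The norm of \<open>T\<^bsub>\<alpha>,c\<^esub>\<close> on finitely supported sequences, extended by \<open>0\<close> to other sequences in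
  order to make it unique as a total function. Upper estimates only involve finite linear
  combinations of the unit vectors, so the completion is not needed.\<close>

definition Tsirelson_norm ::
  "(ctbl_ord \<Rightarrow> nat \<Rightarrow> ctbl_ord) \<Rightarrow> ctbl_ord \<Rightarrow> real \<Rightarrow> (nat \<Rightarrow> real) \<Rightarrow> real" where
  "Tsirelson_norm s \<alpha> c =
     (THE N. norm_on_c00 N \<and> Tsirelson_equation (Schreier s \<alpha>) c N \<and> (\<forall>x. x \<notin> c00 \<longrightarrow> N x = 0))"

definition unit_vec :: "nat \<Rightarrow> nat \<Rightarrow> real" where
  "unit_vec m = (\<lambda>k. if k = m then 1 else 0)"


section \<open>Upper estimates\<close>

text \<open>\<open>(x\<^sub>i)\<^bsub>i\<ge>1\<^esub>\<close> is \<open>C\<close>-dominated by \<open>(y\<^sub>i)\<^bsub>i\<ge>1\<^esub>\<close>, where \<open>y\<^sub>i\<close> are vectors of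
  \<open>c\<^sub>0\<^sub>0\<close> normed by \<open>N\<close>.\<close>

definition dominated ::
  "real \<Rightarrow> (nat \<Rightarrow> 'a::real_normed_vector) \<Rightarrow> ((nat \<Rightarrow> real) \<Rightarrow> real) \<Rightarrow> (nat \<Rightarrow> nat \<Rightarrow> real) \<Rightarrow> bool"
  where
  "dominated C x N y \<longleftrightarrow>
     (\<forall>F a. finite F \<and> F \<subseteq> {1..} \<longrightarrow>
        norm (\<Sum>i\<in>F. a i *\<^sub>R x i) \<le> C * N (\<lambda>k. \<Sum>i\<in>F. a i * y i k))"

definition weakly_null :: "(nat \<Rightarrow> 'a::real_normed_vector) \<Rightarrow> bool" where
  "weakly_null x \<longleftrightarrow> (\<forall>f :: 'a \<Rightarrow>\<^sub>L real. (\<lambda>k. blinfun_apply f (x k)) \<longlonglongrightarrow> 0)"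

definition increasing_tuple :: "nat list \<Rightarrow> bool" where
  "increasing_tuple t \<longleftrightarrow> sorted_wrt (<) t \<and> set t \<subseteq> {1..}"

definition even_tuples :: "nat list set" where
  "even_tuples = {t. increasing_tuple t \<and> t \<noteq> [] \<and> even (length t)}"

text \<open>In the second clause \<open>x (t @ [k])\<close> is a member of the family only for \<open>k > last t\<close>; the
  finitely many other values do not affect the weak limit.\<close>

definition weakly_null_even_tree :: "(nat list \<Rightarrow> 'a::real_normed_vector) \<Rightarrow> bool" where
  "weakly_null_even_tree x \<longleftrightarrow>
     (\<forall>t\<in>even_tuples. norm (x t) = 1) \<and>
     (\<forall>t. increasing_tuple t \<and> odd (length t) \<longrightarrow> weakly_null (\<lambda>k. x (t @ [k])))"

text \<open>Subsequential \<open>V\<close>-upper tree estimates, for \<open>V\<close> the unit vector basis of \<open>c\<^sub>0\<^sub>0\<close> normed by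
  \<open>N\<close>. The list is \<open>(n\<^sub>1, \<dots>, n\<^bsub>2l\<^esub>)\<close>.\<close>

definition upper_tree_estimates ::
  "'a::real_normed_vector itself \<Rightarrow> ((nat \<Rightarrow> real) \<Rightarrow> real) \<Rightarrow> bool" where
  "upper_tree_estimates X N \<longleftrightarrow>
     (\<exists>C\<ge>1. \<forall>x :: nat list \<Rightarrow> 'a. weakly_null_even_tree x \<longrightarrow>
        (\<exists>n :: nat \<Rightarrow> nat. strict_mono_on {1..} n \<and> 1 \<le> n 1 \<and>
           dominated C (\<lambda>l. x (map n [1..<2 * l + 1])) N (\<lambda>l. unit_vec (n (2 * l - 1)))))"

text \<open>An FDD \<open>(E\<^sub>i)\<^bsub>i\<ge>1\<^esub>\<close> of the linear subspace \<open>Z\<close>; the index \<open>0\<close> is padded by the zero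
  space. The subspaces \<open>E\<^sub>i\<close> may be zero.\<close>

definition fdd :: "'z::real_normed_vector set \<Rightarrow> (nat \<Rightarrow> 'z set) \<Rightarrow> bool" where
  "fdd Z E \<longleftrightarrow>
     E 0 = {0} \<and>
     (\<forall>i. E i \<subseteq> Z \<and> (\<exists>B. finite B \<and> E i = span B)) \<and>
     (\<forall>z\<in>Z. \<exists>!zs. (\<forall>i. zs i \<in> E i) \<and> zs sums z)"

definition fdd_supp :: "(nat \<Rightarrow> 'z::real_normed_vector set) \<Rightarrow> 'z \<Rightarrow> nat set" where
  "fdd_supp E z = {i. (THE zs. (\<forall>i. zs i \<in> E i) \<and> zs sums z) i \<noteq> 0}"

definition normalized_block_sequence ::
  "'z::real_normed_vector set \<Rightarrow> (nat \<Rightarrow> 'z set) \<Rightarrow> (nat \<Rightarrow> 'z) \<Rightarrow> bool" where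
  "normalized_block_sequence Z E z \<longleftrightarrow>
     (\<forall>i\<ge>1. z i \<in> Z \<and> norm (z i) = 1 \<and> finite (fdd_supp E (z i)) \<and>
              Max (fdd_supp E (z i)) < Min (fdd_supp E (z (i + 1))))"

definition upper_block_estimates ::
  "'z::real_normed_vector set \<Rightarrow> (nat \<Rightarrow> 'z set) \<Rightarrow> ((nat \<Rightarrow> real) \<Rightarrow> real) \<Rightarrow> bool" where
  "upper_block_estimates Z E N \<longleftrightarrow>
     (\<exists>C\<ge>1. \<forall>z. normalized_block_sequence Z E z \<longrightarrow>
        dominated C z N (\<lambda>i. unit_vec (Min (fdd_supp E (z i)))))"

definition embeds_into :: "'a::real_normed_vector itself \<Rightarrow> 'z::real_normed_vector set \<Rightarrow> bool" where
  "embeds_into X Z \<longleftrightarrow>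
     (\<exists>T :: 'a \<Rightarrow> 'z. bounded_linear T \<and> range T \<subseteq> Z \<and> (\<exists>\<delta>>0. \<forall>x. \<delta> * norm x \<le> norm (T x)))"

section \<open>The three conditions\<close>

definition szlenk_index_at_most :: "'a::banach itself \<Rightarrow> ctbl_ord \<Rightarrow> bool" where
  "szlenk_index_at_most X b \<longleftrightarrow> (\<exists>\<sigma>. has_szlenk_index X \<sigma> \<and> \<sigma> \<le> b)"

definition Tsirelson_upper_tree_estimates ::
  "'a::banach itself \<Rightarrow> (ctbl_ord \<Rightarrow> nat \<Rightarrow> ctbl_ord) \<Rightarrow> ctbl_ord \<Rightarrow> bool" where
  "Tsirelson_upper_tree_estimates X s \<alpha> \<longleftrightarrow>
     (\<exists>c. 0 < c \<and> c < 1 \<and> upper_tree_estimates X (Tsirelson_norm s \<alpha> c))"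

text \<open>The Banach space \<open>Z\<close> ranges over the complete linear subspaces of the type \<open>'z\<close>. A space
  with an FDD is separable, hence isometric to a subspace of \<open>\<ell>\<^sub>\<infinity>\<close>; with \<open>'z = linfty\<close> all
  Banach spaces with an FDD are therefore covered up to isometry.\<close>

type_synonym linfty = "nat \<Rightarrow>\<^sub>C real"

definition embeds_with_Tsirelson_upper_fdd ::
  "'a::banach itself \<Rightarrow> 'z::real_normed_vector itself \<Rightarrow> (ctbl_ord \<Rightarrow> nat \<Rightarrow> ctbl_ord) \<Rightarrow> ctbl_ord \<Rightarrow> bool" where
  "embeds_with_Tsirelson_upper_fdd X W s \<alpha> \<longleftrightarrow>
     (\<exists>(Z :: 'z set) E. complete Z \<and> subspace Z \<and> embeds_into X Z \<and> fdd Z E \<and>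
        (\<exists>c. 0 < c \<and> c < 1 \<and> upper_block_estimates Z E (Tsirelson_norm s \<alpha> c)))"

end

theory Submission
  imports Defs
begin

text \<open>Suppose that the derivation of order \<open>\<omega>\<^bsup>\<alpha>n\<^esup>\<close> of the dual ball is empty for some \<open>\<epsilon>\<close>. Submultiplicativity makes
  the derivations at the scales \<open>\<epsilon> ^ (2 ^ k)\<close> vanish at orders that are again powers of \<open>\<omega>\<^sup>\<alpha>\<close>. Cut the
  ball into finer and finer weak-star cells and choose in every cell a functional that lies, scale by
  scale, in the deepest possible derivation. Along a branch of cells these functionals oscillate by more
  than a given scale only when an ordinal below such a power drops; if the levels are thin enough, the
  drops happen at indices forming sets of an iterated Schreier family, so the oscillations have upper
  \<open>T\<^bsub>\<alpha>,c\<^esub>\<close>-estimates. Evaluation along the branches embeds \<open>X\<close> into a space of functions on the tree of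
  cells, normed by differences relative to these oscillations, and the levels of the tree form the FDD.

  Block estimates pass to tree estimates by perturbing a branch of a weakly null tree to blocks.

  Conversely, a point of a derivation of order \<open>\<omega>\<^bsup>\<alpha>n\<^esup>\<close> yields a weakly null tree all of whose branches are
  seminormalized against a single functional as long as a clock starting at \<open>\<omega>\<^bsup>\<alpha>n\<^esup>\<close> runs. For \<open>\<alpha> \<noteq> 0\<close>
  this is long enough to reach a convex combination of unit vectors of small \<open>T\<^bsub>\<alpha>,c\<^esub>\<close>-norm, which
  contradicts the tree estimates. For \<open>\<alpha> = 0\<close> the tree estimates instead bound the total norm
  variation along weak-star convergent branches, and this bound replaces the derivations.\<close>

text \<open>The obstacle on the way to (iii): the oscillation estimate bounds a weighted sum over
  subwindows of levels by a constant, whereas the norm of the new space needs a bound relative to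
  the oscillation of the enclosing window. Hence the oscillation is enlarged to a weight, the
  supremum of all Tsirelson-normalized combinations of oscillations on successive subwindows.
  Near-optimal families for subwindows join to one for the window, up to a block domination that
  replaces \<open>c\<close> by a larger \<open>c'\<close>. The scales shrink like
  \<open>(1/2) ^ (2 ^ k)\<close> because submultiplicativity doubles the order \<open>n\<close> of
  \<open>wpow \<alpha> n\<close> whenever a scale is squared. Admissible sets of order
  \<open>m\<close> cost a factor \<open>1 / c ^ m\<close>, and a \<open>c\<close> near 1 keeps the
  sum over all scales finite. For \<alpha> = 0, condition (i) says index at most 1, which holds only
  in finite dimensions, whereas the norm of T_{0,c} is the maximum norm and c_0 satisfies (ii) and
  (iii). So (ii) cannot lead through (i) there: the theorem restricts that implication, and a second
  source of branch systems is needed.\<close>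

type_synonym 'a dual = "'a \<Rightarrow>\<^sub>L real"

section \<open>Ordinal arithmetic\<close>

lemma ord_induct [case_names zero suc lim]:
  assumes "P 0" and "!!b. P b ==> P (osuc b)"
    and "!!b. is_limit b ==> (!!d. d < b ==> P d) ==> P b"
  shows "P b"
proof (induction b rule: less_induct)
  case (less b)
  consider "b = 0" | d where "b = osuc d" | "is_limit b" by (auto simp: is_limit_def)
  thus ?case by cases (use assms less less_osuc in auto)
qed

lemma osuc_le_iff: "osuc d <= b \<longleftrightarrow> d < b" using less_osuc_iff[of b d] by (metis not_le)

lemma osuc_less_limit: "is_limit b ==> d < b ==> osuc d < b" by (metis is_limit_def osuc_le_iff order_le_less)

lemma limit_pos: "is_limit b ==> 0 < b" by (metis is_limit_def zero_le_ctbl_ord order_le_less)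

lemma not_less_0 [simp]: "~ b < (0 :: ctbl_ord)" using zero_le_ctbl_ord[of b] by auto

lemma le_0_iff [simp]: "b <= (0 :: ctbl_ord) \<longleftrightarrow> b = 0" using zero_le_ctbl_ord[of b] by auto

lemma gt_0_iff: "(0 :: ctbl_ord) < b \<longleftrightarrow> b ~= 0" using zero_le_ctbl_ord[of b] by auto

lemma less_osup_iff: "countable A ==> x < osup A \<longleftrightarrow> (EX a:A. x < a)"
  using is_osup_osup[of A] unfolding is_osup_def by (meson not_le order_less_le_trans)

lemma less_osup_lessThan_iff: "x < osup (f ` {..<b :: ctbl_ord}) \<longleftrightarrow> (EX d<b. x < f d)"
  using less_osup_iff[of "f ` {..<b}"] countable_lessThan_ctbl_ord by auto

text \<open>Continuity at limits is expressed through the elements below the value, so that no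
  supremum has to be formed. Addition, multiplication with a positive left factor and exponentiation
  are all handled as normal functions of the right argument.\<close>

definition normal :: "(ctbl_ord => ctbl_ord) => bool" where
  "normal F \<longleftrightarrow> (ALL b. F b < F (osuc b)) & (ALL b. is_limit b --> (ALL x. x < F b \<longleftrightarrow> (EX d<b. x < F d)))"

lemma normal_less_limit: "normal F ==> is_limit b ==> x < F b ==> EX d<b. x < F d" by (simp add: normal_def)

lemma normal_strict_mono:
  assumes "normal F" and "d < b"
  shows "F d < F b" using `d < b`
proof (induction b rule: ord_induct)
  case (suc b)
  thus ?case using assms(1) unfolding normal_def by (metis less_osuc_iff order_le_less order_less_trans)
next
  case (lim b)
  have "osuc d < b" using lim by (simp add: osuc_less_limit)
  moreover have "F d < F (osuc d)" using assms(1) by (simp add: normal_def)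
  ultimately show ?case using assms(1) lim unfolding normal_def by blast
qed simp

lemma normal_less_iff: "normal F ==> F d < F b \<longleftrightarrow> d < b" by (metis normal_strict_mono less_asym linorder_neqE)

lemma normal_le_iff: "normal F ==> F d <= F b \<longleftrightarrow> d <= b" by (metis normal_less_iff not_le)

lemma normal_limit:
  assumes "normal F" and "is_limit b"
  shows "is_limit (F b)"
proof -
  have "F 0 < F b" using assms normal_strict_mono limit_pos by blast
  moreover have "F b ~= osuc e" for e
  proof
    assume e: "F b = osuc e"
    then obtain d where d: "d < b" "e < F d" using assms less_osuc[of e] unfolding normal_def by metis
    thus False using e normal_strict_mono[OF assms(1) d(1)] by (metis less_osuc_iff not_le)
  qed
  ultimately show ?thesis unfolding is_limit_def by auto
qed

lemma normal_comp:
  assumes "normal F" "normal G"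
  shows "normal (%b. F (G b))" unfolding normal_def
proof safe
  fix b show "F (G b) < F (G (osuc b))" using assms by (simp add: normal_less_iff less_osuc)
next
  fix b x assume b: "is_limit b" "x < F (G b)"
  have "is_limit (G b)" using assms(2) b(1) by (rule normal_limit)
  then obtain e where e: "e < G b" "x < F e" using assms(1) b(2) unfolding normal_def by metis
  obtain d where d: "d < b" "e < G d" using assms(2) b(1) e(1) unfolding normal_def by metis
  hence "x < F (G d)" using normal_strict_mono[OF assms(1) d(2)] e(2) by simp
  thus "EX d<b. x < F (G d)" using d by blast
next
  fix b x d assume "is_limit b" "d < b" "x < F (G d)"
  moreover have "F (G d) < F (G b)" using assms `d < b` by (simp add: normal_less_iff)
  ultimately show "x < F (G b)" by simp
qed

text \<open>A normal function is determined by its value at 0 and its successor step. The algebraic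
  laws below, such as associativity, left distributivity and \<open>wexp_add\<close>, compare two
  normal functions of the last argument in this way.\<close>

lemma normal_eqI:
  assumes "normal F" "normal G" "F 0 = G 0" "!!b. F b = G b ==> F (osuc b) = G (osuc b)"
  shows "F b = G b"
proof (induction b rule: ord_induct)
  case (lim b)
  have "x < F b \<longleftrightarrow> x < G b" for x using assms lim unfolding normal_def by metis
  thus ?case by (metis less_irrefl linorder_neqE)
qed (use assms in auto)

text \<open>The least \<open>e\<close> with \<open>y < F e\<close> is not 0 and, by continuity, not
  a limit; its predecessor is \<open>m\<close>. Left subtraction and division with remainder are the
  cases of addition and multiplication.\<close>

lemma normal_div:
  assumes "normal F" "F 0 <= y"
  obtains m where "F m <= y" "y < F (osuc m)"
proof -
  have id: "b <= F b" for b
  proof (induction b rule: less_induct)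
    case (less b)
    show ?case
    proof (rule ccontr)
      assume "~ b <= F b"
      thus False using less[of "F b"] normal_strict_mono[OF assms(1), of "F b" b] by (meson not_le)
    qed
  qed
  define e where "e = (LEAST e. y < F e)"
  have "y < F (osuc y)" using id[of "osuc y"] less_osuc[of y] by (rule order_less_le_trans[rotated])
  hence e: "y < F e" unfolding e_def by (rule LeastI)
  have lt: "F d <= y" if "d < e" for d using not_less_Least[of d "%e. y < F e"] that unfolding e_def by auto
  have "e ~= 0" using e assms(2) by auto
  moreover have "~ is_limit e" using e lt assms(1) unfolding normal_def by (metis not_le)
  ultimately obtain m where "e = osuc m" by (auto simp: is_limit_def)
  thus ?thesis using that e lt less_osuc by blast
qed

section \<open>Ordinal addition and multiplication\<close>

lemma oadd_0 [simp]: "a + 0 = (a :: ctbl_ord)"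
  and oadd_osuc [simp]: "a + osuc b = osuc (a + b)"
  and normal_oadd: "normal ((+) a)"
proof -
  show 1: "a + 0 = a" "!!b. a + osuc b = osuc (a + b)" by (simp_all add: plus_ctbl_ord_def ord_rec_0 ord_rec_osuc)
  have "a + b = osup ((+) a ` {..<b})" if "is_limit b" for b
    using that unfolding plus_ctbl_ord_def by (simp add: ord_rec_limit)
  thus "normal ((+) a)" by (simp add: normal_def 1 less_osuc less_osup_lessThan_iff)
qed

lemma oadd_0_left [simp]: "0 + b = (b :: ctbl_ord)"
proof (rule normal_eqI[of "(+) 0" "%b. b", OF normal_oadd])
  show "normal (%b. b)" unfolding normal_def using less_osuc osuc_less_limit order_less_trans by blast
qed simp_all

lemma oadd_less_iff [simp]: "a + b < a + d \<longleftrightarrow> b < (d :: ctbl_ord)" by (rule normal_less_iff[OF normal_oadd])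

lemma oadd_le_iff [simp]: "a + b <= a + d \<longleftrightarrow> b <= (d :: ctbl_ord)" by (rule normal_le_iff[OF normal_oadd])

lemma le_oadd: "a <= a + (b :: ctbl_ord)" using oadd_le_iff[of a 0 b] by (simp add: zero_le_ctbl_ord)

lemma oadd_assoc: "(a + b) + d = a + (b + d :: ctbl_ord)" by (rule normal_eqI[of "(+) (a + b)" "%d. a + (b + d)"])
    (auto intro: normal_oadd normal_comp[OF normal_oadd normal_oadd])

lemma le_obtain_oadd:
  assumes "a <= (b :: ctbl_ord)" obtains d where "b = a + d"
proof -
  obtain d where "a + d <= b" "b < a + osuc d" using normal_div[OF normal_oadd, of a b] assms by auto
  thus ?thesis using that by (auto simp: less_osuc_iff)
qed

lemma omult_0 [simp]: "a * 0 = (0 :: ctbl_ord)"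
  and omult_osuc [simp]: "a * osuc b = a * b + a"
  and omult_limit: "is_limit b ==> x < a * b \<longleftrightarrow> (EX d<b. x < a * d)"
proof -
  show 1: "a * 0 = 0" "!!b. a * osuc b = a * b + a" by (simp_all add: times_ctbl_ord_def ord_rec_0 ord_rec_osuc)
  have "a * b = osup ((*) a ` {..<b})" if "is_limit b" for b
    using that unfolding times_ctbl_ord_def by (simp add: ord_rec_limit)
  thus "is_limit b ==> x < a * b \<longleftrightarrow> (EX d<b. x < a * d)" by (simp add: less_osup_lessThan_iff)
qed

lemma normal_omult: "0 < a ==> normal ((*) a)"
  unfolding normal_def using oadd_less_iff[of _ 0 a] by (auto simp: omult_limit)

lemma omult_0_left [simp]: "0 * b = (0 :: ctbl_ord)"
proof (induction b rule: ord_induct)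
  case (lim b)
  hence "~ 0 < 0 * b" by (auto simp: omult_limit)
  thus ?case by (simp add: gt_0_iff)
qed simp_all

lemma omult_le_mono: "b <= d ==> a * b <= a * (d :: ctbl_ord)"
  by (cases "a = 0") (auto simp: normal_le_iff[OF normal_omult] gt_0_iff)

lemma oadd_omult_distrib: "a * (b + d) = a * b + a * (d :: ctbl_ord)"
proof (cases "a = 0")
  case False
  hence n: "normal ((*) a)" by (simp add: normal_omult gt_0_iff)
  show ?thesis by (rule normal_eqI[of "%d. a * (b + d)" "%d. a * b + a * d"])
      (auto simp: oadd_assoc intro: normal_comp[OF n normal_oadd] normal_comp[OF normal_oadd n])
qed simp

lemma omult_pos: "0 < a ==> 0 < b ==> 0 < a * (b :: ctbl_ord)"
  using normal_strict_mono[OF normal_omult, of a 0 b] by simp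

lemma omult_assoc: "(a * b) * d = a * (b * d :: ctbl_ord)"
proof (cases "a = 0 \<or> b = 0")
  case False
  hence n: "normal ((*) a)" "normal ((*) b)" "normal ((*) (a * b))"
    by (simp_all add: normal_omult gt_0_iff[symmetric] omult_pos)
  show ?thesis by (rule normal_eqI[of "(*) (a * b)" "%d. a * (b * d)"])
      (auto simp: oadd_omult_distrib intro: n normal_comp[OF n(1,2)])
qed auto

lemma omult_div:
  assumes "x < a * (b :: ctbl_ord)"
  obtains m r where "m < b" "r < a" "x = a * m + r"
proof -
  have a: "0 < a" using assms by (cases "a = 0") (auto simp: gt_0_iff)
  obtain m where m: "a * m <= x" "x < a * osuc m"
    using normal_div[OF normal_omult[OF a], of x] zero_le_ctbl_ord[of x] by auto
  obtain r where r: "x = a * m + r" using m(1) by (rule le_obtain_oadd)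
  hence "r < a" using m(2) by simp
  moreover have "a * m < a * b" using m(1) assms by simp
  hence "m < b" using normal_less_iff[OF normal_omult[OF a]] by simp
  ultimately show ?thesis using that r by blast
qed

lemma omult_add_less:
  assumes "r < a" "m < b"
  shows "a * m + r < a * (b :: ctbl_ord)"
proof -
  have "a * m + r < a * osuc m" using assms by simp
  also have "\<dots> <= a * b" using assms by (intro omult_le_mono) (simp add: osuc_le_iff)
  finally show ?thesis .
qed

text \<open>Expansions to base \<open>a\<close> compare lexicographically. Both the descents below a
  product and the ranks that combine several scales rest on this.\<close>

lemma omult_add_less_iff:
  assumes "r < a" "r' < (a :: ctbl_ord)"
  shows "a * m + r < a * m' + r' \<longleftrightarrow> m < m' \<or> (m = m' & r < r')"
proof -
  consider "m < m'" | "m = m'" | "m' < m" by (meson linorder_less_linear)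
  thus ?thesis
  proof cases
    case 1
    hence "a * m + r < a * m'" using assms omult_add_less by blast
    thus ?thesis using 1 le_oadd order_less_le_trans by blast
  next
    case 3
    hence "a * m' + r' < a * m" using assms omult_add_less by blast
    hence "a * m' + r' < a * m + r" using le_oadd order_less_le_trans by blast
    thus ?thesis using 3 by (metis less_asym less_irrefl)
  qed simp
qed

section \<open>Finite ordinals and powers of omega\<close>

primrec fin_ord :: "nat => ctbl_ord" where
  "fin_ord 0 = 0" | "fin_ord (Suc n) = osuc (fin_ord n)"

lemma fin_ord_mono: "m <= n ==> fin_ord m <= fin_ord n"
proof (rule lift_Suc_mono_le[of fin_ord])
  show "fin_ord n <= fin_ord (Suc n)" for n using less_osuc[of "fin_ord n"] by simp
qed

lemma omega_limit: "is_limit omega"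
  and less_omega_iff: "x < omega \<longleftrightarrow> (EX n. x = fin_ord n)"
proof -
  define w where "w = osup (range fin_ord)"
  have w: "x < w \<longleftrightarrow> (EX n. x < fin_ord n)" for x unfolding w_def by (subst less_osup_iff) auto
  have "is_limit w" unfolding is_limit_def
  proof safe
    assume "w = 0" thus False using w[of 0] less_osuc[of 0] by (metis fin_ord.simps not_less_0)
  next
    fix d assume d: "w = osuc d"
    then obtain n where "d < fin_ord n" using w[of d] less_osuc by auto
    hence "osuc d < fin_ord (Suc n)" by (simp add: less_osuc_iff osuc_le_iff)
    thus False using d w[of w] by (metis less_irrefl)
  qed
  thus lim: "is_limit omega" unfolding omega_def by (rule LeastI)
  have "fin_ord n < omega" for n by (induction n) (auto simp: limit_pos osuc_less_limit lim)
  moreover have "EX n. x = fin_ord n" if "x < omega" for x using that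
  proof (induction x rule: ord_induct)
    case zero thus ?case by (metis fin_ord.simps(1))
  next
    case (suc b)
    then obtain n where "b = fin_ord n" using less_osuc[of b] by (metis order_less_trans)
    thus ?case by (metis fin_ord.simps(2))
  next
    case (lim b)
    thus ?case using not_less_Least[of b is_limit] unfolding omega_def by simp
  qed
  ultimately show "x < omega \<longleftrightarrow> (EX n. x = fin_ord n)" by blast
qed

lemma one_less_omega: "1 < omega" "0 < omega"
  using less_omega_iff[of 1] less_omega_iff[of 0] unfolding one_ctbl_ord_def by (metis fin_ord.simps)+

lemma less_one_iff [simp]: "(x :: ctbl_ord) < 1 \<longleftrightarrow> x = 0" by (simp add: one_ctbl_ord_def less_osuc_iff)

lemma omult_1 [simp]: "(a :: ctbl_ord) * 1 = a" "1 * a = (a :: ctbl_ord)"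
proof -
  show "a * 1 = a" by (simp add: one_ctbl_ord_def)
  have n: "normal (%b. b)" unfolding normal_def using less_osuc osuc_less_limit order_less_trans by blast
  have "0 < (1 :: ctbl_ord)" by (simp add: one_ctbl_ord_def less_osuc)
  thus "1 * a = a" using normal_eqI[of "(*) 1" "%b. b", OF normal_omult n] by (simp add: one_ctbl_ord_def)
qed

abbreviation wexp :: "ctbl_ord => ctbl_ord" where "wexp \<equiv> oexp omega"

lemma wexp_0 [simp]: "wexp 0 = 1"
  and wexp_osuc [simp]: "wexp (osuc b) = wexp b * omega"
  and wexp_pos [simp]: "0 < wexp b"
  and normal_wexp: "normal wexp"
proof -
  show 1: "wexp 0 = 1" "!!b. wexp (osuc b) = wexp b * omega" by (simp_all add: oexp_def ord_rec_0 ord_rec_osuc)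
  have l: "wexp b = osup (wexp ` {..<b})" if "is_limit b" for b
    using that unfolding oexp_def by (simp add: ord_rec_limit)
  show pos: "0 < wexp b" for b
  proof (induction b rule: ord_induct)
    case (lim b)
    thus ?case using limit_pos[of b] by (auto simp: l less_osup_lessThan_iff)
  next
    case (suc b) thus ?case by (simp add: 1 omult_pos one_less_omega)
  qed (simp add: 1 gt_0_iff one_ctbl_ord_def osuc_neq_0)
  have "wexp b < wexp (osuc b)" for b
    using normal_strict_mono[OF normal_omult[OF pos] one_less_omega(1)] unfolding 1 by simp
  moreover have "x < wexp b \<longleftrightarrow> (EX d<b. x < wexp d)" if "is_limit b" for x b
    by (subst l[OF that]) (rule less_osup_lessThan_iff)
  ultimately show "normal wexp" unfolding normal_def by blast
qed

lemma wexp_le_iff [simp]: "wexp a <= wexp b \<longleftrightarrow> a <= b" by (rule normal_le_iff[OF normal_wexp])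

lemma wexp_add: "wexp (a + b) = wexp a * wexp b"
proof (rule normal_eqI[of "%b. wexp (a + b)" "%b. wexp a * wexp b"])
  show "normal (%b. wexp (a + b))" by (rule normal_comp[OF normal_wexp normal_oadd])
  show "normal (%b. wexp a * wexp b)" by (rule normal_comp[OF normal_omult[OF wexp_pos] normal_wexp])
qed (simp_all add: omult_assoc)

definition wpow :: "ctbl_ord => nat => ctbl_ord" where
  "wpow \<alpha> n = wexp (\<alpha> * fin_ord n)"

lemma wpow_0 [simp]: "wpow \<alpha> 0 = 1"
  and wpow_Suc: "wpow \<alpha> (Suc n) = wpow \<alpha> n * wexp \<alpha>"
  and wpow_pos [simp]: "0 < wpow \<alpha> n" by (simp_all add: wpow_def wexp_add)

lemma wpow_add: "wpow \<alpha> (m + n) = wpow \<alpha> m * wpow \<alpha> n" by (induction n) (simp_all add: wpow_Suc omult_assoc)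

lemma wpow_mono: "m <= n ==> wpow \<alpha> m <= wpow \<alpha> n" by (simp add: wpow_def omult_le_mono fin_ord_mono)

lemma wpow_le: "wpow \<alpha> n <= wexp (\<alpha> * omega)"
  unfolding wpow_def wexp_le_iff using less_omega_iff by (intro omult_le_mono) (blast intro: less_imp_le)

text \<open>For nonzero \<alpha> this is continuity at the limit \<open>\<alpha> * omega\<close>.
  For \<alpha> = 0 all powers equal 1, and \<open>n = 0\<close> serves.\<close>

lemma less_wexp_omult_omega:
  assumes "x < wexp (\<alpha> * omega)"
  obtains n where "x < wpow \<alpha> n"
proof (cases "\<alpha> = 0")
  case True
  thus ?thesis using assms that[of 0] by simp
next
  case False
  hence n: "normal ((*) \<alpha>)" by (simp add: normal_omult gt_0_iff)
  obtain g where g: "g < \<alpha> * omega" "x < wexp g"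
    using normal_less_limit[OF normal_wexp normal_limit[OF n omega_limit] assms] by metis
  then obtain n where "g < \<alpha> * fin_ord n" by (auto simp: omult_limit[OF omega_limit] less_omega_iff)
  hence "x < wpow \<alpha> n" unfolding wpow_def using g(2) normal_strict_mono[OF normal_wexp] order_less_trans by metis
  thus ?thesis by (rule that)
qed

lemma wexp_mult_fin_less: "wexp \<alpha> * fin_ord n < wexp (osuc \<alpha>)"
proof -
  have "fin_ord n < omega" using less_omega_iff by blast
  thus ?thesis unfolding wexp_osuc by (rule normal_strict_mono[OF normal_omult[OF wexp_pos]])
qed

section \<open>Schreier families\<close>

lemma approximating_less:
  assumes "approximating s" "is_limit \<xi>" "1 <= n"
  shows "s \<xi> n < \<xi>"
proof -
  have "s \<xi> n < s \<xi> (Suc n)" using assms unfolding approximating_def by (auto simp: strict_mono_on_def)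
  moreover have "s \<xi> (Suc n) <= \<xi>" using assms unfolding approximating_def is_osup_def by auto
  ultimately show ?thesis by simp
qed

lemma approximating_cofinal:
  assumes "approximating s" "is_limit \<xi>" "d < \<xi>"
  obtains n where "1 <= n" "d < s \<xi> n"
proof -
  have "~ (ALL a:s \<xi> ` {1..}. a <= d)" using assms unfolding approximating_def is_osup_def by (meson not_le)
  thus ?thesis using that by (auto simp: not_le)
qed

lemma Schreier_0: "Schreier s 0 = {{}} \<union> {{n} | n. 1 <= n}" by (simp add: Schreier_def ord_rec_0)

lemma Schreier_osuc:
  "Schreier s (osuc \<alpha>) = {{}} \<union> {(\<Union>i\<in>{1..n}. E i) | n E.
     1 <= n & successive n E & n <= Min (E 1) & (ALL i:{1..n}. E i : Schreier s \<alpha>)}"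
  by (simp add: Schreier_def ord_rec_osuc)

lemma Schreier_limit:
  assumes "approximating s" "is_limit \<xi>"
  shows "Schreier s \<xi> =
    {{}} \<union> {E. finite E & E ~= {} & (EX n:{1..}. n <= Min E & E : Schreier s (s \<xi> n))}"
  unfolding Schreier_def using approximating_less[OF assms]
  by (subst ord_rec_limit[OF assms(2)]) (auto cong: rev_conj_cong)

lemma Schreier_limit_iff:
  assumes "approximating s" "is_limit \<xi>" "E ~= {}"
  shows "E : Schreier s \<xi> \<longleftrightarrow> finite E & (EX n>=1. n <= Min E & E : Schreier s (s \<xi> n))"
  using assms(3) unfolding Schreier_limit[OF assms(1,2)] by blast

lemma empty_Schreier: "approximating s ==> {} : Schreier s \<alpha>" by (cases "\<alpha> = 0"; cases "is_limit \<alpha>")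
    (auto simp: Schreier_0 Schreier_osuc Schreier_limit is_limit_def)

lemma Schreier_finite:
  assumes "approximating s" "F : Schreier s \<alpha>"
  shows "finite F & F \<subseteq> {1..}" using assms(2)
proof (induction \<alpha> arbitrary: F rule: ord_induct)
  case (suc b)
  thus ?case by (auto simp: Schreier_osuc successive_def)
next
  case (lim b)
  thus ?case using approximating_less[OF assms(1) lim.hyps(1)] by (auto simp: Schreier_limit[OF assms(1)])
qed (auto simp: Schreier_0)

text \<open>A partition into successive sets amounts to a monotone labelling, with the sets as
  fibres. The labels may come from any linear order, so thinning a set out or pulling it back
  requires no renumbering.\<close>

lemma Schreier_osucI:
  fixes f :: "nat => 'b::linorder"
  assumes "finite G" "G ~= {}" "G \<subseteq> {1..}" and mono: "!!g g'. g : G ==> g' : G ==> g < g' ==> f g <= f g'"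
    and n: "card (f ` G) <= Min G" and S: "!!v. v : f ` G ==> {g : G. f g = v} : Schreier s \<alpha>"
  shows "G : Schreier s (osuc \<alpha>)"
proof -
  define n where "n = card (f ` G)"
  \<comment> \<open>The position of a label among all labels; this numbers the fibres from 1 to
    \<open>n\<close>.\<close>
  define h where "h v = card {u : f ` G. u <= v}" for v
  define E where "E i = {g : G. h (f g) = i}" for i
  have fin: "finite (f ` G)" using assms by simp
  have h_less: "h v < h w" if "v : f ` G" "w : f ` G" "v < w" for v w
  proof -
    have "w \<notin> {u : f ` G. u <= v}" "w : {u : f ` G. u <= w}" using that by auto
    moreover have "{u : f ` G. u <= v} \<subseteq> {u : f ` G. u <= w}" using that by auto
    ultimately have "{u : f ` G. u <= v} \<subset> {u : f ` G. u <= w}" by blast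
    thus ?thesis unfolding h_def by (rule psubset_card_mono[rotated]) (use fin in simp)
  qed
  have inj: "inj_on h (f ` G)" by (rule inj_onI) (metis h_less less_irrefl linorder_neqE)
  have hn: "1 <= h v & h v <= n" if "v : f ` G" for v
  proof -
    have "0 < h v" unfolding h_def using that fin by (subst card_gt_0_iff) auto
    moreover have "h v <= n" unfolding h_def n_def by (rule card_mono) (use fin in auto)
    ultimately show ?thesis by simp
  qed
  have "h ` (f ` G) = {1..n}" by (rule card_subset_eq) (use hn in "auto simp: card_image[OF inj] n_def")
  hence ex: "EX v:f ` G. h v = i" if "i : {1..n}" for i using that by (metis imageE)
  have E_fiber: "E (h v) = {g : G. f g = v}" if "v : f ` G" for v using that inj by (auto simp: E_def inj_on_def)
  have succ: "successive n E" unfolding successive_def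
  proof (intro conjI ballI impI)
    fix i assume "i : {1..n}"
    then obtain v where v: "v : f ` G" "i = h v" using ex by metis
    thus "finite (E i)" "E i ~= {}" "E i \<subseteq> {1..}" using assms by (auto simp: E_fiber)
  next
    fix i j a b assume "i < j" "a : E i" "b : E j"
    hence ab: "a : G" "b : G" "h (f a) < h (f b)" by (auto simp: E_def)
    hence "f a < f b" using h_less by (metis imageI less_asym less_irrefl linorder_neqE)
    thus "a < b" using mono[OF ab(2,1)] by (metis ab(3) linorder_neqE leD less_irrefl)
  qed
  have n1: "1 <= n" unfolding n_def using fin assms by (simp add: Suc_le_eq card_gt_0_iff)
  have "n <= Min (E 1)"
  proof -
    have "E 1 ~= {}" "finite (E 1)" "E 1 \<subseteq> G" using succ n1 by (auto simp: successive_def E_def)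
    hence "Min G <= Min (E 1)" using assms by (intro Min_antimono) auto
    thus ?thesis using n n_def by simp
  qed
  moreover have "E i : Schreier s \<alpha>" if "i : {1..n}" for i using ex[OF that] S by (auto simp: E_fiber)
  moreover have "G = (\<Union>i\<in>{1..n}. E i)" using hn by (auto simp: E_def)
  ultimately show ?thesis unfolding Schreier_osuc using succ n1 by blast
qed

lemma Schreier_osucE:
  assumes "G : Schreier s (osuc \<alpha>)" "G ~= {}"
  obtains f :: "nat => nat" where "ALL g:G. ALL g':G. g < g' --> f g <= f g'"
    "card (f ` G) <= Min G" "ALL v:f ` G. {g : G. f g = v} : Schreier s \<alpha>"
proof -
  obtain n E where E: "G = (\<Union>i\<in>{1..n}. E i)" "1 <= n" "successive n E" "n <= Min (E 1)"
    "ALL i:{1..n}. E i : Schreier s \<alpha>" using assms unfolding Schreier_osuc by blast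
  define f where "f g = (THE i. i : {1..n} & g : E i)" for g
  have f: "f g = i" if "i : {1..n}" "g : E i" for g i unfolding f_def
  proof (rule the_equality)
    fix j assume "j : {1..n} & g : E j"
    thus "j = i" using E(3) that unfolding successive_def by (metis less_irrefl linorder_neqE)
  qed (use that in simp)
  show ?thesis
  proof (rule that[of f]; safe?)
    fix g g' assume g: "g : G" "g' : G" "g < g'"
    then obtain i j where "i : {1..n}" "g : E i" "j : {1..n}" "g' : E j" using E by auto
    thus "f g <= f g'" using f E(3) g(3) unfolding successive_def by (metis not_le less_asym)
  next
    have fin: "finite G" using E unfolding successive_def by auto
    have "Min (E 1) <= g" if g: "g : G" for g
    proof -
      obtain i where i: "i : {1..n}" "g : E i" using g unfolding E(1) by blast
      obtain a where "a : E 1" using E unfolding successive_def by fastforce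
      have f1: "finite (E 1)" using E(2,3) unfolding successive_def by auto
      show ?thesis
      proof (cases "i = 1")
        case False
        hence "1 < i" "1 : {1..n}" using i by auto
        hence "a < g" using E(3) i `a : E 1` unfolding successive_def by blast
        thus ?thesis using Min_le[OF f1 `a : E 1`] by simp
      qed (use i f1 in auto)
    qed
    moreover have "f ` G \<subseteq> {1..n}" using f unfolding E(1) by auto
    hence "card (f ` G) <= n" using card_mono[of "{1..n}" "f ` G"] by simp
    ultimately show "card (f ` G) <= Min G" using E(4) Min_in[OF fin assms(2)] by (meson order.trans)
  next
    fix w assume "w : G"
    hence v: "f w : {1..n}" using f unfolding E(1) by auto
    have "{g : G. f g = f w} = E (f w)" using f v unfolding E(1) by auto
    thus "{g : G. f g = f w} : Schreier s \<alpha>" using E(5) v by auto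
  qed
qed

text \<open>Heredity and spreading in one statement; the former is the case of an inclusion
  \<open>j\<close>. At successors the labels are pulled back along \<open>j\<close>: their number
  does not grow, while the minimum that bounds it can only increase.\<close>

lemma Schreier_spread:
  assumes s: "approximating s" and "F : Schreier s \<alpha>" and "finite G"
    and "!!g g'. g : G ==> g' : G ==> g < g' ==> j g < j g'"
    and "!!g. g : G ==> j g : F & j g <= g"
  shows "G : Schreier s \<alpha>" using assms(2-)
proof (induction \<alpha> arbitrary: F G rule: ord_induct)
  case zero
  then consider "F = {}" | n where "F = {n}" "1 <= n" by (auto simp: Schreier_0)
  thus ?case
  proof cases
    case 1 thus ?thesis using zero by (auto simp: Schreier_0)
  next
    case 2
    have "g = g'" if "g : G" "g' : G" for g g' using zero that 2 by (metis linorder_neqE less_irrefl singletonD)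
    hence "G = {} \<or> (EX g. G = {g})" by blast
    thus ?thesis using zero(4) 2 by (force simp: Schreier_0)
  qed
next
  case (suc b)
  show ?case
  proof (cases "G = {}")
    case True thus ?thesis using empty_Schreier[OF s] by simp
  next
    case False
    hence F: "F ~= {}" "finite F" "F \<subseteq> {1..}" using suc Schreier_finite[OF s] by blast+
    obtain f :: "nat => nat" where f: "ALL g:F. ALL g':F. g < g' --> f g <= f g'"
      "card (f ` F) <= Min F" "ALL v:f ` F. {g : F. f g = v} : Schreier s b" by (rule Schreier_osucE[OF suc.prems(1) F(1)])
    show ?thesis
    proof (rule Schreier_osucI[of G "%g. f (j g)"])
      show "G \<subseteq> {1..}" using suc.prems F(3) by force
      show "f (j g) <= f (j g')" if "g : G" "g' : G" "g < g'" for g g' using that suc.prems f(1) by blast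
      have "card ((%g. f (j g)) ` G) <= card (f ` F)" by (rule card_mono) (use suc.prems F in auto)
      also note f(2)
      also have "Min F <= Min G" using suc.prems F False by (meson Min.coboundedI Min_in order.trans)
      finally show "card ((%g. f (j g)) ` G) <= Min G" .
    next
      fix v assume "v : (%g. f (j g)) ` G"
      hence "v : f ` F" using suc.prems by auto
      thus "{g : G. f (j g) = v} : Schreier s b" by (intro suc.IH[OF f(3)[rule_format]]) (use suc.prems in auto)
    qed (use suc.prems False in auto)
  qed
next
  case (lim b)
  show ?case
  proof (cases "G = {}")
    case True thus ?thesis using empty_Schreier[OF s] by simp
  next
    case False
    hence F: "F ~= {}" using lim.prems by auto
    then obtain n where n: "1 <= n" "n <= Min F" "F : Schreier s (s b n)" "finite F"
      using lim.prems(1) unfolding Schreier_limit_iff[OF s lim.hyps(1) F] by blast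
    have "G : Schreier s (s b n)"
      by (rule lim.IH[OF approximating_less[OF s lim.hyps(1) n(1)] n(3)]) (use lim.prems in auto)
    moreover have "n <= Min G" using lim.prems n False by (meson Min.coboundedI Min_in order.trans)
    ultimately show ?thesis unfolding Schreier_limit_iff[OF s lim.hyps(1) False] using lim.prems(2) n(1) by blast
  qed
qed

lemma Schreier_singleton:
  assumes "approximating s" "1 <= n"
  shows "{n} : Schreier s \<alpha>"
proof (induction \<alpha> rule: ord_induct)
  case (suc b)
  show ?case by (rule Schreier_osucI[of "{n}" "%_. 0 :: nat"]) (use suc assms in auto)
next
  case (lim b)
  thus ?case using assms approximating_less[of s b 1] by (auto simp: Schreier_limit intro!: bexI[of _ 1])
qed (use assms in "auto simp: Schreier_0")

section \<open>The Tsirelson norm\<close>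

definition supp :: "(nat => real) => nat set" where "supp x = {k. x k ~= 0}"

lemma finite_supp: "x : c00 ==> finite (supp x)" by (simp add: c00_def supp_def)

lemma supp_ge_1: "x : c00 ==> supp x \<subseteq> {1..}" by (auto simp: c00_def supp_def Suc_le_eq intro!: gr0I)

lemma supp_restr: "supp (restr A x) = A \<inter> supp x" by (auto simp: supp_def restr_def)

lemma c00I: "finite A ==> 0 \<notin> A ==> (!!k. k \<notin> A ==> x k = 0) ==> x : c00"
  unfolding c00_def by (auto intro: finite_subset[of _ A])

lemma restr_c00 [simp]: "x : c00 ==> restr A x : c00" by (auto simp: c00_def restr_def intro: rev_finite_subset)

lemma add_c00: "x : c00 ==> y : c00 ==> (%k. x k + y k) : c00"
  by (auto simp: c00_def intro: finite_subset[of _ "{k. x k ~= 0} \<union> {k. y k ~= 0}"])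

lemma scale_c00: "x : c00 ==> (%k. a * x k) : c00" by (auto simp: c00_def intro: rev_finite_subset)

lemma zero_c00 [simp]: "(%_. 0) : c00" by (simp add: c00_def)

lemma sum_c00: "(!!i. i : F ==> x i : c00) ==> (%k. \<Sum>i\<in>F. x i k) : c00"
  by (induction F rule: infinite_finite_induct) (auto intro: add_c00)

lemma unit_vec_c00: "1 <= n ==> unit_vec n : c00" by (rule c00I[of "{n}"]) (auto simp: unit_vec_def)

section \<open>The norming set\<close>

definition pr :: "nat set => nat => nat" where "pr M k = Max {m\<in>M. m <= k}"

text \<open>The interval from \<open>m\<close> up to the next point of \<open>M\<close>. Enlarging
  successive sets with minima \<open>M\<close> to these intervals only increases the norms of the
  pieces, so the norm can be described by the sets of minima alone.\<close>

definition blk :: "nat set => nat => nat set" where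
  "blk M m = {k. m <= k & (ALL m':M. m' <= k --> m' <= m)}"

lemma pr_blk: "finite M ==> m : M ==> k : blk M m ==> pr M k = m" unfolding pr_def blk_def by (intro Max_eqI) auto

lemma pr_in: "finite M ==> M ~= {} ==> Min M <= k ==> pr M k : M & pr M k <= k & k : blk M (pr M k)"
proof -
  assume a: "finite M" "M ~= {}" "Min M <= k"
  hence f: "finite {m\<in>M. m <= k}" "{m\<in>M. m <= k} ~= {}" using Min_in by auto
  thus ?thesis using Max_in[OF f] unfolding pr_def blk_def by auto
qed

lemma blk_disjoint: "m : M ==> m' : M ==> m ~= m' ==> blk M m \<inter> blk M m' = {}" by (force simp: blk_def)

text \<open>The norm is unconditional: with absolute values taken of \<open>x\<close>, nonnegative
  functionals suffice.\<close>

definition pairing :: "(nat => real) => (nat => real) => real" where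
  "pairing \<phi> x = (\<Sum>k\<in>supp x. \<phi> k * \<bar>x k\<bar>)"

lemma pairing_superset: "finite A ==> supp x \<subseteq> A ==> pairing \<phi> x = (\<Sum>k\<in>A. \<phi> k * \<bar>x k\<bar>)"
  unfolding pairing_def by (rule sum.mono_neutral_left) (auto simp: supp_def)

text \<open>The usual norming set: coordinate functionals, closed under \<open>c\<close> times a sum
  of members that are cut down to the intervals of an admissible set. As a supremum over it the norm
  is constructed directly, and the implicit equation becomes a theorem about it.\<close>

inductive_set tset :: "nat set set => real => (nat => real) set" for S c where
  unit: "unit_vec k : tset S c"
| step: "M : S ==> M ~= {} ==> (!!m. m : M ==> \<phi> m : tset S c) ==>
    (%k. if k < Min M then 0 else c * \<phi> (pr M k) k) : tset S c"

definition tnorm :: "nat set set => real => (nat => real) => real" where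
  "tnorm S c x = (if x : c00 then SUP \<phi>\<in>tset S c. pairing \<phi> x else 0)"

text \<open>All that the theory of the norm uses about the Schreier families.\<close>

locale spreading =
  fixes S :: "nat set set"
  assumes fin: "F : S ==> finite F"
    and pos: "F : S ==> F \<subseteq> {1..}"
    and single: "1 <= n ==> {n} : S"
    and spread: "F : S ==> finite G ==> (!!g g'. g : G ==> g' : G ==> g < g' ==> j g < j g') ==>
      (!!g. g : G ==> j g : F & j g <= g) ==> G : S"
begin

end

lemma spreading_Schreier: "approximating s ==> spreading (Schreier s \<alpha>)"
proof
  fix F G :: "nat set" and j assume s: "approximating s" and F: "F : Schreier s \<alpha>"
  show "finite F" "F \<subseteq> {1..}" using Schreier_finite[OF s F] by auto
  show "G : Schreier s \<alpha>" if "finite G" "!!g g'. g : G ==> g' : G ==> g < g' ==> j g < j g'"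
      "!!g. g : G ==> j g : F & j g <= g" using Schreier_spread[OF s F that] .
qed (rule Schreier_singleton)

locale tsirelson = spreading S for S +
  fixes c :: real
  assumes c_pos: "0 < c" and c_less: "c < 1"
begin

lemma tset_bounds:
  assumes "f : tset S c" shows "0 <= f k & f k <= 1" using assms
proof (induction arbitrary: k rule: tset.induct)
  case (step M f)
  show ?case
  proof (cases "k < Min M")
    case False
    hence "pr M k : M" using pr_in[OF fin[OF step(1)] step(2)] by (meson not_less)
    hence "0 <= f (pr M k) k" "f (pr M k) k <= 1" using step by auto
    thus ?thesis using False c_pos c_less mult_le_one[of c "f (pr M k) k"] by simp
  qed simp
qed (auto simp: unit_vec_def)

lemma pairing_nonneg: "\<phi> : tset S c ==> 0 <= pairing \<phi> x"
  unfolding pairing_def by (intro sum_nonneg mult_nonneg_nonneg) (auto simp: tset_bounds)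

lemma pairing_le_l1: "\<phi> : tset S c ==> pairing \<phi> x <= (\<Sum>k\<in>supp x. \<bar>x k\<bar>)"
  unfolding pairing_def by (intro sum_mono) (auto simp: tset_bounds mult_left_le_one_le)

lemma bdd: "bdd_above ((%\<phi>. pairing \<phi> x) ` tset S c)" using pairing_le_l1 by (intro bdd_aboveI2)

lemma tset_nonempty: "tset S c ~= {}" using tset.unit by blast

lemma pairing_le_tnorm: "x : c00 ==> \<phi> : tset S c ==> pairing \<phi> x <= tnorm S c x"
  unfolding tnorm_def using bdd by (auto intro: cSUP_upper)

lemma tnorm_leI: "x : c00 ==> (!!f. f : tset S c ==> pairing f x <= B) ==> tnorm S c x <= B"
  unfolding tnorm_def using tset_nonempty by (auto intro: cSUP_least)

lemma tnorm_nonneg [simp]: "0 <= tnorm S c x"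
proof (cases "x : c00")
  case True
  thus ?thesis using pairing_le_tnorm[OF True tset.unit] pairing_nonneg[OF tset.unit] by (meson order.trans)
qed (simp add: tnorm_def)

lemma pairing_unit: "x : c00 ==> pairing (unit_vec k) x = \<bar>x k\<bar>"
proof -
  assume x: "x : c00"
  have "pairing (unit_vec k) x = (\<Sum>j\<in>insert k (supp x). unit_vec k j * \<bar>x j\<bar>)"
    by (rule pairing_superset) (use x finite_supp in auto)
  also have "\<dots> = (\<Sum>j\<in>{k}. unit_vec k j * \<bar>x j\<bar>)"
    by (rule sum.mono_neutral_right) (use x finite_supp in "auto simp: unit_vec_def")
  finally show ?thesis by (simp add: unit_vec_def)
qed

lemma abs_le_tnorm: "x : c00 ==> \<bar>x k\<bar> <= tnorm S c x" using pairing_le_tnorm[OF _ tset.unit[of k]] pairing_unit by simp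

lemma tnorm_le_l1: "x : c00 ==> tnorm S c x <= (\<Sum>k\<in>supp x. \<bar>x k\<bar>)" by (rule tnorm_leI) (auto intro: pairing_le_l1)

lemma pairing_mono:
  assumes "f : tset S c" "y : c00" "!!k. \<bar>x k\<bar> <= \<bar>y k\<bar>"
  shows "pairing f x <= pairing f y"
proof -
  have "supp x \<subseteq> supp y"
  proof
    fix k assume "k : supp x"
    thus "k : supp y" using assms(3)[of k] by (auto simp: supp_def)
  qed
  hence "pairing f x = (\<Sum>k\<in>supp y. f k * \<bar>x k\<bar>)" using assms by (intro pairing_superset) (auto simp: finite_supp)
  also have "\<dots> <= pairing f y" unfolding pairing_def by (intro sum_mono mult_left_mono) (use assms tset_bounds in auto)
  finally show ?thesis .
qed

lemma tnorm_mono: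
  assumes "x : c00" "y : c00" "!!k. \<bar>x k\<bar> <= \<bar>y k\<bar>"
  shows "tnorm S c x <= tnorm S c y"
  by (rule tnorm_leI[OF assms(1)]) (meson assms pairing_mono pairing_le_tnorm order.trans)

lemma tnorm_scale: "x : c00 ==> tnorm S c (%k. a * x k) = \<bar>a\<bar> * tnorm S c x"
proof -
  have le: "tnorm S c (%k. b * x k) <= \<bar>b\<bar> * tnorm S c x" if x: "x : c00" for x b
  proof (rule tnorm_leI[OF scale_c00[OF x]])
    fix f assume p: "f : tset S c"
    have "pairing f (%k. b * x k) = (\<Sum>k\<in>supp x. f k * \<bar>b * x k\<bar>)"
      by (rule pairing_superset) (use x finite_supp in "auto simp: supp_def")
    also have "\<dots> = \<bar>b\<bar> * pairing f x" by (simp add: pairing_def sum_distrib_left abs_mult mult_ac)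
    finally show "pairing f (%k. b * x k) <= \<bar>b\<bar> * tnorm S c x"
      using pairing_le_tnorm[OF x p] by (simp add: mult_left_mono)
  qed
  assume x: "x : c00"
  show ?thesis
  proof (cases "a = 0")
    case True
    thus ?thesis using le[OF x, of 0] tnorm_nonneg[of "%_. 0"] by (simp del: tnorm_nonneg)
  next
    case False
    have "x = (%k. inverse a * (a * x k))" using False by (simp add: fun_eq_iff)
    hence "\<bar>a\<bar> * tnorm S c x = \<bar>a\<bar> * tnorm S c (%k. inverse a * (a * x k))" by simp
    also have "\<dots> <= \<bar>a\<bar> * (\<bar>inverse a\<bar> * tnorm S c (%k. a * x k))"
      by (rule mult_left_mono[OF le[OF scale_c00[OF x]]]) simp
    also have "\<dots> = tnorm S c (%k. a * x k)" using False by (simp add: abs_inverse)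
    finally show ?thesis using le[OF x, of a] by simp
  qed
qed

lemma tnorm_triangle:
  assumes "x : c00" "y : c00"
  shows "tnorm S c (%k. x k + y k) <= tnorm S c x + tnorm S c y"
proof (rule tnorm_leI[OF add_c00[OF assms]])
  fix g assume p: "g : tset S c"
  let ?A = "supp x \<union> supp y"
  have f: "finite ?A" using assms finite_supp by simp
  have "pairing g (%k. x k + y k) = (\<Sum>k\<in>?A. g k * \<bar>x k + y k\<bar>)"
    by (rule pairing_superset) (use f in "auto simp: supp_def")
  also have "\<dots> <= (\<Sum>k\<in>?A. g k * \<bar>x k\<bar> + g k * \<bar>y k\<bar>)" unfolding distrib_left[symmetric]
    by (intro sum_mono mult_left_mono) (use tset_bounds[OF p] in auto)
  also have "\<dots> = pairing g x + pairing g y" by (simp add: sum.distrib pairing_superset[OF f])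
  also have "\<dots> <= tnorm S c x + tnorm S c y" using assms p by (intro add_mono pairing_le_tnorm)
  finally show "pairing g (%k. x k + y k) <= tnorm S c x + tnorm S c y" .
qed

lemma tnorm_sum:
  assumes "finite F" "!!i. i : F ==> x i : c00"
  shows "tnorm S c (%k. \<Sum>i\<in>F. x i k) <= (\<Sum>i\<in>F. tnorm S c (x i))" using assms
proof (induction F)
  case empty
  have "tnorm S c (%k. 0) = 0" using tnorm_scale[of "%_. 0" 0] by simp
  thus ?case by simp
next
  case (insert i F)
  thus ?case using tnorm_triangle[of "x i" "%k. \<Sum>i\<in>F. x i k"] sum_c00[of F x] by force
qed

lemma tnorm_zero [simp]: "tnorm S c (%_. 0) = 0" using tnorm_scale[of "%_. 0" 0] by simp

lemma pairing_step:
  assumes x: "x : c00" and M: "finite M" "M ~= {}"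
  shows "pairing (%k. if k < Min M then 0 else c * f (pr M k) k) x
    = c * (\<Sum>m\<in>M. pairing (f m) (restr (blk M m) x))"
proof -
  let ?A = "supp x" and ?B = "{k : supp x. ~ k < Min M}"
  have fA: "finite ?A" using x finite_supp by simp
  have fib: "{k : ?B. pr M k = m} = supp (restr (blk M m) x)" if "m : M" for m
  proof -
    have "k : blk M m ==> Min M <= k" for k using order.trans[OF Min_le[OF M(1) that], of k] unfolding blk_def by blast
    thus ?thesis using pr_blk[OF M(1) that] pr_in[OF M] unfolding supp_restr not_less by blast
  qed
  have "pairing (%k. if k < Min M then 0 else c * f (pr M k) k) x
      = (\<Sum>k\<in>?B. c * f (pr M k) k * \<bar>x k\<bar>)" unfolding pairing_def using fA by (intro sum.mono_neutral_cong_right) auto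
  also have "\<dots> = (\<Sum>m\<in>M. \<Sum>k\<in>{k : ?B. pr M k = m}. c * f (pr M k) k * \<bar>x k\<bar>)"
  proof (rule sum.group[symmetric])
    show "pr M ` ?B \<subseteq> M" using pr_in[OF M] unfolding not_less by blast
  qed (use fA M in auto)
  also have "\<dots> = (\<Sum>m\<in>M. c * pairing (f m) (restr (blk M m) x))"
  proof (rule sum.cong[OF refl])
    fix m assume m: "m : M"
    have "(\<Sum>k\<in>{k : ?B. pr M k = m}. c * f (pr M k) k * \<bar>x k\<bar>)
      = (\<Sum>k\<in>supp (restr (blk M m) x). c * f m k * \<bar>restr (blk M m) x k\<bar>)" unfolding fib[OF m] supp_restr
      by (rule sum.cong[OF refl]) (simp add: restr_def pr_blk[OF M(1) m])
    thus "(\<Sum>k\<in>{k : ?B. pr M k = m}. c * f (pr M k) k * \<bar>x k\<bar>) = c * pairing (f m) (restr (blk M m) x)"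
      by (simp add: pairing_def sum_distrib_left mult.assoc)
  qed
  finally show ?thesis by (simp add: sum_distrib_left)
qed

text \<open>Members of the norming set that nearly attain the norms of the pieces are combined by
  \<open>tset.step\<close>; the errors \<open>e / card M\<close> add up to at most
  \<open>e\<close>.\<close>

lemma tnorm_lower:
  assumes x: "x : c00" and M: "M : S" "M ~= {}"
  shows "c * (\<Sum>m\<in>M. tnorm S c (restr (blk M m) x)) <= tnorm S c x"
proof (rule field_le_epsilon)
  fix e :: real assume e: "0 < e"
  have fM: "finite M" using M fin by simp
  define d where "d = e / card M"
  have d: "0 < d" using e M fM by (simp add: d_def card_gt_0_iff)
  have "EX f. f : tset S c & tnorm S c (restr (blk M m) x) - d < pairing f (restr (blk M m) x)" for m
  proof (rule ccontr)
    assume "~ ?thesis"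
    hence "tnorm S c (restr (blk M m) x) <= tnorm S c (restr (blk M m) x) - d"
      using x by (intro tnorm_leI) (auto simp: not_less)
    thus False using d by simp
  qed
  then obtain f where f: "!!m. f m : tset S c"
    "!!m. tnorm S c (restr (blk M m) x) - d < pairing (f m) (restr (blk M m) x)" by metis
  have "(\<Sum>m\<in>M. tnorm S c (restr (blk M m) x)) - e = (\<Sum>m\<in>M. tnorm S c (restr (blk M m) x) - d)"
    using M fM by (simp add: sum_subtractf d_def)
  also have "\<dots> <= (\<Sum>m\<in>M. pairing (f m) (restr (blk M m) x))" by (intro sum_mono less_imp_le f)
  finally have "c * (\<Sum>m\<in>M. tnorm S c (restr (blk M m) x)) <=
    c * (\<Sum>m\<in>M. pairing (f m) (restr (blk M m) x)) + c * e"
    using mult_left_mono[of _ _ c] c_pos by (fastforce simp: algebra_simps)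
  also have "c * (\<Sum>m\<in>M. pairing (f m) (restr (blk M m) x)) <= tnorm S c x"
    unfolding pairing_step[OF x fM M(2), symmetric] by (intro pairing_le_tnorm x tset.step M f)
  also have "c * e <= e" using e c_less by simp
  finally show "c * (\<Sum>m\<in>M. tnorm S c (restr (blk M m) x)) <= tnorm S c x + e" by simp
qed

lemma tnorm_upper0:
  assumes x: "x : c00" and "!!k. \<bar>x k\<bar> <= B"
    and "!!M. M : S ==> M ~= {} ==> c * (\<Sum>m\<in>M. tnorm S c (restr (blk M m) x)) <= B"
  shows "tnorm S c x <= B"
proof (rule tnorm_leI[OF x])
  fix f assume "f : tset S c"
  thus "pairing f x <= B"
  proof cases
    case (unit k)
    thus ?thesis using pairing_unit[OF x] assms by simp
  next
    case (step M \<psi>)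
    have "pairing f x = c * (\<Sum>m\<in>M. pairing (\<psi> m) (restr (blk M m) x))" using pairing_step[OF x fin step(3)] step by simp
    also have "\<dots> <= c * (\<Sum>m\<in>M. tnorm S c (restr (blk M m) x))"
      using step x c_pos by (intro mult_left_mono sum_mono pairing_le_tnorm) auto
    also have "\<dots> <= B" using step assms by blast
    finally show ?thesis .
  qed
qed

text \<open>Only admissible sets inside the support need testing. Each point of \<open>M\<close> is
  moved to the first support point of its interval; the result is a spread of a subset of
  \<open>M\<close>, and the pieces of \<open>x\<close> stay the same.\<close>

lemma tnorm_upper:
  assumes x: "x : c00" and B: "!!k. \<bar>x k\<bar> <= B"
    and le: "!!M. M : S ==> M ~= {} ==> M \<subseteq> supp x ==> c * (\<Sum>m\<in>M. tnorm S c (restr (blk M m) x)) <= B"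
  shows "tnorm S c x <= B"
proof (rule tnorm_upper0[OF x B])
  fix M assume M: "M : S" "M ~= {}"
  have fM: "finite M" using M fin by simp
  have fx: "finite (supp x)" using x finite_supp by simp
  define P where "P = {m : M. blk M m \<inter> supp x ~= {}}"
  define h where "h m = Min (blk M m \<inter> supp x)" for m
  have h: "h m : blk M m" "h m : supp x" "!!k. k : blk M m ==> k : supp x ==> h m <= k" if "m : P" for m
    using that fx Min_in[of "blk M m \<inter> supp x"] by (auto simp: P_def h_def)
  have hP: "h m < h m'" if "m : P" "m' : P" "m < m'" for m m'
  proof -
    have "m' <= h m'" "m' <= h m --> m' <= m"
      using h(1)[OF that(1)] h(1)[OF that(2)] that unfolding blk_def P_def by auto
    thus ?thesis using that(3) by linarith
  qed
  have hle: "m <= h m" if "m : P" for m using h[OF that] by (simp add: blk_def)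
  have inj: "inj_on h P" by (rule inj_onI) (metis hP less_irrefl linorder_neqE_nat)
  have zero: "tnorm S c (restr (blk M m) x) = 0" if "m : M - P" for m
  proof -
    have "restr (blk M m) x = (%_. 0)" using that by (auto simp: P_def restr_def supp_def fun_eq_iff)
    thus ?thesis by simp
  qed
  have eq: "restr (blk M m) x = restr (blk (h ` P) (h m)) x" if m: "m : P" for m
  proof -
    have "k : blk M m \<longleftrightarrow> k : blk (h ` P) (h m)" if k: "k : supp x" for k
    proof
      assume a: "k : blk M m"
      have "m' <= m" if "m' : P" "h m' <= k" for m' using a that hle[OF that(1)] by (auto simp: blk_def P_def)
      hence "h m' <= h m" if "m' : P" "h m' <= k" for m' using that hP[OF that(1) m] by (metis order_le_less)
      thus "k : blk (h ` P) (h m)" using a k h(3)[OF m] by (auto simp: blk_def)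
    next
      assume a: "k : blk (h ` P) (h m)"
      hence "h m <= k" by (simp add: blk_def)
      hence mk: "m <= k" using hle[OF m] by simp
      have mM: "m : M" using m by (simp add: P_def)
      have "Min M <= k" using Min_le[OF fM mM] mk by simp
      hence p: "pr M k : M" "pr M k <= k" "k : blk M (pr M k)" using pr_in[OF fM M(2)] by auto
      hence pP: "pr M k : P" using k by (auto simp: P_def)
      have "h (pr M k) <= k" using h(3)[OF pP] p k by simp
      hence "h (pr M k) <= h m" using a pP by (auto simp: blk_def)
      hence "pr M k <= m" using hP[OF m pP] by (metis not_le)
      moreover have "m <= pr M k" using p(3) mM mk by (auto simp: blk_def)
      ultimately show "k : blk M m" using p by simp
    qed
    thus ?thesis by (fastforce simp: restr_def supp_def)
  qed
  have PM: "P \<subseteq> M" by (auto simp: P_def)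
  have sum: "(\<Sum>m\<in>M. tnorm S c (restr (blk M m) x)) = (\<Sum>m\<in>h ` P. tnorm S c (restr (blk (h ` P) m) x))"
  proof -
    have "(\<Sum>m\<in>M. tnorm S c (restr (blk M m) x)) = (\<Sum>m\<in>P. tnorm S c (restr (blk M m) x))"
      using fM PM zero by (intro sum.mono_neutral_right) auto
    also have "\<dots> = (\<Sum>m\<in>P. tnorm S c (restr (blk (h ` P) (h m)) x))" by (rule sum.cong) (auto simp: eq)
    finally show ?thesis by (simp add: sum.reindex[OF inj])
  qed
  show "c * (\<Sum>m\<in>M. tnorm S c (restr (blk M m) x)) <= B"
  proof (cases "P = {}")
    case True
    thus ?thesis using sum B[of 0] by simp
  next
    case False
    have "h ` P : S"
    proof (rule spread[OF M(1), where j = "the_inv_into P h"])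
      show "finite (h ` P)" using PM fM finite_subset by blast
    next
      fix g g' assume "g : h ` P" "g' : h ` P" "g < g'"
      thus "the_inv_into P h g < the_inv_into P h g'"
        using the_inv_into_f_f[OF inj] hP by (metis imageE less_asym linorder_neqE_nat)
    next
      fix g assume "g : h ` P"
      thus "the_inv_into P h g : M & the_inv_into P h g <= g" using the_inv_into_f_f[OF inj] hle PM by auto
    qed
    thus ?thesis unfolding sum using False h by (intro le) auto
  qed
qed

end

section \<open>The implicit equation and its unique solution\<close>

lemma enum_finite_nat:
  fixes M :: "nat set"
  assumes "finite M"
  obtains e where "bij_betw e {1..card M} M" "strict_mono_on {1..card M} e"
proof -
  obtain h where h: "bij_betw h {..<card M} M" "strict_mono_on {..<card M} h"
    by (rule ex_bij_betw_strict_mono_card[OF assms])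
  have "bij_betw (%i. i - 1) {1..card M} {..<card M}" by (rule bij_betw_byWitness[where f' = Suc]) auto
  hence "bij_betw (%i. h (i - 1)) {1..card M} M" using bij_betw_trans[OF _ h(1)] by (simp add: comp_def)
  moreover have "strict_mono_on {1..card M} (%i. h (i - 1))"
  proof (rule strict_mono_onI)
    fix r s assume "r : {1..card M}" "s : {1..card M}" "r < s"
    thus "h (r - 1) < h (s - 1)" by (intro strict_mono_onD[OF h(2)]) auto
  qed
  ultimately show ?thesis by (rule that)
qed

context tsirelson
begin

definition split_sums :: "((nat => real) => real) => (nat => real) => real set" where
  "split_sums N x = {c * (\<Sum>i=1..n. N (restr (A i) x)) | n A.
     1 <= n & successive n A & (%i. Min (A i)) ` {1..n} : S}"

lemma Tsirelson_equation_iff: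
  "Tsirelson_equation S c N \<longleftrightarrow> (ALL x:c00. N x = max (SUP k. \<bar>x k\<bar>) (Sup (split_sums N x)))"
  unfolding Tsirelson_equation_def split_sums_def ..

lemma successive_Min:
  assumes "successive n A" "i : {1..n}"
  shows "Min (A i) : A i" "A i ~= {}" "finite (A i)" using assms unfolding successive_def by auto

lemma successive_disjoint:
  assumes "successive n A" "i : {1..n}" "j : {1..n}" "i ~= j"
  shows "A i \<inter> A j = {}"
proof -
  have False if "a : A i" "a : A j" for a
    using assms that unfolding successive_def by (metis less_irrefl linorder_neqE_nat)
  thus ?thesis by blast
qed

lemma successive_Min_less:
  assumes "successive n A" "i : {1..n}" "j : {1..n}" "i < j"
  shows "Min (A i) < Min (A j)"
  using assms successive_Min[OF assms(1,2)] successive_Min[OF assms(1,3)] unfolding successive_def by blast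

lemma successive_blk:
  assumes "successive n A" "i : {1..n}"
  shows "A i \<subseteq> blk ((%i. Min (A i)) ` {1..n}) (Min (A i))"
proof
  fix k assume k: "k : A i"
  have "Min (A j) <= Min (A i)" if "j : {1..n}" "Min (A j) <= k" for j
  proof (rule ccontr)
    assume "~ ?thesis"
    hence "i < j" using successive_Min_less[OF assms(1) that(1) assms(2)] by (metis linorder_neqE_nat not_le less_imp_le)
    hence "k < Min (A j)" using k assms that successive_Min(1)[OF assms(1) that(1)] unfolding successive_def by blast
    thus False using that by simp
  qed
  thus "k : blk ((%i. Min (A i)) ` {1..n}) (Min (A i))" using k successive_Min(3)[OF assms] by (auto simp: blk_def)
qed

lemma inj_successive_Min: "successive n A ==> inj_on (%i. Min (A i)) {1..n}"
  by (rule inj_onI) (metis successive_Min_less less_irrefl linorder_neqE_nat)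

lemma split_sums_le_tnorm:
  assumes x: "x : c00" and q: "q : split_sums (tnorm S c) x"
  shows "q <= tnorm S c x"
proof -
  obtain n A where A: "q = c * (\<Sum>i=1..n. tnorm S c (restr (A i) x))" "1 <= n" "successive n A"
    "(%i. Min (A i)) ` {1..n} : S" using q unfolding split_sums_def by blast
  let ?M = "(%i. Min (A i)) ` {1..n}"
  have "(\<Sum>i=1..n. tnorm S c (restr (A i) x)) <= (\<Sum>i=1..n. tnorm S c (restr (blk ?M (Min (A i))) x))"
    using successive_blk[OF A(3)] x by (intro sum_mono tnorm_mono restr_c00) (auto simp: restr_def)
  also have "\<dots> = (\<Sum>m\<in>?M. tnorm S c (restr (blk ?M m) x))"
    by (simp only: sum.reindex[OF inj_successive_Min[OF A(3)]] comp_def)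
  finally have "q <= c * (\<Sum>m\<in>?M. tnorm S c (restr (blk ?M m) x))" unfolding A(1) using c_pos by simp
  also have "\<dots> <= tnorm S c x" using A by (intro tnorm_lower[OF x]) auto
  finally show ?thesis .
qed

lemma blk_in_split_sums:
  assumes x: "x : c00" and M: "M : S" "M ~= {}"
  shows "c * (\<Sum>m\<in>M. N (restr (blk M m) x)) : split_sums N x"
proof -
  have fM: "finite M" using M fin by simp
  obtain e where e: "bij_betw e {1..card M} M" "strict_mono_on {1..card M} e" using enum_finite_nat[OF fM] by blast
  \<comment> \<open>Inserting \<open>e i\<close> keeps the minimum at the prescribed point, and the
    set nonempty, even if \<open>x\<close> vanishes there.\<close>
  define A where "A i = insert (e i) (blk M (e i) \<inter> supp x)" for i
  have eM: "e i : M" if "i : {1..card M}" for i using that e(1) by (auto simp: bij_betw_def)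
  have Min: "Min (A i) = e i" if "i : {1..card M}" for i
    unfolding A_def using finite_supp[OF x] by (intro Min_eqI) (auto simp: blk_def)
  have "successive (card M) A" unfolding successive_def
  proof (intro conjI ballI impI)
    fix i assume "i : {1..card M}"
    thus "finite (A i)" "A i ~= {}" "A i \<subseteq> {1..}"
      using eM[of i] pos[OF M(1)] finite_supp[OF x] supp_ge_1[OF x] by (auto simp: A_def)
  next
    fix i j a b assume ij: "i : {1..card M}" "j : {1..card M}" "i < j" "a : A i" "b : A j"
    have "e i < e j" using e(2) ij by (auto simp: strict_mono_on_def)
    hence "a < e j" using ij(4) eM[OF ij(2)] unfolding A_def blk_def
      by (metis (mono_tags, lifting) Int_iff insert_iff mem_Collect_eq not_le)
    moreover have "e j <= b" using ij(5) unfolding A_def blk_def by auto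
    ultimately show "a < b" by simp
  qed
  moreover have "(%i. Min (A i)) ` {1..card M} = M" using e(1) Min by (auto simp: bij_betw_def image_def)
  moreover have "restr (A i) x = restr (blk M (e i)) x" if "i : {1..card M}" for i
    by (auto simp: restr_def A_def supp_def blk_def fun_eq_iff)
  hence "(\<Sum>m\<in>M. N (restr (blk M m) x)) = (\<Sum>i=1..card M. N (restr (A i) x))"
    using sum.reindex_bij_betw[OF e(1), of "%m. N (restr (blk M m) x)"] by simp
  moreover have "1 <= card M" using M fM by (simp add: Suc_le_eq card_gt_0_iff)
  ultimately show ?thesis unfolding split_sums_def using M(1) by (auto intro!: exI[of _ "card M"] exI[of _ A])
qed

lemma split_sums_nonempty: "x : c00 ==> split_sums N x ~= {}" using blk_in_split_sums[OF _ single[of 1]] by blast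

lemma bdd_abs_c00: "x : c00 ==> bdd_above (range (%k. \<bar>x k\<bar>))" using abs_le_tnorm by (intro bdd_aboveI2)

lemma norm_on_c00_tnorm: "norm_on_c00 (tnorm S c)"
proof -
  have "x = (%_. 0)" if "x : c00" "tnorm S c x = 0" for x
    using abs_le_tnorm[OF that(1)] that(2) by (auto simp: fun_eq_iff)
  thus ?thesis unfolding norm_on_c00_def using tnorm_scale tnorm_triangle by auto
qed

lemma Tsirelson_equation_tnorm: "Tsirelson_equation S c (tnorm S c)" unfolding Tsirelson_equation_iff
proof
  fix x assume x: "x : c00"
  have bdd: "bdd_above (split_sums (tnorm S c) x)" using split_sums_le_tnorm[OF x] by (intro bdd_aboveI) auto
  show "tnorm S c x = max (SUP k. \<bar>x k\<bar>) (Sup (split_sums (tnorm S c) x))" (is "_ = ?m")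
  proof (rule antisym)
    show "tnorm S c x <= ?m"
    proof (rule tnorm_upper0[OF x])
      show "\<bar>x k\<bar> <= ?m" for k using cSUP_upper[OF UNIV_I bdd_abs_c00[OF x], of k] by simp
      show "c * (\<Sum>m\<in>M. tnorm S c (restr (blk M m) x)) <= ?m" if "M : S" "M ~= {}" for M
        using cSup_upper[OF blk_in_split_sums[OF x that] bdd] by simp
    qed
    have "(SUP k. \<bar>x k\<bar>) <= tnorm S c x" using abs_le_tnorm[OF x] by (intro cSUP_least) auto
    moreover have "Sup (split_sums (tnorm S c) x) <= tnorm S c x"
      using split_sums_le_tnorm[OF x] split_sums_nonempty[OF x] by (intro cSup_least) auto
    ultimately show "?m <= tnorm S c x" by simp
  qed
qed

lemma norm_on_c00_l1_bound:
  assumes N: "norm_on_c00 N" and x: "x : c00"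
  shows "N x <= (\<Sum>k\<in>supp x. \<bar>x k\<bar> * N (unit_vec k))"
proof -
  have "N (%j. \<Sum>k\<in>F. x k * unit_vec k j) <= (\<Sum>k\<in>F. \<bar>x k\<bar> * N (unit_vec k))"
    if "finite F" "F \<subseteq> {1..}" for F using that
  proof (induction F)
    case empty
    have "N (%_. 0) = 0" using N zero_c00 unfolding norm_on_c00_def by blast
    thus ?case by simp
  next
    case (insert k F)
    have u: "unit_vec k : c00" using insert by (intro unit_vec_c00) auto
    have v: "(%j. \<Sum>k\<in>F. x k * unit_vec k j) : c00" using insert by (intro sum_c00 scale_c00 unit_vec_c00) auto
    have "N (%j. x k * unit_vec k j + (\<Sum>k\<in>F. x k * unit_vec k j))
        <= N (%j. x k * unit_vec k j) + N (%j. \<Sum>k\<in>F. x k * unit_vec k j)"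
      using N scale_c00[OF u, of "x k"] v unfolding norm_on_c00_def by simp
    also have "N (%j. x k * unit_vec k j) = \<bar>x k\<bar> * N (unit_vec k)" using N u unfolding norm_on_c00_def by blast
    finally show ?case using insert by simp
  qed
  hence "N (%j. \<Sum>k\<in>supp x. x k * unit_vec k j) <= (\<Sum>k\<in>supp x. \<bar>x k\<bar> * N (unit_vec k))"
    using finite_supp[OF x] supp_ge_1[OF x] .
  moreover have "x j = (\<Sum>k\<in>supp x. x k * unit_vec k j)" for j
  proof -
    have "(\<Sum>k\<in>supp x. x k * unit_vec k j) = (\<Sum>k\<in>supp x. if k = j then x j else 0)"
      by (rule sum.cong) (auto simp: unit_vec_def)
    also have "\<dots> = x j" using finite_supp[OF x] by (auto simp: supp_def)
    finally show ?thesis by simp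
  qed
  hence "N x = N (%j. \<Sum>k\<in>supp x. x k * unit_vec k j)" by (intro arg_cong[where f = N] ext)
  ultimately show ?thesis by simp
qed

lemma bdd_split_sums:
  assumes N: "norm_on_c00 N" and x: "x : c00"
  shows "bdd_above (split_sums N x)"
proof (rule bdd_aboveI)
  fix q assume "q : split_sums N x"
  then obtain n A where A: "q = c * (\<Sum>i=1..n. N (restr (A i) x))" "successive n A" unfolding split_sums_def by blast
  have nn: "0 <= \<bar>x k\<bar> * N (unit_vec k)" if "k : supp x" for k
    using N unit_vec_c00[of k] supp_ge_1[OF x] that unfolding norm_on_c00_def by auto
  have "(\<Sum>i=1..n. N (restr (A i) x)) <= (\<Sum>i=1..n. \<Sum>k\<in>A i \<inter> supp x. \<bar>x k\<bar> * N (unit_vec k))"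
  proof (rule sum_mono)
    fix i
    have "N (restr (A i) x) <= (\<Sum>k\<in>supp (restr (A i) x). \<bar>restr (A i) x k\<bar> * N (unit_vec k))"
      by (rule norm_on_c00_l1_bound[OF N restr_c00[OF x]])
    also have "\<dots> = (\<Sum>k\<in>A i \<inter> supp x. \<bar>x k\<bar> * N (unit_vec k))"
      unfolding supp_restr by (rule sum.cong) (auto simp: restr_def)
    finally show "N (restr (A i) x) <= (\<Sum>k\<in>A i \<inter> supp x. \<bar>x k\<bar> * N (unit_vec k))" .
  qed
  also have "\<dots> = (\<Sum>k\<in>(\<Union>i\<in>{1..n}. A i \<inter> supp x). \<bar>x k\<bar> * N (unit_vec k))"
  proof (rule sum.UNION_disjoint[symmetric])
    show "ALL i:{1..n}. ALL j:{1..n}. i ~= j --> (A i \<inter> supp x) \<inter> (A j \<inter> supp x) = {}"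
      using successive_disjoint[OF A(2)] by blast
  qed (use finite_supp[OF x] in auto)
  also have "\<dots> <= (\<Sum>k\<in>supp x. \<bar>x k\<bar> * N (unit_vec k))" by (rule sum_mono2) (use finite_supp[OF x] nn in auto)
  finally show "q <= c * (\<Sum>k\<in>supp x. \<bar>x k\<bar> * N (unit_vec k))" unfolding A(1) using c_pos by simp
qed

text \<open>Induction on the size of the support. All pieces have smaller support unless one of the
  sets contains the whole support. Then the sum is only \<open>c * N x\<close>, which is less than
  \<open>N x\<close> unless \<open>N x = 0\<close>, so it does not decide the maximum.\<close>

lemma Tsirelson_equation_le:
  assumes N: "norm_on_c00 N" "Tsirelson_equation S c N"
    and N': "norm_on_c00 N'" "Tsirelson_equation S c N'" and "x : c00"
  shows "N x <= N' x" using `x : c00`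
proof (induction "card (supp x)" arbitrary: x rule: less_induct)
  case less
  note x = less.prems
  have eq: "N x = max (SUP k. \<bar>x k\<bar>) (Sup (split_sums N x))"
    "N' x = max (SUP k. \<bar>x k\<bar>) (Sup (split_sums N' x))" using N(2) N'(2) x unfolding Tsirelson_equation_iff by auto
  have nn: "0 <= N x" "0 <= N' x" using N(1) N'(1) x unfolding norm_on_c00_def by auto
  have "q <= max (N' x) (c * N x)" if q: "q : split_sums N x" for q
  proof -
    obtain n A where A: "q = c * (\<Sum>i=1..n. N (restr (A i) x))" "1 <= n" "successive n A"
      "(%i. Min (A i)) ` {1..n} : S" using q unfolding split_sums_def by blast
    show ?thesis
    proof (cases "EX i:{1..n}. supp x \<subseteq> A i")
      case True
      then obtain i where i: "i : {1..n}" "supp x \<subseteq> A i" by blast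
      have "restr (A j) x = (%_. 0)" if "j : {1..n}" "j ~= i" for j
      proof -
        have "A i \<inter> A j = {}" using successive_disjoint[OF A(3) i(1) that(1)] that(2) by blast
        thus ?thesis using i(2) by (auto simp: restr_def supp_def fun_eq_iff)
      qed
      moreover have "N (%_. 0) = 0" using N(1) zero_c00 unfolding norm_on_c00_def by blast
      ultimately have "(\<Sum>j=1..n. N (restr (A j) x)) = (\<Sum>j\<in>{i}. N (restr (A j) x))"
        using i by (intro sum.mono_neutral_right) auto
      moreover have "restr (A i) x = x" using i by (auto simp: restr_def supp_def fun_eq_iff)
      ultimately show ?thesis unfolding A(1) by simp
    next
      case False
      have "N (restr (A i) x) <= N' (restr (A i) x)" if "i : {1..n}" for i
      proof (rule less.hyps)
        show "card (supp (restr (A i) x)) < card (supp x)"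
          using False that finite_supp[OF x] by (intro psubset_card_mono) (auto simp: supp_restr)
      qed (use x in simp)
      hence "q <= c * (\<Sum>i=1..n. N' (restr (A i) x))" unfolding A(1) using c_pos by (intro mult_left_mono sum_mono) auto
      also have "\<dots> <= Sup (split_sums N' x)"
        using A by (intro cSup_upper bdd_split_sums N' x) (auto simp: split_sums_def)
      also have "\<dots> <= N' x" unfolding eq(2) by simp
      finally show ?thesis by simp
    qed
  qed
  hence "Sup (split_sums N x) <= max (N' x) (c * N x)" using split_sums_nonempty[OF x] by (intro cSup_least) auto
  moreover have "(SUP k. \<bar>x k\<bar>) <= N' x" unfolding eq(2) by simp
  ultimately have "N x <= max (N' x) (c * N x)" using eq(1) by linarith
  moreover have "c * N x < N x" if "N x ~= 0" using that c_less nn by simp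
  ultimately show ?case using nn by (cases "N x = 0") (auto simp: max_def split: if_splits)
qed

lemma Tsirelson_norm_unique:
  "(THE N. norm_on_c00 N & Tsirelson_equation S c N & (ALL x. x \<notin> c00 --> N x = 0)) = tnorm S c"
proof (rule the_equality)
  show "norm_on_c00 (tnorm S c) & Tsirelson_equation S c (tnorm S c) & (ALL x. x \<notin> c00 --> tnorm S c x = 0)"
    using norm_on_c00_tnorm Tsirelson_equation_tnorm by (simp add: tnorm_def)
next
  fix N assume N: "norm_on_c00 N & Tsirelson_equation S c N & (ALL x. x \<notin> c00 --> N x = 0)"
  have "N x = tnorm S c x" for x
  proof (cases "x : c00")
    case True
    thus ?thesis using N norm_on_c00_tnorm Tsirelson_equation_tnorm by (intro antisym Tsirelson_equation_le) auto
  qed (use N in "simp add: tnorm_def")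
  thus "N = tnorm S c" by auto
qed

lemma unit_vec_sum_at:
  assumes "finite F" "inj_on m F" "i : F"
  shows "(\<Sum>j\<in>F. a j * unit_vec (m j) (m i)) = a i"
proof -
  have "(\<Sum>j\<in>F. a j * unit_vec (m j) (m i)) = (\<Sum>j\<in>F. if j = i then a j else 0)"
    using assms by (intro sum.cong) (auto simp: unit_vec_def inj_on_def)
  thus ?thesis using assms by simp
qed

lemma tnorm_coefficients_mono:
  assumes F: "finite F" "inj_on m F" "!!i. i : F ==> 1 <= m i" and le: "!!i. i : F ==> \<bar>a i\<bar> <= \<bar>b i\<bar>"
  shows "tnorm S c (%k. \<Sum>i\<in>F. a i * unit_vec (m i) k) <= tnorm S c (%k. \<Sum>i\<in>F. b i * unit_vec (m i) k)"
proof (rule tnorm_mono)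
  have "(%k. \<Sum>i\<in>F. h i * unit_vec (m i) k) : c00" for h :: "_ => real" by (intro sum_c00 scale_c00 unit_vec_c00 F(3))
  thus "(%k. \<Sum>i\<in>F. a i * unit_vec (m i) k) : c00" "(%k. \<Sum>i\<in>F. b i * unit_vec (m i) k) : c00" by blast+
  fix k
  show "\<bar>\<Sum>i\<in>F. a i * unit_vec (m i) k\<bar> <= \<bar>\<Sum>i\<in>F. b i * unit_vec (m i) k\<bar>"
  proof (cases "k : m ` F")
    case True
    then obtain i where i: "i : F" "k = m i" by blast
    thus ?thesis using le by (simp add: unit_vec_sum_at[OF F(1,2)])
  next
    case False
    hence "(\<Sum>i\<in>F. a i * unit_vec (m i) k) = 0" by (intro sum.neutral) (auto simp: unit_vec_def)
    thus ?thesis by simp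
  qed
qed

lemma coefficient_le_tnorm:
  assumes F: "finite F" "inj_on m F" "!!i. i : F ==> 1 <= m i" and i: "i : F"
  shows "\<bar>a i\<bar> <= tnorm S c (%k. \<Sum>i\<in>F. a i * unit_vec (m i) k)"
proof -
  have "(%k. \<Sum>i\<in>F. a i * unit_vec (m i) k) : c00" by (intro sum_c00 scale_c00 unit_vec_c00 F(3))
  from abs_le_tnorm[OF this, of "m i"] show ?thesis by (simp add: unit_vec_sum_at[OF F(1,2) i])
qed

end

lemma tsirelson_Schreier: "approximating s ==> 0 < c ==> c < 1 ==> tsirelson (Schreier s \<alpha>) c"
  unfolding tsirelson_def tsirelson_axioms_def by (simp add: spreading_Schreier)

lemma Tsirelson_norm_eq:
  "approximating s ==> 0 < c ==> c < 1 ==> Tsirelson_norm s \<alpha> c = tnorm (Schreier s \<alpha>) c"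
  unfolding Tsirelson_norm_def by (rule tsirelson.Tsirelson_norm_unique[OF tsirelson_Schreier])

section \<open>Blocks in Tsirelson spaces\<close>

text \<open>The intervals of \<open>R\<close> that contain points of \<open>M\<close>. An interval
  that is not hit is nowhere divided by \<open>M\<close>.\<close>

definition hit :: "nat set => nat set => nat set" where
  "hit R M = {\<mu> : R. M \<inter> blk R \<mu> ~= {}}"

lemma hit_subset: "hit R M \<subseteq> R" by (auto simp: hit_def)

lemma blk_unhit:
  assumes "u : R - hit R M" "m : M" "k : blk R u" "k : blk M m"
  shows "u : blk M m"
proof -
  have "m <= u"
  proof (rule ccontr)
    assume "~ m <= u"
    hence "m : blk R u" using assms(3,4) by (auto simp: blk_def)
    thus False using assms(1,2) by (auto simp: hit_def)
  qed
  thus ?thesis using assms(3,4) by (auto simp: blk_def)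
qed

context tsirelson
begin

lemma blk_abs_le:
  assumes "x : c00" "k : B"
  shows "\<bar>x k\<bar> <= tnorm S c (restr B x)"
  using abs_le_tnorm[OF restr_c00[OF assms(1), of B], of k] assms(2) by (simp add: restr_def)

lemma sum_S_le_tnorm:
  assumes y: "y : c00" and G: "G : S"
  shows "c * (\<Sum>k\<in>G. \<bar>y k\<bar>) <= tnorm S c y"
proof (cases "G = {}")
  case False
  have "c * (\<Sum>k\<in>G. \<bar>y k\<bar>) <= c * (\<Sum>k\<in>G. tnorm S c (restr (blk G k) y))"
    using c_pos y by (intro mult_left_mono sum_mono blk_abs_le) (auto simp: blk_def)
  also have "\<dots> <= tnorm S c y" by (rule tnorm_lower[OF y G False])
  finally show ?thesis .
qed simp

text \<open>Distinct hit intervals contain distinct points of \<open>M\<close>. Increasing points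
  \<open>k u\<close>, one for each hit interval and beyond the points of \<open>M\<close> in it,
  therefore form a spread of a subset of \<open>M\<close>.\<close>

lemma hit_in_S:
  assumes M: "M : S" and k: "!!u u'. u : hit R M ==> u' : hit R M ==> u < u' ==> k u < k u'"
    and ge: "!!u m. u : hit R M ==> m : M \<inter> blk R u ==> m <= k u" and R: "finite R"
  shows "k ` hit R M : S"
proof -
  have inj: "inj_on k (hit R M)" by (rule inj_onI) (metis k less_irrefl linorder_neqE_nat)
  define h where "h u = Min (M \<inter> blk R u)" for u
  have h: "h u : M \<inter> blk R u" if "u : hit R M" for u
    unfolding h_def by (rule Min_in) (use that M fin in "auto simp: hit_def")
  show ?thesis
  proof (rule spread[OF M, where j = "%g. h (the_inv_into (hit R M) k g)"])
    show "finite (k ` hit R M)" using R finite_subset[OF hit_subset] by blast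
  next
    fix g g' assume "g : k ` hit R M" "g' : k ` hit R M" "g < g'"
    then obtain u u' where *: "u : hit R M" "u' : hit R M" "g = k u" "g' = k u'" by blast
    hence "u < u'" using `g < g'` k by (metis less_asym linorder_neqE_nat)
    have "u' <= h u'" "h u < u'"
      using h[OF *(1)] h[OF *(2)] `u < u'` *(2) hit_subset[of R M] unfolding blk_def by force+
    thus "h (the_inv_into (hit R M) k g) < h (the_inv_into (hit R M) k g')"
      using * by (simp add: the_inv_into_f_f[OF inj])
  next
    fix g assume "g : k ` hit R M"
    thus "h (the_inv_into (hit R M) k g) : M & h (the_inv_into (hit R M) k g) <= g"
      using h ge by (auto simp: the_inv_into_f_f[OF inj])
  qed
qed

text \<open>The first hit interval may start below all of \<open>M\<close>, so its starting point is
  dropped. Every other starting point lies beyond a point of \<open>M\<close> in the preceding hit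
  interval.\<close>

lemma hit_tail_in_S:
  assumes M: "M : S" and R: "finite R"
  shows "hit R M - {Min (hit R M)} : S"
proof -
  let ?H = "hit R M"
  have fH: "finite ?H" using R finite_subset[OF hit_subset] by blast
  define prev where "prev m = Max {v : ?H. v < m}" for m
  define h where "h m = Min (M \<inter> blk R m)" for m
  have h: "h m : M \<inter> blk R m" if "m : ?H" for m
    unfolding h_def by (rule Min_in) (use that M fin in "auto simp: hit_def")
  have prev: "prev m : ?H" "prev m < m" "!!v. v : ?H ==> v < m ==> v <= prev m" if "m : ?H - {Min ?H}" for m
  proof -
    have ne: "?H ~= {}" using that by auto
    have "Min ?H < m" using that fH by (metis DiffE Min_le order_le_less singletonI)
    hence "Min ?H : {v : ?H. v < m}" using Min_in[OF fH ne] by simp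
    hence f: "finite {v : ?H. v < m}" "{v : ?H. v < m} ~= {}"  by auto
    show "prev m : ?H" "prev m < m" using Max_in[OF f] by (auto simp: prev_def)
    show "v <= prev m" if "v : ?H" "v < m" for v using that by (simp add: prev_def)
  qed
  have h_less: "h v < m" if "v : ?H" "m : ?H" "v < m" for v m
    using h[OF that(1)] that(2,3) hit_subset[of R M] unfolding blk_def by force
  have h_ge: "m <= h m" if "m : ?H" for m using h[OF that] by (simp add: blk_def)
  show ?thesis
  proof (rule spread[OF M, where j = "%m. h (prev m)"])
    fix g g' assume g: "g : ?H - {Min ?H}" "g' : ?H - {Min ?H}" "g < g'"
    have "h (prev g) < g" using h_less prev[OF g(1)] g by blast
    also have "g <= prev g'" using prev(3)[OF g(2)] g by blast
    also have "\<dots> <= h (prev g')" using h_ge prev(1)[OF g(2)] by blast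
    finally show "h (prev g) < h (prev g')" .
  next
    fix g assume g: "g : ?H - {Min ?H}"
    show "h (prev g) : M & h (prev g) <= g" using h[OF prev(1)[OF g]] h_less[OF prev(1)[OF g] _ prev(2)[OF g]] g by auto
  qed (use fH in simp)
qed

text \<open>The parts of \<open>x\<close> on hit intervals are split off by the triangle inequality.
  For a fixed hit interval, \<open>tnorm_lower\<close> bounds the sum over \<open>M\<close> by the
  norm of that part, so no factor \<open>1 / c\<close> is lost.\<close>

lemma cut_estimate:
  assumes x: "x : c00" and R: "finite R" "!!k. k : supp x ==> EX u:R. u <= k"
    and M: "M : S" "M ~= {}"
  defines "V \<equiv> \<Union>u\<in>R - hit R M. blk R u"
  shows "c * (\<Sum>m\<in>M. tnorm S c (restr (blk M m) x)) <=
    c * (\<Sum>m\<in>M. tnorm S c (restr (blk M m \<inter> V) x)) + (\<Sum>u\<in>hit R M. tnorm S c (restr (blk R u) x))"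
proof -
  let ?H = "hit R M"
  have fH: "finite ?H" using R finite_subset[OF hit_subset] by blast
  have split: "restr (blk M m) x k = restr (blk M m \<inter> V) x k + (\<Sum>u\<in>?H. restr (blk M m) (restr (blk R u) x) k)" for m k
  proof (cases "x k = 0 \<or> k \<notin> blk M m")
    case True
    thus ?thesis by (auto simp: restr_def intro!: sum.neutral)
  next
    case False
    then obtain v where "v : R" "v <= k" using R(2)[of k] by (auto simp: supp_def)
    hence ne: "R ~= {}" "Min R <= k" using R(1) by (auto intro: order.trans[OF Min_le])
    define u where "u = pr R k"
    have u: "u : R" "k : blk R u" using pr_in[OF R(1) ne] by (auto simp: u_def)
    have uniq: "u' = u" if "u' : R" "k : blk R u'" for u' using pr_blk[OF R(1) that] by (simp add: u_def)
    have "(\<Sum>u\<in>?H. restr (blk M m) (restr (blk R u) x) k) = (\<Sum>v\<in>?H. if v = u then x k else 0)"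
    proof (rule sum.cong[OF refl])
      fix v assume "v : ?H"
      hence "v : R" by (simp add: hit_def)
      hence "k : blk R v \<longleftrightarrow> v = u" using uniq[of v] u(2) by blast
      thus "restr (blk M m) (restr (blk R v) x) k = (if v = u then x k else 0)" using False by (simp add: restr_def)
    qed
    also have "\<dots> = (if u : ?H then x k else 0)" using fH by simp
    moreover have "k : V \<longleftrightarrow> u \<notin> ?H" unfolding V_def using u uniq by blast
    ultimately show ?thesis  by (auto simp: restr_def)
  qed
  have "tnorm S c (restr (blk M m) x) <= tnorm S c (restr (blk M m \<inter> V) x)
      + (\<Sum>u\<in>?H. tnorm S c (restr (blk M m) (restr (blk R u) x)))" for m
  proof -
    have "tnorm S c (restr (blk M m) x) =
        tnorm S c (%k. restr (blk M m \<inter> V) x k + (\<Sum>u\<in>?H. restr (blk M m) (restr (blk R u) x) k))"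
      using split by (intro arg_cong[where f = "tnorm S c"] ext)
    also have "\<dots> <= tnorm S c (restr (blk M m \<inter> V) x) + tnorm S c (%k. \<Sum>u\<in>?H. restr (blk M m) (restr (blk R u) x) k)"
      using x by (intro tnorm_triangle sum_c00) auto
    also have "tnorm S c (%k. \<Sum>u\<in>?H. restr (blk M m) (restr (blk R u) x) k)
        <= (\<Sum>u\<in>?H. tnorm S c (restr (blk M m) (restr (blk R u) x)))" using x fH by (intro tnorm_sum) auto
    finally show ?thesis by simp
  qed
  hence "c * (\<Sum>m\<in>M. tnorm S c (restr (blk M m) x)) <= c * (\<Sum>m\<in>M. tnorm S c (restr (blk M m \<inter> V) x)
      + (\<Sum>u\<in>?H. tnorm S c (restr (blk M m) (restr (blk R u) x))))" using c_pos by (intro mult_left_mono sum_mono) auto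
  also have "\<dots> = c * (\<Sum>m\<in>M. tnorm S c (restr (blk M m \<inter> V) x))
      + (\<Sum>u\<in>?H. c * (\<Sum>m\<in>M. tnorm S c (restr (blk M m) (restr (blk R u) x))))"
    by (simp add: sum.distrib distrib_left sum.swap[of _ M] sum_distrib_left)
  also have "\<dots> <= c * (\<Sum>m\<in>M. tnorm S c (restr (blk M m \<inter> V) x)) + (\<Sum>u\<in>?H. tnorm S c (restr (blk R u) x))"
    using x by (intro add_left_mono sum_mono tnorm_lower M) auto
  finally show ?thesis .
qed

text \<open>Blocks that are not hit stay whole inside an admissible sum and contribute at most
  \<open>c * d\<close>, the coefficients having sum at most 1. The points \<kappa> of the hit blocks
  form a set of \<open>S\<close>, so the coefficients of these blocks sum to at most \<eta>.\<close>

lemma averaging_estimate: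
  assumes x: "x : c00" and R: "finite R" "R \<subseteq> {1..}" "!!k. k : supp x ==> EX \<mu>:R. \<mu> <= k"
    and b: "!!\<mu>. \<mu> : R ==> 0 <= b \<mu>" "(\<Sum>\<mu>\<in>R. b \<mu>) <= 1" and d: "0 <= d" "d <= 1"
    and blk: "!!\<mu>. \<mu> : R ==> tnorm S c (restr (blk R \<mu>) x) <= b \<mu> * d"
    and \<kappa>: "!!\<mu> \<mu>'. \<mu> : R ==> \<mu>' : R ==> \<mu> < \<mu>' ==> \<kappa> \<mu> < \<kappa> \<mu>'"
      "!!\<mu> k. \<mu> : R ==> k : supp x \<inter> blk R \<mu> ==> k <= \<kappa> \<mu>" "!!\<mu>. \<mu> : R ==> 1 <= \<kappa> \<mu>"
    and \<eta>: "0 <= \<eta>" "!!G. G \<subseteq> R ==> \<kappa> ` G : S ==> (\<Sum>\<mu>\<in>G. b \<mu>) <= \<eta>"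
  shows "tnorm S c x <= c * d + \<eta>"
proof (rule tnorm_upper[OF x])
  have cd: "0 <= c * d" using d c_pos by simp
  fix k
  show "\<bar>x k\<bar> <= c * d + \<eta>"
  proof (cases "k : supp x")
    case True
    then obtain \<nu> where "\<nu> : R" "\<nu> <= k" using R(3) by blast
    hence ne: "R ~= {}" "Min R <= k" using R(1) by (auto intro: order.trans[OF Min_le])
    have \<mu>: "pr R k : R" "k : blk R (pr R k)" using pr_in[OF R(1) ne] by auto
    have "\<bar>x k\<bar> <= b (pr R k) * d" using blk_abs_le[OF x \<mu>(2)] blk[OF \<mu>(1)] by simp
    also have "\<dots> <= b (pr R k)" using b(1)[OF \<mu>(1)] d by (simp add: mult_left_le)
    also have "\<dots> <= \<eta>" using \<eta>(2)[of "{pr R k}"] \<mu> single \<kappa>(3) by simp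
    finally show ?thesis using cd by simp
  qed (use cd \<eta> in "simp add: supp_def")
next
  fix M assume M: "M : S" "M ~= {}" "M \<subseteq> supp x"
  let ?H = "hit R M"
  define V where "V = (\<Union>\<mu>\<in>R - hit R M. blk R \<mu>)"
  define B where "B m = {\<mu> : R - ?H. \<mu> : blk M m}" for m
  have fM: "finite M" using M fin by simp
  have "tnorm S c (restr (blk M m \<inter> V) x) <= (\<Sum>\<mu>\<in>B m. b \<mu> * d)" if m: "m : M" for m
  proof -
    have "\<bar>restr (blk M m \<inter> V) x k\<bar> <= \<bar>\<Sum>\<mu>\<in>B m. restr (blk R \<mu>) x k\<bar>" for k
    proof (cases "k : blk M m \<inter> V")
      case True
      then obtain \<mu> where \<mu>: "\<mu> : R - ?H" "k : blk R \<mu>" by (auto simp: V_def)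
      hence \<mu>B: "\<mu> : B m" using blk_unhit[OF \<mu>(1) m \<mu>(2)] True by (simp add: B_def)
      have uniq: "\<mu>' = \<mu>" if "\<mu>' : B m" "k : blk R \<mu>'" for \<mu>'
      proof -
        have "\<mu>' : R" "\<mu> : R" using that(1) \<mu>(1) by (auto simp: B_def)
        thus ?thesis using pr_blk[OF R(1) _ that(2)] pr_blk[OF R(1) _ \<mu>(2)] by simp
      qed
      have "restr (blk R \<nu>) x k = (if \<nu> = \<mu> then x k else 0)" if "\<nu> : B m" for \<nu>
      proof -
        have "k : blk R \<nu> \<longleftrightarrow> \<nu> = \<mu>" using uniq[OF that] \<mu>(2) by blast
        thus ?thesis by (simp add: restr_def)
      qed
      hence "(\<Sum>\<mu>\<in>B m. restr (blk R \<mu>) x k) = (\<Sum>\<nu>\<in>B m. if \<nu> = \<mu> then x k else 0)" by (intro sum.cong[OF refl])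
      also have "\<dots> = x k" using R(1) \<mu>B by (simp add: B_def)
      finally show ?thesis by (simp add: restr_def)
    qed (auto simp: restr_def)
    hence "tnorm S c (restr (blk M m \<inter> V) x) <= tnorm S c (%k. \<Sum>\<mu>\<in>B m. restr (blk R \<mu>) x k)"
      using x by (intro tnorm_mono restr_c00 sum_c00) auto
    also have "\<dots> <= (\<Sum>\<mu>\<in>B m. tnorm S c (restr (blk R \<mu>) x))" using x R by (intro tnorm_sum) (auto simp: B_def)
    also have "\<dots> <= (\<Sum>\<mu>\<in>B m. b \<mu> * d)" by (intro sum_mono blk) (auto simp: B_def)
    finally show ?thesis .
  qed
  hence "(\<Sum>m\<in>M. tnorm S c (restr (blk M m \<inter> V) x)) <= (\<Sum>m\<in>M. \<Sum>\<mu>\<in>B m. b \<mu> * d)" by (rule sum_mono)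
  also have "\<dots> = (\<Sum>\<mu>\<in>(\<Union>m\<in>M. B m). b \<mu> * d)"
  proof (rule sum.UNION_disjoint[symmetric])
    show "ALL i:M. ALL j:M. i ~= j --> B i \<inter> B j = {}" unfolding B_def using blk_disjoint[of _ M] by blast
  qed (use fM R in "auto simp: B_def")
  also have "\<dots> <= (\<Sum>\<mu>\<in>R. b \<mu> * d)" by (rule sum_mono2) (use R b d in "auto simp: B_def")
  also have "\<dots> <= d" using mult_right_mono[OF b(2) d(1)] by (simp add: sum_distrib_right[symmetric])
  finally have 1: "c * (\<Sum>m\<in>M. tnorm S c (restr (blk M m \<inter> V) x)) <= c * d" using c_pos by simp
  have "\<kappa> ` ?H : S"
  proof (rule hit_in_S[OF M(1) _ _ R(1)])
    fix \<mu> m assume "\<mu> : ?H" "m : M \<inter> blk R \<mu>"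
    thus "m <= \<kappa> \<mu>" using \<kappa>(2) M(3) hit_subset by blast
  qed (use \<kappa>(1) hit_subset in blast)
  hence "(\<Sum>\<mu>\<in>?H. b \<mu>) <= \<eta>" using \<eta>(2) hit_subset by blast
  moreover have "(\<Sum>\<mu>\<in>?H. tnorm S c (restr (blk R \<mu>) x)) <= (\<Sum>\<mu>\<in>?H. b \<mu>)"
  proof (rule sum_mono)
    fix \<mu> assume "\<mu> : ?H"
    hence "\<mu> : R" using hit_subset by blast
    thus "tnorm S c (restr (blk R \<mu>) x) <= b \<mu>" using blk[of \<mu>] b(1)[of \<mu>] d mult_left_le[of d "b \<mu>"] by linarith
  qed
  ultimately show "c * (\<Sum>m\<in>M. tnorm S c (restr (blk M m) x)) <= c * d + \<eta>"
    using cut_estimate[OF x R(1,3) M(1,2)] 1 unfolding V_def by linarith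
qed

end

text \<open>The loss from \<open>c\<close> to \<open>c' > c\<close> turns the one-level estimate, which costs an additive
  multiple of the right-hand side, into a geometric series.\<close>

lemma (in spreading) block_domination:
  assumes c: "0 < c" "c < c'" "c' < 1"
    and x: "x : c00" and R: "finite R" "R \<subseteq> {1..}" "!!k. k : supp x ==> EX u:R. u <= k"
  shows "tnorm S c x <= (1 + 1 / c') / (1 - c / c') * tnorm S c' (%u. if u : R then tnorm S c (restr (blk R u) x) else 0)"
  using x R(3)
proof (induction "card (supp x)" arbitrary: x rule: less_induct)
  case less
  interpret a: tsirelson S c by standard (use c in auto)
  interpret b: tsirelson S c' by standard (use c in auto)
  note x = less.prems(1)
  \<comment> \<open>The fixed point of the recursion below: the part that is not hit costs
    \<open>c / c'\<close> times the inductive bound \<open>K\<close>, the hit part costs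
    \<open>1 + 1 / c'\<close>.\<close>
  define K where "K = (1 + 1 / c') / (1 - c / c')"
  define y where "y u = (if u : R then tnorm S c (restr (blk R u) x) else 0)" for u
  have y: "y : c00" by (rule c00I[OF R(1)]) (use R(2) in "auto simp: y_def")
  have y0: "0 <= y k" for k by (simp add: y_def)
  have "0 < 1 - c / c'" using c by (simp add: field_simps)
  hence K: "K = c / c' * K + (1 + 1 / c')" "1 <= K" "0 <= K"
  proof -
    assume a: "0 < 1 - c / c'"
    hence "1 - c / c' ~= 0" by linarith
    hence "K * (1 - c / c') = 1 + 1 / c'" by (rule iffD1[OF nonzero_eq_divide_eq K_def])
    thus "K = c / c' * K + (1 + 1 / c')" by (simp add: algebra_simps)
    have "1 - c / c' <= 1 + 1 / c'" using c by (simp add: field_simps)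
    thus "1 <= K" unfolding K_def using a by (simp add: le_divide_eq)
    thus "0 <= K" by simp
  qed
  have "tnorm S c x <= K * tnorm S c' y"
  proof (rule a.tnorm_upper[OF x])
    fix k
    show "\<bar>x k\<bar> <= K * tnorm S c' y"
    proof (cases "k : supp x")
      case True
      then obtain v where "v : R" "v <= k" using less.prems(2) by blast
      hence ne: "R ~= {}" "Min R <= k" using R(1) by (auto intro: order.trans[OF Min_le])
      have u: "pr R k : R" "k : blk R (pr R k)" using pr_in[OF R(1) ne] by auto
      have "\<bar>x k\<bar> <= y (pr R k)" using a.blk_abs_le[OF x u(2)] u(1) by (simp add: y_def)
      also have "\<dots> <= tnorm S c' y" using b.abs_le_tnorm[OF y, of "pr R k"] by simp
      also have "\<dots> <= K * tnorm S c' y" using K(2) mult_right_mono[of 1 K "tnorm S c' y"] by simp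
      finally show ?thesis .
    qed (use K(3) in "simp add: supp_def")
  next
    fix M assume M: "M : S" "M ~= {}" "M \<subseteq> supp x"
    let ?H = "hit R M"
    define V where "V = (\<Union>u\<in>R - ?H. blk R u)"
    have fM: "finite M" using M fin by simp
    have fH: "finite ?H" using R finite_subset[OF hit_subset] by blast
    have "tnorm S c (restr (blk M m \<inter> V) x) <= K * tnorm S c' (restr (blk M m) y)" if m: "m : M" for m
    proof -
      let ?x = "restr (blk M m \<inter> V) x"
      \<comment> \<open>A point of \<open>M\<close> lies in no interval that is not hit. It belongs
        to the support of \<open>x\<close>, so restriction to \<open>V\<close> shrinks the support
        and the induction hypothesis applies.\<close>
      have "m \<notin> V"
      proof
        assume "m : V"
        then obtain u where "u : R - ?H" "m : blk R u" by (auto simp: V_def)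
        thus False using m by (auto simp: hit_def)
      qed
      hence "supp ?x \<subset> supp x" using m M(3) by (auto simp: supp_restr)
      hence card: "card (supp ?x) < card (supp x)" using finite_supp[OF x] by (rule psubset_card_mono[rotated])
      have "tnorm S c ?x <= K * tnorm S c' (%u. if u : R then tnorm S c (restr (blk R u) ?x) else 0)"
        unfolding K_def by (rule less.hyps[OF card]) (use x less.prems(2) in "auto simp: supp_restr")
      also have "\<dots> <= K * tnorm S c' (restr (blk M m) y)"
      proof (rule mult_left_mono[OF b.tnorm_mono K(3)])
        show "(%u. if u : R then tnorm S c (restr (blk R u) ?x) else 0) : c00"
          by (rule c00I[OF R(1)]) (use R(2) in auto)
        show "restr (blk M m) y : c00" using y by simp
        fix u
        show "\<bar>if u : R then tnorm S c (restr (blk R u) ?x) else 0\<bar> <= \<bar>restr (blk M m) y u\<bar>"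
        proof (cases "u : R & restr (blk R u) ?x ~= (%_. 0)")
          case True
          hence uR: "u : R" by simp
          from True have "EX k. restr (blk R u) ?x k ~= 0" by (auto simp: fun_eq_iff)
          then obtain k where "restr (blk R u) ?x k ~= 0" by blast
          hence k: "k : blk R u" "k : blk M m" "k : V" by (auto simp: restr_def split: if_splits)
          then obtain u' where u': "u' : R - ?H" "k : blk R u'" by (auto simp: V_def)
          hence "u' = u" using pr_blk[OF R(1)] k(1) uR by (metis DiffD1)
          hence "u : blk M m" using blk_unhit[OF _ m k(1,2)] u' by blast
          moreover have "tnorm S c (restr (blk R u) ?x) <= tnorm S c (restr (blk R u) x)"
            using x by (intro a.tnorm_mono restr_c00) (auto simp: restr_def)
          ultimately show ?thesis  by (simp add: restr_def y_def)
        qed auto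
      qed
      finally show ?thesis .
    qed
    hence "(\<Sum>m\<in>M. tnorm S c (restr (blk M m \<inter> V) x)) <= K * (\<Sum>m\<in>M. tnorm S c' (restr (blk M m) y))"
      unfolding sum_distrib_left by (rule sum_mono)
    moreover have "(\<Sum>m\<in>M. tnorm S c' (restr (blk M m) y)) <= tnorm S c' y / c'"
      using b.tnorm_lower[OF y M(1,2)] c by (simp add: field_simps)
    ultimately have "(\<Sum>m\<in>M. tnorm S c (restr (blk M m \<inter> V) x)) <= K * (tnorm S c' y / c')"
      using K(3) by (meson mult_left_mono order.trans)
    hence 1: "c * (\<Sum>m\<in>M. tnorm S c (restr (blk M m \<inter> V) x)) <= c / c' * K * tnorm S c' y"
      using c by (fastforce simp: field_simps)
    have "(\<Sum>u\<in>?H. tnorm S c (restr (blk R u) x)) = (\<Sum>u\<in>?H. y u)"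
      using hit_subset[of R M] by (intro sum.cong) (auto simp: y_def)
    also have "\<dots> <= y (Min ?H) + (\<Sum>u\<in>?H - {Min ?H}. y u)"
    proof (cases "?H = {}")
      case False
      thus ?thesis using sum.remove[OF fH Min_in[OF fH False], of y] by simp
    qed (simp add: y0)
    also have "(\<Sum>u\<in>?H - {Min ?H}. y u) = (\<Sum>u\<in>?H - {Min ?H}. \<bar>y u\<bar>)" using y0 by simp
    also have "\<dots> <= tnorm S c' y / c'"
      using b.sum_S_le_tnorm[OF y a.hit_tail_in_S[OF M(1) R(1)]] c by (simp add: field_simps)
    also have "y (Min ?H) <= tnorm S c' y" using b.abs_le_tnorm[OF y, of "Min ?H"] by simp
    finally have 2: "(\<Sum>u\<in>?H. tnorm S c (restr (blk R u) x)) <= (1 + 1 / c') * tnorm S c' y" by (simp add: algebra_simps)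
    have "c * (\<Sum>m\<in>M. tnorm S c (restr (blk M m) x)) <= c / c' * K * tnorm S c' y + (1 + 1 / c') * tnorm S c' y"
      using a.cut_estimate[OF x R(1) less.prems(2) M(1,2)] 1 2 unfolding V_def by linarith
    also have "\<dots> = K * tnorm S c' y" by (subst (2) K(1)) (simp add: algebra_simps)
    finally show "c * (\<Sum>m\<in>M. tnorm S c (restr (blk M m) x)) <= K * tnorm S c' y" .
  qed
  thus ?case unfolding K_def y_def .
qed

section \<open>Descending ordinals and admissible sets\<close>

text \<open>The \<open>n\<close>-fold iterated family. The parts are the traces of \<open>F\<close>
  on the intervals of \<open>M\<close>, so no list of successive sets has to be carried
  along.\<close>

primrec adm :: "nat set set => nat => nat set set" where
  "adm S 0 = {{}} \<union> {{n} | n. 1 <= n}"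
| "adm S (Suc n) = {F. finite F & F \<subseteq> {1..} &
     (EX M:S. M \<subseteq> F & (ALL k:F. EX m:M. m <= k) & (ALL m:M. F \<inter> blk M m : adm S n))}"

lemma (in tsirelson) sum_adm_le_tnorm:
  assumes "F : adm S n" "y : c00"
  shows "c ^ n * (\<Sum>k\<in>F. \<bar>y k\<bar>) <= tnorm S c y" using assms
proof (induction n arbitrary: F y)
  case 0
  thus ?case using abs_le_tnorm by auto
next
  case (Suc n)
  then obtain M where F: "finite F" "M : S" "M \<subseteq> F" "ALL k:F. EX m:M. m <= k" "ALL m:M. F \<inter> blk M m : adm S n" by auto
  show ?case
  proof (cases "F = {}")
    case False
    hence M: "M ~= {}" using F by blast
    have fM: "finite M" using F fin by blast
    have "pr M k : M & k : blk M (pr M k)" if "k : F" for k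
    proof -
      have "Min M <= k" using F(4) that fM by (meson Min_le order.trans)
      thus ?thesis using pr_in[OF fM M] by blast
    qed
    hence "F = (\<Union>m\<in>M. F \<inter> blk M m)" by blast
    hence "(\<Sum>k\<in>F. \<bar>y k\<bar>) = (\<Sum>k\<in>(\<Union>m\<in>M. F \<inter> blk M m). \<bar>y k\<bar>)" by simp
    also have "\<dots> = (\<Sum>m\<in>M. \<Sum>k\<in>F \<inter> blk M m. \<bar>y k\<bar>)"
      by (rule sum.UNION_disjoint) (use fM F(1) blk_disjoint[of _ M] in blast)+
    finally have "c ^ n * (\<Sum>k\<in>F. \<bar>y k\<bar>) = (\<Sum>m\<in>M. c ^ n * (\<Sum>k\<in>F \<inter> blk M m. \<bar>y k\<bar>))" by (simp add: sum_distrib_left)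
    also have "\<dots> <= (\<Sum>m\<in>M. tnorm S c (restr (blk M m) y))"
    proof (rule sum_mono)
      fix m assume m: "m : M"
      have "(\<Sum>k\<in>F \<inter> blk M m. \<bar>y k\<bar>) = (\<Sum>k\<in>F \<inter> blk M m. \<bar>restr (blk M m) y k\<bar>)" by (rule sum.cong) (auto simp: restr_def)
      thus "c ^ n * (\<Sum>k\<in>F \<inter> blk M m. \<bar>y k\<bar>) <= tnorm S c (restr (blk M m) y)"
        using Suc.IH[of "F \<inter> blk M m" "restr (blk M m) y"] F(5) m Suc.prems(2) by simp
    qed
    finally have "c * (c ^ n * (\<Sum>k\<in>F. \<bar>y k\<bar>)) <= c * (\<Sum>m\<in>M. tnorm S c (restr (blk M m) y))" using c_pos by simp
    also have "\<dots> <= tnorm S c y" by (rule tnorm_lower[OF Suc.prems(2) F(2) M])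
    finally show ?thesis by (simp add: mult.assoc)
  qed simp
qed

text \<open>\<open>descents \<Lambda> \<F>\<close>: if only finitely many ordinals below \<open>\<Lambda>\<close> are available at each time, then,
  after speeding up the clock, the sets of times at which the ordinal drops belong to \<open>\<F>\<close>.\<close>

definition clocked :: "(nat => ctbl_ord set) => nat set set => (nat => nat) => bool" where
  "clocked B \<F> q \<longleftrightarrow> (ALL q' J \<beta>. strict_mono q' --> finite J --> (ALL j:J. q j <= q' j) --> (ALL j:J. \<beta> j : B j) -->
     (ALL i:J. ALL j:J. i < j --> \<beta> j < \<beta> i) --> q' ` J : \<F>)"

definition descents :: "ctbl_ord => nat set set => bool" where
  "descents \<Lambda> \<F> \<longleftrightarrow> (ALL B. (ALL j. finite (B j) & B j \<subseteq> {..<\<Lambda>}) --> (EX q. clocked B \<F> q))"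

lemma clockedD:
  assumes "clocked B \<F> q" "strict_mono q'" "finite J" "!!j. j : J ==> q j <= q' j" "!!j. j : J ==> \<beta> j : B j"
    "!!i j. i : J ==> j : J ==> i < j ==> \<beta> j < \<beta> i"
  shows "q' ` J : \<F>" by (rule assms(1)[unfolded clocked_def, rule_format, OF assms(2-6)])

lemma clockedI:
  assumes "!!q' J \<beta>. strict_mono q' ==> finite J ==> ALL j:J. q j <= q' j ==> ALL j:J. \<beta> j : B j ==>
    ALL i:J. ALL j:J. i < j --> \<beta> j < \<beta> i ==> q' ` J : \<F>"
  shows "clocked B \<F> q" unfolding clocked_def by (intro allI impI) (rule assms)

lemma descentsE:
  assumes "descents \<Lambda> \<F>" "!!j. finite (B j)" "!!j. B j \<subseteq> {..<\<Lambda>}"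
  obtains q where "clocked B \<F> q" using assms unfolding descents_def by metis

lemma descents_one:
  assumes "{} : \<F>" "!!n. 1 <= n ==> {n} : \<F>"
  shows "descents 1 \<F>" unfolding descents_def clocked_def
proof (intro allI impI exI[of _ "%_. 1 :: nat"])
  fix B :: "nat => ctbl_ord set" and q' :: "nat => nat" and J and \<beta> :: "nat => ctbl_ord"
  assume a: "ALL j. finite (B j) & B j \<subseteq> {..<1}" "ALL j:J. 1 <= q' j" "ALL j:J. \<beta> j : B j"
    "ALL i:J. ALL j:J. i < j --> \<beta> j < \<beta> i"
  have "\<beta> j = 0" if "j : J" for j
  proof -
    have "\<beta> j : {..<1}" using a(1,3) that by blast
    thus ?thesis by simp
  qed
  hence "i = j" if "i : J" "j : J" for i j using a(4) that by (metis less_irrefl linorder_neqE_nat)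
  hence "J = {} \<or> (EX j. J = {j})" by blast
  thus "q' ` J : \<F>" using assms a(2) by auto
qed

definition odiv :: "ctbl_ord => ctbl_ord => ctbl_ord" where
  "odiv a x = (SOME m. EX r<a. x = a * m + r)"

definition omod :: "ctbl_ord => ctbl_ord => ctbl_ord" where
  "omod a x = (SOME r. r < a & x = a * odiv a x + r)"

lemma odiv_omod:
  assumes "x < a * b"
  shows "odiv a x < b" "omod a x < a" "a * odiv a x + omod a x = x"
proof -
  obtain m r where mr: "m < b" "r < a" "x = a * m + r" using assms by (rule omult_div)
  have *: "EX r<a. x = a * odiv a x + r" unfolding odiv_def by (rule someI_ex) (use mr in blast)
  then obtain r' where r': "r' < a" "x = a * odiv a x + r'" by blast
  have "odiv a x = m"
    using omult_add_less_iff[OF mr(2) r'(1), of m "odiv a x"] omult_add_less_iff[OF r'(1) mr(2), of "odiv a x" m]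
      mr(3) r'(2) by (metis less_irrefl linorder_neqE)
  thus "odiv a x < b" using mr by simp
  have "omod a x < a & x = a * odiv a x + omod a x" unfolding omod_def by (rule someI_ex) (use * in blast)
  thus "omod a x < a" "a * odiv a x + omod a x = x" by simp_all
qed

lemma odiv_omod_less:
  assumes "x < a * b" "y < a * b"
  shows "x < y \<longleftrightarrow> odiv a x < odiv a y \<or> odiv a x = odiv a y & omod a x < omod a y"
  using omult_add_less_iff[OF odiv_omod(2)[OF assms(1)] odiv_omod(2)[OF assms(2)], of "odiv a x" "odiv a y"]
  by (simp add: odiv_omod(3)[OF assms(1)] odiv_omod(3)[OF assms(2)])

text \<open>Write the ordinals as \<open>a * d + r\<close>. Along a descent the quotients
  \<open>d\<close> never increase: the times at which a new quotient appears belong to a descent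
  below \<open>b\<close>, and while the quotient is constant the remainders descend below
  \<open>a\<close>. The map \<open>p\<close> of the hypothesis sends a time to the first time with
  the same quotient.\<close>

lemma descents_mult:
  assumes F: "descents a F" and G: "descents b G"
    and K: "!!H p. finite H ==> H \<subseteq> {1..} ==> (!!g. g : H ==> p g : H & p g <= g & p (p g) = p g) ==>
      (!!g g'. g : H ==> g' : H ==> g <= g' ==> p g <= p g') ==> p ` H : G ==>
      (!!v. v : p ` H ==> {g : H. p g = v} : F) ==> H : K"
  shows "descents (a * b) K" unfolding descents_def
proof (intro allI impI)
  fix B :: "nat => ctbl_ord set"
  assume B: "ALL j. finite (B j) & B j \<subseteq> {..<a * b}"
  hence BW: "x < a * b" if "x : B j" for x j using that by auto
  obtain q1 where q1: "clocked (%j. odiv a ` B j) G q1"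
    by (rule descentsE[OF G, of "%j. odiv a ` B j"]) (use B odiv_omod(1)[OF BW] in auto)
  obtain q2 where q2: "clocked (%j. omod a ` B j) F q2"
    by (rule descentsE[OF F, of "%j. omod a ` B j"]) (use B odiv_omod(2)[OF BW] in auto)
  have main: "q' ` J : K" if q': "strict_mono q'" "ALL j:J. q1 j + q2 j + 1 <= q' j" and J: "finite J" "ALL j:J. \<beta> j : B j"
    and dec: "ALL i:J. ALL j:J. i < j --> \<beta> j < \<beta> i" for q' J \<beta>
  proof -
    define d where "d j = odiv a (\<beta> j)" for j
    have lex: "\<beta> j < \<beta> i \<longleftrightarrow> d j < d i \<or> d j = d i & omod a (\<beta> j) < omod a (\<beta> i)" if "i : J" "j : J" for i j
      unfolding d_def using odiv_omod_less[OF BW BW] J(2) that by blast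
    have d_le: "d j <= d i" if "i : J" "j : J" "i <= j" for i j
      using lex[OF that(1,2)] dec that by (metis less_imp_le order_le_less)
    define r where "r j = (LEAST i. i : J & d i = d j)" for j
    have r: "r j : J & d (r j) = d j" "r j <= j" "r (r j) = r j" if "j : J" for j
    proof -
      show *: "r j : J & d (r j) = d j" unfolding r_def by (rule LeastI[of _ j]) (use that in simp)
      show "r j <= j" unfolding r_def by (rule Least_le) (use that in simp)
      show "r (r j) = r j" using * by (simp add: r_def)
    qed
    have r_eq: "d i = d j ==> r i = r j" for i j by (simp add: r_def)
    have rmono: "r i <= r j" if ij: "i : J" "j : J" "i <= j" for i j
    proof (cases "d i = d j")
      case False
      hence "~ r j <= i" using d_le[of "r j" i] d_le[OF ij] r(1)[OF ij(2)] ij by auto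
      thus ?thesis using r(2)[OF ij(1)] by simp
    next
      case True
      have "r i = r j" by (rule r_eq[OF True])
      thus ?thesis by simp
    qed
    define p where "p g = q' (r (the_inv q' g))" for g
    have p: "p (q' j) = q' (r j)" for j unfolding p_def the_inv_f_f[OF strict_mono_imp_inj_on[OF q'(1)]] ..
    have pq: "p ` q' ` J = q' ` r ` J" by (simp add: image_image p)
    show ?thesis
    proof (rule K[of _ p])
      show "finite (q' ` J)" "q' ` J \<subseteq> {1..}" using J(1) q'(2) by fastforce+
      show "p ` q' ` J : G" unfolding pq
      proof (rule clockedD[OF q1 q'(1), where \<beta> = d])
        fix j assume "j : r ` J"
        hence j: "j : J" using r(1) by auto
        thus "q1 j <= q' j" "d j : odiv a ` B j" using q'(2) J(2) by (auto simp: d_def)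
        fix i assume i: "i : r ` J" "i < j"
        hence "i : J" "r i ~= r j" using r \<open>j : r ` J\<close> by auto
        thus "d j < d i" using d_le[of i j] r_eq[of i j] j i(2) by (auto simp: order_le_less)
      qed (use J(1) in simp)
    next
      fix v assume "v : p ` q' ` J"
      then obtain k where k: "k : J" "v = q' (r k)" unfolding pq by blast
      have "{g : q' ` J. p g = v} = q' ` {j : J. d j = d k}"
      proof (intro equalityI subsetI)
        fix g assume "g : {g : q' ` J. p g = v}"
        then obtain j where j: "j : J" "g = q' j" "q' (r j) = q' (r k)" using k by (auto simp: p)
        hence "r j = r k" using strict_mono_eq[OF q'(1)] by blast
        hence "d j = d k" using r(1)[OF j(1)] r(1)[OF k(1)] by metis
        thus "g : q' ` {j : J. d j = d k}" using j by blast
      next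
        fix g assume "g : q' ` {j : J. d j = d k}"
        then obtain j where j: "j : J" "g = q' j" "d j = d k" by blast
        thus "g : {g : q' ` J. p g = v}" using r_eq[OF j(3)] k by (simp add: p)
      qed
      moreover have "q' ` {j : J. d j = d k} : F"
      proof (rule clockedD[OF q2 q'(1), where \<beta> = "%j. omod a (\<beta> j)"])
        fix j assume j: "j : {j : J. d j = d k}"
        thus "q2 j <= q' j" "omod a (\<beta> j) : omod a ` B j" using q'(2) J(2) by auto
        fix i assume i: "i : {j : J. d j = d k}" "i < j"
        hence "\<beta> j < \<beta> i" using dec j by blast
        thus "omod a (\<beta> j) < omod a (\<beta> i)" using lex[of i j] i(1) j by simp
      qed (use J(1) in simp)
      ultimately show "{g : q' ` J. p g = v} : F" by simp
    qed (use r rmono strict_mono_less_eq[OF q'(1)] in "auto simp: p")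
  qed
  have "clocked B K (%j. q1 j + q2 j + 1)" by (rule clockedI, rule main) assumption+
  thus "EX q. clocked B K q" by blast
qed

lemma fin_ord_le_iff: "fin_ord m <= fin_ord n \<longleftrightarrow> m <= n"
  using fin_ord_mono less_osuc by (metis fin_ord.simps(2) leD not_less_eq_eq order_less_le_trans)

text \<open>The clock reading at time \<open>j\<close> exceeds every number available then, so a
  descent that begins at \<open>j\<close> has at most that many members.\<close>

lemma descents_omega: "descents omega {A. A = {} \<or> card A <= Min A}" unfolding descents_def
proof (intro allI impI)
  fix B :: "nat => ctbl_ord set"
  assume B: "ALL j. finite (B j) & B j \<subseteq> {..<omega}"
  hence "EX n. x = fin_ord n" if "x : B j" for x j using that less_omega_iff by blast
  then obtain m where m: "!!j x. x : B j ==> x = fin_ord (m x)" by metis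
  have q: "m x < (\<Sum>x\<in>B j. m x) + 1" if "x : B j" for x j
    using B member_le_sum[of x "B j" m] that by (auto simp: less_Suc_eq_le)
  have main: "card (q' ` J) <= Min (q' ` J)" if q': "strict_mono q'" "ALL j:J. (\<Sum>x\<in>B j. m x) + 1 <= q' j"
    and J: "finite J" "ALL j:J. \<beta> j : B j" "J ~= {}" and dec: "ALL i:J. ALL j:J. i < j --> \<beta> j < \<beta> i" for q' J \<beta>
  proof -
    have j0: "Min J : J" using J by simp
    have inj: "inj_on (%j. m (\<beta> j)) J"
    proof (rule inj_onI)
      fix i j assume ij: "i : J" "j : J" "m (\<beta> i) = m (\<beta> j)"
      hence "\<beta> i = \<beta> j" using m[of "\<beta> i" i] m[of "\<beta> j" j] J(2) by simp
      thus "i = j" using dec ij(1,2) by (metis less_irrefl linorder_neqE_nat)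
    qed
    have "m (\<beta> j) <= m (\<beta> (Min J))" if "j : J" for j
    proof -
      have "\<beta> j <= \<beta> (Min J)" using dec j0 that Min_le[OF J(1) that] by (metis less_imp_le order_le_less)
      moreover have "\<beta> j = fin_ord (m (\<beta> j))" "\<beta> (Min J) = fin_ord (m (\<beta> (Min J)))" using m J(2) j0 that by blast+
      ultimately show ?thesis by (metis fin_ord_le_iff)
    qed
    moreover have "m (\<beta> (Min J)) < q' (Min J)"
      using q[of "\<beta> (Min J)" "Min J"] q'(2) J(2) j0 by (meson order_less_le_trans)
    ultimately have "(%j. m (\<beta> j)) ` J \<subseteq> {..<q' (Min J)}" using order_le_less_trans by blast
    from card_mono[OF finite_lessThan this] have "card J <= q' (Min J)" by (simp add: card_image[OF inj])
    moreover have "card (q' ` J) <= card J" by (rule card_image_le[OF J(1)])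
    moreover have "Min (q' ` J) = q' (Min J)" using J(1,3) q'(1) by (intro Min_eqI) (auto simp: strict_mono_less_eq)
    ultimately show ?thesis by simp
  qed
  have "clocked B {A. A = {} \<or> card A <= Min A} (%j. (\<Sum>x\<in>B j. m x) + 1)"
  proof (rule clockedI)
    fix q' :: "nat => nat" and J and \<beta> :: "nat => ctbl_ord"
    assume "strict_mono q'" "finite J" "ALL j:J. (\<Sum>x\<in>B j. m x) + 1 <= q' j" "ALL j:J. \<beta> j : B j"
      "ALL i:J. ALL j:J. i < j --> \<beta> j < \<beta> i"
    thus "q' ` J : {A. A = {} \<or> card A <= Min A}" using main[of q' J \<beta>] by (cases "J = {}") simp_all
  qed
  thus "EX q. clocked B {A. A = {} \<or> card A <= Min A} q" by blast
qed

text \<open>At a limit \<xi> the finitely many ordinals available at time \<open>j\<close> lie below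
  \<open>wexp (s \<xi> (N j))\<close>, and a descent that starts at \<open>j0\<close> remains below
  the power for \<open>N j0\<close>. The clock \<open>q\<close> runs at least as fast as the clocks
  of all powers met so far, and as \<open>N\<close> itself; the latter is the condition
  \<open>n <= Min E\<close> of the limit family.\<close>

lemma descents_Schreier:
  assumes s: "approximating s"
  shows "descents (wexp \<alpha>) (Schreier s \<alpha>)"
proof (induction \<alpha> rule: ord_induct)
  case zero
  thus ?case unfolding wexp_0 using empty_Schreier[OF s] Schreier_singleton[OF s] by (rule descents_one)
next
  case (suc \<alpha>)
  have "descents (wexp \<alpha> * omega) (Schreier s (osuc \<alpha>))"
  proof (rule descents_mult[OF suc.IH descents_omega])
    fix H and p :: "nat => nat"
    assume H: "finite H" "H \<subseteq> {1..}" and p: "!!g. g : H ==> p g : H & p g <= g & p (p g) = p g"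
      "!!g g'. g : H ==> g' : H ==> g <= g' ==> p g <= p g'"
      and G: "p ` H : {A. A = {} \<or> card A <= Min A}" "!!v. v : p ` H ==> {g : H. p g = v} : Schreier s \<alpha>"
    show "H : Schreier s (osuc \<alpha>)"
    proof (cases "H = {}")
      case False
      have "card (p ` H) <= Min (p ` H)" using G(1) False by simp
      also have "\<dots> <= p (Min H)" using False H(1) by simp
      also have "\<dots> <= Min H" using p(1)[of "Min H"] False H(1) by simp
      finally show ?thesis by (intro Schreier_osucI[of H p]) (use H p G False in auto)
    qed (simp add: empty_Schreier[OF s])
  qed
  thus ?case by simp
next
  case (lim \<xi>)
  show ?case unfolding descents_def
  proof (intro allI impI)
    fix B :: "nat => ctbl_ord set"
    assume B: "ALL j. finite (B j) & B j \<subseteq> {..<wexp \<xi>}"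
    have ex: "EX n>=1. x < wexp (s \<xi> n)" if "x < wexp \<xi>" for x
    proof -
      obtain d where d: "d < \<xi>" "x < wexp d" using normal_less_limit[OF normal_wexp lim.hyps(1) `x < wexp \<xi>`] by metis
      obtain n where "1 <= n" "d < s \<xi> n" using approximating_cofinal[OF s lim.hyps(1) d(1)] by metis
      moreover from this have "wexp d <= wexp (s \<xi> n)" by simp
      ultimately show ?thesis using d(2) by (meson order_less_le_trans)
    qed
    have smono: "s \<xi> m <= s \<xi> n" if "1 <= m" "m <= n" for m n
    proof (cases "m = n")
      case False
      hence "s \<xi> m < s \<xi> n" using s lim.hyps(1) that unfolding approximating_def strict_mono_on_def by auto
      thus ?thesis by simp
    qed simp
    have "EX n>=1. ALL x:A. x < wexp (s \<xi> n)" if "finite A" "A \<subseteq> {..<wexp \<xi>}" for A using that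
    proof (induction A)
      case (insert x A)
      then obtain n m where "1 <= n" "ALL x:A. x < wexp (s \<xi> n)" "1 <= m" "x < wexp (s \<xi> m)" using ex[of x] by auto
      moreover from this have "wexp (s \<xi> n) <= wexp (s \<xi> (max m n))" "wexp (s \<xi> m) <= wexp (s \<xi> (max m n))"
        using smono by simp_all
      ultimately show ?case by (intro exI[of _ "max m n"]) (auto intro: order_less_le_trans)
    qed auto
    hence "EX n>=1. ALL x:B j. x < wexp (s \<xi> n)" for j using B by blast
    then obtain N where N: "!!j. 1 <= N j" "!!j x. x : B j ==> x < wexp (s \<xi> (N j))" by metis
    have "EX q. clocked (%j. B j \<inter> {..<wexp (s \<xi> n)}) (Schreier s (s \<xi> n)) q" if "1 <= n" for n
      by (rule descentsE[OF lim.IH[OF approximating_less[OF s lim.hyps(1) that]], of "%j. B j \<inter> {..<wexp (s \<xi> n)}"])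
        (use B in auto)
    then obtain Q where Q: "!!n. 1 <= n ==> clocked (%j. B j \<inter> {..<wexp (s \<xi> n)}) (Schreier s (s \<xi> n)) (Q n)" by metis
    define q where "q j = (\<Sum>i\<le>j. Q (N i) j) + N j" for j
    have qQ: "Q (N i) j <= q j" if "i <= j" for i j
      using member_le_sum[of i "{..j}" "%i. Q (N i) j"] that by (simp add: q_def)
    show "EX q. clocked B (Schreier s \<xi>) q" unfolding clocked_def
    proof (intro exI[of _ q] allI impI)
      fix q' :: "nat => nat" and J and \<beta> :: "nat => ctbl_ord"
      assume q': "strict_mono q'" "ALL j:J. q j <= q' j" and J: "finite J" "ALL j:J. \<beta> j : B j"
        and dec: "ALL i:J. ALL j:J. i < j --> \<beta> j < \<beta> i"
      show "q' ` J : Schreier s \<xi>"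
      proof (cases "J = {}")
        case True thus ?thesis using empty_Schreier[OF s] by simp
      next
        case False
        define j0 where "j0 = Min J"
        have j0: "j0 : J" "!!j. j : J ==> j0 <= j" using False J(1) by (auto simp: j0_def)
        have min: "Min (q' ` J) = q' j0" using J(1) j0 q'(1) by (intro Min_eqI) (auto simp: strict_mono_less_eq)
        have "\<beta> j : B j \<inter> {..<wexp (s \<xi> (N j0))}" if "j : J" for j
        proof -
          have "\<beta> j <= \<beta> j0" using dec j0 that by (metis less_imp_le order_le_less)
          thus ?thesis using N(2)[of "\<beta> j0" j0] J(2) j0(1) that by (auto intro: order_le_less_trans)
        qed
        moreover have "Q (N j0) j <= q' j" if "j : J" for j
          using qQ[OF j0(2)[OF that]] q'(2) that by (meson order.trans)
        ultimately have "q' ` J : Schreier s (s \<xi> (N j0))"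
          using q' J dec by (intro clockedD[OF Q[OF N(1)], where \<beta> = \<beta>]) auto
        moreover have "N j0 <= Min (q' ` J)" unfolding min using q'(2) j0(1) by (metis add_leD2 q_def)
        ultimately show ?thesis using Schreier_limit_iff[OF s lim.hyps(1), of "q' ` J"] False J N(1) by auto
      qed
    qed
  qed
qed

lemma descents_adm:
  assumes s: "approximating s"
  shows "descents (wpow \<alpha> n) (adm (Schreier s \<alpha>) n)"
proof (induction n)
  case 0
  show ?case unfolding wpow_0 by (rule descents_one) auto
next
  case (Suc n)
  show ?case unfolding wpow_Suc
  proof (rule descents_mult[OF Suc.IH descents_Schreier[OF s]])
    fix H and p :: "nat => nat"
    assume H: "finite H" "H \<subseteq> {1..}" and p: "!!g. g : H ==> p g : H & p g <= g & p (p g) = p g"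
      "!!g g'. g : H ==> g' : H ==> g <= g' ==> p g <= p g'"
      and G: "p ` H : Schreier s \<alpha>" "!!v. v : p ` H ==> {g : H. p g = v} : adm (Schreier s \<alpha>) n"
    have "H \<inter> blk (p ` H) (p h) = {g : H. p g = p h}" if "h : H" for h
    proof (intro equalityI subsetI)
      fix k assume "k : H \<inter> blk (p ` H) (p h)"
      hence k: "k : H" "p h <= k" "!!i. i : H ==> p i <= k ==> p i <= p h" by (auto simp: blk_def)
      have "p h <= p k" using p(2)[of "p h" k] p(1)[OF that] k by simp
      thus "k : {g : H. p g = p h}" using k p(1)[OF k(1)] by force
    next
      fix k assume "k : {g : H. p g = p h}"
      hence k: "k : H" "p k = p h" by auto
      have "p i <= p k" if "i : H" "p i <= k" for i using p(2)[of "p i" k] p(1)[OF that(1)] k(1) that(2) by simp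
      thus "k : H \<inter> blk (p ` H) (p h)" using k p(1)[OF k(1)] by (auto simp: blk_def)
    qed
    thus "H : adm (Schreier s \<alpha>) (Suc n)"
      using H p(1) G unfolding adm.simps by (intro CollectI conjI bexI[OF _ G(1)]) (auto intro: bexI[rotated])
  qed
qed

section \<open>Small averages on trees of prescribed rank\<close>

text \<open>\<open>forces P \<beta> t\<close>: however the opponent prolongs the tuple \<open>t\<close>, a tuple satisfying \<open>P\<close> is
  reached before a clock starting at \<open>\<beta>\<close> runs out.\<close>

inductive forces :: "(nat list => bool) => ctbl_ord => nat list => bool" for P where
  stop: "P t ==> forces P \<beta> t"
| move: "(!!n. increasing_tuple (t @ [n]) ==> EX \<gamma><\<beta>. forces P \<gamma> (t @ [n])) ==> forces P \<beta> t"

lemma forces_mono: "forces P \<beta> t ==> \<beta> <= \<beta>' ==> forces P \<beta>' t"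
proof (induction arbitrary: \<beta>' rule: forces.induct)
  case (move t \<beta>)
  show ?case
  proof (rule forces.move)
    fix n assume "increasing_tuple (t @ [n])"
    then obtain g where "g < \<beta>" "forces P g (t @ [n])" using move.IH by blast
    thus "EX \<gamma><\<beta>'. forces P \<gamma> (t @ [n])" using move.prems order_less_le_trans by blast
  qed
qed (rule forces.stop)

text \<open>The order of the summands matters: the first stage uses up \<beta> on the right, after
  which \<open>h\<close> is left for the second stage.\<close>

lemma forces_bind:
  assumes "forces P \<beta> t" "!!t'. P t' ==> forces Q h t'"
  shows "forces Q (h + \<beta>) t" using assms(1)
proof (induction rule: forces.induct)
  case (stop t \<beta>)
  thus ?case using assms(2) forces_mono le_oadd by blast
next
  case (move t \<beta>)
  show ?case
  proof (rule forces.move)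
    fix n assume "increasing_tuple (t @ [n])"
    then obtain g where "g < \<beta>" "forces Q (h + g) (t @ [n])" using move by blast
    thus "EX h'<h + \<beta>. forces Q h' (t @ [n])" by (intro exI[of _ "h + g"]) simp
  qed
qed

lemma forces_imp: "forces P \<beta> t ==> (!!t. P t ==> Q t) ==> forces Q \<beta> t"
proof (induction rule: forces.induct)
  case (move t \<beta>)
  thus ?case by (intro forces.move) blast
qed (blast intro: forces.stop)

definition prob_on :: "nat set => (nat => real) => bool" where
  "prob_on U b \<longleftrightarrow> (ALL k. 0 <= b k) & (ALL k. k \<notin> U --> b k = 0) & (\<Sum>k\<in>U. b k) = 1"

definition small_avg :: "nat set set => real => nat list => nat list => bool" where
  "small_avg \<F> \<eta> t0 t \<longleftrightarrow> (EX u b. t = t0 @ u & increasing_tuple t & prob_on (set u) b &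
     (ALL G:\<F>. (\<Sum>k\<in>G. b k) <= \<eta>))"

lemma increasing_tuple_append:
  "increasing_tuple (t @ u) \<longleftrightarrow> increasing_tuple t & increasing_tuple u & (ALL a:set t. ALL b:set u. a < b)"
  by (auto simp: increasing_tuple_def sorted_wrt_append)

lemma increasing_tuple_singleton [simp]: "increasing_tuple [n] \<longleftrightarrow> 1 <= n" by (auto simp: increasing_tuple_def)

lemma increasing_tuple_Nil [simp]: "increasing_tuple []" by (simp add: increasing_tuple_def)

lemma prob_on_nonempty: "prob_on (set u) b ==> u ~= []" by (auto simp: prob_on_def)

lemma prob_on_unit: "prob_on {n} (unit_vec n)" by (auto simp: prob_on_def unit_vec_def)

lemma prob_on_sum_le:
  assumes "prob_on U b" "finite U" "finite G"
  shows "(\<Sum>k\<in>G. b k) <= 1"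
proof -
  have "(\<Sum>k\<in>G. b k) = (\<Sum>k\<in>G \<inter> U. b k)" using assms by (intro sum.mono_neutral_right) (auto simp: prob_on_def)
  also have "\<dots> <= (\<Sum>k\<in>U. b k)" using assms by (intro sum_mono2) (auto simp: prob_on_def)
  finally show ?thesis using assms by (simp add: prob_on_def)
qed

lemma forces_point:
  assumes "increasing_tuple t0" shows "forces (%t. EX n. t = t0 @ [n] & increasing_tuple t) 1 t0"
proof (rule forces.move)
  fix n assume "increasing_tuple (t0 @ [n])"
  thus "EX \<gamma><1. forces (%t. EX n. t = t0 @ [n] & increasing_tuple t) \<gamma> (t0 @ [n])"
    by (intro exI[of _ "0 :: ctbl_ord"] conjI forces.stop exI[of _ n]) simp_all
qed

text \<open>The sets of \<open>\<S>\<^sub>\<gamma>\<close> with minimum at most \<open>M\<close> split into at most \<open>M\<close> sets from lower families.\<close>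

definition lower_indices :: "(ctbl_ord => nat => ctbl_ord) => ctbl_ord set => nat => ctbl_ord set" where
  "lower_indices s I M = {\<gamma>. osuc \<gamma> : I} \<union> (\<Union>\<gamma>\<in>{\<gamma>\<in>I. is_limit \<gamma>}. s \<gamma> ` {1..M})"

lemma finite_lower_indices: "finite I ==> finite (lower_indices s I M)"
proof -
  assume I: "finite I"
  have "finite (osuc ` {g. osuc g : I})" by (rule finite_subset[OF _ I]) auto
  hence "finite {g. osuc g : I}" by (rule finite_imageD) (auto simp: inj_on_def osuc_inject)
  thus ?thesis using I by (simp add: lower_indices_def)
qed

lemma lower_indices_less:
  assumes "approximating s" "!!g. g : I ==> g <= \<alpha>" "g : lower_indices s I M"
  shows "g < \<alpha>" using assms(3) unfolding lower_indices_def
proof (elim UnE)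
  assume "g : {g. osuc g : I}"
  thus ?thesis using assms(2)[of "osuc g"] by (simp add: osuc_le_iff)
next
  assume "g : (\<Union>g\<in>{g\<in>I. is_limit g}. s g ` {1..M})"
  then obtain d i where "d : I" "is_limit d" "1 <= i" "g = s d i" by auto
  thus ?thesis using approximating_less[OF assms(1), of d i] assms(2)[of d] by auto
qed

text \<open>A set of a successor family falls into at most \<open>Min G <= M\<close> parts from the
  preceding family, a set of a limit family belongs to one lower family; in both cases the bound
  \<open>h / M\<close> for lower families yields \<open>h\<close>. Singletons have no lower family
  and are covered by \<open>zero\<close>.\<close>

lemma mass_via_lower_indices:
  assumes s: "approximating s" and G: "G : Schreier s u" "u : I" "G ~= {}" "Min G <= M" "1 <= M"
    and y: "!!k. 0 <= y k" "0 <= h" and zero: "u = 0 ==> (\<Sum>k\<in>G. y k) = 0"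
    and small: "!!F. F : (\<Union>u\<in>lower_indices s I M. Schreier s u) ==> (\<Sum>k\<in>F. y k) <= h / M"
  shows "(\<Sum>k\<in>G. y k) <= h"
proof -
  have fG: "finite G" using Schreier_finite[OF s G(1)] by simp
  consider "u = 0" | d where "u = osuc d" | "is_limit u" by (auto simp: is_limit_def)
  thus ?thesis
  proof cases
    case 1 thus ?thesis using zero y by simp
  next
    case 2
    obtain f :: "nat => nat" where f: "card (f ` G) <= Min G" "ALL v:f ` G. {g : G. f g = v} : Schreier s d"
      using Schreier_osucE[OF G(1)[unfolded 2] G(3)] by metis
    have "d : lower_indices s I M" using G(2) 2 by (simp add: lower_indices_def)
    hence *: "(\<Sum>k\<in>{g : G. f g = v}. y k) <= h / M" if "v : f ` G" for v using small f(2) that by blast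
    have "(\<Sum>k\<in>G. y k) = (\<Sum>v\<in>f ` G. \<Sum>k\<in>{g : G. f g = v}. y k)" using fG by (rule sum.image_gen)
    also have "\<dots> <= card (f ` G) * (h / M)"
      using sum_bounded_above[of "f ` G" "%v. \<Sum>k\<in>{g : G. f g = v}. y k" "h / M"] * by simp
    also have "\<dots> <= real M * (h / M)" using f(1) G(4) y(2) by (intro mult_right_mono) auto
    also have "\<dots> = h" using G(5) by simp
    finally show ?thesis .
  next
    case 3
    obtain n where n: "1 <= n" "n <= Min G" "G : Schreier s (s u n)" using G(1) Schreier_limit_iff[OF s 3 G(3)] by blast
    have "s u n : lower_indices s I M" using n G 3 unfolding lower_indices_def by (intro UnI2 UN_I[of u]) auto
    hence "(\<Sum>k\<in>G. y k) <= h / M" using small n(3) by blast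
    also have "\<dots> <= h" using y(2) G(5) by (simp add: divide_le_eq mult_le_cancel_left1)
    finally show ?thesis .
  qed
qed

text \<open>The average is built in \<open>L\<close> stages of mass 1. A set that begins after the
  earlier stages receives at most 1 from the current one. A set that has met an earlier stage has
  minimum at most \<open>M\<close>, the last index played, and by induction the current stage can be
  arranged to give it at most \<open>h / 2\<close>. Division by \<open>L > 2 / h\<close> leaves
  \<open>1 / L + h / 2 <= h\<close>. A stage costs at most \<open>wexp \<alpha>\<close>, since the
  lower families have ranks below \<alpha>.\<close>

lemma forces_small_avg:
  assumes s: "approximating s"
  shows "finite I ==> (!!g. g : I ==> g <= \<alpha>) ==> 0 < h ==>
    EX L. ALL t0. increasing_tuple t0 --> forces (small_avg (\<Union>g\<in>I. Schreier s g) h t0) (wexp \<alpha> * fin_ord L) t0"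
proof (induction \<alpha> arbitrary: I h rule: less_induct)
  case (less \<alpha>)
  define \<F> where "\<F> = (\<Union>g\<in>I. Schreier s g)"
  have fin\<F>: "finite G" if "G : \<F>" for G using that Schreier_finite[OF s] by (auto simp: \<F>_def)
  define stage where "stage t0 j t \<longleftrightarrow> (EX u b. t = t0 @ u & increasing_tuple t & (ALL k. 0 <= b k) &
      (ALL k. k \<notin> set u --> b k = (0::real)) & (\<Sum>k\<in>set u. b k) = real j &
      (ALL G:\<F>. (\<Sum>k\<in>G. b k) <= 1 + real j * (h / 2)))" for t0 j t
  have step: "forces (stage t0 (Suc j)) (wexp \<alpha>) t" if st: "stage t0 j t" for t0 j t
  proof -
    obtain u b where u: "t = t0 @ u" "increasing_tuple t" "ALL k. 0 <= b k" "ALL k. k \<notin> set u --> b k = (0::real)"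
      "(\<Sum>k\<in>set u. b k) = real j" "ALL G:\<F>. (\<Sum>k\<in>G. b k) <= 1 + real j * (h / 2)" using st unfolding stage_def by blast
    define M where "M = Max (insert 1 (set u))"
    have M: "1 <= M" "!!k. k : set u ==> k <= M" by (auto simp: M_def)
    let ?L = "lower_indices s I M"
    let ?\<G> = "\<Union>g\<in>?L. Schreier s g"
    have stage: "stage t0 (Suc j) t'" if t': "t' = t @ u'" "increasing_tuple t'" "prob_on (set u') y"
      and small: "ALL G:?\<G>. (\<Sum>k\<in>G. y k) <= h / 2 / M" and zero: "\<alpha> = 0 ==> EX n. u' = [n]" for t' u' y unfolding stage_def
    proof (intro exI[of _ "u @ u'"] exI[of _ "%k. b k + y k"] conjI allI impI ballI)
      show "t' = t0 @ u @ u'" "increasing_tuple t'" using t' u by auto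
      show "0 <= b k + y k" for k using u t' by (simp add: prob_on_def)
      show "b k + y k = 0" if "k \<notin> set (u @ u')" for k using u t' that by (simp add: prob_on_def)
      have disj: "set u \<inter> set u' = {}" using t'(2) unfolding t'(1) u(1) by (auto simp: increasing_tuple_append)
      have "(\<Sum>k\<in>set (u @ u'). b k + y k) = (\<Sum>k\<in>set u \<union> set u'. b k) + (\<Sum>k\<in>set u \<union> set u'. y k)"
        by (simp add: sum.distrib)
      also have "(\<Sum>k\<in>set u \<union> set u'. b k) = (\<Sum>k\<in>set u. b k)" using u(4) by (intro sum.mono_neutral_right) auto
      also have "(\<Sum>k\<in>set u \<union> set u'. y k) = (\<Sum>k\<in>set u'. y k)"
        using t'(3) by (intro sum.mono_neutral_right) (auto simp: prob_on_def)
      finally show "(\<Sum>k\<in>set (u @ u'). b k + y k) = real (Suc j)" using u(5) t'(3) by (simp add: prob_on_def)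
      fix G assume G: "G : \<F>"
      then obtain g where g: "g : I" "G : Schreier s g" by (auto simp: \<F>_def)
      show "(\<Sum>k\<in>G. b k + y k) <= 1 + real (Suc j) * (h / 2)"
      proof (cases "G \<inter> set u = {}")
        case True
        hence "(\<Sum>k\<in>G. b k) = 0" using u(4) by (intro sum.neutral) auto
        moreover have "(\<Sum>k\<in>G. y k) <= 1" using prob_on_sum_le[OF t'(3) _ fin\<F>[OF G]] by simp
        ultimately show ?thesis using less.prems(3) by (simp add: sum.distrib add_increasing2)
      next
        case False
        then obtain n where n: "n : G" "n : set u" by blast
        have "Min G <= M" using n M fin\<F>[OF G] Min_le[of G n] by (meson order.trans)
        have "(\<Sum>k\<in>G. y k) <= h / 2"
        proof (rule mass_via_lower_indices[OF s g(2,1) _ `Min G <= M` M(1)])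
          show "0 <= y k" for k using t'(3) by (simp add: prob_on_def)
          show "(\<Sum>k\<in>G. y k) = 0" if "g = 0"
          proof -
            have "G = {n}" using g(2) n(1) that by (auto simp: Schreier_0)
            moreover have "n \<notin> set u'" using disj n by blast
            ultimately show ?thesis using t'(3) by (simp add: prob_on_def)
          qed
        qed (use n less.prems(3) small in auto)
        moreover have "(\<Sum>k\<in>G. b k) <= 1 + real j * (h / 2)" using u(6) G by blast
        moreover have "real (Suc j) * (h / 2) = real j * (h / 2) + h / 2" by (simp add: algebra_simps)
        ultimately show ?thesis unfolding sum.distrib by linarith
      qed
    qed
    show ?thesis
    proof (cases "\<alpha> = 0")
      case True
      hence "I \<subseteq> {0}" using less.prems by auto
      hence L: "?L = {}" by (auto simp: lower_indices_def osuc_neq_0 is_limit_def)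
      have "forces (stage t0 (Suc j)) 1 t"
      proof (rule forces_imp[OF forces_point[OF u(2)]])
        fix t' assume "EX n. t' = t @ [n] & increasing_tuple t'"
        then obtain n where "t' = t @ [n]" "increasing_tuple t'" by blast
        thus "stage t0 (Suc j) t'" by (intro stage[of t' "[n]" "unit_vec n"]) (auto simp: prob_on_unit L)
      qed
      thus ?thesis using True by simp
    next
      case False
      define \<alpha>' where "\<alpha>' = Max (insert 0 ?L)"
      have fL: "finite (insert 0 ?L)" using finite_lower_indices less.prems by simp
      have "g < \<alpha>" if "g : insert 0 ?L" for g
        using that lower_indices_less[OF s less.prems(2)] False by (auto simp: gt_0_iff)
      hence \<alpha>': "\<alpha>' < \<alpha>" using Max_in[OF fL] unfolding \<alpha>'_def by blast
      have "g <= \<alpha>'" if "g : ?L" for g using Max_ge[OF fL] that by (simp add: \<alpha>'_def)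
      then obtain L where L: "!!t0. increasing_tuple t0 ==> forces (small_avg ?\<G> (h / 2 / M) t0) (wexp \<alpha>' * fin_ord L) t0"
        using less.IH[OF \<alpha>', of ?L "h / 2 / M"] fL less.prems(3) M(1) by auto
      have "forces (stage t0 (Suc j)) (wexp \<alpha>' * fin_ord L) t"
      proof (rule forces_imp[OF L[OF u(2)]])
        fix t' assume "small_avg ?\<G> (h / 2 / M) t t'"
        thus "stage t0 (Suc j) t'" unfolding small_avg_def using stage False by blast
      qed
      moreover have "wexp \<alpha>' * fin_ord L <= wexp \<alpha>"
      proof -
        have "wexp (osuc \<alpha>') <= wexp \<alpha>" using \<alpha>' by (simp del: wexp_osuc add: osuc_le_iff)
        thus ?thesis using wexp_mult_fin_less[of \<alpha>' L] by simp
      qed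
      ultimately show ?thesis by (rule forces_mono)
    qed
  qed
  have steps: "forces (stage t0 (j + k)) (wexp \<alpha> * fin_ord k) t" if "stage t0 j t" for t0 j k t using that
  proof (induction k arbitrary: j t)
    case (Suc k)
    have "forces (stage t0 (Suc j + k)) (wexp \<alpha> * fin_ord k + wexp \<alpha>) t"
      by (rule forces_bind[OF step[OF Suc.prems] Suc.IH])
    thus ?case by simp
  qed (simp add: forces.stop)
  obtain L :: nat where L: "2 / h < L" using reals_Archimedean2 by blast
  have L0: "0 < real L" using L less.prems(3) by (metis divide_pos_pos less_trans zero_less_numeral)
  have "forces (small_avg \<F> h t0) (wexp \<alpha> * fin_ord L) t0" if t0: "increasing_tuple t0" for t0
  proof -
    have "stage t0 0 t0" unfolding stage_def by (intro exI[of _ "[]"] exI[of _ "%_. 0"]) (use t0 in auto)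
    from steps[OF this, of L] have "forces (stage t0 L) (wexp \<alpha> * fin_ord L) t0" by simp
    thus ?thesis
    proof (rule forces_imp)
      fix t assume "stage t0 L t"
      then obtain u b where u: "t = t0 @ u" "increasing_tuple t" "ALL k. 0 <= b k" "ALL k. k \<notin> set u --> b k = (0::real)"
        "(\<Sum>k\<in>set u. b k) = real L" "ALL G:\<F>. (\<Sum>k\<in>G. b k) <= 1 + real L * (h / 2)" unfolding stage_def by blast
      have "prob_on (set u) (%k. b k / L)" using u L0 by (simp add: prob_on_def sum_divide_distrib[symmetric])
      moreover have "(\<Sum>k\<in>G. b k / L) <= h" if "G : \<F>" for G
      proof -
        have "(\<Sum>k\<in>G. b k / L) <= (1 + real L * (h / 2)) / L"
          using u(6) that L0 by (simp add: sum_divide_distrib[symmetric] divide_right_mono)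
        also have "\<dots> = 1 / L + h / 2" using L0 by (simp add: field_simps)
        also have "1 / L <= h / 2" using L L0 less.prems(3) by (simp add: field_simps)
        finally show ?thesis by simp
      qed
      ultimately show "small_avg \<F> h t0 t" unfolding small_avg_def using u by blast
    qed
  qed
  thus ?case unfolding \<F>_def by blast
qed

section \<open>Averages of small Tsirelson norm\<close>

context tsirelson
begin

definition small_norm :: "real => nat list => nat list => bool" where
  "small_norm \<delta> t0 t \<longleftrightarrow> (EX u b. t = t0 @ u & increasing_tuple t & prob_on (set u) b & tnorm S c b <= \<delta>)"

lemma prob_on_c00: "prob_on U b ==> finite U ==> U \<subseteq> {1..} ==> b : c00" by (rule c00I[of U]) (auto simp: prob_on_def)

text \<open>\<open>Y k\<close> is the block ending at \<open>k\<close>; the game for averages is played on the end points.\<close>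

lemma nested_average:
  assumes s: "increasing_tuple s" and b: "prob_on (set s) b" "!!G. G : S ==> (\<Sum>k\<in>G. b k) <= h" "0 <= h"
    and U: "finite U" "U \<subseteq> {1..}" and d: "0 <= d" "d <= 1"
    and Y: "!!k. k : set s ==> prob_on {j : U. j <= k & (ALL k':set s. k' < k --> k' < j)} (Y k)"
      "!!k. k : set s ==> tnorm S c (Y k) <= d"
  shows "prob_on U (%j. \<Sum>k\<in>set s. b k * Y k j)" "tnorm S c (%j. \<Sum>k\<in>set s. b k * Y k j) <= c * d + h"
proof -
  define x where "x j = (\<Sum>k\<in>set s. b k * Y k j)" for j
  have Y0: "0 <= Y k j" if "k : set s" for k j using Y(1)[OF that] by (simp add: prob_on_def)
  have Yz: "Y k j = 0" if "k : set s" "~ (j : U & j <= k & (ALL k':set s. k' < k --> k' < j))" for k j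
    using Y(1)[OF that(1)] that(2) by (simp add: prob_on_def)
  have YU: "(\<Sum>j\<in>U. Y k j) = 1" if "k : set s" for k
  proof -
    have "(\<Sum>j\<in>U. Y k j) = (\<Sum>j\<in>{j : U. j <= k & (ALL k':set s. k' < k --> k' < j)}. Y k j)"
      using U(1) Yz[OF that] by (intro sum.mono_neutral_right) auto
    thus ?thesis using Y(1)[OF that] by (simp add: prob_on_def)
  qed
  have b0: "0 <= b k" for k using b(1) by (simp add: prob_on_def)
  have "(\<Sum>j\<in>U. x j) = (\<Sum>k\<in>set s. b k * (\<Sum>j\<in>U. Y k j))" unfolding x_def by (subst sum.swap) (simp add: sum_distrib_left)
  also have "\<dots> = 1" using YU b(1) by (simp add: prob_on_def)
  finally have "(\<Sum>j\<in>U. x j) = 1" .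
  moreover have "x j = 0" if "j \<notin> U" for j unfolding x_def using Yz that by (intro sum.neutral) auto
  moreover have x0: "0 <= x j" for j unfolding x_def using Y0 b0 by (intro sum_nonneg mult_nonneg_nonneg) auto
  ultimately have pr: "prob_on U x" by (simp add: prob_on_def)
  thus "prob_on U (%j. \<Sum>k\<in>set s. b k * Y k j)" unfolding x_def .
  have x: "x : c00" by (rule prob_on_c00[OF pr U])
  \<comment> \<open>\<open>Suc (prev k)\<close> is the first possible place of the block that ends
    at \<open>k\<close>. The default 0 for a missing predecessor is harmless, as all indices are at
    least 1.\<close>
  define prev where "prev k = Max (insert 0 {k'\<in>set s. k' < k})" for k
  have prev: "prev k < k" "!!k'. k' : set s ==> k' < k ==> k' <= prev k" "prev k = 0 \<or> prev k : set s & prev k < k"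
    if "k : set s" for k
  proof -
    have f: "finite (insert 0 {k'\<in>set s. k' < k})" by simp
    have k: "0 < k" using that s by (auto simp: increasing_tuple_def Suc_le_eq)
    show "prev k = 0 \<or> prev k : set s & prev k < k" using Max_in[OF f] by (auto simp: prev_def)
    thus "prev k < k" using k by auto
    show "k' <= prev k" if "k' : set s" "k' < k" for k' using Max_ge[OF f] that by (simp add: prev_def)
  qed
  have prev_mono: "k <= prev k'" if "k : set s" "k' : set s" "k < k'" for k k' using prev(2)[OF that(2,1,3)] .
  \<comment> \<open>Recovers the end point of a block from its starting point; the smallness of
    \<open>b\<close> is known for sets of end points.\<close>
  define \<kappa> where "\<kappa> m = Min {k\<in>set s. m <= k}" for m
  have \<kappa>: "\<kappa> (Suc (prev k)) = k" if k: "k : set s" for k unfolding \<kappa>_def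
  proof (rule Min_eqI)
    fix y assume "y : {j : set s. Suc (prev k) <= j}"
    thus "k <= y" using prev(2)[OF k, of y] by (cases "y < k") auto
  qed (use k prev(1)[OF k] in auto)
  define R where "R = (%k. Suc (prev k)) ` set s"
  have R: "finite R" "R \<subseteq> {1..}" by (auto simp: R_def)
  have Yblk: "j : blk R (Suc (prev k))" if k: "k : set s" and "Y k j ~= 0" for k j
  proof -
    have j: "j <= k" "ALL k':set s. k' < k --> k' < j" "j : U" using Yz[OF k] that(2) by blast+
    have "1 <= j" using j(3) U by auto
    hence "Suc (prev k) <= j" using prev(3)[OF k] j(2) by auto
    moreover have "Suc (prev k') <= Suc (prev k)" if "k' : set s" "Suc (prev k') <= j" for k'
    proof (rule ccontr)
      assume "~ ?thesis"
      hence "k < k'" using prev(2)[OF k, of k'] prev(1,3)[OF that(1)] prev_mono[of k k']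
        by (metis Suc_le_mono k linorder_neqE_nat not_less_eq_eq le_trans less_imp_le order_refl that(1) prev(1))
      thus False using prev_mono[OF k that(1)] that(2) j(1) by simp
    qed
    ultimately show ?thesis by (auto simp: blk_def R_def)
  qed
  have restr: "restr (blk R (Suc (prev k))) x = (%j. b k * Y k j)" if k: "k : set s" for k
  proof
    fix j
    have other: "Y k' j = 0" if "k' : set s" "k' ~= k" "j : blk R (Suc (prev k))" for k'
    proof (rule ccontr)
      assume "Y k' j ~= 0"
      hence "j : blk R (Suc (prev k'))" using Yblk that(1) by blast
      hence "Suc (prev k') = Suc (prev k)"
        using pr_blk[OF R(1), of "Suc (prev k)" j] pr_blk[OF R(1), of "Suc (prev k')" j] that k by (auto simp: R_def)
      thus False using \<kappa>[OF k] \<kappa>[OF that(1)] that(2) by simp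
    qed
    show "restr (blk R (Suc (prev k))) x j = b k * Y k j"
    proof (cases "j : blk R (Suc (prev k))")
      case True
      have "x j = (\<Sum>k'\<in>set s. if k' = k then b k * Y k j else 0)"
        unfolding x_def using other True by (intro sum.cong) auto
      thus ?thesis using k True by (simp add: restr_def)
    next
      case False
      thus ?thesis using Yblk[OF k] by (auto simp: restr_def)
    qed
  qed
  have "tnorm S c x <= c * d + h"
  proof (rule averaging_estimate[OF x R, where b = "%m. b (\<kappa> m)" and \<kappa> = \<kappa>])
    fix j assume "j : supp x"
    then obtain k where "k : set s" "Y k j ~= 0"
      unfolding supp_def x_def by (metis (mono_tags, lifting) mem_Collect_eq mult_zero_right sum.neutral)
    thus "EX m:R. m <= j" using Yblk by (intro bexI[of _ "Suc (prev k)"]) (auto simp: blk_def R_def)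
  next
    have "inj_on (%k. Suc (prev k)) (set s)" by (rule inj_onI) (metis \<kappa>)
    hence "(\<Sum>m\<in>R. b (\<kappa> m)) = (\<Sum>k\<in>set s. b k)" unfolding R_def by (subst sum.reindex) (auto simp: \<kappa> intro!: sum.cong)
    thus "(\<Sum>m\<in>R. b (\<kappa> m)) <= 1" using b(1) by (simp add: prob_on_def)
  next
    fix m assume "m : R"
    then obtain k where k: "k : set s" "m = Suc (prev k)" by (auto simp: R_def)
    have Yc: "Y k : c00" by (rule prob_on_c00[OF Y(1)[OF k(1)]]) (use U in auto)
    show "tnorm S c (restr (blk R m) x) <= b (\<kappa> m) * d"
      unfolding k(2) restr[OF k(1)] \<kappa>[OF k(1)] tnorm_scale[OF Yc] using Y(2)[OF k(1)] b0 by (simp add: mult_left_mono)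
    show "1 <= \<kappa> m" using k \<kappa>[OF k(1)] prev(1)[OF k(1)] by simp
    fix j assume "j : supp x \<inter> blk R m"
    hence "restr (blk R m) x j ~= 0" by (simp add: restr_def supp_def)
    hence "Y k j ~= 0" unfolding k(2) restr[OF k(1)] by auto
    thus "j <= \<kappa> m" using Yz[OF k(1), of j] k \<kappa>[OF k(1)] by auto
  next
    fix m m' assume "m : R" "m' : R" "m < m'"
    then obtain k k' where k: "k : set s" "m = Suc (prev k)" "k' : set s" "m' = Suc (prev k')" by (auto simp: R_def)
    have "k < k'"
    proof (rule ccontr)
      assume "~ k < k'"
      hence "k' < k" using `m < m'` k by (metis less_irrefl linorder_neqE_nat)
      thus False using prev_mono[OF k(3,1)] prev(1)[OF k(3)] `m < m'` k by simp
    qed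
    thus "\<kappa> m < \<kappa> m'" using k \<kappa> by simp
  next
    fix G assume G: "G \<subseteq> R" "\<kappa> ` G : S"
    have "inj_on \<kappa> R" unfolding R_def by (rule inj_onI) (use \<kappa> in auto)
    hence "(\<Sum>m\<in>G. b (\<kappa> m)) = (\<Sum>k\<in>\<kappa> ` G. b k)" using G(1) by (subst sum.reindex) (auto intro: inj_on_subset)
    thus "(\<Sum>m\<in>G. b (\<kappa> m)) <= h" using b(2)[OF G(2)] by simp
  qed (use b0 b(3) d in auto)
  thus "tnorm S c (%j. \<Sum>k\<in>set s. b k * Y k j) <= c * d + h" unfolding x_def .
qed

text \<open>Each move of the game for averages is simulated by a complete inner game producing an
  average of norm at most \<open>d\<close>, whose last index is the move. That index is known only
  after the inner game, so one inner game has to be paid for before the outer clock drops; hence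
  \<open>osuc \<beta>\<close>.\<close>

lemma forces_nested:
  assumes z: "!!t. increasing_tuple t ==> forces (small_norm d t) z t" and d: "0 <= d" "d <= 1" and h: "0 <= h"
    and avg: "forces (small_avg S h []) \<beta> []" and t0: "increasing_tuple t0"
  shows "forces (small_norm (c * d + h) t0) (z * osuc \<beta>) t0"
proof -
  define sim where "sim s t Y \<longleftrightarrow> increasing_tuple s & increasing_tuple t & (EX u. t = t0 @ u & set s \<subseteq> set u &
      (ALL k:set s. prob_on {j : set u. j <= k & (ALL k':set s. k' < k --> k' < j)} (Y k) & tnorm S c (Y k) <= d))"
    for s t Y
  have "forces (small_norm (c * d + h) t0) (z * osuc \<beta>) t" if "forces (small_avg S h []) \<beta> s" "sim s t Y" for \<beta> s t Y
    using that
  proof (induction arbitrary: t Y rule: forces.induct)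
    case (stop s \<beta>)
    then obtain b where b: "prob_on (set s) b" "ALL G:S. (\<Sum>k\<in>G. b k) <= h" by (auto simp: small_avg_def)
    obtain u where u: "increasing_tuple s" "increasing_tuple t" "t = t0 @ u"
      "ALL k:set s. prob_on {j : set u. j <= k & (ALL k':set s. k' < k --> k' < j)} (Y k) & tnorm S c (Y k) <= d"
      using stop.prems unfolding sim_def by blast
    have U: "set u \<subseteq> {1..}" using u(2,3) by (auto simp: increasing_tuple_def)
    note * = nested_average[OF u(1) b(1) _ h finite_set U d, of Y]
    have "small_norm (c * d + h) t0 t" unfolding small_norm_def using u b *(1,2) by blast
    thus ?case by (rule forces.stop)
  next
    case (move s \<beta>)
    obtain u where u: "increasing_tuple s" "increasing_tuple t" "t = t0 @ u" "set s \<subseteq> set u"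
      "ALL k:set s. prob_on {j : set u. j <= k & (ALL k':set s. k' < k --> k' < j)} (Y k) & tnorm S c (Y k) <= d"
      using move.prems unfolding sim_def by blast
    have "forces (small_norm (c * d + h) t0) (z * \<beta> + z) t"
    proof (rule forces_bind[OF z[OF u(2)]])
      fix t' assume "small_norm d t t'"
      then obtain u' y where t': "t' = t @ u'" "increasing_tuple t'" "prob_on (set u') y" "tnorm S c y <= d"
        unfolding small_norm_def by blast
      have ne: "u' ~= []" using t'(3) by (rule prob_on_nonempty)
      define k where "k = last u'"
      have lt: "a < b" if "a : set t" "b : set u'" for a b using t'(1,2) that by (auto simp: increasing_tuple_append)
      have ku: "k : set u'" using ne by (simp add: k_def)
      have "increasing_tuple (butlast u' @ [k])" using t'(1,2) ne by (simp add: increasing_tuple_append k_def)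
      hence le_k: "j <= k" if "j : set u'" for j using that ne unfolding increasing_tuple_append k_def
        by (metis append_butlast_last_id in_set_conv_decomp less_imp_le order_refl rotate1.simps(2) set_ConsD set_rotate1)
      have st: "set s \<subseteq> set t" using u by auto
      have inc: "increasing_tuple (s @ [k])"
        using u(1) ku lt st t'(1,2) by (auto simp: increasing_tuple_append increasing_tuple_def Suc_le_eq sorted_wrt_append)
      then obtain g where g: "g < \<beta>" "!!t Y. sim (s @ [k]) t Y ==> forces (small_norm (c * d + h) t0) (z * osuc g) t"
        using move.IH by blast
      have ks: "k \<notin> set s" "!!k'. k' : set s ==> k' < k" using lt[OF _ ku] st by auto
      have "sim (s @ [k]) t' (Y(k := y))" unfolding sim_def
      proof (intro conjI inc t'(2) exI[of _ "u @ u'"])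
        show "t' = t0 @ u @ u'" "set (s @ [k]) \<subseteq> set (u @ u')" using t' u ku by auto
        show "ALL k':set (s @ [k]). prob_on {j : set (u @ u'). j <= k' & (ALL k'':set (s @ [k]). k'' < k' --> k'' < j)} ((Y(k := y)) k') &
            tnorm S c ((Y(k := y)) k') <= d"
        proof
          fix k' assume k': "k' : set (s @ [k])"
          show "prob_on {j : set (u @ u'). j <= k' & (ALL k'':set (s @ [k]). k'' < k' --> k'' < j)} ((Y(k := y)) k') &
            tnorm S c ((Y(k := y)) k') <= d"
          proof (cases "k' = k")
            case True
            let ?A = "{j : set (u @ u'). j <= k & (ALL k'':set (s @ [k]). k'' < k --> k'' < j)}"
            have sub: "set u' \<subseteq> ?A" using lt st le_k by auto
            have "(\<Sum>j\<in>?A. y j) = (\<Sum>j\<in>set u'. y j)"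
              using sub t'(3) by (intro sum.mono_neutral_right) (auto simp: prob_on_def)
            hence "prob_on ?A y" using t'(3) sub by (auto simp: prob_on_def)
            thus ?thesis using True t'(4) by simp
          next
            case False
            hence k'': "k' : set s" "k' < k" using k' ks by auto
            have "{j : set (u @ u'). j <= k' & (ALL k'':set (s @ [k]). k'' < k' --> k'' < j)}
                = {j : set u. j <= k' & (ALL k'':set s. k'' < k' --> k'' < j)}" using k'' lt st by fastforce
            thus ?thesis using False u(5) k''(1) by simp
          qed
        qed
      qed
      hence "forces (small_norm (c * d + h) t0) (z * osuc g) t'" by (rule g(2))
      moreover have "z * osuc g <= z * \<beta>" using g(1) by (intro omult_le_mono) (simp add: osuc_le_iff)
      ultimately show "forces (small_norm (c * d + h) t0) (z * \<beta>) t'" by (rule forces_mono)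
    qed
    thus ?case by simp
  qed
  from this[OF avg, of t0 "%_ _. 0"] show ?thesis using t0 by (simp add: sim_def)
qed

end

text \<open>Nesting turns \<open>d\<close> into \<open>c * d + h\<close>. The choice
  \<open>h = (1 - c) * z / 2\<close> makes \<open>z / 2\<close> the fixed point, so after
  \<open>m\<close> nestings the norm is at most \<open>c ^ m + z / 2\<close>. Each nesting
  multiplies the clock by at most \<open>wpow \<alpha> 2\<close>; for nonzero \<alpha> this exceeds
  every \<open>wexp \<alpha> * fin_ord L\<close>.\<close>

lemma forces_small_norm:
  assumes s: "approximating s" and c: "0 < c" "c < 1" and \<alpha>: "\<alpha> ~= 0" and z: "0 < z"
  shows "EX n. forces (tsirelson.small_norm (Schreier s \<alpha>) c z []) (wpow \<alpha> n) []"
proof -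
  interpret tsirelson "Schreier s \<alpha>" c by (rule tsirelson_Schreier[OF s c])
  define h where "h = (1 - c) * z / 2"
  have h: "0 < h" using c z by (simp add: h_def)
  obtain L where L: "forces (small_avg (Schreier s \<alpha>) h []) (wexp \<alpha> * fin_ord L) []"
    using forces_small_avg[OF s, of "{\<alpha>}" \<alpha> h] h increasing_tuple_Nil by fastforce
  have le: "osuc (wexp \<alpha> * fin_ord L) <= wpow \<alpha> 2"
  proof -
    have "osuc \<alpha> <= \<alpha> + \<alpha>" using oadd_less_iff[of \<alpha> 0 \<alpha>] \<alpha> by (simp add: osuc_le_iff gt_0_iff)
    hence "wexp (osuc \<alpha>) <= wexp (\<alpha> + \<alpha>)" by (simp del: wexp_osuc)
    also have "\<dots> = wpow \<alpha> 2" by (simp add: numeral_2_eq_2 wpow_Suc wexp_add)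
    finally show ?thesis using wexp_mult_fin_less[of \<alpha> L] by (simp add: osuc_le_iff del: wexp_osuc)
  qed
  have "EX d. 0 <= d & d <= 1 & d <= c ^ m + z / 2 & (ALL t. increasing_tuple t --> forces (small_norm d t) (wpow \<alpha> (2 * m)) t)" for m
  proof (induction m)
    case 0
    have "forces (small_norm 1 t) 1 t" if "increasing_tuple t" for t
    proof (rule forces_imp[OF forces_point[OF that]])
      fix t' assume "EX n. t' = t @ [n] & increasing_tuple t'"
      then obtain n where n: "t' = t @ [n]" "increasing_tuple t'" by blast
      hence "1 <= n" by (simp add: increasing_tuple_append)
      hence "tnorm (Schreier s \<alpha>) c (unit_vec n) <= (\<Sum>k\<in>supp (unit_vec n). \<bar>unit_vec n k\<bar>)"
        by (intro tnorm_le_l1 unit_vec_c00)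
      also have "\<dots> = 1" by (simp add: supp_def unit_vec_def)
      finally show "small_norm 1 t t'" unfolding small_norm_def using n prob_on_unit[of n] by (intro exI[of _ "[n]"]) auto
    qed
    thus ?case using z by (intro exI[of _ 1]) auto
  next
    case (Suc m)
    then obtain d where d: "0 <= d" "d <= 1" "d <= c ^ m + z / 2"
      "!!t. increasing_tuple t ==> forces (small_norm d t) (wpow \<alpha> (2 * m)) t" by blast
    have f: "forces (small_norm (c * d + h) t) (wpow \<alpha> (2 * Suc m)) t" if "increasing_tuple t" for t
    proof (rule forces_mono[OF forces_nested[OF d(4,1,2) _ L that]])
      have "wpow \<alpha> (2 * Suc m) = wpow \<alpha> (2 * m) * wpow \<alpha> 2" by (simp add: wpow_add[symmetric])
      thus "wpow \<alpha> (2 * m) * osuc (wexp \<alpha> * fin_ord L) <= wpow \<alpha> (2 * Suc m)"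
        using le by (simp add: omult_le_mono del: omult_osuc)
    qed (use h in auto)
    have d': "c * d + h <= c ^ Suc m + z / 2"
    proof -
      have "c * d <= c * c ^ m + c * z / 2" using mult_left_mono[OF d(3), of c] c by (simp add: distrib_left)
      moreover have "h = z / 2 - c * z / 2" by (simp add: h_def left_diff_distrib diff_divide_distrib)
      ultimately show ?thesis by simp
    qed
    show ?case
    proof (intro exI[of _ "min 1 (c * d + h)"] conjI allI impI)
      fix t assume t: "increasing_tuple t"
      show "forces (small_norm (min 1 (c * d + h)) t) (wpow \<alpha> (2 * Suc m)) t"
      proof (rule forces_imp[OF f[OF t]])
        fix t' assume "small_norm (c * d + h) t t'"
        then obtain u b where u: "t' = t @ u" "increasing_tuple t'" "prob_on (set u) b"
          "tnorm (Schreier s \<alpha>) c b <= c * d + h" unfolding small_norm_def by blast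
        have U: "set u \<subseteq> {1..}" using u(1,2) by (auto simp: increasing_tuple_def)
        have "tnorm (Schreier s \<alpha>) c b <= (\<Sum>k\<in>supp b. \<bar>b k\<bar>)" using prob_on_c00[OF u(3) _ U] by (intro tnorm_le_l1) simp
        also have "\<dots> = (\<Sum>k\<in>supp b. b k)" using u(3) by (simp add: prob_on_def)
        also have "\<dots> <= 1" using prob_on_sum_le[OF u(3)] finite_supp[OF prob_on_c00[OF u(3) _ U]] by simp
        finally show "small_norm (min 1 (c * d + h)) t t'" unfolding small_norm_def using u by auto
      qed
    qed (use d d' c h in auto)
  qed
  moreover obtain m where m: "c ^ m < z / 2" using real_arch_pow_inv[of "z / 2" c] z c by auto
  ultimately obtain d where d: "d <= c ^ m + z / 2" "forces (small_norm d []) (wpow \<alpha> (2 * m)) []"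
    by (metis increasing_tuple_Nil)
  have "forces (small_norm z []) (wpow \<alpha> (2 * m)) []"
    by (rule forces_imp[OF d(2)]) (use d(1) m in "fastforce simp: small_norm_def")
  thus ?thesis by blast
qed

section \<open>Hahn--Banach and the weak-star topology of the dual ball\<close>

definition sublinear :: "('a::real_vector => real) => bool" where
  "sublinear p \<longleftrightarrow> (ALL x y. p (x + y) <= p x + p y) & (ALL t>0. ALL x. p (t *\<^sub>R x) <= t * p x)"

lemma sublinearD:
  assumes "sublinear p"
  shows "p (x + y) <= p x + p y" "0 < t ==> p (t *\<^sub>R x) = t * p x" "p 0 = 0" "- p (- x) <= p x"
proof -
  show add: "p (x + y) <= p x + p y" for x y using assms unfolding sublinear_def by blast
  have le: "p (t *\<^sub>R x) <= t * p x" if "0 < t" for t x using assms that unfolding sublinear_def by blast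
  show "p (t *\<^sub>R x) = t * p x" if t: "0 < t"
    using le[OF t, of x] le[of "inverse t" "t *\<^sub>R x"] t by (simp add: field_simps)
  show "p 0 = 0" using le[of 2 0] le[of "1 / 2" 0] by simp
  thus "- p (- x) <= p x" using add[of x "- x"] by simp
qed

text \<open>Serves for \<open>sub_shift\<close>, for chains in Zorn's lemma and for the distance to
  a subspace.\<close>

lemma sublinear_INF:
  fixes g :: "'i => 'a::real_vector => real"
  assumes I: "I ~= {}" and lower: "!!i x. i : I ==> b x <= g i x"
    and add: "!!i j. i : I ==> j : I ==> EX k:I. ALL x y. g k (x + y) <= g i x + g j y"
    and scale: "!!i t. i : I ==> 0 < t ==> EX k:I. ALL x. g k (t *\<^sub>R x) <= t * g i x"
  shows "sublinear (%x. INF i\<in>I. g i x)" "i : I ==> (INF i\<in>I. g i x) <= g i x"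
proof -
  let ?m = "%x. INF i\<in>I. g i x"
  have le: "?m x <= g i x" if "i : I" for i x by (rule cINF_lower[OF bdd_belowI2[OF lower] that])
  thus "i : I ==> ?m x <= g i x" .
  have ge: "B <= ?m x" if "!!i. i : I ==> B <= g i x" for B x using I that by (rule cINF_greatest)
  show "sublinear ?m" unfolding sublinear_def
  proof (intro conjI allI impI)
    fix x y
    have "?m (x + y) - g i x <= ?m y" if i: "i : I" for i
    proof (rule ge)
      fix j assume "j : I"
      hence "?m (x + y) <= g i x + g j y" using add[OF i] le by (meson order_trans)
      thus "?m (x + y) - g i x <= g j y" by linarith
    qed
    hence "?m (x + y) - ?m y <= ?m x" by (intro ge) (simp add: algebra_simps)
    thus "?m (x + y) <= ?m x + ?m y" by simp
  next
    fix t :: real and x assume t: "0 < t"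
    have "?m (t *\<^sub>R x) <= t * g i x" if "i : I" for i using scale[OF that t] le by (meson order_trans)
    hence "?m (t *\<^sub>R x) / t <= ?m x" using t by (intro ge) (simp add: pos_divide_le_eq mult.commute)
    thus "?m (t *\<^sub>R x) <= t * ?m x" using t by (simp add: pos_divide_le_eq mult.commute)
  qed
qed

text \<open>Lowers \<open>p\<close> so that the value at \<open>- y\<close> becomes at most
  \<open>- p y\<close>. A linear functional below the result therefore agrees with \<open>p\<close>
  at \<open>y\<close>.\<close>

definition sub_shift :: "('a::real_vector => real) => 'a => 'a => real" where
  "sub_shift p y x = (INF t\<in>{0..}. p (x + t *\<^sub>R y) - t * p y)"

lemma sub_shift:
  assumes p: "sublinear p"
  shows "sublinear (sub_shift p y)" "0 <= t ==> sub_shift p y x <= p (x + t *\<^sub>R y) - t * p y"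
proof -
  have lower: "- p (- x) <= p (x + t *\<^sub>R y) - t * p y" if "t : {0..}" for t x
  proof -
    have "t * p y = p (t *\<^sub>R y)" using that sublinearD(2,3)[OF p] by (cases "t = 0") auto
    thus ?thesis using sublinearD(1)[OF p, of "x + t *\<^sub>R y" "- x"] by simp
  qed
  have add: "EX k:{0..}. ALL x z. p (x + z + k *\<^sub>R y) - k * p y <= (p (x + i *\<^sub>R y) - i * p y) + (p (z + j *\<^sub>R y) - j * p y)"
    if "i : {0..}" "j : {0..}" for i j
  proof (intro bexI[of _ "i + j"] allI)
    fix x z
    show "p (x + z + (i + j) *\<^sub>R y) - (i + j) * p y <= (p (x + i *\<^sub>R y) - i * p y) + (p (z + j *\<^sub>R y) - j * p y)"
      using sublinearD(1)[OF p, of "x + i *\<^sub>R y" "z + j *\<^sub>R y"] by (simp add: algebra_simps)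
  qed (use that in simp)
  have scale: "EX k:{0..}. ALL x. p (t *\<^sub>R x + k *\<^sub>R y) - k * p y <= t * (p (x + i *\<^sub>R y) - i * p y)"
    if "i : {0..}" "0 < t" for i t
  proof (intro bexI[of _ "t * i"] allI)
    show "p (t *\<^sub>R x + (t * i) *\<^sub>R y) - (t * i) * p y <= t * (p (x + i *\<^sub>R y) - i * p y)" for x
      using sublinearD(2)[OF p that(2), of "x + i *\<^sub>R y"] by (simp add: algebra_simps)
  qed (use that in simp)
  have ne: "{0..} ~= ({} :: real set)" by simp
  show "sublinear (sub_shift p y)" unfolding sub_shift_def by (rule sublinear_INF(1)[OF ne lower add scale])
  show "0 <= t ==> sub_shift p y x <= p (x + t *\<^sub>R y) - t * p y"
    unfolding sub_shift_def by (rule sublinear_INF(2)[OF ne lower add scale]) auto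
qed

lemma sub_shift_le: "sublinear p ==> sub_shift p y x <= p x" "sublinear p ==> sub_shift p y (- y) <= - p y"
  using sub_shift(2)[of p 0 y x] sub_shift(2)[of p 1 y "- y"] sublinearD(3)[of p] by auto

text \<open>A minimal sublinear functional is linear, since it cannot be lowered by \<open>sub_shift\<close>.\<close>

lemma sublinear_dominates_linear:
  fixes p :: "'a::real_vector => real"
  assumes p: "sublinear p"
  obtains f where "linear f" "!!x. f x <= p x"
proof -
  define A where "A = {q. sublinear q & q <= p}"
  define P where "P = (%a b :: 'a => real. b <= a)"
  have po: "partial_order_on A (relation_of P A)" unfolding P_def by (rule partial_order_on_relation_ofI) auto
  have "EX m:A. ALL a:A. P m a --> a = m"
  proof (rule predicate_Zorn[OF po])
    fix C assume "C : Chains (relation_of P A)"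
    hence CA: "!!q. q : C ==> sublinear q & q <= p" and ch: "!!q r. q : C ==> r : C ==> q <= r \<or> r <= q"
      by (auto simp: Chains_def relation_of_def P_def A_def)
    show "EX u:A. ALL a:C. P a u"
    proof (cases "C = {}")
      case True thus ?thesis using p by (auto simp: A_def)
    next
      case False
      have lower: "- p (- x) <= q x" if "q : C" for q x
        using sublinearD(4)[of q x] CA[OF that] le_funD[of q p "- x"] by force
      have add: "EX k:C. ALL x y. k (x + y) <= q x + r y" if qr: "q : C" "r : C" for q r
      proof -
        obtain u where u: "u : C" "u <= q" "u <= r" using ch[OF qr] qr by blast
        have "u (x + y) <= q x + r y" for x y
          using sublinearD(1)[of u x y] CA[OF u(1)] le_funD[OF u(2), of x] le_funD[OF u(3), of y] by linarith
        thus ?thesis using u(1) by blast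
      qed
      have scale: "EX k:C. ALL x. k (t *\<^sub>R x) <= t * q x" if "q : C" "0 < t" for q t
        using CA[OF that(1)] that unfolding sublinear_def by blast
      have "sublinear (%x. INF q\<in>C. q x)"
        by (rule sublinear_INF(1)[of C "%x. - p (- x)" "%q. q"]) (fact False lower add scale)+
      moreover have "(%x. INF q\<in>C. q x) <= q" if "q : C" for q
        unfolding le_fun_def by (intro allI sublinear_INF(2)[of C "%x. - p (- x)" "%q. q"]) (fact False lower add scale that)+
      ultimately show ?thesis using CA False by (intro bexI[of _ "%x. INF q\<in>C. q x"]) (auto simp: A_def P_def intro: order_trans)
    qed
  qed
  then obtain q where q: "sublinear q" "q <= p" and min: "!!r. sublinear r ==> r <= q ==> r = q"
    unfolding A_def P_def by (metis (no_types, lifting) mem_Collect_eq order.trans)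
  have neg: "q (- y) = - q y" for y
  proof -
    have "sub_shift q y = q" by (rule min[OF sub_shift(1)[OF q(1)]]) (simp add: le_fun_def sub_shift_le[OF q(1)])
    thus ?thesis using sub_shift_le(2)[OF q(1), of y] sublinearD(4)[OF q(1), of y] by simp
  qed
  have "linear q"
  proof (rule linearI)
    show "q (x + y) = q x + q y" for x y
      using sublinearD(1)[OF q(1), of x y] sublinearD(1)[OF q(1), of "- x" "- y"] neg[of "x + y"] neg[of x] neg[of y] by simp
    show "q (t *\<^sub>R x) = t *\<^sub>R q x" for t x
      using sublinearD(2,3)[OF q(1)] neg[of "t *\<^sub>R x"] sublinearD(2)[OF q(1), of "- t" x]
      by (cases t "0 :: real" rule: linorder_cases) auto
  qed
  thus ?thesis using that q(2) by (auto simp: le_fun_def)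
qed

lemma hahn_banach:
  fixes p :: "'a::real_vector => real"
  assumes p: "sublinear p"
  obtains f where "linear f" "!!x. f x <= p x" "f y = p y"
proof -
  obtain f where f: "linear f" "!!x. f x <= sub_shift p y x"
    using sublinear_dominates_linear[OF sub_shift(1)[OF p]] by blast
  have "f x <= p x" for x using f(2)[of x] sub_shift_le(1)[OF p, of y x] by linarith
  moreover have "p y <= f y" using f(2)[of "- y"] sub_shift_le(2)[OF p, of y] linear_neg[OF f(1), of y] by linarith
  ultimately show ?thesis using that f(1) by (metis antisym)
qed

lemma blinfun_of_le_norm:
  fixes f :: "'a::real_normed_vector => real"
  assumes "linear f" "!!x. f x <= norm x"
  obtains g :: "'a dual" where "blinfun_apply g = f" "norm g <= 1"
proof -
  have b: "\<bar>f x\<bar> <= norm x" for x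
    using assms(2)[of x] assms(2)[of "- x"] by (simp add: linear_neg[OF assms(1)] abs_le_iff)
  have bl: "bounded_linear f" by (rule bounded_linear_intro[where K = 1])
      (use assms(1) b in "auto simp: linear_add linear_scale")
  show ?thesis
  proof (rule that[of "Blinfun f"])
    show "blinfun_apply (Blinfun f) = f" using bl by (rule bounded_linear_Blinfun_apply)
    thus "norm (Blinfun f) <= 1" using b by (intro norm_blinfun_bound) auto
  qed
qed

lemma norming_functional:
  fixes x :: "'a::real_normed_vector"
  obtains f :: "'a dual" where "norm f <= 1" "f x = norm x"
proof -
  have "sublinear (norm :: 'a => real)" by (auto simp: sublinear_def norm_triangle_ineq)
  then obtain f :: "'a => real" where f: "linear f" "!!x. f x <= norm x" "f x = norm x"
    using hahn_banach[of norm x] by blast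
  thus ?thesis using blinfun_of_le_norm[OF f(1,2)] that by metis
qed

text \<open>A linear functional below the distance to \<open>Y\<close> vanishes on \<open>Y\<close>;
  if it agrees with the distance at \<open>x\<close>, it is not zero.\<close>

lemma annihilating_functional:
  fixes Y :: "'a::real_normed_vector set"
  assumes Y: "subspace Y" and x: "x \<notin> closure Y"
  obtains f :: "'a dual" where "!!y. y : Y ==> blinfun_apply f y = 0" "f ~= 0"
proof -
  define p where "p = (%z. INF y\<in>Y. norm (z - y))"
  have add: "EX k:Y. ALL u v. norm ((u + v) - k) <= norm (u - i) + norm (v - j)" if "i : Y" "j : Y" for i j
  proof (intro bexI[of _ "i + j"] allI)
    show "norm ((u + v) - (i + j)) <= norm (u - i) + norm (v - j)" for u v
      using norm_triangle_ineq[of "u - i" "v - j"] by (simp add: algebra_simps)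
  qed (rule subspace_add[OF Y that])
  have scale: "EX k:Y. ALL u. norm (t *\<^sub>R u - k) <= t * norm (u - i)" if "i : Y" "0 < t" for i t
    by (intro bexI[of _ "t *\<^sub>R i"] allI)
      (use that subspace_scale[OF Y] in "simp_all add: scaleR_diff_right[symmetric]")
  have ne: "Y ~= {}" using subspace_0[OF Y] by blast
  have inf: "sublinear p" "!!y z. y : Y ==> p z <= norm (z - y)"
    unfolding p_def by (rule sublinear_INF[where b = "%_. 0", OF ne _ add scale]; simp)+
  obtain f where f: "linear f" "!!z. f z <= p z" "f x = p x" using hahn_banach[OF inf(1), of x] by blast
  have "f z <= norm z" for z using f(2)[of z] inf(2)[OF subspace_0[OF Y], of z] by simp
  then obtain g :: "'a dual" where g: "blinfun_apply g = f" using blinfun_of_le_norm[OF f(1)] by metis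
  show ?thesis
  proof (rule that[of g])
    fix y assume y: "y : Y"
    hence "- y : Y" using Y subspace_neg by blast
    thus "blinfun_apply g y = 0"
      using f(2)[of y] f(2)[of "- y"] inf(2)[OF y, of y] inf(2)[of "- y" "- y"] by (simp add: g linear_neg[OF f(1)])
  next
    obtain d where d: "0 < d" "!!y. y : Y ==> d <= dist y x" using x unfolding closure_approachable by (meson not_le)
    have "d <= p x" unfolding p_def by (rule cINF_greatest[OF ne]) (use d(2) in "simp add: dist_norm norm_minus_commute")
    thus "g ~= 0" using f(3) g d(1) by auto
  qed
qed

lemma almost_norming_vector:
  fixes f :: "'a::real_normed_vector dual"
  obtains u where "norm u <= 1" "norm f / 2 <= f u"
proof (cases "f = 0")
  case True
  thus ?thesis using that[of 0] by simp
next
  case False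
  have "EX u. norm u <= 1 & norm f / 2 <= f u"
  proof (rule ccontr)
    assume a: "~ ?thesis"
    have "norm (f x) <= norm f / 2 * norm x" for x
    proof (cases "x = 0")
      case False
      hence n: "norm (inverse (norm x) *\<^sub>R x) <= 1" "norm (- (inverse (norm x) *\<^sub>R x)) <= 1" by auto
      have "f (inverse (norm x) *\<^sub>R x) < norm f / 2" "f (- (inverse (norm x) *\<^sub>R x)) < norm f / 2"
        using a n by (meson not_le)+
      hence "\<bar>inverse (norm x) * f x\<bar> < norm f / 2" by (simp add: blinfun.scaleR_right blinfun.minus_right abs_less_iff)
      thus ?thesis using False by (simp add: abs_mult field_simps)
    qed simp
    hence "norm f <= norm f / 2" by (intro norm_blinfun_bound) auto
    thus False using False by simp
  qed
  thus ?thesis using that by blast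
qed

text \<open>The \<open>e j\<close> almost norm a dense sequence \<open>h j\<close>. If a nonzero
  \<open>f\<close> vanished on all of them, an \<open>h j\<close> within \<open>norm f / 4\<close>
  of \<open>f\<close> would be small at \<open>e j\<close>, hence of norm less than
  \<open>norm f / 2\<close>, which is too little to be that close to \<open>f\<close>.\<close>

lemma separable_dual_total_sequence:
  assumes "separable_space (euclidean :: 'a::real_normed_vector dual topology)"
  obtains h :: "nat => 'a::real_normed_vector dual" and e :: "nat => 'a::real_normed_vector"
  where "closure (range h) = UNIV" "!!j. norm (e j) <= 1" "closure (span (range e)) = UNIV"
proof -
  obtain D :: "'a dual set" where D: "countable D" "closure D = UNIV"
    using assms unfolding separable_space_def by auto
  hence "D ~= {}" by auto
  define h where "h = from_nat_into D"
  have rh: "range h = D" unfolding h_def using D `D ~= {}` by (simp add: range_from_nat_into)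
  have "ALL j. EX u. norm u <= 1 & norm (h j) / 2 <= (h j) u" using almost_norming_vector by metis
  then obtain e where e: "!!j. norm (e j) <= 1" "!!j. norm (h j) / 2 <= (h j) (e j)" by metis
  have "closure (span (range e)) = UNIV"
  proof (rule ccontr)
    assume "closure (span (range e)) ~= UNIV"
    then obtain x where "x \<notin> closure (span (range e))" by blast
    then obtain f :: "'a dual" where f: "!!y. y : span (range e) ==> f y = 0" "f ~= 0"
      using annihilating_functional[OF subspace_span] by blast
    have "0 < norm f / 4" using f(2) by simp
    then obtain j where j: "dist (h j) f < norm f / 4"
      using D(2) rh closure_approachable[of f D] by (metis UNIV_I imageE)
    have "norm (h j) / 2 <= (h j) (e j)" by (rule e)
    also have "\<dots> = (h j - f) (e j)" using f(1)[of "e j"] by (simp add: span_base blinfun.diff_left)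
    also have "\<dots> <= norm (h j - f) * norm (e j)" using norm_blinfun[of "h j - f" "e j"] by simp
    also have "\<dots> <= norm (h j - f)" using e(1)[of j] by (simp add: mult_left_le)
    also have "\<dots> < norm f / 4" using j by (simp add: dist_norm)
    finally have "norm (h j) < norm f / 2" by simp
    moreover have "norm f <= norm (h j) + norm (h j - f)" using norm_triangle_ineq4[of "h j" "h j - f"] by simp
    ultimately show False using j norm_ge_zero[of f] unfolding dist_norm by linarith
  qed
  thus ?thesis using that rh D(2) e(1) by metis
qed

section \<open>The weak-star topology of the dual ball\<close>

abbreviation dual_ball :: "'a::real_normed_vector dual set" where "dual_ball \<equiv> cball 0 1"

lemma openin_weak_star_iff: "openin weak_star U \<longleftrightarrow> (EX V. open V & U = blinfun_apply -` V)"
  unfolding strong_operator_topology_def openin_pullback_topology by auto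

lemma openin_weak_star_ball: "openin weak_star {f. \<bar>blinfun_apply f x - a\<bar> < e}"
proof -
  have "open {g :: 'a => real. \<bar>g x - a\<bar> < e}"
    by (intro open_Collect_less continuous_intros) (auto intro: continuous_on_product_coordinates)
  thus ?thesis unfolding openin_weak_star_iff by (intro exI[of _ "{g. \<bar>g x - a\<bar> < e}"]) auto
qed

lemma openin_weak_star_far: "openin weak_star {f. e < \<bar>blinfun_apply f x - a\<bar>}"
proof -
  have "open {g :: 'a => real. e < \<bar>g x - a\<bar>}"
    by (intro open_Collect_less continuous_intros) (auto intro: continuous_on_product_coordinates)
  thus ?thesis unfolding openin_weak_star_iff by (intro exI[of _ "{g. e < \<bar>g x - a\<bar>}"]) auto
qed

text \<open>Banach-Alaoglu: as functions, the elements of the ball are the linear members of a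
  product of compact intervals, and linearity is a closed condition for pointwise
  convergence.\<close>

lemma compactin_dual_ball: "compactin weak_star (dual_ball :: 'a::real_normed_vector dual set)"
proof -
  define B where "B = (\<Pi>\<^sub>E x\<in>UNIV. {- norm (x::'a)..norm x})"
  have "compactin (product_topology (%_. euclidean) UNIV) B" unfolding B_def compactin_PiE by simp
  hence cB: "compact B" by (simp add: euclidean_product_topology)
  define L where "L = {h :: 'a => real. (ALL x y. h (x + y) = h x + h y) & (ALL t x. h (t *\<^sub>R x) = t * h x)}"
  have cont: "continuous_on UNIV (%h :: 'a => real. h x)" for x by (rule continuous_on_product_coordinates)
  have "closed L"
    unfolding L_def by (intro closed_Collect_conj closed_Collect_all closed_Collect_eq continuous_intros cont)
  hence "compact (B \<inter> L)" using cB by blast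
  have im: "blinfun_apply ` dual_ball = B \<inter> L"
  proof (intro equalityI subsetI)
    fix h assume "h : blinfun_apply ` (dual_ball :: 'a dual set)"
    then obtain f :: "'a dual" where f: "h = blinfun_apply f" "norm f <= 1" by auto
    have "\<bar>blinfun_apply f x\<bar> <= norm x" for x using norm_blinfun[of f x] mult_right_mono[OF f(2), of "norm x"] by simp
    hence "- norm x <= blinfun_apply f x & blinfun_apply f x <= norm x" for x using abs_le_iff[of "blinfun_apply f x" "norm x"] by (simp add: minus_le_iff)
    thus "h : B \<inter> L" by (auto simp: B_def L_def f blinfun.add_right blinfun.scaleR_right)
  next
    fix h assume p: "h : B \<inter> L"
    hence "linear h" by (intro linearI) (auto simp: L_def)
    moreover have "h x <= norm x" for x using p by (auto simp: B_def PiE_def Pi_def)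
    ultimately obtain g :: "'a dual" where "blinfun_apply g = h" "norm g <= 1" by (rule blinfun_of_le_norm)
    thus "h : blinfun_apply ` dual_ball" by (auto intro!: image_eqI[of _ _ g])
  qed
  show ?thesis unfolding compactin_def
  proof (intro conjI allI impI)
    show "dual_ball \<subseteq> topspace weak_star" by (simp add: strong_operator_topology_topspace)
    fix \<U> :: "'a dual set set"
    assume U: "Ball \<U> (openin weak_star) & dual_ball \<subseteq> \<Union> \<U>"
    hence "ALL U:\<U>. EX V. open V & U = blinfun_apply -` V" by (simp add: openin_weak_star_iff)
    then obtain V where V: "!!U. U : \<U> ==> open (V U)" "!!U. U : \<U> ==> U = blinfun_apply -` V U" by metis
    have "B \<inter> L \<subseteq> (\<Union>U\<in>\<U>. V U)"
    proof
      fix h assume "h : B \<inter> L"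
      then obtain f where f: "f : dual_ball" "h = blinfun_apply f" unfolding im[symmetric] by blast
      then obtain U where "U : \<U>" "f : U" using U by blast
      thus "h : (\<Union>U\<in>\<U>. V U)" using V(2) f(2) by blast
    qed
    then obtain \<F> where F: "\<F> \<subseteq> \<U>" "finite \<F>" "B \<inter> L \<subseteq> (\<Union>U\<in>\<F>. V U)"
      using compactE_image[OF \<open>compact (B \<inter> L)\<close>, of \<U> V] V(1) by metis
    have "dual_ball \<subseteq> \<Union> \<F>"
    proof
      fix f :: "'a dual" assume "f : dual_ball"
      hence "blinfun_apply f : B \<inter> L" unfolding im[symmetric] by blast
      then obtain U where "U : \<F>" "blinfun_apply f : V U" using F by blast
      thus "f : \<Union> \<F>" using V(2)[of U] F(1) by blast
    qed
    thus "EX \<F>. finite \<F> & \<F> \<subseteq> \<U> & dual_ball \<subseteq> \<Union> \<F>" using F by blast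
  qed
qed

lemma Hausdorff_weak_star: "Hausdorff_space (weak_star :: 'a::real_normed_vector dual topology)"
  unfolding Hausdorff_space_def
proof (intro allI impI)
  fix f g :: "'a dual" assume "f : topspace weak_star & g : topspace weak_star & f ~= g"
  then obtain x where x: "blinfun_apply f x ~= blinfun_apply g x" using blinfun_eqI by blast
  define d where "d = \<bar>blinfun_apply f x - blinfun_apply g x\<bar> / 2"
  have "0 < d" using x by (simp add: d_def)
  show "EX U V. openin weak_star U & openin weak_star V & f : U & g : V & disjnt U V"
  proof (intro exI conjI)
    show "openin weak_star {h. \<bar>blinfun_apply h x - blinfun_apply f x\<bar> < d}"
      "openin weak_star {h. \<bar>blinfun_apply h x - blinfun_apply g x\<bar> < d}" by (rule openin_weak_star_ball)+
    show "disjnt {h. \<bar>blinfun_apply h x - blinfun_apply f x\<bar> < d} {h. \<bar>blinfun_apply h x - blinfun_apply g x\<bar> < d}"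
      unfolding disjnt_iff d_def by (auto simp: abs_if split: if_splits)
  qed (use \<open>0 < d\<close> in auto)
qed

lemma closedin_dual_ball: "closedin weak_star dual_ball"
  by (rule compactin_imp_closedin[OF Hausdorff_weak_star compactin_dual_ball])

lemma compactin_closed_subset_ball:
  "closedin weak_star A ==> A \<subseteq> dual_ball ==> compactin weak_star A" by (rule closed_compactin[OF compactin_dual_ball])

text \<open>By compactness, the functionals outside \<open>U\<close> are uniformly separated from \<open>f\<close> by finitely many \<open>e j\<close>.\<close>

lemma weak_star_nbhd_base:
  fixes e :: "nat => 'a::real_normed_vector"
  assumes e: "closure (span (range e)) = UNIV" and U: "openin weak_star U" "f : U"
  obtains n d where "0 < d" "!!g. g : dual_ball ==> (!!j. j < n ==> \<bar>blinfun_apply g (e j) - blinfun_apply f (e j)\<bar> < d) ==> g : U"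
proof -
  define V where "V n = (\<Union>j<n. {g. 1 / real (Suc n) < \<bar>blinfun_apply g (e j) - blinfun_apply f (e j)\<bar>})" for n
  have "closedin weak_star (dual_ball - U)" using closedin_dual_ball U(1) by (rule closedin_diff)
  hence cK: "compactin weak_star (dual_ball - U)" by (rule compactin_closed_subset_ball) blast
  have oV: "openin weak_star (V n)" for n unfolding V_def by (intro openin_Union) (auto intro: openin_weak_star_far)
  have "dual_ball - U \<subseteq> \<Union>(range V)"
  proof
    fix g assume "g : dual_ball - U"
    hence "g ~= f" using U(2) by blast
    have "EX j. blinfun_apply g (e j) ~= blinfun_apply f (e j)"
    proof (rule ccontr)
      assume eq: "~ ?thesis"
      have "blinfun_apply (g - f) x = 0" if "x : span (range e)" for x
        by (rule linear_eq_0_on_span[OF bounded_linear.linear[OF blinfun.bounded_linear_right] _ that])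
          (use eq in "auto simp: blinfun.diff_left")
      hence "blinfun_apply (g - f) x = 0" for x
        using e continuous_constant_on_closure[of "span (range e)" "blinfun_apply (g - f)" 0 x]
        by (simp add: linear_continuous_on blinfun.bounded_linear_right)
      thus False using \<open>g ~= f\<close> by (metis blinfun_eqI eq_iff_diff_eq_0 zero_blinfun.rep_eq)
    qed
    then obtain j where j: "blinfun_apply g (e j) ~= blinfun_apply f (e j)" by blast
    then obtain m where "1 / real (Suc m) < \<bar>blinfun_apply g (e j) - blinfun_apply f (e j)\<bar>"
      using reals_Archimedean[of "\<bar>blinfun_apply g (e j) - blinfun_apply f (e j)\<bar>"] by (auto simp: inverse_eq_divide)
    moreover have "1 / real (Suc (max m (Suc j))) <= 1 / real (Suc m)" by (simp add: frac_le)
    ultimately have "g : V (max m (Suc j))" unfolding V_def by (auto intro!: bexI[of _ j])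
    thus "g : \<Union>(range V)" by blast
  qed
  then obtain \<F> where F: "finite \<F>" "\<F> \<subseteq> range V" "dual_ball - U \<subseteq> \<Union>\<F>" using compactinD[OF cK, of "range V"] oV by auto
  then obtain N where N: "finite N" "\<F> = V ` N" by (meson finite_subset_image)
  define n where "n = Max (insert 0 N)"
  show ?thesis
  proof (rule that[of "1 / real (Suc n)" n])
    fix g assume g: "g : dual_ball" "!!j. j < n ==> \<bar>blinfun_apply g (e j) - blinfun_apply f (e j)\<bar> < 1 / real (Suc n)"
    have "g \<notin> V k" if "k : N" for k
    proof
      assume "g : V k"
      then obtain j where j: "j < k" "1 / real (Suc k) < \<bar>blinfun_apply g (e j) - blinfun_apply f (e j)\<bar>" by (auto simp: V_def)
      have "k <= n" unfolding n_def using N(1) that by (intro Max_ge) auto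
      hence "1 / real (Suc n) <= 1 / real (Suc k)" by (simp add: frac_le)
      thus False using g(2)[of j] j \<open>k <= n\<close> by linarith
    qed
    thus "g : U" using F(3) g(1) unfolding N(2) by blast
  qed simp
qed

section \<open>From weak-star derivations to weakly null trees\<close>

lemma szlenk_derived_0: "szlenk_derived \<epsilon> 0 = dual_ball"
  and szlenk_derived_osuc: "szlenk_derived \<epsilon> (osuc b) = szlenk_step \<epsilon> (szlenk_derived \<epsilon> b)"
  and szlenk_derived_limit: "is_limit b ==> szlenk_derived \<epsilon> b = (\<Inter>d\<in>{..<b}. szlenk_derived \<epsilon> d)"
  by (simp_all add: szlenk_derived_def ord_rec_0 ord_rec_osuc ord_rec_limit)

lemma szlenk_step_subset: "szlenk_step \<epsilon> K \<subseteq> K" by (auto simp: szlenk_step_def)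

lemma szlenk_derived_antimono: "a <= b ==> szlenk_derived \<epsilon> b \<subseteq> szlenk_derived \<epsilon> a"
proof (induction b rule: ord_induct)
  case (suc b)
  show ?case
  proof (cases "a = osuc b")
    case False
    hence "a <= b" using suc.prems less_osuc_iff by (metis order_le_less)
    thus ?thesis using suc.IH szlenk_step_subset[of \<epsilon> "szlenk_derived \<epsilon> b"] by (auto simp: szlenk_derived_osuc)
  qed simp
next
  case (lim b)
  show ?case
  proof (cases "a = b")
    case False
    thus ?thesis using lim.prems unfolding szlenk_derived_limit[OF lim.hyps(1)] by (intro INF_lower) simp
  qed simp
qed simp

lemma szlenk_derived_subset: "szlenk_derived \<epsilon> b \<subseteq> dual_ball"
  using szlenk_derived_antimono[OF zero_le_ctbl_ord, of \<epsilon> b] by (simp add: szlenk_derived_0)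

lemma bounded_subset_dual_ball: "A \<subseteq> dual_ball ==> bounded A" using bounded_cball bounded_subset by blast

text \<open>If all of \<open>U \<inter> K\<close> were within \<open>\<epsilon> / 3\<close> of
  \<open>f\<close>, its diameter would be at most \<open>2 * (\<epsilon> / 3)\<close>.\<close>

lemma szlenk_step_far_point:
  assumes f: "f : szlenk_step \<epsilon> K" and "0 < \<epsilon>" and U: "openin weak_star U" "f : U"
  obtains g where "g : U" "g : K" "\<epsilon> / 3 <= norm (g - f)"
proof -
  have d: "\<epsilon> < diameter (U \<inter> K)" using f U unfolding szlenk_step_def by blast
  have "EX g:U \<inter> K. \<epsilon> / 3 <= norm (g - f)"
  proof (rule ccontr)
    assume "~ ?thesis"
    hence lt: "dist g f <= \<epsilon> / 3" if "g : U \<inter> K" for g using that by (force simp: dist_norm)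
    have "diameter (U \<inter> K) <= 2 * (\<epsilon> / 3)"
    proof (rule diameter_le)
      fix g h assume "g : U \<inter> K" "h : U \<inter> K"
      from lt[OF this(1)] lt[OF this(2)] show "norm (g - h) <= 2 * (\<epsilon> / 3)"
        using dist_triangle2[of g h f] by (simp add: dist_norm)
    qed (use assms in auto)
    thus False using d `0 < \<epsilon>` by simp
  qed
  thus ?thesis using that by blast
qed

text \<open>Two almost norming vectors on which the finitely many functionals of \<open>H\<close> nearly agree
  have a difference that still almost norms and is nearly annihilated by \<open>H\<close>.\<close>

lemma annihilated_almost_norming:
  fixes f :: "'a::real_normed_vector dual" and t :: real
  assumes "0 < d" and Q: "!!U. openin weak_star U ==> f : U ==> EX g:U. d <= norm (g - f) & g : Q"
    and H: "finite H" and t: "0 < t" and V: "openin weak_star V" "f : V"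
  obtains g x where "g : Q" "g : V" "norm x = 1" "!!h. h : H ==> \<bar>blinfun_apply h x\<bar> <= t" "d / 8 <= blinfun_apply (g - f) x"
proof -
  define good where "good A g u \<longleftrightarrow> g : Q & g : V & d <= norm (g - f) & norm u <= 1 &
    norm (g - f) / 2 <= blinfun_apply (g - f) u & (ALL v:A. \<bar>blinfun_apply (g - f) v\<bar> < d / 8)"
    for A g and u :: 'a
  have ex: "EX p. good A (fst p) (snd p)" if "finite A" for A
  proof -
    define W where "W = V \<inter> (\<Inter>v\<in>A. {g. \<bar>blinfun_apply g v - blinfun_apply f v\<bar> < d / 8})"
    have "openin weak_star W"
    proof (cases "A = {}")
      case False
      thus ?thesis unfolding W_def using that V by (intro openin_Int openin_INT2 openin_weak_star_ball) auto
    qed (use V in "simp add: W_def")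
    moreover have "f : W" using V \<open>0 < d\<close> by (simp add: W_def)
    ultimately obtain g where g: "g : W" "d <= norm (g - f)" "g : Q" using Q by blast
    obtain u where "norm u <= 1" "norm (g - f) / 2 <= blinfun_apply (g - f) u" by (rule almost_norming_vector)
    hence "good A g u" using g unfolding good_def W_def by (auto simp: blinfun.diff_left)
    thus ?thesis by (intro exI[of _ "(g, u)"]) simp
  qed
  define nxt where "nxt A = (SOME p. good A (fst p) (snd p))" for A
  have nxt: "good A (fst (nxt A)) (snd (nxt A))" if "finite A" for A
    unfolding nxt_def by (rule someI_ex[OF ex[OF that]])
  \<comment> \<open>The vectors chosen so far. Each new functional nearly agrees with
    \<open>f\<close> on all of them, by weak-star closeness.\<close>
  define acc where "acc = rec_nat {} (%_ A. insert (snd (nxt A)) A)"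
  have acc_Suc: "acc (Suc i) = insert (snd (nxt (acc i))) (acc i)" for i by (simp add: acc_def)
  have facc: "finite (acc i)" for i by (induction i) (auto simp: acc_Suc, simp add: acc_def)
  define g where "g i = fst (nxt (acc i))" for i
  define u where "u i = snd (nxt (acc i))" for i
  have good: "good (acc i) (g i) (u i)" for i unfolding g_def u_def by (rule nxt[OF facc])
  have u_acc: "u m : acc i" if "m < i" for m i using that by (induction i) (auto simp: acc_Suc u_def less_Suc_eq)
  \<comment> \<open>Pigeonhole: of infinitely many vectors two have the same values on
    \<open>H\<close> up to the mesh \<open>t / 4\<close>.\<close>
  define cell where "cell i = (\<lambda>h\<in>H. \<lfloor>blinfun_apply h (u i) / (t / 4)\<rfloor>)" for i
  have "cell i : (\<Pi>\<^sub>E h\<in>H. {\<lfloor>- norm h / (t / 4)\<rfloor>..\<lfloor>norm h / (t / 4)\<rfloor>})" for i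
  proof (rule PiE_I)
    fix h assume h: "h : H"
    have "norm (u i) <= 1" using good[of i] by (simp add: good_def)
    hence "\<bar>blinfun_apply h (u i)\<bar> <= norm h"
      using norm_blinfun[of h "u i"] mult_left_mono[of "norm (u i)" 1 "norm h"] by simp
    hence "- norm h <= blinfun_apply h (u i)" "blinfun_apply h (u i) <= norm h" by (auto simp: abs_le_iff)
    hence "\<lfloor>- norm h / (t / 4)\<rfloor> <= \<lfloor>blinfun_apply h (u i) / (t / 4)\<rfloor>"
      "\<lfloor>blinfun_apply h (u i) / (t / 4)\<rfloor> <= \<lfloor>norm h / (t / 4)\<rfloor>" using t by (intro floor_mono divide_right_mono; simp)+
    thus "cell i h : {\<lfloor>- norm h / (t / 4)\<rfloor>..\<lfloor>norm h / (t / 4)\<rfloor>}" using h by (simp add: cell_def)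
  qed (simp add: cell_def)
  hence "range cell \<subseteq> (\<Pi>\<^sub>E h\<in>H. {\<lfloor>- norm h / (t / 4)\<rfloor>..\<lfloor>norm h / (t / 4)\<rfloor>})" by blast
  hence "finite (range cell)" by (rule finite_subset) (intro finite_PiE H, simp)
  hence "~ inj cell" using finite_imageD by blast
  then obtain m i where mi: "m < i" "cell m = cell i" unfolding inj_on_def by (metis linorder_neqE_nat)
  define z where "z = u i - u m"
  have gi: "g i : Q" "g i : V" "d <= norm (g i - f)" "norm (u i) <= 1" "norm (g i - f) / 2 <= blinfun_apply (g i - f) (u i)"
    "\<bar>blinfun_apply (g i - f) (u m)\<bar> < d / 8" using good[of i] u_acc[OF mi(1)] by (auto simp: good_def)
  have um: "norm (u m) <= 1" using good[of m] by (simp add: good_def)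
  have z2: "norm z <= 2" using norm_triangle_ineq4[of "u i" "u m"] gi(4) um by (simp add: z_def)
  \<comment> \<open>Here \<open>3 / 8 = 1 / 2 - 1 / 8\<close>: the value at \<open>u i\<close> is at
    least half of the norm, the value at the earlier \<open>u m\<close> is less than
    \<open>d / 8\<close>. It follows that \<open>norm z\<close> lies between \<open>3 / 8\<close>
    and 2, so normalizing keeps both the lower bound \<open>d / 8\<close> and the upper bound
    \<open>t\<close>.\<close>
  have big: "3 / 8 * norm (g i - f) <= blinfun_apply (g i - f) z"
    using gi(3,5,6) by (simp add: z_def blinfun.diff_right abs_less_iff)
  also have "\<dots> <= norm (g i - f) * norm z" using norm_blinfun[of "g i - f" z] by simp
  finally have "3 / 8 * norm (g i - f) <= norm z * norm (g i - f)" by (simp only: mult.commute)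
  moreover have "0 < norm (g i - f)" using gi(3) \<open>0 < d\<close> by linarith
  ultimately have "3 / 8 <= norm z" by (rule mult_right_le_imp_le)
  define x where "x = inverse (norm z) *\<^sub>R z"
  have zpos: "0 < norm z" using \<open>3 / 8 <= norm z\<close> by linarith
  show ?thesis
  proof (rule that[OF gi(1,2), of x])
    show "norm x = 1" using zpos by (simp add: x_def)
    fix h assume h: "h : H"
    have "\<lfloor>blinfun_apply h (u m) / (t / 4)\<rfloor> = \<lfloor>blinfun_apply h (u i) / (t / 4)\<rfloor>"
      using fun_cong[OF mi(2), of h] h by (simp add: cell_def)
    hence "\<bar>blinfun_apply h (u i) / (t / 4) - blinfun_apply h (u m) / (t / 4)\<bar> < 1" by linarith
    hence "\<bar>blinfun_apply h z / (t / 4)\<bar> < 1" by (simp add: z_def blinfun.diff_right diff_divide_distrib)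
    hence "\<bar>blinfun_apply h z\<bar> < t / 4" using t by (simp add: abs_divide pos_divide_less_eq)
    also have "t / 4 <= t * norm z" using \<open>3 / 8 <= norm z\<close> t by (simp add: mult_left_mono)
    finally show "\<bar>blinfun_apply h x\<bar> <= t"
      using zpos by (simp add: x_def blinfun.scaleR_right abs_mult divide_simps mult.commute)
  next
    have "d / 8 * norm z <= d / 8 * 2" using z2 \<open>0 < d\<close> by (intro mult_left_mono) auto
    also have "\<dots> <= 3 / 8 * norm (g i - f)" using gi(3) \<open>0 < d\<close> by linarith
    finally have "d / 8 * norm z <= blinfun_apply (g i - f) z" using big by linarith
    thus "d / 8 <= blinfun_apply (g i - f) x"
      using zpos by (simp add: x_def blinfun.scaleR_right divide_simps mult.commute)
  qed
qed

lemma weakly_null_of_dense: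
  fixes h :: "nat => 'a::real_normed_vector dual"
  assumes h: "closure (range h) = UNIV" and x: "!!k. norm (x k) <= 1"
    and le: "!!j k. j <= k ==> \<bar>(h j) (x k)\<bar> <= 1 / (real k + 1)"
  shows "weakly_null x" unfolding weakly_null_def
proof
  fix f :: "'a dual"
  show "(%k. f (x k)) \<longlonglongrightarrow> 0"
  proof (rule LIMSEQ_I)
    fix e :: real assume e: "0 < e"
    hence "0 < e / 2" by simp
    moreover have "f : closure (range h)" using h by simp
    ultimately obtain j where j: "dist (h j) f < e / 2" using closure_approachable by (metis imageE)
    obtain N :: nat where N: "2 / e < N" using reals_Archimedean2 by blast
    show "EX no. ALL n>=no. norm (f (x n) - 0) < e"
    proof (intro exI[of _ "max j N"] allI impI)
      fix n assume n: "max j N <= n"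
      have "2 / e < real n + 1" using N n by linarith
      hence "1 / (real n + 1) < e / 2" using e by (simp add: field_simps)
      hence 1: "\<bar>(h j) (x n)\<bar> < e / 2" using le[of j n] n by simp
      have "\<bar>(f - h j) (x n)\<bar> <= norm (f - h j) * norm (x n)" using norm_blinfun[of "f - h j" "x n"] by simp
      also have "\<dots> <= norm (f - h j)" using x[of n] by (simp add: mult_left_le)
      also have "\<dots> < e / 2" using j by (simp add: dist_norm norm_minus_commute)
      finally have "\<bar>f (x n) - (h j) (x n)\<bar> < e / 2" by (simp add: blinfun.diff_left)
      thus "norm (f (x n) - 0) < e" using 1 unfolding real_norm_def diff_zero by linarith
    qed
  qed
qed

section \<open>The tree game\<close>

inductive adv :: "((nat \<times> real) list => bool) => (nat \<times> real) list => 'a::real_normed_vector dual => bool" for P where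
  stop: "P t ==> f : dual_ball ==> adv P t f"
| jump: "f : dual_ball ==> (!!n. increasing_tuple (map fst t @ [n]) ==>
    EX \<eta>>0. ALL U. openin weak_star U & f : U --> (EX g:U. \<eta> <= norm (g - f) & adv P (t @ [(n, \<eta>)]) g)) ==> adv P t f"
| slide: "f : dual_ball ==> (!!U. openin weak_star U ==> f : U ==> EX g:U. adv P t g) ==> adv P t f"

text \<open>Demanded of all lists, increasing or not, so that subtrees can be grafted below any node
  without side conditions.\<close>

definition total_tree :: "(nat list => 'a::real_normed_vector) => bool" where
  "total_tree x \<longleftrightarrow> (ALL u. even (length u) & u ~= [] --> norm (x u) = 1) &
     (ALL u. odd (length u) --> weakly_null (%k. x (u @ [k])))"

text \<open>A single functional has to serve the whole branch. The factor \<open>1 / 16\<close>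
  absorbs what later moves change at earlier nodes.\<close>

definition branch_estimate :: "((nat \<times> real) list => bool) => (nat \<times> real) list => 'a::real_normed_vector dual set =>
    (nat list => 'a) => (nat => nat) => bool" where
  "branch_estimate P t V x \<nu> \<longleftrightarrow> (EX r \<eta> h. h : dual_ball & h : V & P (t @ map (%i. (\<nu> (2 * i), \<eta> i)) [0..<r]) &
     (ALL i<r. 0 < \<eta> i & \<eta> i / 16 <= blinfun_apply h (x (map \<nu> [0..<2 * i + 2]))))"

text \<open>The bounds \<open>1 / (k + 1)\<close> on an initial part of the dense sequence make the
  vectors weakly null. Including \<open>f\<close> among the nearly annihilated functionals turns the
  bound for \<open>g - f\<close> into one for \<open>g\<close>, with
  \<open>7 / 64 = 1 / 8 - 1 / 64\<close>.\<close>

lemma weakly_null_node: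
  fixes f :: "'a::real_normed_vector dual" and hs :: "nat => 'a dual"
  assumes hs: "closure (range hs) = UNIV" and u: "0 < u"
    and Q: "!!U. openin weak_star U ==> f : U ==> EX g:U. u <= norm (g - f) & g : Q"
    and V: "openin weak_star V" "f : V"
  obtains g x where "!!k. g k : Q" "!!k. g k : V" "!!k. norm (x k) = 1" "weakly_null x"
    "!!k. 7 * u / 64 <= blinfun_apply (g k) (x k)"
proof -
  have "EX g x. g : Q & g : V & norm x = 1 & (ALL h:insert f (hs ` {..k}). \<bar>blinfun_apply h x\<bar> <= min (u / 64) (1 / (real k + 1))) &
    u / 8 <= blinfun_apply (g - f) x" for k
    by (rule annihilated_almost_norming[OF u Q, of "insert f (hs ` {..k})" "min (u / 64) (1 / (real k + 1))" V])
      (use u V in auto)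
  then obtain g x where gx: "!!k. g k : Q" "!!k. g k : V" "!!k. norm (x k) = 1"
    "!!k h. h : insert f (hs ` {..k}) ==> \<bar>blinfun_apply h (x k)\<bar> <= min (u / 64) (1 / (real k + 1))"
    "!!k. u / 8 <= blinfun_apply (g k - f) (x k)" by metis
  show ?thesis
  proof (rule that[OF gx(1,2,3)])
    show "weakly_null x" using hs by (rule weakly_null_of_dense) (use gx(3) gx(4)[of "hs _"] in auto)
    fix k
    have "\<bar>blinfun_apply f (x k)\<bar> <= u / 64" using gx(4)[of f k] by simp
    thus "7 * u / 64 <= blinfun_apply (g k) (x k)" using gx(5)[of k] by (simp add: blinfun.diff_left abs_le_iff)
  qed
qed

text \<open>In each pair of indices the first is the opponent's move and the second runs through a
  weakly null sequence. Below \<open>X n k\<close> the neighbourhood is shrunk to functionals within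
  \<open>d / 64\<close> of \<open>g n k\<close> at that vector, so the last functional still has at
  least \<open>6 / 64\<close> of the distance there, which exceeds \<open>1 / 16\<close>.\<close>

lemma adv_tree:
  fixes hs :: "nat => 'a::real_normed_vector dual"
  assumes hs: "closure (range hs) = UNIV" and w: "weakly_null w" "!!k. norm (w k :: 'a) = 1"
    and "adv P t f" "openin weak_star V" "f : V"
  shows "EX x :: nat list => 'a. total_tree x &
    (ALL v. strict_mono v & increasing_tuple (map fst t @ [v 0]) --> branch_estimate P t V x v)" using assms(4-)
proof (induction arbitrary: V rule: adv.induct)
  case (stop t f)
  let ?x = "%u. w (last u)"
  have "total_tree ?x" using w by (simp add: total_tree_def)
  moreover have "branch_estimate P t V ?x v" for v
    unfolding branch_estimate_def using stop by (intro exI[of _ 0] exI[of _ "%_. 0"] exI[of _ f]) simp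
  ultimately show ?case by blast
next
  case (slide f t)
  then obtain g where g: "g : V" "!!V. openin weak_star V ==> g : V ==> EX x :: nat list => 'a. total_tree x &
    (ALL v. strict_mono v & increasing_tuple (map fst t @ [v 0]) --> branch_estimate P t V x v)" by metis
  from g(2)[OF slide.prems(1) g(1)] show ?case .
next
  case (jump f t)
  let ?T = "%t V x. total_tree (x :: nat list => 'a) &
    (ALL v. strict_mono v & increasing_tuple (map fst t @ [v 0]) --> branch_estimate P t V x v)"
  let ?ok = "%n. increasing_tuple (map fst t @ [n])"
  have node: "EX d g X. 0 < d & (ALL k. norm (X k) = 1) & weakly_null X & (ALL k. 7 * d / 64 <= blinfun_apply (g k) (X k)) &
      (ALL k. EX y. ?T (t @ [(n, d)]) (V \<inter> {h. \<bar>blinfun_apply h (X k) - blinfun_apply (g k) (X k)\<bar> < d / 64}) y)"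
    if n: "?ok n" for n
  proof -
    from jump.IH[OF n] obtain d where d: "0 < d" "ALL U. openin weak_star U & f : U -->
        (EX g:U. d <= norm (g - f) & adv P (t @ [(n, d)]) g &
          (ALL V. openin weak_star V --> g : V --> (EX y. ?T (t @ [(n, d)]) V y)))" by (elim exE conjE) (rule that)
    define Q where "Q = {g. ALL V. openin weak_star V --> g : V --> (EX y. ?T (t @ [(n, d)]) V y)}"
    have Q: "EX g:U. d <= norm (g - f) & g : Q" if "openin weak_star U" "f : U" for U
      using d(2)[rule_format, OF conjI[OF that]] unfolding Q_def by blast
    obtain g X where gX: "!!k. g k : Q" "!!k. g k : V" "!!k. norm (X k) = 1" "weakly_null X"
      "!!k. 7 * d / 64 <= blinfun_apply (g k) (X k)" by (rule weakly_null_node[OF hs d(1) Q jump.prems]) blast+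
    have "EX y. ?T (t @ [(n, d)]) (V \<inter> {h. \<bar>blinfun_apply h (X k) - blinfun_apply (g k) (X k)\<bar> < d / 64}) y" for k
    proof -
      have "g k : V \<inter> {h. \<bar>blinfun_apply h (X k) - blinfun_apply (g k) (X k)\<bar> < d / 64}" using gX(2) d(1) by simp
      moreover have "openin weak_star (V \<inter> {h. \<bar>blinfun_apply h (X k) - blinfun_apply (g k) (X k)\<bar> < d / 64})"
        by (intro openin_Int jump.prems(1) openin_weak_star_ball)
      ultimately show ?thesis using gX(1)[of k] unfolding Q_def by blast
    qed
    thus ?thesis using d(1) gX by blast
  qed
  define R where "R n d g X \<longleftrightarrow> 0 < d & (ALL k. norm (X k) = 1) & weakly_null X & (ALL k. 7 * d / 64 <= blinfun_apply (g k) (X k)) &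
      (ALL k. EX y. ?T (t @ [(n, d)]) (V \<inter> {h. \<bar>blinfun_apply h (X k) - blinfun_apply (g k) (X k)\<bar> < d / 64}) y)"
    for n d g and X :: "nat => 'a"
  have "EX d g X. R n d g X" if "?ok n" for n unfolding R_def by (rule node[OF that])
  then obtain d g X where R: "!!n. ?ok n ==> R n (d n) (g n) (X n)" by metis
  have gX: "0 < d n" "norm (X n k) = 1" "weakly_null (X n)" "7 * d n / 64 <= blinfun_apply (g n k) (X n k)"
    "EX y. ?T (t @ [(n, d n)]) (V \<inter> {h. \<bar>blinfun_apply h (X n k) - blinfun_apply (g n k) (X n k)\<bar> < d n / 64}) y"
    if "?ok n" for n k using R[OF that] unfolding R_def by blast+
  have "ALL n k. EX y. ?ok n --> ?T (t @ [(n, d n)]) (V \<inter> {h. \<bar>blinfun_apply h (X n k) - blinfun_apply (g n k) (X n k)\<bar> < d n / 64}) y"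
    using gX(5) by blast
  then obtain Y where Y: "!!n k. ?ok n ==> total_tree (Y n k)"
    "!!n k v. ?ok n ==> strict_mono v ==> increasing_tuple (map fst (t @ [(n, d n)]) @ [v 0]) ==>
      branch_estimate P (t @ [(n, d n)]) (V \<inter> {h. \<bar>blinfun_apply h (X n k) - blinfun_apply (g n k) (X n k)\<bar> < d n / 64}) (Y n k) v"
    by metis
  \<comment> \<open>At indices that do not continue the increasing tuple, the spare weakly null
    sequence \<open>w\<close> is used.\<close>
  define x where "x u = (case u of n # k # u' => if ?ok n then if u' = [] then X n k else Y n k u' else w (last u) | _ => w (last u))" for u
  have "total_tree x" unfolding total_tree_def
  proof (intro conjI allI impI)
    fix u :: "nat list" assume u: "even (length u) & u ~= []"
    then obtain n k u' where "u = n # k # u'" by (cases u; cases "tl u") auto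
    thus "norm (x u) = 1" using u w(2) gX(2) Y(1) by (auto simp: x_def total_tree_def)
  next
    fix u :: "nat list" assume u: "odd (length u)"
    then consider n where "u = [n]" | n k u' where "u = n # k # u'" "odd (length u')" by (cases u; cases "tl u") auto
    thus "weakly_null (%k. x (u @ [k]))"
    proof cases
      case 1 thus ?thesis using w(1) gX(3) by (cases "?ok n") (auto simp: x_def)
    next
      case 2 thus ?thesis using w(1) Y(1) by (cases "?ok n") (auto simp: x_def total_tree_def)
    qed
  qed
  moreover have "branch_estimate P t V x v" if v: "strict_mono v" "?ok (v 0)" for v
  proof -
    define n where "n = v 0"
    define k where "k = v 1"
    define v' where "v' i = v (i + 2)" for i
    have n: "?ok n" using v by (simp add: n_def)
    have sm: "strict_mono v'" using v(1) by (auto simp: v'_def strict_mono_def)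
    have lt: "v 0 < v 2" using v(1) by (auto simp: strict_mono_def)
    have "increasing_tuple (map fst (t @ [(n, d n)]) @ [v' 0])"
    proof -
      have "fst p < v 2" if "p : set t" for p
        using n lt that by (auto simp: increasing_tuple_append n_def intro: less_trans)
      moreover have "increasing_tuple [v 0, v 2]" using n lt by (auto simp: increasing_tuple_def n_def)
      moreover have "map fst (t @ [(n, d n)]) @ [v' 0] = map fst t @ [v 0, v 2]" by (simp add: v'_def n_def numeral_2_eq_2)
      ultimately show ?thesis using n by (simp only: increasing_tuple_append) (auto simp: n_def)
    qed
    from Y(2)[OF n sm this, of k] obtain r d' h where h: "h : dual_ball" "h : V"
      "\<bar>blinfun_apply h (X n k) - blinfun_apply (g n k) (X n k)\<bar> < d n / 64"
      "P ((t @ [(n, d n)]) @ map (%i. (v' (2 * i), d' i)) [0..<r])"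
      "!!i. i < r ==> 0 < d' i & d' i / 16 <= blinfun_apply h (Y n k (map v' [0..<2 * i + 2]))"
      unfolding branch_estimate_def by blast
    define d2 where "d2 i = (case i of 0 => d n | Suc i => d' i)" for i
    have x0: "x (map v [0..<2]) = X n k" using n by (simp add: x_def n_def k_def numeral_2_eq_2)
    have map_split: "map v [0..<2 * Suc i + 2] = n # k # map v' [0..<2 * i + 2]" for i
      by (rule nth_equalityI) (auto simp: nth_Cons' n_def k_def v'_def simp del: upt_Suc intro!: arg_cong[where f = v])
    have xS: "x (map v [0..<2 * Suc i + 2]) = Y n k (map v' [0..<2 * i + 2])" for i
      unfolding map_split using n by (simp add: x_def)
    show ?thesis unfolding branch_estimate_def
    proof (intro exI[of _ "Suc r"] exI[of _ d2] exI[of _ h] conjI h(1,2) allI impI)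
      have "map (%i. (v (2 * i), d2 i)) [0..<Suc r] = (n, d n) # map (%i. (v' (2 * i), d' i)) [0..<r]"
        by (rule nth_equalityI) (auto simp: nth_Cons' n_def v'_def d2_def split: nat.split simp del: upt_Suc)
      thus "P (t @ map (%i. (v (2 * i), d2 i)) [0..<Suc r])" using h(4) by simp
    next
      fix i assume i: "i < Suc r"
      show "0 < d2 i" using i gX(1)[OF n] h(5) by (auto simp: d2_def split: nat.split)
      show "d2 i / 16 <= blinfun_apply h (x (map v [0..<2 * i + 2]))"
      proof (cases i)
        case 0
        have "d n / 16 <= blinfun_apply h (X n k)"
          using gX(4)[OF n, of k] h(3) gX(1)[OF n]  by linarith
        thus ?thesis using 0 x0 by (simp add: d2_def numeral_2_eq_2)
      next
        case (Suc j)
        hence "j < r" using i by simp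
        thus ?thesis unfolding Suc xS using h(5)[of j] by (simp add: d2_def)
      qed
    qed
  qed
  ultimately show ?case by blast
qed

lemma adv_upper_tree_estimate:
  fixes hs :: "nat => 'a::real_normed_vector dual" and f :: "'a dual"
  assumes hs: "closure (range hs) = UNIV" and w: "weakly_null w" "!!k. norm (w k :: 'a) = 1"
    and est: "!!x :: nat list => 'a. weakly_null_even_tree x ==>
        (EX n :: nat => nat. strict_mono_on {1..} n & 1 <= n 1 &
           dominated C (%l. x (map n [1..<2 * l + 1])) N (%l. unit_vec (n (2 * l - 1))))"
    and adv: "adv P [] f"
  obtains m :: "nat => nat" and r u where "strict_mono m" "1 <= m 0" "P (map (%i. (m i, u i)) [0..<r])" "ALL i<r. 0 < u i"
    "ALL a. (ALL i<r. 0 <= a i) --> (\<Sum>i<r. a i * u i) / 16 <= C * N (%k. \<Sum>i<r. a i * unit_vec (m i) k)"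
proof -
  have o: "openin weak_star UNIV" using openin_topspace[of weak_star] by (simp add: strong_operator_topology_topspace)
  from adv_tree[OF hs w adv o UNIV_I] obtain x :: "nat list => 'a" where x: "total_tree x"
    "!!v. strict_mono v ==> 1 <= v 0 ==> branch_estimate P [] UNIV x v" by auto
  have "weakly_null_even_tree x" using x(1) by (auto simp: weakly_null_even_tree_def total_tree_def even_tuples_def)
  from est[OF this] obtain n :: "nat => nat" where n: "strict_mono_on {1..} n" "1 <= n 1"
    "dominated C (%l. x (map n [1..<2 * l + 1])) N (%l. unit_vec (n (2 * l - 1)))" by blast
  define v where "v i = n (Suc i)" for i
  have v: "strict_mono v" using n(1) by (auto simp: strict_mono_def strict_mono_on_def v_def)
  from x(2)[OF this] obtain r u h where h: "h : dual_ball" "P (map (%i. (v (2 * i), u i)) [0..<r])"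
    "!!i. i < r ==> 0 < u i & u i / 16 <= h (x (map v [0..<2 * i + 2]))"
    using n(2) unfolding branch_estimate_def by (auto simp: v_def)
  \<comment> \<open>The game numbers the entries of a branch from 0, the tree estimates from
    1.\<close>
  have map: "map n [1..<2 * Suc i + 1] = map v [0..<2 * i + 2]" for i
    by (rule nth_equalityI) (auto simp: v_def simp del: upt_Suc)
  show ?thesis
  proof (rule that[of "%i. v (2 * i)" u r]; (intro allI impI)?)
    show "strict_mono (%i. v (2 * i))" using v by (auto simp: strict_mono_def)
    show "1 <= v (2 * 0)" using n(2) by (simp add: v_def)
    show "P (map (%i. (v (2 * i), u i)) [0..<r])" by (rule h(2))
    show "0 < u i" if "i < r" for i using h(3)[OF that] by blast
    fix a :: "nat => real" assume a: "ALL i<r. 0 <= a i"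
    have "(\<Sum>i<r. a i * u i) / 16 = (\<Sum>i<r. a i * (u i / 16))" by (simp add: sum_divide_distrib)
    also have "\<dots> <= (\<Sum>i<r. a i * h (x (map v [0..<2 * i + 2])))" using a h(3) by (intro sum_mono mult_left_mono) auto
    also have "\<dots> = h (\<Sum>i<r. a i *\<^sub>R x (map v [0..<2 * i + 2]))" by (simp add: blinfun.sum_right blinfun.scaleR_right)
    also have "\<dots> <= norm (\<Sum>i<r. a i *\<^sub>R x (map v [0..<2 * i + 2]))"
      using norm_blinfun[of h "\<Sum>i<r. a i *\<^sub>R x (map v [0..<2 * i + 2])"] h(1)
        mult_right_mono[of "norm h" 1 "norm (\<Sum>i<r. a i *\<^sub>R x (map v [0..<2 * i + 2]))"] by simp
    also have "(\<Sum>i<r. a i *\<^sub>R x (map v [0..<2 * i + 2])) = (\<Sum>l\<in>Suc ` {..<r}. a (l - 1) *\<^sub>R x (map n [1..<2 * l + 1]))"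
      by (simp only: sum.reindex[OF inj_Suc] comp_def map diff_Suc_1)
    also have "norm \<dots> <= C * N (%k. \<Sum>l\<in>Suc ` {..<r}. a (l - 1) * unit_vec (n (2 * l - 1)) k)"
    proof -
      have "finite (Suc ` {..<r}) & Suc ` {..<r} \<subseteq> {1..}" by auto
      from n(3)[unfolded dominated_def, rule_format, OF this, of "%l. a (l - 1)"] show ?thesis .
    qed
    also have "(%k. \<Sum>l\<in>Suc ` {..<r}. a (l - 1) * unit_vec (n (2 * l - 1)) k) = (%k. \<Sum>i<r. a i * unit_vec (v (2 * i)) k)"
      by (rule ext, subst sum.reindex) (auto simp: v_def)
    finally show "(\<Sum>i<r. a i * u i) / 16 <= C * N (%k. \<Sum>i<r. a i * unit_vec (v (2 * i)) k)" .
  qed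
qed

text \<open>Each drop of the clock is paid for by one Szlenk step, which supplies a point at
  distance \<open>\<epsilon> / 3\<close> in every neighbourhood; all recorded distances are
  therefore equal.\<close>

lemma szlenk_derived_adv:
  fixes f :: "'a::real_normed_vector dual"
  assumes "forces P \<beta> t'" "f : szlenk_derived \<epsilon> \<beta>" "0 < \<epsilon>" "map fst t = t'" "!!p. p : set t ==> snd p = \<epsilon> / 3"
  shows "adv (%t. P (map fst t) & (ALL p:set t. snd p = \<epsilon> / 3)) t f" using assms
proof (induction arbitrary: f t rule: forces.induct)
  case (stop t' \<beta>)
  have "f : dual_ball" using stop.prems(1) szlenk_derived_subset by blast
  thus ?case using stop by (intro adv.stop) auto
next
  case (move t' \<beta>)
  show ?case
  proof (rule adv.jump)
    show "f : dual_ball" using move.prems szlenk_derived_subset by blast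
    fix n assume n: "increasing_tuple (map fst t @ [n])"
    hence "increasing_tuple (t' @ [n])" using move.prems(3) by simp
    from move.IH[OF this] obtain g where g: "g < \<beta>" "ALL h :: 'a dual. h : szlenk_derived \<epsilon> g --> 0 < \<epsilon> -->
        (ALL t. map fst t = t' @ [n] --> (ALL p. p : set t --> snd p = \<epsilon> / 3) -->
          adv (%t. P (map fst t) & (ALL p:set t. snd p = \<epsilon> / 3)) t h)" by blast
    have f: "f : szlenk_step \<epsilon> (szlenk_derived \<epsilon> g)"
      using move.prems(1) szlenk_derived_antimono[of "osuc g" \<beta> \<epsilon>] g(1) by (auto simp: szlenk_derived_osuc osuc_le_iff)
    show "EX u>0. ALL U. openin weak_star U & f : U --> (EX g:U. u <= norm (g - f) &
        adv (%t. P (map fst t) & (ALL p:set t. snd p = \<epsilon> / 3)) (t @ [(n, u)]) g)"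
    proof (intro exI[of _ "\<epsilon> / 3"] conjI allI impI)
      fix U assume U: "openin weak_star U & f : U"
      obtain h where h: "h : U" "h : szlenk_derived \<epsilon> g" "\<epsilon> / 3 <= norm (h - f)"
        by (rule szlenk_step_far_point[OF f `0 < \<epsilon>`, of U]) (use U in auto)
      have "adv (%t. P (map fst t) & (ALL p:set t. snd p = \<epsilon> / 3)) (t @ [(n, \<epsilon> / 3)]) h"
        by (rule g(2)[rule_format, OF h(2)]) (use move.prems in auto)
      thus "EX g:U. \<epsilon> / 3 <= norm (g - f) & adv (%t. P (map fst t) & (ALL p:set t. snd p = \<epsilon> / 3)) (t @ [(n, \<epsilon> / 3)]) g"
        using h by blast
    qed (use `0 < \<epsilon>` in simp)
  qed
qed

lemma szlenk_step_weakly_null: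
  fixes hs :: "nat => 'a::real_normed_vector dual" and f :: "'a dual"
  assumes hs: "closure (range hs) = UNIV" and f: "f : szlenk_step \<epsilon> K" and "0 < \<epsilon>"
  obtains w :: "nat => 'a" where "weakly_null w" "!!k. norm (w k) = 1"
proof -
  have o: "openin weak_star UNIV" using openin_topspace[of weak_star] by (simp add: strong_operator_topology_topspace)
  have Q: "EX g:U. \<epsilon> / 3 <= norm (g - f) & g : UNIV" if "openin weak_star U" "f : U" for U
    by (rule szlenk_step_far_point[OF f `0 < \<epsilon>` that]) blast
  obtain g x where "!!k. norm (x k) = 1" "weakly_null (x :: nat => 'a)" "!!k. g k : (UNIV :: 'a dual set)"
    by (rule weakly_null_node[OF hs _ Q o]) (use `0 < \<epsilon>` in auto)
  thus ?thesis using that by blast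
qed

lemma tree_estimates_imp_derived_empty:
  fixes s :: "ctbl_ord => nat => ctbl_ord"
  assumes s: "approximating s" and sep: "separable_space (euclidean :: 'a::banach dual topology)"
    and \<alpha>: "\<alpha> ~= 0" and est: "Tsirelson_upper_tree_estimates TYPE('a) s \<alpha>" and \<epsilon>: "0 < \<epsilon>"
  shows "szlenk_derived \<epsilon> (wexp (\<alpha> * omega)) = ({} :: 'a dual set)"
proof (rule ccontr)
  assume "~ ?thesis"
  then obtain f :: "'a dual" where f: "f : szlenk_derived \<epsilon> (wexp (\<alpha> * omega))" by blast
  obtain hs :: "nat => 'a dual" and e :: "nat => 'a" where hs: "closure (range hs) = UNIV"
    by (rule separable_dual_total_sequence[OF sep])
  obtain c C where c: "0 < c" "c < 1" "1 <= C" and est': "!!x :: nat list => 'a. weakly_null_even_tree x ==>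
        (EX n :: nat => nat. strict_mono_on {1..} n & 1 <= n 1 &
           dominated C (%l. x (map n [1..<2 * l + 1])) (Tsirelson_norm s \<alpha> c) (%l. unit_vec (n (2 * l - 1))))"
    using est unfolding Tsirelson_upper_tree_estimates_def upper_tree_estimates_def by blast
  interpret tsirelson "Schreier s \<alpha>" c by (rule tsirelson_Schreier[OF s c(1,2)])
  \<comment> \<open>Averaging distances \<open>\<epsilon> / 3\<close> gives
    \<open>\<epsilon> / 48\<close> on the left of the branch estimate; \<open>C * d\<close> is half
    of that.\<close>
  define d where "d = \<epsilon> / (96 * C)"
  have d: "0 < d" using \<epsilon> c by (simp add: d_def)
  obtain n where n: "forces (small_norm d []) (wpow \<alpha> n) []" using forces_small_norm[OF s c(1,2) \<alpha> d] by blast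
  have fn: "f : szlenk_derived \<epsilon> (wpow \<alpha> n)" using f szlenk_derived_antimono[OF wpow_le] by blast
  have "osuc 0 <= wexp (\<alpha> * omega)" unfolding osuc_le_iff by simp
  hence "f : szlenk_step \<epsilon> dual_ball"
    using f szlenk_derived_antimono[of "osuc 0" "wexp (\<alpha> * omega)" \<epsilon>] by (auto simp: szlenk_derived_osuc szlenk_derived_0)
  then obtain w :: "nat => 'a" where w: "weakly_null w" "!!k. norm (w k) = 1"
    using szlenk_step_weakly_null[OF hs _ \<epsilon>] by metis
  have adv: "adv (%t. small_norm d [] (map fst t) & (ALL p:set t. snd p = \<epsilon> / 3)) [] f"
    by (rule szlenk_derived_adv[OF n fn \<epsilon>]) auto
  obtain m :: "nat => nat" and r h where m: "strict_mono m" "1 <= m 0"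
    "small_norm d [] (map fst (map (%i. (m i, h i)) [0..<r])) & (ALL p:set (map (%i. (m i, h i)) [0..<r]). snd p = \<epsilon> / 3)"
    "ALL a. (ALL i<r. 0 <= a i) --> (\<Sum>i<r. a i * h i) / 16 <= C * Tsirelson_norm s \<alpha> c (%k. \<Sum>i<r. a i * unit_vec (m i) k)"
    by (rule adv_upper_tree_estimate[OF hs w est' adv])
  have inj: "inj m" using m(1) by (rule strict_mono_imp_inj_on)
  have h: "h i = \<epsilon> / 3" if "i < r" for i using m(3) that by auto
  obtain b where b: "prob_on (m ` {..<r}) b" "tnorm (Schreier s \<alpha>) c b <= d"
    using m(3) by (auto simp: small_norm_def comp_def lessThan_atLeast0)
  have "b = (%k. \<Sum>i<r. b (m i) * unit_vec (m i) k)"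
  proof
    fix k
    have "(\<Sum>i<r. b (m i) * unit_vec (m i) k) = (\<Sum>j\<in>m ` {..<r}. b j * unit_vec j k)"
      using inj by (subst sum.reindex) (auto intro: inj_on_subset)
    also have "\<dots> = (\<Sum>j\<in>m ` {..<r}. if j = k then b k else 0)" by (rule sum.cong) (auto simp: unit_vec_def)
    also have "\<dots> = b k" using b(1) by (auto simp: prob_on_def)
    finally show "b k = (\<Sum>i<r. b (m i) * unit_vec (m i) k)" by simp
  qed
  moreover have "(\<Sum>i<r. b (m i) * h i) / 16 <= C * Tsirelson_norm s \<alpha> c (%k. \<Sum>i<r. b (m i) * unit_vec (m i) k)"
    by (rule m(4)[rule_format]) (use b in "auto simp: prob_on_def")
  moreover have "(\<Sum>i<r. b (m i) * h i) = \<epsilon> / 3"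
  proof -
    have "(\<Sum>i<r. b (m i) * h i) = (\<Sum>i<r. b (m i)) * (\<epsilon> / 3)" by (simp add: h sum_distrib_right)
    also have "(\<Sum>i<r. b (m i)) = (\<Sum>j\<in>m ` {..<r}. b j)" using inj by (subst sum.reindex) (auto intro: inj_on_subset)
    finally show ?thesis using b(1) by (simp add: prob_on_def)
  qed
  ultimately have "\<epsilon> / 48 <= C * tnorm (Schreier s \<alpha>) c b" unfolding Tsirelson_norm_eq[OF s c(1,2)] by simp
  also have "\<dots> <= C * d" using b(2) c(3) by (intro mult_left_mono) auto
  also have "\<dots> = \<epsilon> / 96" using c(3) by (simp add: d_def)
  finally show False using \<epsilon> by simp
qed

lemma szlenk_index_at_mostI:
  assumes "!!\<epsilon>. 0 < \<epsilon> ==> szlenk_derived \<epsilon> \<Omega> = ({} :: 'a::banach dual set)"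
  shows "szlenk_index_at_most TYPE('a) \<Omega>"
proof -
  define m where "m \<epsilon> = (LEAST b. szlenk_derived \<epsilon> b = ({} :: 'a dual set))" for \<epsilon>
  have m: "szlenk_derived \<epsilon> (m \<epsilon>) = ({} :: 'a dual set)" "m \<epsilon> <= \<Omega>" if "0 < \<epsilon>" for \<epsilon>
    unfolding m_def using LeastI[of "%b. szlenk_derived \<epsilon> b = ({} :: 'a dual set)", OF assms[OF that]]
      Least_le[of "%b. szlenk_derived \<epsilon> b = ({} :: 'a dual set)", OF assms[OF that]] by auto
  have "m ` {0<..} \<subseteq> {..<osuc \<Omega>}" using m(2) by (auto simp: less_osuc_iff)
  hence "countable (m ` {0<..})" using countable_lessThan_ctbl_ord countable_subset by blast
  hence os: "is_osup (m ` {0<..}) (osup (m ` {0<..}))" by (rule is_osup_osup)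
  have "osup (m ` {0<..}) <= \<Omega>" using os m(2) unfolding is_osup_def by auto
  moreover have "has_szlenk_index TYPE('a) (osup (m ` {0<..}))" unfolding has_szlenk_index_def using os m(1)
    by (intro exI[of _ m]) (auto simp: m_def intro: Least_le)
  ultimately show ?thesis unfolding szlenk_index_at_most_def by blast
qed

lemma szlenk_index_at_mostD:
  assumes "szlenk_index_at_most TYPE('a::banach) \<Omega>" "0 < \<epsilon>"
  shows "szlenk_derived \<epsilon> \<Omega> = ({} :: 'a dual set)"
proof -
  obtain \<sigma> m where m: "\<sigma> <= \<Omega>" "szlenk_derived \<epsilon> (m \<epsilon>) = ({} :: 'a dual set)" "is_osup (m ` {0<..}) \<sigma>"
    using assms unfolding szlenk_index_at_most_def has_szlenk_index_def by blast
  hence "m \<epsilon> <= \<Omega>" using assms(2) unfolding is_osup_def by (meson greaterThan_iff imageI order.trans)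
  thus ?thesis using szlenk_derived_antimono[of "m \<epsilon>" \<Omega> \<epsilon>] m(2) by blast
qed

section \<open>Submultiplicativity of the Szlenk derivations\<close>

lemma openin_weak_star_affine:
  fixes U :: "'a::real_normed_vector dual set"
  assumes U: "openin weak_star U"
  shows "openin weak_star {g. c *\<^sub>R (g - f) : U}"
proof -
  have "continuous_map weak_star weak_star (%g :: 'a dual. c *\<^sub>R (g - f))"
  proof (subst continuous_on_strong_operator_topo_iff_coordinatewise, rule allI)
    fix x
    have "continuous_map weak_star euclidean (%g. c * (g x - f x))"
      using strong_operator_topology_continuous_evaluation[of x] by (intro continuous_intros) auto
    thus "continuous_map weak_star euclidean (%g. (c *\<^sub>R (g - f)) x)"
      by (simp add: blinfun.scaleR_left blinfun.diff_left)
  qed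
  from openin_continuous_map_preimage[OF this U] show ?thesis by (simp add: strong_operator_topology_topspace)
qed

text \<open>Subtracting \<open>f\<close> and dividing by \<open>s\<close> moves the part inside
  \<open>U\<close> into the unit ball, and turns derivations at scale \<open>s * \<epsilon>\<close>
  into derivations at scale \<epsilon>, since diameters are divided by \<open>s\<close>.\<close>

lemma szlenk_derived_rescale:
  fixes f :: "'a::real_normed_vector dual"
  assumes s: "0 < s" and U: "openin weak_star U" and near: "!!g. g : szlenk_derived (s * \<epsilon>) a \<inter> U ==> norm (g - f) <= s"
    and g: "g : szlenk_derived (s * \<epsilon>) (a + b) \<inter> U"
  shows "inverse s *\<^sub>R (g - f) : szlenk_derived \<epsilon> b" using g
proof (induction b arbitrary: g rule: ord_induct)
  case zero
  hence "norm (g - f) <= s" by (intro near) simp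
  hence "norm (inverse s *\<^sub>R (g - f)) <= 1" using s by (simp add: divide_simps)
  thus ?case unfolding szlenk_derived_0 mem_cball_0 .
next
  case (suc b)
  let ?h = "%g. inverse s *\<^sub>R (g - f)" and ?D = "szlenk_derived (s * \<epsilon>) (a + b) :: 'a dual set"
  have g: "g : szlenk_step (s * \<epsilon>) ?D" "g : U" using suc.prems by (auto simp: szlenk_derived_osuc)
  show ?case unfolding szlenk_derived_osuc szlenk_step_def
  proof (intro CollectI conjI allI impI)
    show "?h g : szlenk_derived \<epsilon> b" using g suc.IH szlenk_step_subset by blast
    fix V assume V: "openin weak_star V & ?h g : V"
    define W where "W = {g. ?h g : V} \<inter> U"
    have W: "openin weak_star W" "g : W" using V U g(2) openin_weak_star_affine unfolding W_def by auto
    hence d: "s * \<epsilon> < diameter (W \<inter> ?D)" using g unfolding szlenk_step_def by blast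
    have bd: "bounded (V \<inter> szlenk_derived \<epsilon> b)" using szlenk_derived_subset by (intro bounded_subset_dual_ball) blast
    have "diameter (W \<inter> ?D) <= s * diameter (V \<inter> szlenk_derived \<epsilon> b)"
    proof (rule diameter_le)
      show "W \<inter> ?D ~= {} \<or> 0 <= s * diameter (V \<inter> szlenk_derived \<epsilon> b)" using diameter_ge_0[OF bd] s by simp
      fix u v assume "u : W \<inter> ?D" "v : W \<inter> ?D"
      hence "?h u : V \<inter> szlenk_derived \<epsilon> b" "?h v : V \<inter> szlenk_derived \<epsilon> b" using suc.IH by (auto simp: W_def)
      hence "dist (?h u) (?h v) <= diameter (V \<inter> szlenk_derived \<epsilon> b)" by (rule diameter_bounded_bound[OF bd])
      moreover have "?h u - ?h v = inverse s *\<^sub>R (u - v)" by (simp add: scaleR_diff_right[symmetric])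
      ultimately have "inverse s * norm (u - v) <= diameter (V \<inter> szlenk_derived \<epsilon> b)" using s by (simp add: dist_norm)
      thus "norm (u - v) <= s * diameter (V \<inter> szlenk_derived \<epsilon> b)" using s by (simp add: field_simps)
    qed
    thus "\<epsilon> < diameter (V \<inter> szlenk_derived \<epsilon> b)" using d s by (meson less_le_trans mult_less_cancel_left_pos)
  qed
next
  case (lim b)
  have "g : szlenk_derived (s * \<epsilon>) (a + d) \<inter> U" if "d < b" for d
    using szlenk_derived_antimono[of "a + d" "a + b" "s * \<epsilon>"] lim.prems less_imp_le[OF that] by (auto simp: oadd_le_iff)
  thus ?case using lim.IH by (auto simp: szlenk_derived_limit[OF lim.hyps(1)])
qed

text \<open>A point that is removed at scale \<open>s\<close> has a neighbourhood in which the
  current set has diameter at most \<open>s\<close>. There the finer derivations are rescaled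
  derivations of the ball and die out after \<Lambda> steps, so one coarse step is worth \<Lambda>
  fine ones.\<close>

lemma szlenk_derived_mult:
  assumes empty: "szlenk_derived \<epsilon> \<Lambda> = ({} :: 'a::real_normed_vector dual set)" and s: "0 < s"
  shows "szlenk_derived (s * \<epsilon>) (\<Lambda> * b) \<subseteq> (szlenk_derived s b :: 'a dual set)"
proof (induction b rule: ord_induct)
  case (suc b)
  let ?L = "szlenk_derived (s * \<epsilon>) (\<Lambda> * b) :: 'a dual set"
  show ?case
  proof
    fix f :: "'a dual" assume f: "f : szlenk_derived (s * \<epsilon>) (\<Lambda> * osuc b)"
    hence fK: "f : szlenk_derived s b"
      using suc szlenk_derived_antimono[OF omult_le_mono, of b "osuc b" "s * \<epsilon>" \<Lambda>] less_imp_le[OF less_osuc[of b]] by blast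
    show "f : szlenk_derived s (osuc b)"
    proof (rule ccontr)
      assume "~ ?thesis"
      then obtain U where U: "openin weak_star U" "f : U" "diameter (U \<inter> szlenk_derived s b) <= s"
        using fK unfolding szlenk_derived_osuc szlenk_step_def by (auto simp: not_less)
      have bd: "bounded (U \<inter> szlenk_derived s b)" using szlenk_derived_subset by (intro bounded_subset_dual_ball) blast
      have "norm (g - f) <= s" if "g : ?L \<inter> U" for g
      proof -
        have "g : U \<inter> szlenk_derived s b" "f : U \<inter> szlenk_derived s b" using that suc fK U by auto
        hence "dist g f <= diameter (U \<inter> szlenk_derived s b)" by (rule diameter_bounded_bound[OF bd])
        thus ?thesis using U(3) by (simp add: dist_norm)
      qed
      moreover have "f : szlenk_derived (s * \<epsilon>) (\<Lambda> * b + \<Lambda>) \<inter> U" using f U(2) by simp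
      ultimately have "inverse s *\<^sub>R (f - f) : szlenk_derived \<epsilon> \<Lambda>" by (rule szlenk_derived_rescale[OF s U(1)])
      thus False using empty by simp
    qed
  qed
next
  case (lim b)
  have "szlenk_derived (s * \<epsilon>) (\<Lambda> * b) \<subseteq> (szlenk_derived s d :: 'a dual set)" if "d < b" for d
    using lim.IH[OF that] szlenk_derived_antimono[OF omult_le_mono, of d b "s * \<epsilon>" \<Lambda>] that by (auto dest: less_imp_le)
  thus ?case unfolding szlenk_derived_limit[OF lim.hyps(1)] by blast
qed (simp add: szlenk_derived_0)

section \<open>Weak-star closed sets and cells\<close>

lemma topspace_weak_star [simp]: "topspace weak_star = UNIV" by (rule strong_operator_topology_topspace)

lemma closedin_szlenk_step:
  assumes "closedin weak_star K" shows "closedin weak_star (szlenk_step \<epsilon> K)"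
proof -
  have "openin weak_star (- szlenk_step \<epsilon> K)"
  proof (subst openin_subopen, intro ballI)
    fix f assume f: "f : - szlenk_step \<epsilon> K"
    show "EX T. openin weak_star T & f : T & T \<subseteq> - szlenk_step \<epsilon> K"
    proof (cases "f : K")
      case True
      then obtain U where U: "openin weak_star U" "f : U" "~ \<epsilon> < diameter (U \<inter> K)"
        using f by (auto simp: szlenk_step_def)
      hence "U \<subseteq> - szlenk_step \<epsilon> K" unfolding szlenk_step_def by blast
      thus ?thesis using U by blast
    next
      case False
      have "openin weak_star (- K)" using assms by (simp add: closedin_def Compl_eq_Diff_UNIV)
      thus ?thesis using False szlenk_step_subset[of \<epsilon> K] by blast
    qed
  qed
  thus ?thesis by (simp add: closedin_def Compl_eq_Diff_UNIV)
qed

lemma closedin_szlenk_derived: "closedin weak_star (szlenk_derived \<epsilon> b)"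
proof (induction b rule: ord_induct)
  case zero thus ?case by (simp add: szlenk_derived_0 closedin_dual_ball)
next
  case (suc b) thus ?case by (simp add: szlenk_derived_osuc closedin_szlenk_step)
next
  case (lim b)
  thus ?case unfolding szlenk_derived_limit[OF lim.hyps(1)] using limit_pos[OF lim.hyps(1)] by (intro closedin_INT) auto
qed

lemma nested_closed_nonempty:
  assumes A: "!!i. i : I ==> closedin weak_star (A i)" "!!i. i : I ==> A i \<subseteq> dual_ball" "!!i. i : I ==> A i ~= {}"
    and chain: "!!i j. i : I ==> j : I ==> A i \<subseteq> A j \<or> A j \<subseteq> A i" and I: "I ~= {}"
  shows "(\<Inter>i\<in>I. A i) ~= {}"
proof -
  have fin: "dual_ball \<inter> \<Inter>\<F> ~= {}" if "finite \<F>" "\<F> \<subseteq> A ` I" for \<F>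
  proof (cases "\<F> = {}")
    case False
    have "EX i:I. A i \<subseteq> \<Inter>\<F>" using that(1) False that(2)
    proof (induction \<F> rule: finite_ne_induct)
      case (insert B \<F>)
      then obtain i j where "i : I" "A i \<subseteq> \<Inter>\<F>" "j : I" "B = A j" by auto
      then consider "A i \<subseteq> A j" | "A j \<subseteq> A i" using chain[of i j] by blast
      thus ?case
      proof cases
        case 1 thus ?thesis using `i : I` `A i \<subseteq> \<Inter>\<F>` `B = A j` by blast
      next
        case 2 thus ?thesis using `j : I` `A i \<subseteq> \<Inter>\<F>` `B = A j` by blast
      qed
    qed auto
    thus ?thesis using A by blast
  qed (simp; use norm_zero in "auto intro!: exI[of _ 0]")
  have "dual_ball \<inter> \<Inter>(A ` I) ~= {}"
    by (rule compactin_dual_ball[unfolded compactin_fip, THEN conjunct2, rule_format, of "A ` I"])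
      (use A(1) fin in blast)
  thus ?thesis by blast
qed

text \<open>A dyadic box in the first \<open>m\<close> coordinates. Both inequalities are weak so
  that cells are weak-star closed; neighbouring cells may overlap.\<close>

definition cell :: "(nat => 'a::real_normed_vector) => nat => 'a dual => 'a dual set" where
  "cell e m t = {s : dual_ball. ALL j<m. of_int \<lfloor>2 ^ m * blinfun_apply t (e j)\<rfloor> <= 2 ^ m * blinfun_apply s (e j) &
     2 ^ m * blinfun_apply s (e j) <= of_int \<lfloor>2 ^ m * blinfun_apply t (e j)\<rfloor> + 1}"

lemma cell_self: "t : dual_ball ==> t : cell e m t"
  by (auto simp: cell_def intro: less_imp_le[OF floor_correct[THEN conjunct2]])

lemma cell_subset_ball: "cell e m t \<subseteq> dual_ball" by (auto simp: cell_def)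

lemma cell_Suc_subset: "cell e (Suc m) t \<subseteq> cell e m t"
proof
  fix s assume s: "s : cell e (Suc m) t"
  have "of_int \<lfloor>2 ^ m * t (e j)\<rfloor> <= 2 ^ m * s (e j) &
     2 ^ m * s (e j) <= of_int \<lfloor>2 ^ m * t (e j)\<rfloor> + 1" if "j < m" for j
  proof -
    define v where "v = 2 ^ m * t (e j)"
    define k where "k = \<lfloor>v\<rfloor>"
    have s': "of_int \<lfloor>2 * v\<rfloor> <= 2 * (2 ^ m * s (e j))" "2 * (2 ^ m * s (e j)) <= of_int \<lfloor>2 * v\<rfloor> + 1"
      using s that unfolding cell_def v_def by (auto simp: mult.assoc)
    have "2 * k <= \<lfloor>2 * v\<rfloor>" "\<lfloor>2 * v\<rfloor> <= 2 * k + 1" unfolding k_def by linarith+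
    hence "real_of_int (2 * k) <= real_of_int \<lfloor>2 * v\<rfloor>" "real_of_int \<lfloor>2 * v\<rfloor> <= real_of_int (2 * k + 1)"
      by (simp_all only: of_int_le_iff)
    thus ?thesis using s' unfolding v_def[symmetric] k_def[symmetric] by (simp add: k_def)
  qed
  thus "s : cell e m t" using s by (simp add: cell_def)
qed

lemma cell_antimono: "m <= n ==> cell e n t \<subseteq> cell e m t"
  by (rule lift_Suc_antimono_le[of "%m. cell e m t", OF cell_Suc_subset])

lemma cell_mesh:
  assumes "s : cell e m t" "s' : cell e m t" "j < m"
  shows "\<bar>s (e j) - s' (e j)\<bar> <= 1 / 2 ^ m"
proof -
  have "\<bar>2 ^ m * s (e j) - 2 ^ m * s' (e j)\<bar> <= 1" using assms unfolding cell_def by (smt (verit) mem_Collect_eq)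
  hence "\<bar>2 ^ m * (s (e j) - s' (e j))\<bar> <= 1" by (simp only: right_diff_distrib)
  thus ?thesis unfolding abs_mult by (simp add: field_simps)
qed

lemma closedin_cell: "closedin weak_star (cell e m t)"
proof -
  have cl: "closedin weak_star {s. a <= 2 ^ m * blinfun_apply s x & 2 ^ m * blinfun_apply s x <= b}" for a b and x :: 'a
  proof -
    have "closed {y :: real. a <= 2 ^ m * y & 2 ^ m * y <= b}"
      by (intro closed_Collect_conj closed_Collect_le continuous_intros)
    from closedin_continuous_map_preimage[OF strong_operator_topology_continuous_evaluation[of x], of "{y. a <= 2 ^ m * y & 2 ^ m * y <= b}"]
    show ?thesis using \<open>closed _\<close> by simp
  qed
  have "cell e m t = (if m = 0 then dual_ball else dual_ball \<inter> (\<Inter>j\<in>{..<m}. {s. of_int \<lfloor>2 ^ m * blinfun_apply t (e j)\<rfloor> <= 2 ^ m * blinfun_apply s (e j) &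
     2 ^ m * blinfun_apply s (e j) <= of_int \<lfloor>2 ^ m * blinfun_apply t (e j)\<rfloor> + 1}))" by (auto simp: cell_def)
  thus ?thesis using closedin_dual_ball cl by (auto intro!: closedin_Int closedin_INT)
qed

lemma finite_cells:
  assumes e: "!!j. norm (e j) <= 1"
  shows "finite (cell e m ` dual_ball)"
proof -
  define code where "code t = (\<lambda>j\<in>{..<m}. \<lfloor>2 ^ m * t (e j)\<rfloor>)" for t :: "'a dual"
  have "code t : (\<Pi>\<^sub>E j\<in>{..<m}. {- (2 ^ m)..2 ^ m})" if t: "t : dual_ball" for t
  proof (rule PiE_I)
    fix j assume j: "j : {..<m}"
    have "\<bar>t (e j)\<bar> <= norm t * norm (e j)" using norm_blinfun[of t "e j"] by simp
    also have "\<dots> <= 1" using t e[of j] by (simp add: mult_le_one)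
    finally have "- 1 <= t (e j)" "t (e j) <= 1" by (auto simp: abs_le_iff)
    hence b: "- (2 ^ m) <= 2 ^ m * t (e j)" "2 ^ m * t (e j) <= 2 ^ m"
      using mult_left_mono[of "- 1" "t (e j)" "2 ^ m"] mult_left_mono[of "t (e j)" 1 "2 ^ m"] by simp_all
    hence "- (2 ^ m) <= \<lfloor>2 ^ m * t (e j)\<rfloor>" by (simp only: le_floor_iff of_int_minus of_int_power of_int_numeral)
    moreover have "\<lfloor>2 ^ m * t (e j)\<rfloor> <= 2 ^ m" using b unfolding floor_le_iff of_int_power of_int_numeral by linarith
    ultimately show "code t j : {- (2 ^ m)..2 ^ m}" using j by (simp add: code_def)
  qed (simp add: code_def)
  hence "code ` dual_ball \<subseteq> (\<Pi>\<^sub>E j\<in>{..<m}. {- (2 ^ m)..2 ^ m})" by blast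
  hence "finite (code ` dual_ball)" by (rule finite_subset) (intro finite_PiE; simp)
  define D where "D g = {s : dual_ball. ALL j<m. of_int (g j) <= 2 ^ m * s (e j) &
     2 ^ m * s (e j) <= of_int (g j) + 1}" for g :: "nat => int"
  have "cell e m t = D (code t)" for t by (auto simp: cell_def D_def code_def)
  hence "cell e m ` dual_ball = D ` code ` dual_ball" by (simp add: image_image)
  thus ?thesis using \<open>finite (code ` dual_ball)\<close> by simp
qed

text \<open>The Lebesgue number lemma on the weak-star compact set \<open>L\<close>, with cells of
  high level in place of small balls.\<close>

lemma cell_lebesgue:
  assumes e: "closure (span (range e)) = UNIV" and L: "closedin weak_star L" "L \<subseteq> dual_ball"
    and cover: "!!f. f : L ==> EX U. openin weak_star U & f : U & R U"
  obtains m where "ALL B t. B ~= {} --> B \<subseteq> cell e m t \<inter> L --> (EX U. R U & B \<subseteq> U)"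
proof -
  have "EX U n d. R U & 0 < d & (ALL g:dual_ball. (ALL j<n. \<bar>blinfun_apply g (e j) - blinfun_apply f (e j)\<bar> < d) --> g : U)" if f: "f : L" for f
  proof -
    obtain U where U: "openin weak_star U" "f : U" "R U" using cover[OF f] by blast
    have "f : dual_ball" using f L by blast
    show ?thesis by (rule weak_star_nbhd_base[OF e U(1,2)]) (intro exI[of _ U] exI conjI U(3); blast)
  qed
  then obtain U n d where Und: "!!f. f : L ==> R (U f)" "!!f. f : L ==> 0 < (d f :: real)"
    "!!f g. f : L ==> g : dual_ball ==> ALL j<n f. \<bar>blinfun_apply g (e j) - blinfun_apply f (e j)\<bar> < d f ==> g : U f" by metis
  \<comment> \<open>Half the radius: a point in the same fine cell as a point of \<open>W f\<close>
    still lies in \<open>U f\<close>.\<close>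
  define W where "W f = (\<Inter>j\<in>{..<n f}. {g. \<bar>blinfun_apply g (e j) - blinfun_apply f (e j)\<bar> < d f / 2})" for f
  have W: "openin weak_star (W f)" for f
  proof (cases "n f = 0")
    case True
    thus ?thesis using openin_topspace[of weak_star] by (simp add: W_def)
  next
    case False
    thus ?thesis unfolding W_def by (intro openin_INT2 openin_weak_star_ball) auto
  qed
  have "compactin weak_star L" using L by (rule compactin_closed_subset_ball)
  moreover have "L \<subseteq> \<Union>(W ` L)" using Und(2) by (force simp: W_def)
  ultimately obtain F where F: "finite F" "F \<subseteq> L" "L \<subseteq> \<Union>(W ` F)"
    using W unfolding compactin_def by (metis (no_types, lifting) finite_subset_image imageE)
  have "EX m. (ALL f:F. n f <= m) & (ALL f:F. 1 / 2 ^ m < d f / 2)" using F(1,2)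
  proof (induction F)
    case (insert f F)
    then obtain m where m: "ALL f:F. n f <= m" "ALL f:F. 1 / 2 ^ m < d f / 2" by auto
    obtain k where k: "(1 / 2 :: real) ^ k < d f / 2" using real_arch_pow_inv[of "d f / 2" "1 / 2"] Und(2)[of f] insert.prems by auto
    have mono: "(1::real) / 2 ^ (m + k + n f) <= 1 / 2 ^ i" if "i <= m + k + n f" for i
      using that by (intro divide_left_mono power_increasing) auto
    have "1 / 2 ^ (m + k + n f) < d g / 2" if "g : F" for g
      using mono[of m] m(2) that by (meson le_add1 add.assoc order_le_less_trans trans_le_add1)
    moreover have "1 / 2 ^ (m + k + n f) < d f / 2" using mono[of k] k by (simp add: power_one_over)
    ultimately show ?case using m(1) by (intro exI[of _ "m + k + n f"]) (auto intro: trans_le_add1)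
  qed simp
  then obtain m where m: "!!f. f : F ==> n f <= m" "!!f. f : F ==> 1 / 2 ^ m < d f / 2" by blast
  have "EX U. R U & B \<subseteq> U" if ne: "B ~= {}" and sub: "B \<subseteq> cell e m t \<inter> L" for B t
  proof -
    obtain g0 where g0: "g0 : B" using ne by blast
    then obtain f where f: "f : F" "g0 : W f" using F(3) sub by blast
    have "B \<subseteq> U f"
    proof
      fix g assume g: "g : B"
      have "\<bar>blinfun_apply g (e j) - blinfun_apply f (e j)\<bar> < d f" if j: "j < n f" for j
      proof -
        have "\<bar>blinfun_apply g (e j) - blinfun_apply g0 (e j)\<bar> <= 1 / 2 ^ m"
          using g g0 sub m(1)[OF f(1)] j by (intro cell_mesh[of g e m t]) auto
        moreover have "\<bar>blinfun_apply g0 (e j) - blinfun_apply f (e j)\<bar> < d f / 2" using f(2) j by (simp add: W_def)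
        ultimately show ?thesis using m(2)[OF f(1)] by linarith
      qed
      moreover have "g : dual_ball" using g sub L(2) by blast
      moreover have "f : L" using f F by blast
      ultimately show "g : U f" using Und(3) by blast
    qed
    thus ?thesis using Und(1) f F by blast
  qed
  thus ?thesis using that by blast
qed

section \<open>Branch systems\<close>

text \<open>\<open>r n b\<close> is the \<open>n\<close>-th node of the \<open>b\<close>-th branch of a finitely branching tree in the dual
  ball along which the functionals converge in the weak-star topology.\<close>

definition branch_system :: "(nat => 'a::real_normed_vector) => (nat => nat => 'a dual) => bool" where
  "branch_system e r \<longleftrightarrow> (ALL b. r 0 b = 0) & (ALL n b. norm (r n b) <= 1) & (ALL n. finite (range (r n))) &
     (ALL b j p q. 1 <= p & j <= p & p <= q --> \<bar>blinfun_apply (r q b) (e j) - blinfun_apply (r p b) (e j)\<bar> <= 1 / 4 ^ p) &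
     (ALL x. ALL \<delta>>0. EX n b. norm x - \<delta> <= blinfun_apply (r n b) x)"

definition osc :: "(nat => nat => 'a::real_normed_vector dual) => nat => nat => nat => real" where
  "osc r b p q = Max ((%(m, m'). norm (r m b - r m' b)) ` ({p..q} \<times> {p..q}))"

text \<open>The windows from \<open>i\<close> to \<open>en i\<close> do not overlap. The coefficient
  of a window sits at \<open>Q (Suc i)\<close> because the first change inside it is the one from
  level \<open>i\<close> to level \<open>Suc i\<close>.\<close>

definition osc_estimate :: "nat set set => real => (nat => nat) => real => (nat => nat => 'a::real_normed_vector dual) => bool" where
  "osc_estimate S c Q C r \<longleftrightarrow> (ALL b I en a. finite I --> (ALL i:I. i < en i) --> (ALL i:I. ALL j:I. i < j --> en i <= j) -->
     (ALL i:I. 0 <= a i) -->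
     (\<Sum>i\<in>I. a i * osc r b i (en i)) <= C * tnorm S c (%k. \<Sum>i\<in>I. a i * unit_vec (Q (Suc i)) k))"

lemma osc_upper: "p <= m ==> m <= q ==> p <= m' ==> m' <= q ==> norm (r m b - r m' b) <= osc r b p q"
  unfolding osc_def by (rule Max_ge) auto

lemma osc_leI:
  assumes "p <= q" "!!m m'. p <= m ==> m <= q ==> p <= m' ==> m' <= q ==> norm (r m b - r m' b) <= B"
  shows "osc r b p q <= B" unfolding osc_def using assms by (subst Max_le_iff) auto

lemma osc_nonneg: "p <= q ==> 0 <= osc r b p q" using osc_upper[of p p q p r b] by simp

lemma osc_le_steps: "p <= q ==> osc r b p q <= (\<Sum>n\<in>{p..<q}. norm (r (Suc n) b - r n b))"
proof (rule osc_leI)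
  assume pq: "p <= q"
  have le: "norm (r m' b - r m b) <= (\<Sum>n\<in>{p..<q}. norm (r (Suc n) b - r n b))" if "p <= m" "m <= m'" "m' <= q" for m m'
  proof -
    have "r m' b - r m b = (\<Sum>n\<in>{m..<m'}. r (Suc n) b - r n b)" using sum_Suc_diff'[OF that(2), of "%n. r n b"] by simp
    hence "norm (r m' b - r m b) <= (\<Sum>n\<in>{m..<m'}. norm (r (Suc n) b - r n b))" by (simp add: norm_sum)
    also have "\<dots> <= (\<Sum>n\<in>{p..<q}. norm (r (Suc n) b - r n b))" using that by (intro sum_mono2) auto
    finally show ?thesis .
  qed
  fix m m' assume "p <= m" "m <= q" "p <= m'" "m' <= q"
  thus "norm (r m b - r m' b) <= (\<Sum>n\<in>{p..<q}. norm (r (Suc n) b - r n b))"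
    using le[of m m'] le[of m' m] by (cases "m <= m'") (auto simp: norm_minus_commute)
qed

definition closed_piece :: "'a::real_normed_vector dual set => bool" where
  "closed_piece A \<longleftrightarrow> closedin weak_star A & A \<subseteq> dual_ball & A ~= {}"

lemma closed_piece_cell: "t : dual_ball ==> closed_piece (cell e m t)"
  unfolding closed_piece_def using closedin_cell cell_subset_ball cell_self by blast

text \<open>A diagonal choice. A level has finitely many cells, and only the properties numbered up
  to that level are asked for, so one sufficiently high next level serves them all. The lower bound
  on \<open>\<l> n\<close> gives mesh at most \<open>1 / 4 ^ n\<close>.\<close>

lemma thin_levels:
  fixes e :: "nat => 'a::real_normed_vector" and stab :: "nat => 'a dual set => nat => bool"
  assumes e: "!!j. norm (e j) <= 1"
    and mono: "!!k A m m'. stab k A m ==> m <= m' ==> stab k A m'"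
    and ex: "!!k A. closed_piece A ==> EX m. stab k A m"
  obtains \<l> where "ALL n. 2 * n + 2 <= \<l> n" "strict_mono \<l>" "ALL n. ALL t:dual_ball. ALL k <= n. stab k (cell e (\<l> n) t) (\<l> (Suc n))"
proof -
  have "EX \<l>. ALL n. (2 * n + 2 <= \<l> n) & (\<l> n < \<l> (Suc n) & (ALL t:dual_ball. ALL k <= n. stab k (cell e (\<l> n) t) (\<l> (Suc n))))"
  proof (rule dependent_nat_choice)
    show "EX x :: nat. 2 * 0 + 2 <= x" by blast
    fix x n :: nat assume "2 * n + 2 <= x"
    define F where "F = cell e x ` (dual_ball :: 'a dual set)"
    have fF: "finite F" unfolding F_def by (rule finite_cells[OF e])
    define m where "m k A = (SOME m. stab k A m)" for k A
    have m: "stab k A (m k A)" if "A : F" for k A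
      unfolding m_def by (rule someI_ex) (use that ex closed_piece_cell in "unfold F_def, blast")
    define y where "y = (\<Sum>k\<le>n. \<Sum>A\<in>F. m k A) + x + 2 * n + 5"
    have "m k A <= y" if "A : F" "k <= n" for k A
    proof -
      have "m k A <= (\<Sum>A\<in>F. m k A)" using that fF by (intro member_le_sum) auto
      also have "\<dots> <= (\<Sum>k\<le>n. \<Sum>A\<in>F. m k A)" using that by (intro member_le_sum[of k "{..n}" "%k. \<Sum>A\<in>F. m k A"]) auto
      finally show ?thesis by (simp add: y_def)
    qed
    hence "stab k A y" if "A : F" "k <= n" for k A using that m mono by blast
    hence "ALL t:dual_ball. ALL k <= n. stab k (cell e x t) y" unfolding F_def by simp
    thus "EX y. 2 * Suc n + 2 <= y & x < y & (ALL t:dual_ball. ALL k <= n. stab k (cell e x t) y)"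
      by (intro exI[of _ y]) (simp add: y_def)
  qed
  then obtain \<l> where \<l>: "ALL n. (2 * n + 2 <= \<l> n) & (\<l> n < \<l> (Suc n) & (ALL t:dual_ball. ALL k <= n. stab k (cell e (\<l> n) t) (\<l> (Suc n))))"
    by blast
  thus ?thesis by (intro that[of \<l>]) (auto simp: strict_mono_Suc_iff)
qed

text \<open>One functional is selected for every cell of every level. There are countably many of
  them, so branches can be numbered by natural numbers.\<close>

lemma representative_branches:
  fixes e :: "nat => 'a::real_normed_vector" and \<l> :: "nat => nat"
  assumes e: "!!j. norm (e j) <= 1"
  obtains tb :: "nat => 'a dual" where "ALL b. tb b : dual_ball"
    "ALL n. ALL t:dual_ball. EX b. cell e (\<l> n) (tb b) = cell e (\<l> n) t"
proof -
  define sel where "sel n C = (SOME t. t : dual_ball & cell e (\<l> n) t = C)" for n C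
  have sel: "sel n C : dual_ball & cell e (\<l> n) (sel n C) = C" if "C : cell e (\<l> n) ` dual_ball" for n C
    unfolding sel_def by (rule someI_ex) (use that in blast)
  define T where "T = (\<Union>n. sel n ` cell e (\<l> n) ` dual_ball)"
  have cnt: "countable (sel n ` cell e (\<l> n) ` dual_ball)" for n
    by (rule countable_finite[OF finite_imageI[OF finite_cells[OF e]]])
  have "countable T" unfolding T_def by (rule countable_UN[OF countableI_type]) (rule cnt)
  moreover have "T ~= {}" unfolding T_def by (simp; use norm_zero in force)
  ultimately have r: "range (from_nat_into T) = T" by (simp add: range_from_nat_into)
  show ?thesis
  proof (rule that[of "from_nat_into T"]; intro allI ballI)
    have "T \<subseteq> dual_ball" using sel unfolding T_def by blast
    thus "from_nat_into T b : dual_ball" for b using r by (metis rangeI subsetD)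
    fix n and t :: "'a dual" assume t: "t : dual_ball"
    hence "sel n (cell e (\<l> n) t) : T" unfolding T_def by blast
    then obtain b where "from_nat_into T b = sel n (cell e (\<l> n) t)" using r by (metis imageE)
    thus "EX b. cell e (\<l> n) (from_nat_into T b) = cell e (\<l> n) t" using sel[of "cell e (\<l> n) t" n] t by (intro exI[of _ b]) auto
  qed
qed

text \<open>The root is set to 0, so that differences from level 0 recover the values
  themselves.\<close>

definition branch_rep :: "(nat => 'a::real_normed_vector) => ('a dual set => 'a dual) => (nat => nat) =>
    (nat => 'a dual) => nat => nat => 'a dual" where
  "branch_rep e \<rho> \<l> tb n b = (if n = 0 then 0 else \<rho> (cell e (\<l> n) (tb b)))"

lemma branch_system_branch_rep:
  fixes e :: "nat => 'a::real_normed_vector"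
  assumes e: "!!j. norm (e j) <= 1" "closure (span (range e)) = UNIV"
    and s: "!!A. closed_piece A ==> s A : A"
    and \<l>: "ALL n. 2 * n + 2 <= \<l> n" "strict_mono \<l>"
    and tb: "ALL b. tb b : dual_ball" "ALL n. ALL t:dual_ball. EX b. cell e (\<l> n) (tb b) = cell e (\<l> n) t"
  shows "branch_system e (branch_rep e s \<l> tb)"
proof -
  let ?r = "branch_rep e s \<l> tb"
  have rc: "?r n b : cell e (\<l> m) (tb b)" if "1 <= n" "m <= n" for n m b
  proof -
    have "?r n b : cell e (\<l> n) (tb b)" using that tb(1) by (simp add: branch_rep_def s closed_piece_cell)
    thus ?thesis using cell_antimono[of "\<l> m" "\<l> n"] \<l>(2) that(2) by (meson strict_mono_less_eq subsetD)
  qed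
  show ?thesis unfolding branch_system_def
  proof (intro conjI allI impI)
    show "?r 0 b = 0" for b by (simp add: branch_rep_def)
    show "norm (?r n b) <= 1" for n b
      using rc[of n n b] cell_subset_ball[of e "\<l> n" "tb b"] by (cases "n = 0") (auto simp: branch_rep_def)
    show "finite (range (?r n))" for n
    proof (cases "n = 0")
      case False
      have "range (?r n) \<subseteq> s ` cell e (\<l> n) ` dual_ball" using False tb(1) by (auto simp: branch_rep_def)
      thus ?thesis by (rule finite_subset) (intro finite_imageI finite_cells e)
    qed (simp add: branch_rep_def)
  next
    fix b j p q :: nat assume a: "1 <= p & j <= p & p <= q"
    have "j < \<l> p" using a \<l>(1)[rule_format, of p] by simp
    have "\<bar>blinfun_apply (?r q b) (e j) - blinfun_apply (?r p b) (e j)\<bar> <= 1 / 2 ^ \<l> p"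
      by (rule cell_mesh[OF rc rc \<open>j < \<l> p\<close>]) (use a in auto)
    also have "\<dots> <= 1 / 2 ^ (2 * p)" using \<l>(1)[rule_format, of p] by (intro divide_left_mono power_increasing) auto
    also have "\<dots> = 1 / 4 ^ p" by (simp add: power_mult)
    finally show "\<bar>blinfun_apply (?r q b) (e j) - blinfun_apply (?r p b) (e j)\<bar> <= 1 / 4 ^ p" .
  next
    fix x :: 'a and u :: real assume u: "0 < u"
    obtain f :: "'a dual" where f: "norm f <= 1" "blinfun_apply f x = norm x" by (rule norming_functional)
    have fb: "f : dual_ball" using f by simp
    have fU: "f : {g. \<bar>blinfun_apply g x - blinfun_apply f x\<bar> < u}" using u by simp
    show "EX n b. norm x - u <= blinfun_apply (?r n b) x"
    proof (rule weak_star_nbhd_base[OF e(2) openin_weak_star_ball fU])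
      fix n d assume d: "0 < (d :: real)" and
        U: "!!g. g : dual_ball ==> (!!j. j < n ==> \<bar>blinfun_apply g (e j) - blinfun_apply f (e j)\<bar> < d) ==>
          g : {g. \<bar>blinfun_apply g x - blinfun_apply f x\<bar> < u}"
      obtain k where k: "(1 / 2 :: real) ^ k < d" using real_arch_pow_inv[OF d, of "1 / 2"] by auto
      define m where "m = n + k + 1"
      obtain b where b: "cell e (\<l> m) (tb b) = cell e (\<l> m) f" using tb(2) fb by blast
      have c: "?r m b : cell e (\<l> m) f" "f : cell e (\<l> m) f" using rc[of m m b] b cell_self[OF fb] by (auto simp: m_def)
      have lm: "n + k <= \<l> m" using \<l>(1)[rule_format, of m] by (simp add: m_def)
      have "?r m b : {g. \<bar>blinfun_apply g x - blinfun_apply f x\<bar> < u}"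
      proof (rule U)
        show "?r m b : dual_ball" using c cell_subset_ball by blast
        fix j assume "j < n"
        hence "\<bar>blinfun_apply (?r m b) (e j) - blinfun_apply f (e j)\<bar> <= 1 / 2 ^ \<l> m"
          by (intro cell_mesh[OF c]) (use lm in simp)
        also have "\<dots> <= 1 / 2 ^ k" using lm by (intro divide_left_mono power_increasing) auto
        also have "\<dots> < d" using k by (simp add: power_one_over)
        finally show "\<bar>blinfun_apply (?r m b) (e j) - blinfun_apply f (e j)\<bar> < d" .
      qed
      hence "norm x - u <= blinfun_apply (?r m b) x" using f(2) by (simp add: abs_less_iff)
      thus ?thesis by blast
    qed
  qed
qed

section \<open>Branch systems from the Szlenk index\<close>

text \<open>The first derivation that misses \<open>A\<close> is not the whole ball, and by
  compactness its order is not a limit.\<close>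

lemma top_exists:
  assumes A: "closed_piece A" and empty: "szlenk_derived \<epsilon> \<Lambda> = ({} :: 'a::real_normed_vector dual set)"
  shows "EX \<beta><\<Lambda>. A \<inter> szlenk_derived \<epsilon> \<beta> ~= {} & A \<inter> szlenk_derived \<epsilon> (osuc \<beta>) = ({} :: 'a dual set)"
proof -
  define g where "g = (LEAST h. A \<inter> szlenk_derived \<epsilon> h = ({} :: 'a dual set))"
  have ex: "A \<inter> szlenk_derived \<epsilon> \<Lambda> = {}" using empty by simp
  have g: "A \<inter> szlenk_derived \<epsilon> g = {}" "g <= \<Lambda>" "!!d. d < g ==> A \<inter> szlenk_derived \<epsilon> d ~= {}"
    unfolding g_def using LeastI[of "%h. A \<inter> szlenk_derived \<epsilon> h = {}", OF ex] Least_le[of "%h. A \<inter> szlenk_derived \<epsilon> h = {}", OF ex]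
      not_less_Least[of _ "%h. A \<inter> szlenk_derived \<epsilon> h = {}"] by blast+
  have "g ~= 0"
  proof
    assume "g = 0"
    hence "A \<inter> dual_ball = {}" using g(1) by (simp add: szlenk_derived_0)
    moreover have "A \<inter> dual_ball = A" "A ~= {}" using A by (auto simp: closed_piece_def)
    ultimately show False by metis
  qed
  moreover have "~ is_limit g"
  proof
    assume lim: "is_limit g"
    have "(\<Inter>d\<in>{..<g}. A \<inter> szlenk_derived \<epsilon> d) ~= {}"
    proof (rule nested_closed_nonempty)
      show "closedin weak_star (A \<inter> szlenk_derived \<epsilon> d)" for d
        using A closedin_szlenk_derived by (auto simp: closed_piece_def)
      show "A \<inter> szlenk_derived \<epsilon> i \<subseteq> A \<inter> szlenk_derived \<epsilon> j \<or> A \<inter> szlenk_derived \<epsilon> j \<subseteq> A \<inter> szlenk_derived \<epsilon> i" for i j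
        using szlenk_derived_antimono[of i j \<epsilon>] szlenk_derived_antimono[of j i \<epsilon>] linear[of i j] by blast
      show "{..<g} ~= {}" using limit_pos[OF lim] by auto
    qed (use A g(3) in "auto simp: closed_piece_def")
    then obtain f where f: "f : (\<Inter>d\<in>{..<g}. A \<inter> szlenk_derived \<epsilon> d)" by (rule ex_in_conv[THEN iffD2, THEN exE])
    have f': "f : A \<inter> szlenk_derived \<epsilon> d" if "d < g" for d using INT_D[OF f] that by simp
    hence "f : A \<inter> szlenk_derived \<epsilon> g"
      using limit_pos[OF lim] unfolding szlenk_derived_limit[OF lim] by (intro IntI INT_I) (blast, simp)
    thus False using g(1) by (metis empty_iff)
  qed
  ultimately obtain \<beta> where \<beta>: "g = osuc \<beta>" by (auto simp: is_limit_def)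
  hence "\<beta> < g" by (simp add: less_osuc)
  thus ?thesis using g \<beta> by (intro exI[of _ \<beta>]) auto
qed

section \<open>Deepest points at all scales\<close>

locale szlenk_scales =
  fixes e :: "nat => 'a::real_normed_vector" and eps :: "nat => real" and \<Lambda> :: "nat => ctbl_ord"
  assumes e: "!!j. norm (e j) <= 1" "closure (span (range e)) = UNIV"
    and empty: "!!k. szlenk_derived (eps k) (\<Lambda> k) = ({} :: 'a dual set)"
begin

definition tp :: "nat => 'a dual set => ctbl_ord" where
  "tp k A = (SOME \<beta>. \<beta> < \<Lambda> k & A \<inter> szlenk_derived (eps k) \<beta> ~= {} & A \<inter> szlenk_derived (eps k) (osuc \<beta>) = {})"

lemma tp:
  assumes "closed_piece A"
  shows "tp k A < \<Lambda> k" "A \<inter> szlenk_derived (eps k) (tp k A) ~= {}" "A \<inter> szlenk_derived (eps k) (osuc (tp k A)) = {}"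
  using someI_ex[OF top_exists[OF assms empty[of k], unfolded Bex_def]] unfolding tp_def by auto

lemma tp_mono: "closed_piece A ==> closed_piece C ==> C \<subseteq> A ==> tp k C <= tp k A"
proof (rule ccontr)
  assume a: "closed_piece A" "closed_piece C" "C \<subseteq> A" "~ tp k C <= tp k A"
  hence "osuc (tp k A) <= tp k C" by (simp add: osuc_le_iff)
  hence "A \<inter> szlenk_derived (eps k) (tp k C) = {}"
    using szlenk_derived_antimono[of "osuc (tp k A)" "tp k C" "eps k"] tp(3)[OF a(1), of k] by blast
  thus False using tp(2)[OF a(2), of k] a(3) by blast
qed

text \<open>The cores choose the deepest nonempty derivation scale by scale; \<open>rk\<close> records the depths
  lexicographically.\<close>

primrec core :: "'a dual set => nat => 'a dual set" where
  "core A 0 = A"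
| "core A (Suc k) = core A k \<inter> szlenk_derived (eps k) (tp k (core A k))"

primrec rk :: "'a dual set => nat => ctbl_ord" where
  "rk A 0 = 0"
| "rk A (Suc k) = \<Lambda> k * rk A k + tp k (core A k)"

primrec bound :: "nat => ctbl_ord" where
  "bound 0 = 1"
| "bound (Suc k) = \<Lambda> k * bound k"

lemma closed_piece_core: "closed_piece A ==> closed_piece (core A k)"
proof (induction k)
  case (Suc k)
  hence c: "closed_piece (core A k)" by simp
  show ?case using c tp(2)[OF c] closedin_szlenk_derived unfolding closed_piece_def core.simps by blast
qed simp

lemma core_antimono: "k <= k' ==> core A k' \<subseteq> core A k" by (rule lift_Suc_antimono_le[of "core A"]) auto

lemma rk_less: "closed_piece A ==> rk A k < bound k"
  by (induction k) (simp_all add: omult_add_less tp(1) closed_piece_core)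

text \<open>While the ranks up to scale \<open>k\<close> agree, the cores are nested and the depth
  at the next scale cannot grow. Once an earlier rank has fallen, later depths cannot compensate, by
  the lexicographic order.\<close>

lemma rk_mono:
  assumes "closed_piece A" "closed_piece C" "C \<subseteq> A"
  shows "rk C k <= rk A k & (rk C k = rk A k --> core C k \<subseteq> core A k)"
proof (induction k)
  case (Suc k)
  note cp = closed_piece_core[OF assms(1), of k] closed_piece_core[OF assms(2), of k]
  note lex = omult_add_less_iff[OF tp(1)[OF cp(2), of k] tp(1)[OF cp(1), of k], of "rk C k" "rk A k"]
  show ?case
  proof (cases "rk C k = rk A k")
    case True
    hence sub: "core C k \<subseteq> core A k" using Suc by blast
    have t: "tp k (core C k) <= tp k (core A k)" by (rule tp_mono[OF cp sub])
    show ?thesis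
    proof (cases "tp k (core C k) = tp k (core A k)")
      case True
      thus ?thesis using `rk C k = rk A k` sub by auto
    next
      case False
      hence "rk C (Suc k) < rk A (Suc k)" using t True by simp
      thus ?thesis by auto
    qed
  next
    case False
    hence "rk C (Suc k) < rk A (Suc k)" using Suc lex by simp
    thus ?thesis by auto
  qed
qed (use assms in simp)

text \<open>A point that is as deep as possible at all scales at once; it exists by
  compactness.\<close>

definition rep :: "'a dual set => 'a dual" where
  "rep A = (SOME f. f : (\<Inter>k. core A k))"

lemma rep_core: "closed_piece A ==> rep A : core A k"
proof -
  assume A: "closed_piece A"
  have "(\<Inter>k. core A k) ~= {}"
  proof (rule nested_closed_nonempty)
    show "core A i \<subseteq> core A j \<or> core A j \<subseteq> core A i" for i j
      using core_antimono[of i j A] core_antimono[of j i A] by (meson nat_le_linear)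
  qed (use closed_piece_core[OF A] in "auto simp: closed_piece_def")
  hence "rep A : (\<Inter>k. core A k)" unfolding rep_def by (metis some_in_eq)
  thus ?thesis by blast
qed

lemma rep_in: "closed_piece A ==> rep A : A" using rep_core[of A 0] by simp

text \<open>Quantified over all closed pieces \<open>B\<close> and \<open>C\<close>, because the
  levels from which they will come have not been chosen yet.\<close>

definition stab :: "nat => 'a dual set => nat => bool" where
  "stab k A m \<longleftrightarrow> (ALL B C t. closed_piece B --> closed_piece C --> C \<subseteq> B --> B \<subseteq> A \<inter> cell e m t -->
     rk C (Suc k) = rk A (Suc k) --> norm (rep C - rep B) <= eps k)"

lemma stab_mono: "stab k A m ==> m <= m' ==> stab k A m'" unfolding stab_def using cell_antimono[of m m' e] by blast

text \<open>No point of the core survives a further derivation at scale \<open>k\<close>, so the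
  core is covered by weak-star open sets that meet \<open>?K\<close> in diameter at most
  \<open>eps k\<close>. If the rank has not dropped, both representatives lie in this core, and a
  fine cell puts them into one set of the cover.\<close>

lemma stab_exists:
  assumes A: "closed_piece A"
  shows "EX m. stab k A m"
proof -
  define L where "L = core A (Suc k)"
  let ?K = "szlenk_derived (eps k) (tp k (core A k)) :: 'a dual set"
  have L: "closedin weak_star L" "L \<subseteq> dual_ball"
    using closed_piece_core[OF A, of "Suc k"] unfolding L_def closed_piece_def by blast+
  have cover: "EX U. openin weak_star U & f : U & diameter (U \<inter> ?K) <= eps k" if "f : L" for f
  proof -
    have "f : core A k" "f : ?K" using that by (auto simp: L_def)
    hence "f \<notin> szlenk_step (eps k) ?K"
      using tp(3)[OF closed_piece_core[OF A], of k k] unfolding szlenk_derived_osuc by blast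
    thus ?thesis using `f : ?K` unfolding szlenk_step_def by (auto simp: not_less)
  qed
  obtain m where m: "ALL B t. B ~= {} --> B \<subseteq> cell e m t \<inter> L --> (EX U. diameter (U \<inter> ?K) <= eps k & B \<subseteq> U)"
    by (rule cell_lebesgue[OF e(2) L cover])
  have "stab k A m" unfolding stab_def
  proof (intro allI impI)
    fix B C t
    assume a: "closed_piece B" "closed_piece C" "C \<subseteq> B" "B \<subseteq> A \<inter> cell e m t" "rk C (Suc k) = rk A (Suc k)"
    have BA: "B \<subseteq> A" using a by blast
    note le = conjunct1[OF rk_mono[OF A a(1) BA, of "Suc k"]] conjunct1[OF rk_mono[OF a(1,2,3), of "Suc k"]]
    have "rk B (Suc k) = rk A (Suc k)" by (rule antisym[OF le(1) le(2)[unfolded a(5)]])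
    moreover from this have "rk C (Suc k) = rk B (Suc k)" using a(5) by (simp del: rk.simps)
    ultimately have "rk B (Suc k) = rk A (Suc k)" "rk C (Suc k) = rk B (Suc k)" by blast+
    hence "core B (Suc k) \<subseteq> L" "core C (Suc k) \<subseteq> L"
      using rk_mono[OF A a(1) BA, of "Suc k"] rk_mono[OF a(1,2,3), of "Suc k"] unfolding L_def by blast+
    hence r: "rep B : L" "rep C : L" using rep_core[OF a(1)] rep_core[OF a(2)] by blast+
    moreover have "rep B : B" "rep C : B" using rep_in[OF a(1)] rep_in[OF a(2)] a(3) by blast+
    ultimately have "{rep B, rep C} \<subseteq> cell e m t \<inter> L" using a(4) by blast
    hence "EX U. diameter (U \<inter> ?K) <= eps k & {rep B, rep C} \<subseteq> U" by (rule m[rule_format, rotated]) simp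
    then obtain U where U: "diameter (U \<inter> ?K) <= eps k" "{rep B, rep C} \<subseteq> U" by (elim exE conjE)
    have "bounded (U \<inter> ?K)" using szlenk_derived_subset by (intro bounded_subset_dual_ball) blast
    hence "dist (rep C) (rep B) <= diameter (U \<inter> ?K)"
      by (rule diameter_bounded_bound) (use U(2) r in "auto simp: L_def")
    thus "norm (rep C - rep B) <= eps k" using U(1) by (simp add: dist_norm)
  qed
  thus ?thesis by blast
qed

end

section \<open>Summation over the scales\<close>

lemma sum_over_scales:
  fixes osc a :: "'i => real"
  assumes fin: "finite I" and a: "!!i. i : I ==> 0 <= a i" and o: "!!i. i : I ==> osc i <= \<theta> 0"
    and \<theta>: "!!k. 0 <= \<theta> k" "!!\<delta>. 0 < \<delta> ==> EX k. \<theta> k < \<delta>"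
    and D: "!!k. (\<Sum>i\<in>{i\<in>I. \<theta> (Suc k) < osc i}. a i) <= D k"
    and C: "!!K. (\<Sum>k<K. \<theta> k * D k) <= C"
  shows "(\<Sum>i\<in>I. a i * osc i) <= C"
proof -
  define \<delta> where "\<delta> = Min (insert 1 {osc i | i. i : I & 0 < osc i})"
  have f: "finite (insert 1 {osc i | i. i : I & 0 < osc i})" using fin by simp
  have "0 < \<delta>" unfolding \<delta>_def using f by (subst Min_gr_iff) auto
  then obtain K where K: "\<theta> K < \<delta>" using \<theta>(2) by blast
  \<comment> \<open>A layer-cake bound: for the least \<open>k\<close> with
    \<open>\<theta> (Suc k) < osc i\<close>, the value \<open>\<theta> k\<close> is not below
    \<open>osc i\<close>. Only finitely many scales occur, as the positive oscillations have a
    positive minimum.\<close>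
  have pt: "osc i <= (\<Sum>k<K. if \<theta> (Suc k) < osc i then \<theta> k else 0)" if i: "i : I" for i
  proof (cases "0 < osc i")
    case True
    hence "\<delta> <= osc i" unfolding \<delta>_def using f i by (intro Min_le) auto
    hence ex: "\<theta> K < osc i" using K by simp
    define j where "j = (LEAST j. \<theta> j < osc i)"
    have j: "\<theta> j < osc i" "j <= K" using LeastI[of "%j. \<theta> j < osc i", OF ex] Least_le[of "%j. \<theta> j < osc i", OF ex] by (auto simp: j_def)
    have "j ~= 0" using o[OF i] j(1) by (metis linorder_not_less)
    then obtain k where k: "j = Suc k" by (cases j) auto
    have "~ \<theta> k < osc i" using not_less_Least[of k "%j. \<theta> j < osc i"] k by (auto simp: j_def)
    hence "osc i <= (if \<theta> (Suc k) < osc i then \<theta> k else 0)" using j k by simp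
    also have "\<dots> <= (\<Sum>k<K. if \<theta> (Suc k) < osc i then \<theta> k else 0)"
      using j(2) k \<theta>(1) by (intro member_le_sum[of k "{..<K}" "%k. if \<theta> (Suc k) < osc i then \<theta> k else 0"]) auto
    finally show ?thesis .
  next
    case False
    thus ?thesis using \<theta>(1) by (intro order_trans[OF _ sum_nonneg]) auto
  qed
  have "(\<Sum>i\<in>I. a i * osc i) <= (\<Sum>i\<in>I. a i * (\<Sum>k<K. if \<theta> (Suc k) < osc i then \<theta> k else 0))"
    by (intro sum_mono mult_left_mono pt a)
  also have "\<dots> = (\<Sum>k<K. \<Sum>i\<in>I. a i * (if \<theta> (Suc k) < osc i then \<theta> k else 0))"
    unfolding sum_distrib_left by (rule sum.swap)
  also have "\<dots> = (\<Sum>k<K. \<theta> k * (\<Sum>i\<in>{i\<in>I. \<theta> (Suc k) < osc i}. a i))"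
    unfolding sum.inter_filter[OF fin] sum_distrib_left by (intro sum.cong) auto
  also have "\<dots> <= (\<Sum>k<K. \<theta> k * D k)" by (intro sum_mono mult_left_mono D \<theta>)
  finally show ?thesis using C[of K] by linarith
qed

lemma sum_Un_nonneg_le:
  fixes a :: "nat => real"
  assumes "finite A" "finite B" "!!i. i : A \<inter> B ==> 0 <= a i"
  shows "sum a (A \<union> B) <= sum a A + sum a B"
  using sum.union_inter[OF assms(1,2), of a] sum_nonneg[of "A \<inter> B" a] assms(3) by simp

text \<open>Split by parity of the position. It is needed because the rank drop of a window is
  measured from the level before it, which may still belong to the preceding window.\<close>

lemma separated_halves:
  fixes J :: "nat set"
  assumes "finite J"
  obtains J1 J2 where "J = J1 \<union> J2" "ALL P:{J1, J2}. ALL i:P. ALL j:P. i < j --> (EX h:J. i < h & h < j)"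
proof -
  define pos where "pos i = card {h\<in>J. h < i}" for i
  have *: "EX h:J. i < h & h < j" if "i : J" "i < j" "even (pos i) \<longleftrightarrow> even (pos j)" for i j
  proof (rule ccontr)
    assume "~ ?thesis"
    hence "{h\<in>J. h < j} = insert i {h\<in>J. h < i}" using that(1,2) by (auto simp: not_less dest: order.antisym)
    hence "pos j = Suc (pos i)"  by (simp add: pos_def)
    thus False using that(3) by simp
  qed
  show ?thesis by (rule that[of "{i\<in>J. even (pos i)}" "{i\<in>J. odd (pos i)}"]) (use * in auto)
qed

definition scale :: "nat => real" where "scale k = (1 / 2) ^ (2 ^ k)"

text \<open>The exponent of \<open>c\<close> is about \<open>4 * n * d\<close> for
  \<open>d = 2 ^ k div 2\<close>. As \<open>c ^ (4 * n) = 2 / 3\<close>, the cost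
  \<open>1 / c ^ _\<close> grows like \<open>(3 / 2) ^ d\<close>, which the factor
  \<open>(1 / 2) ^ d\<close> overcomes. The terms are at most \<open>10 * (3 / 4) ^ k\<close>, and
  40 is the sum of that series.\<close>

lemma scale_sum_bound:
  assumes n: "1 <= n" and c: "0 < c" "c < 1" "c ^ (4 * n) = 2 / 3"
  shows "(\<Sum>k<K. 2 * (1 / 2) ^ (2 ^ k div 2) * (real k + 1 + 2 / c ^ (n * (2 ^ Suc k - 1)))) <= 40"
proof -
  have T: "2 * (1 / 2) ^ (2 ^ k div 2) * (real k + 1 + 2 / c ^ (n * (2 ^ Suc k - 1))) <= 10 * (3 / 4 :: real) ^ k" for k
  proof -
    define d :: nat where "d = 2 ^ k div 2"
    have d: "k <= d" unfolding d_def by (cases k) (auto simp: Suc_le_eq less_exp)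
    have "2 ^ Suc k - 1 <= 4 * d + (1 :: nat)" unfolding d_def by (cases k) auto
    hence "n * (2 ^ Suc k - 1) <= n * (4 * d + 1)" by (rule mult_le_mono2)
    also have "\<dots> <= 4 * n * (d + 1)" by (simp add: algebra_simps)
    finally have "c ^ (4 * n * (d + 1)) <= c ^ (n * (2 ^ Suc k - 1))" by (rule power_decreasing) (use c in auto)
    hence low: "(2 / 3) ^ (d + 1) <= c ^ (n * (2 ^ Suc k - 1))" unfolding power_mult[of c "4 * n"] c(3) .
    have "2 / c ^ (n * (2 ^ Suc k - 1)) <= 2 / (2 / 3) ^ (d + 1)" by (rule divide_left_mono[OF low]) (use c in auto)
    also have "\<dots> = 3 * (3 / 2) ^ d" by (simp add: power_divide field_simps)
    finally have 1: "2 / c ^ (n * (2 ^ Suc k - 1)) <= 3 * (3 / 2) ^ d" .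
    have 2: "real k + 1 <= 2 * (3 / 2) ^ k"
    proof (induction k)
      case (Suc k)
      show ?case
      proof (cases "k = 0")
        case False
        hence "1 <= real k" by simp
        thus ?thesis using Suc by simp
      qed simp
    qed simp
    have "(1 / 2 :: real) ^ d * (real k + 1) <= (1 / 2) ^ k * (2 * (3 / 2) ^ k)"
      by (intro mult_mono 2 power_decreasing d) auto
    also have "\<dots> = 2 * (3 / 4) ^ k" using power_mult_distrib[of "1 / 2 :: real" "3 / 2" k] by simp
    finally have 3: "(1 / 2 :: real) ^ d * (real k + 1) <= 2 * (3 / 4) ^ k" .
    have "(1 / 2 :: real) ^ d * (2 / c ^ (n * (2 ^ Suc k - 1))) <= (1 / 2) ^ d * (3 * (3 / 2) ^ d)"
      by (intro mult_left_mono 1) auto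
    also have "\<dots> = 3 * (3 / 4) ^ d" using power_mult_distrib[of "1 / 2 :: real" "3 / 2" d] by simp
    also have "\<dots> <= 3 * (3 / 4) ^ k" by (intro mult_left_mono power_decreasing d) auto
    finally show ?thesis using 3 unfolding d_def[symmetric] by (simp add: distrib_left)
  qed
  have "(\<Sum>k<K. 2 * (1 / 2) ^ (2 ^ k div 2) * (real k + 1 + 2 / c ^ (n * (2 ^ Suc k - 1)))) <= (\<Sum>k<K. 10 * (3 / 4 :: real) ^ k)"
    by (intro sum_mono T)
  also have "\<dots> = 10 * ((1 - (3 / 4) ^ K) / (1 - 3 / 4))"
    unfolding sum_distrib_left[symmetric] by (subst sum_gp_strict) simp
  also have "\<dots> <= 40" by simp
  finally show ?thesis .
qed

text \<open>Applying submultiplicativity to the scale itself squares the scale and doubles the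
  order.\<close>

lemma szlenk_derived_scale:
  assumes "szlenk_derived (1 / 2) (wpow \<alpha> n) = ({} :: 'a::real_normed_vector dual set)"
  shows "szlenk_derived (scale k) (wpow \<alpha> (n * 2 ^ k)) = ({} :: 'a dual set)"
proof (induction k)
  case (Suc k)
  have pos: "0 < scale k" by (simp add: scale_def)
  have "scale k * scale k = scale (Suc k)" by (simp add: scale_def power_add[symmetric] mult_2)
  moreover have "wpow \<alpha> (n * 2 ^ k) * wpow \<alpha> (n * 2 ^ k) = wpow \<alpha> (n * 2 ^ Suc k)"
    unfolding wpow_add[symmetric] by (simp add: algebra_simps mult_2)
  ultimately show ?case using szlenk_derived_mult[OF Suc pos, of "wpow \<alpha> (n * 2 ^ k)"] Suc by simp
qed (use assms in "simp add: scale_def")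

context szlenk_scales
begin

text \<open>Cells of level \<open>i - 1\<close> have been made stable for level \<open>i\<close>,
  provided \<open>k <= i - 1\<close>; so the rank is compared with the level before the window. The
  2 comes from comparing two levels through the representative at level \<open>q\<close>.\<close>

lemma osc_branch_le:
  assumes st: "ALL n. ALL t:dual_ball. ALL k <= n. stab k (cell e (\<l> n) t) (\<l> (Suc n))" and \<l>: "strict_mono \<l>"
    and tb: "tb b : dual_ball" and i: "Suc k <= i" "i < q"
    and eq: "rk (cell e (\<l> q) (tb b)) (Suc k) = rk (cell e (\<l> (i - 1)) (tb b)) (Suc k)"
  shows "osc (branch_rep e rep \<l> tb) b i q <= 2 * eps k"
proof -
  define A where "A m = cell e (\<l> m) (tb b)" for m
  have cp: "closed_piece (A m)" for m unfolding A_def by (rule closed_piece_cell[OF tb])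
  have sub: "A m' \<subseteq> A m" if "m <= m'" for m m'
    unfolding A_def by (rule cell_antimono) (use that \<l> in "simp add: strict_mono_less_eq")
  have near: "norm (rep (A q) - rep (A m)) <= eps k" if "i <= m" "m <= q" for m
  proof -
    have "stab k (A (i - 1)) (\<l> i)" using st[rule_format, OF tb, of k "i - 1"] i by (simp add: A_def)
    moreover have "A m \<subseteq> A (i - 1) \<inter> cell e (\<l> i) (tb b)" using sub[of "i - 1" m] sub[of i m] that by (auto simp: A_def)
    ultimately show ?thesis using cp sub[OF that(2)] eq[folded A_def] unfolding stab_def by blast
  qed
  have r: "branch_rep e rep \<l> tb m b = rep (A m)" if "i <= m" for m using that i by (simp add: branch_rep_def A_def)
  show ?thesis
  proof (rule osc_leI)
    fix m m' assume m: "i <= m" "m <= q" "i <= m'" "m' <= q"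
    have "rep (A m) - rep (A m') = (rep (A q) - rep (A m')) - (rep (A q) - rep (A m))" by simp
    hence "norm (rep (A m) - rep (A m')) <= norm (rep (A q) - rep (A m')) + norm (rep (A q) - rep (A m))"
      by (metis norm_triangle_ineq4)
    thus "norm (branch_rep e rep \<l> tb m b - branch_rep e rep \<l> tb m' b) <= 2 * eps k"
      using near[OF m(1,2)] near[OF m(3,4)] by (simp add: r m)
  qed (use i in simp)
qed

text \<open>A window with large oscillation sees its rank drop. Within one of the two separated
  halves the ranks form a descent, so the clock readings form an admissible set of order
  \<open>M\<close>, at cost \<open>1 / c ^ M\<close>. The at most \<open>k + 1\<close> windows that
  start up to level \<open>k\<close>, where scale \<open>k\<close> is not yet controlled, are
  estimated one by one.\<close>

lemma large_oscillations:
  assumes st: "ALL n. ALL t:dual_ball. ALL k <= n. stab k (cell e (\<l> n) t) (\<l> (Suc n))" and \<l>: "strict_mono \<l>"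
    and tb: "tb b : dual_ball" and S: "tsirelson S c" and Q: "strict_mono Q" "1 <= Q 0"
    and q: "clocked (%j. \<Union>i\<le>j. (%A. rk A (Suc k)) ` cell e (\<l> i) ` dual_ball) (adm S M) q"
    and qQ: "!!j. k <= j ==> q j <= Q (Suc j)"
    and I: "finite I" "ALL i:I. i < en i" "ALL i:I. ALL j:I. i < j --> en i <= j" and a: "ALL i:I. 0 <= a i"
  shows "(\<Sum>i\<in>{i\<in>I. 2 * eps k < osc (branch_rep e rep \<l> tb) b i (en i)}. a i)
    <= (real k + 1 + 2 / c ^ M) * tnorm S c (%u. \<Sum>i\<in>I. a i * unit_vec (Q (Suc i)) u)"
proof -
  interpret T: tsirelson S c by (rule S)
  define y where "y = (%u. \<Sum>i\<in>I. a i * unit_vec (Q (Suc i)) u)"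
  have Q1: "1 <= Q i" for i using Q strict_mono_less_eq[OF Q(1), of 0 i] by simp
  have yc: "y : c00" unfolding y_def by (intro sum_c00 scale_c00 unit_vec_c00 Q1)
  have "inj_on (%i. Q (Suc i)) I" by (simp add: inj_on_def strict_mono_eq[OF Q(1)])
  hence yQ: "y (Q (Suc i)) = a i" if "i : I" for i unfolding y_def by (rule T.unit_vec_sum_at[OF I(1) _ that])
  let ?o = "%i. osc (branch_rep e rep \<l> tb) b i (en i)"
  define R where "R i = rk (cell e (\<l> i) (tb b)) (Suc k)" for i
  have cp: "closed_piece (cell e m (tb b))" for m by (rule closed_piece_cell[OF tb])
  have Rmono: "R j <= R i" if "i <= j" for i j unfolding R_def
    by (rule conjunct1[OF rk_mono[OF cp cp cell_antimono]]) (use that \<l> in "simp add: strict_mono_less_eq")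
  define J where "J = {i\<in>I. 2 * eps k < ?o i & Suc k <= i}"
  have drop: "R (en i) < R (i - 1)" if "i : J" for i
  proof -
    have i: "i < en i" "Suc k <= i" "2 * eps k < ?o i" using that I(2) by (auto simp: J_def)
    hence "R (en i) ~= R (i - 1)" using osc_branch_le[OF st \<l>, of tb b k i "en i"] tb by (auto simp: R_def simp del: rk.simps)
    moreover have "i - 1 <= en i" using i by linarith
    ultimately show ?thesis using Rmono[of "i - 1" "en i"] by (simp add: less_le)
  qed
  have "finite J" using I(1) by (simp add: J_def)
  then obtain J1 J2 where J12: "J = J1 \<union> J2" "ALL P:{J1, J2}. ALL i:P. ALL j:P. i < j --> (EX h:J. i < h & h < j)"
    by (rule separated_halves)
  hence fJ: "finite J1" "finite J2" using `finite J` by auto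
  have half: "(\<Sum>i\<in>P. a i) <= tnorm S c y / c ^ M" if P: "P : {J1, J2}" for P
  proof -
    have PJ: "P \<subseteq> J" using P J12(1) by blast
    have fP: "finite P" using PJ `finite J` by (rule finite_subset)
    have sm: "strict_mono (%j. Q (Suc j))" using Q(1) by (auto simp: strict_mono_def)
    have "(%j. Q (Suc j)) ` P : adm S M"
    proof (rule clockedD[OF q sm fP, where \<beta> = "%j. R (j - 1)"])
      fix j assume "j : P"
      hence "k <= j" using PJ by (auto simp: J_def)
      thus "q j <= Q (Suc j)" by (rule qQ)
    next
      fix j
      show "R (j - 1) : (\<Union>i\<le>j. (%A. rk A (Suc k)) ` cell e (\<l> i) ` dual_ball)"
        unfolding R_def using tb by (intro UN_I[of "j - 1"] imageI) auto
    next
      fix i j assume ij: "i : P" "j : P" "i < j"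
      then obtain h where h: "h : J" "i < h" "h < j" using J12(2) P by blast
      have iJ: "i : J" "i : I" "h : I" using ij PJ h by (auto simp: J_def)
      have "R (j - 1) <= R (en i)" using I(3) iJ h by (intro Rmono) fastforce
      thus "R (j - 1) < R (i - 1)" using drop[OF iJ(1)] by simp
    qed
    from T.sum_adm_le_tnorm[OF this yc] have "c ^ M * (\<Sum>u\<in>(%j. Q (Suc j)) ` P. \<bar>y u\<bar>) <= tnorm S c y" .
    moreover have "(\<Sum>u\<in>(%j. Q (Suc j)) ` P. \<bar>y u\<bar>) = (\<Sum>i\<in>P. a i)"
    proof -
      have "(\<Sum>u\<in>(%j. Q (Suc j)) ` P. \<bar>y u\<bar>) = (\<Sum>i\<in>P. \<bar>y (Q (Suc i))\<bar>)"
        by (rule sum.reindex_cong[OF _ refl refl]) (auto simp: inj_on_def strict_mono_eq[OF Q(1)])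
      also have "\<dots> = (\<Sum>i\<in>P. a i)" using PJ yQ a by (intro sum.cong) (auto simp: J_def)
      finally show ?thesis .
    qed
    ultimately show ?thesis using T.c_pos by (simp add: field_simps)
  qed
  have nn: "0 <= a i" if "i : I" for i using a that by blast
  have "(\<Sum>i\<in>{i\<in>I. 2 * eps k < ?o i}. a i) <= (\<Sum>i\<in>{i\<in>I. i <= k} \<union> (J1 \<union> J2). a i)"
    using I(1) nn J12(1) fJ by (intro sum_mono2) (auto simp: J_def)
  also have "\<dots> <= (\<Sum>i\<in>{i\<in>I. i <= k}. a i) + (\<Sum>i\<in>J1 \<union> J2. a i)" by (rule sum_Un_nonneg_le) (use I(1) nn fJ in auto)
  also have "(\<Sum>i\<in>J1 \<union> J2. a i) <= (\<Sum>i\<in>J1. a i) + (\<Sum>i\<in>J2. a i)"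
    by (rule sum_Un_nonneg_le) (use nn J12(1) fJ in "auto simp: J_def")
  also have "(\<Sum>i\<in>{i\<in>I. i <= k}. a i) <= (\<Sum>i\<in>{i\<in>I. i <= k}. tnorm S c y)"
    using T.abs_le_tnorm[OF yc] yQ by (intro sum_mono) (metis (mono_tags, lifting) abs_ge_self mem_Collect_eq order_trans)
  also have "\<dots> <= (real k + 1) * tnorm S c y"
  proof -
    have "card {i\<in>I. i <= k} <= card {..k}" by (rule card_mono) auto
    hence "real (card {i\<in>I. i <= k}) <= real k + 1" by simp
    thus ?thesis  by (simp add: mult_right_mono)
  qed
  finally show ?thesis using half[of J1] half[of J2] unfolding y_def[symmetric] by (simp add: distrib_right)
qed

end


lemma szlenk_imp_branch_system:
  fixes e :: "nat => 'a::real_normed_vector"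
  assumes s: "approximating s" and e: "!!j. norm (e j) <= 1" "closure (span (range e)) = UNIV"
    and empty: "szlenk_derived (1 / 2) (wexp (\<alpha> * omega)) = ({} :: 'a dual set)"
  shows "EX c r Q C. 0 < c & c < 1 & branch_system e (r :: nat => nat => 'a dual) & strict_mono Q & 1 <= Q 0 &
    osc_estimate (Schreier s \<alpha>) c Q C r"
proof -
  have "closed_piece (dual_ball :: 'a dual set)" unfolding closed_piece_def using closedin_dual_ball by auto
  from top_exists[OF this empty] obtain \<beta> where \<beta>: "\<beta> < wexp (\<alpha> * omega)"
    "dual_ball \<inter> szlenk_derived (1 / 2) (osuc \<beta>) = ({} :: 'a dual set)" by blast
  obtain n0 where n0: "\<beta> < wpow \<alpha> n0" using less_wexp_omult_omega[OF \<beta>(1)] .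
  \<comment> \<open>The successor keeps \<open>n\<close> positive, so that \<open>c\<close> can be
    defined as a root of order \<open>4 * n\<close>.\<close>
  define n where "n = Suc n0"
  have n: "1 <= n" by (simp add: n_def)
  have "osuc \<beta> <= wpow \<alpha> n" using n0 wpow_mono[of n0 n \<alpha>] by (simp add: osuc_le_iff n_def)
  hence "szlenk_derived (1 / 2) (wpow \<alpha> n) \<subseteq> (szlenk_derived (1 / 2) (osuc \<beta>) :: 'a dual set)"
    by (rule szlenk_derived_antimono)
  hence base: "szlenk_derived (1 / 2) (wpow \<alpha> n) = ({} :: 'a dual set)"
    using \<beta>(2) szlenk_derived_subset[of "1 / 2" "osuc \<beta>", where 'a = 'a] by (metis inf.absorb_iff2 subset_empty)
  interpret szlenk_scales e scale "%k. wpow \<alpha> (n * 2 ^ k)"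
    by unfold_locales (use e szlenk_derived_scale[OF base] in auto)
  have bd: "bound k = wpow \<alpha> (n * (2 ^ k - 1))" for k
  proof (induction k)
    case (Suc k)
    have "n * 2 ^ k + n * (2 ^ k - 1) = n * (2 ^ Suc k - 1)" by (simp add: algebra_simps diff_mult_distrib2)
    thus ?case using Suc by (simp add: wpow_add[symmetric])
  qed simp
  obtain \<l> where \<l>: "ALL n. 2 * n + 2 <= \<l> n" "strict_mono \<l>"
    "ALL n. ALL t:dual_ball. ALL k <= n. stab k (cell e (\<l> n) t) (\<l> (Suc n))" by (rule thin_levels[OF e(1) stab_mono stab_exists])
  obtain tb :: "nat => 'a dual" where tb: "ALL b. tb b : dual_ball"
    "ALL n. ALL t:dual_ball. EX b. cell e (\<l> n) (tb b) = cell e (\<l> n) t" by (rule representative_branches[OF e(1)])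
  let ?r = "branch_rep e rep \<l> tb"
  have bs: "branch_system e ?r" by (rule branch_system_branch_rep[OF e rep_in \<l>(1,2) tb])
  define M where "M k = n * (2 ^ Suc k - 1)" for k
  \<comment> \<open>All ranks of cells up to level \<open>j\<close>. They are finitely many, and the
    ranks along every branch are drawn from them.\<close>
  define B where "B k j = (\<Union>i\<le>j. (%A. rk A (Suc k)) ` cell e (\<l> i) ` dual_ball)" for k j
  have "EX q. clocked (B k) (adm (Schreier s \<alpha>) (M k)) q" for k
  proof (rule descentsE[OF descents_adm[OF s, of \<alpha> "M k"], of "B k"])
    show "finite (B k j)" for j unfolding B_def by (intro finite_UN_I finite_imageI finite_cells e) simp
    show "B k j \<subseteq> {..<wpow \<alpha> (M k)}" for j
      unfolding B_def M_def bd[symmetric] using rk_less[OF closed_piece_cell] by blast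
  qed blast
  then obtain q where q: "!!k. clocked (B k) (adm (Schreier s \<alpha>) (M k)) (q k)" by metis
  \<comment> \<open>One clock for all scales: \<open>Q (Suc j)\<close> is at least the reading at
    \<open>j\<close> of the clocks of scales 0 to \<open>j\<close>.\<close>
  define Q where "Q m = (\<Sum>j<m. Suc (\<Sum>k\<le>j. q k j)) + 1" for m
  have Q: "strict_mono Q" "1 <= Q 0" by (auto simp: Q_def strict_mono_Suc_iff)
  have qQ: "q k j <= Q (Suc j)" if "k <= j" for k j
    using member_le_sum[of k "{..j}" "%k. q k j"] that by (simp add: Q_def)
  define c where "c = root (4 * n) (2 / 3)"
  have c: "0 < c" "c < 1" "c ^ (4 * n) = 2 / 3"
    unfolding c_def using n by (simp_all add: real_root_gt_zero real_root_lt_1_iff real_root_pow_pos2)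
  have ts: "tsirelson (Schreier s \<alpha>) c" by (rule tsirelson_Schreier[OF s c(1,2)])
  interpret T: tsirelson "Schreier s \<alpha>" c by (rule ts)
  have "osc_estimate (Schreier s \<alpha>) c Q 40 ?r" unfolding osc_estimate_def
  proof (intro allI impI)
    fix b I and en :: "nat => nat" and a :: "nat => real"
    assume I: "finite I" "ALL i:I. i < en i" "ALL i:I. ALL j:I. i < j --> en i <= j" and a: "ALL i:I. 0 <= a i"
    define N where "N = tnorm (Schreier s \<alpha>) c (%k. \<Sum>i\<in>I. a i * unit_vec (Q (Suc i)) k)"
    have N: "0 <= N" unfolding N_def by (rule T.tnorm_nonneg)
    \<comment> \<open>The integer division shifts the scales by one:
      \<open>\<theta> (Suc k) = 2 * scale k\<close>, while \<open>\<theta> 0 = 2\<close> bounds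
      every oscillation in the ball.\<close>
    define \<theta> :: "nat => real" where "\<theta> k = 2 * (1 / 2) ^ (2 ^ k div 2)" for k
    have \<theta>S: "\<theta> (Suc k) = 2 * scale k" for k by (simp add: \<theta>_def scale_def)
    show "(\<Sum>i\<in>I. a i * osc ?r b i (en i)) <= 40 * N"
    proof (rule sum_over_scales[where \<theta> = \<theta> and D = "%k. (real k + 1 + 2 / c ^ M k) * N"])
      show "osc ?r b i (en i) <= \<theta> 0" if "i : I" for i
      proof (rule osc_leI)
        have 1: "norm (?r m b) <= 1" for m using bs unfolding branch_system_def by blast
        show "norm (?r m b - ?r m' b) <= \<theta> 0" for m m'
          using norm_triangle_ineq4[of "?r m b" "?r m' b"] 1[of m] 1[of m'] by (simp add: \<theta>_def)
      qed (use that I(2) in "auto intro: less_imp_le")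
      show "EX k. \<theta> k < d" if "0 < d" for d
      proof -
        obtain k where k: "(1 / 2 :: real) ^ k < d / 2" using real_arch_pow_inv[of "d / 2" "1 / 2"] `0 < d` by auto
        have "(1 / 2 :: real) ^ (2 ^ k) <= (1 / 2) ^ k" by (rule power_decreasing) (auto simp: less_imp_le less_exp)
        hence "\<theta> (Suc k) < d" using k unfolding \<theta>S scale_def by linarith
        thus ?thesis by blast
      qed
      show "(\<Sum>i\<in>{i\<in>I. \<theta> (Suc k) < osc ?r b i (en i)}. a i) <= (real k + 1 + 2 / c ^ M k) * N" for k
        unfolding \<theta>S N_def using large_oscillations[OF \<l>(3,2) tb(1)[rule_format] ts Q q[unfolded B_def, of k] qQ I a] .
      show "(\<Sum>k<K. \<theta> k * ((real k + 1 + 2 / c ^ M k) * N)) <= 40 * N" for K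
        using mult_right_mono[OF scale_sum_bound[OF n c, of K] N] by (simp add: \<theta>_def M_def sum_distrib_right mult.assoc)
    qed (use I a in \<open>auto simp: \<theta>_def\<close>)
  qed
  thus ?thesis using c(1,2) bs Q by blast
qed

section \<open>Weights\<close>

locale branch_weights = tsirelson S c for S c +
  fixes Q :: "nat => nat" and C :: real and r :: "nat => nat => 'a::real_normed_vector dual"
  assumes Q: "strict_mono Q" "1 <= Q 0" and estimate: "osc_estimate S c Q C r"
begin

text \<open>The summand \<open>(1 / 2) ^ p\<close> keeps the weights away from 0. This makes the
  indicator functions of nodes bounded and the truncations of the image of each \<open>e j\<close>
  convergent.\<close>

definition gain :: "nat => nat => nat => real" where
  "gain b p q = osc r b p q + (1 / 2) ^ p"

definition intervals :: "nat => nat => nat set => (nat => nat) => (nat => real) => bool" where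
  "intervals p q I en w \<longleftrightarrow> finite I & (ALL i:I. p <= i & i < en i & en i <= q) &
     (ALL i:I. ALL j:I. i < j --> en i <= j) & (ALL i:I. 0 <= w i)"

definition vec :: "nat set => (nat => real) => nat => real" where
  "vec I w = (%k. \<Sum>i\<in>I. w i * unit_vec (Q (Suc i)) k)"

definition gains :: "nat => nat => nat => real set" where
  "gains b p q = {\<Sum>i\<in>I. w i * gain b i (en i) | I en w. intervals p q I en w & tnorm S c (vec I w) <= 1}"

text \<open>Replaces the oscillation of a window as its unit of measurement; it is at most a
  constant, yet large enough for \<open>weight_split\<close>.\<close>

definition weight :: "nat => nat => nat => real" where
  "weight b p q = Sup (gains b p q)"

lemma Q_ge_1: "1 <= Q i" using Q strict_mono_less_eq[OF Q(1), of 0 i] by simp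

lemma vec_c00: "vec I w : c00" unfolding vec_def by (intro sum_c00 scale_c00 unit_vec_c00 Q_ge_1)

lemma vec_at: "finite I ==> i : I ==> vec I w (Q (Suc i)) = w i"
  unfolding vec_def by (rule unit_vec_sum_at) (simp_all add: inj_on_def strict_mono_eq[OF Q(1)])

lemma vec_support: "vec I w k ~= 0 ==> EX i:I. k = Q (Suc i)"
  unfolding vec_def unit_vec_def by (rule ccontr) (auto intro!: sum.neutral)

lemma gain_le:
  assumes "intervals p q I en w"
  shows "(\<Sum>i\<in>I. w i * gain b i (en i)) <= (\<bar>C\<bar> + 2) * tnorm S c (vec I w)"
proof -
  let ?t = "tnorm S c (vec I w)"
  have I: "finite I" "ALL i:I. i < en i" "ALL i:I. ALL j:I. i < j --> en i <= j" "ALL i:I. 0 <= w i"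
    using assms by (auto simp: intervals_def)
  have "(\<Sum>i\<in>I. w i * osc r b i (en i)) <= C * ?t" using estimate I unfolding osc_estimate_def vec_def by blast
  also have "\<dots> <= \<bar>C\<bar> * ?t" by (simp add: mult_right_mono)
  finally have 1: "(\<Sum>i\<in>I. w i * osc r b i (en i)) <= \<bar>C\<bar> * ?t" .
  have "w i <= ?t" if "i : I" for i
    using abs_le_tnorm[OF vec_c00, of I w "Q (Suc i)"] vec_at[OF I(1) that, of w] by simp
  hence "(\<Sum>i\<in>I. w i * (1 / 2) ^ i) <= (\<Sum>i\<in>I. ?t * (1 / 2) ^ i)" by (intro sum_mono mult_right_mono) auto
  also have "\<dots> = ?t * (\<Sum>i\<in>I. (1 / 2) ^ i)" by (simp add: sum_distrib_left)
  also have "(\<Sum>i\<in>I. (1 / 2 :: real) ^ i) <= (\<Sum>i<Suc (Max I). (1 / 2) ^ i)"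
    using I(1) by (intro sum_mono2) (auto simp: less_Suc_eq_le)
  also have "\<dots> <= 2" by (subst sum_gp_strict) simp
  finally have "(\<Sum>i\<in>I. w i * (1 / 2) ^ i) <= ?t * 2" by (simp add: mult_left_mono)
  thus ?thesis using 1 by (simp add: gain_def distrib_left sum.distrib distrib_right mult.commute)
qed

lemma gainsE:
  assumes "x : gains b p q"
  obtains I en w where "x = (\<Sum>i\<in>I. w i * gain b i (en i))" "intervals p q I en w" "tnorm S c (vec I w) <= 1"
  using assms unfolding gains_def by blast

lemma gains_le: "x : gains b p q ==> x <= \<bar>C\<bar> + 2"
proof (erule gainsE)
  fix I en w assume *: "x = (\<Sum>i\<in>I. w i * gain b i (en i))" "intervals p q I en w" "tnorm S c (vec I w) <= 1"
  have "x <= (\<bar>C\<bar> + 2) * tnorm S c (vec I w)" unfolding *(1) by (rule gain_le[OF *(2)])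
  also have "\<dots> <= (\<bar>C\<bar> + 2) * 1" using *(3) by (intro mult_left_mono) auto
  finally show "x <= \<bar>C\<bar> + 2" by simp
qed

lemma gains_nonempty: "gains b p q ~= {}"
proof -
  have "intervals p q {} (%_. 0) (%_. 0) & tnorm S c (vec {} (%_. 0)) <= 1" by (simp add: intervals_def vec_def)
  thus ?thesis unfolding gains_def by blast
qed

lemma weight_ge: "intervals p q I en w ==> tnorm S c (vec I w) <= 1 ==> (\<Sum>i\<in>I. w i * gain b i (en i)) <= weight b p q"
  unfolding weight_def by (intro cSup_upper bdd_aboveI[OF gains_le]) (auto simp: gains_def)

lemma weight_bound: "weight b p q <= \<bar>C\<bar> + 2" unfolding weight_def by (rule cSup_least[OF gains_nonempty gains_le])

lemma weight_mono:
  assumes "q' <= q" shows "weight b p q' <= weight b p q"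
proof -
  have "intervals p q I en w" if "intervals p q' I en w" for I en w using that assms by (auto simp: intervals_def)
  hence "gains b p q' \<subseteq> gains b p q" unfolding gains_def by blast
  thus ?thesis unfolding weight_def by (intro cSup_subset_mono gains_nonempty bdd_aboveI[OF gains_le])
qed

lemma weight_ge_gain:
  assumes "p < q" shows "osc r b p q + (1 / 2) ^ p <= weight b p q"
proof -
  have "tnorm S c (vec {p} (%_. 1)) <= (\<Sum>k\<in>supp (vec {p} (%_. 1)). \<bar>vec {p} (%_. 1) k\<bar>)" by (rule tnorm_le_l1[OF vec_c00])
  also have "supp (vec {p} (%_. 1)) = {Q (Suc p)}" by (auto simp: supp_def vec_def unit_vec_def)
  also have "(\<Sum>k\<in>{Q (Suc p)}. \<bar>vec {p} (%_. 1) k\<bar>) = 1" by (simp add: vec_at)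
  finally show ?thesis using weight_ge[of p q "{p}" "%_. q" "%_. 1" b] assms by (simp add: intervals_def gain_def)
qed

lemma weight_pos: "p < q ==> 0 < weight b p q"
  using weight_ge_gain[of p q b] osc_nonneg[of p q r b] by (smt (verit) less_imp_le zero_less_power half_gt_zero_iff)

lemma weight_upper:
  assumes "intervals p q I en w" "p < q"
  shows "(\<Sum>i\<in>I. w i * gain b i (en i)) <= weight b p q * tnorm S c (vec I w)"
proof (cases "tnorm S c (vec I w) = 0")
  case True
  thus ?thesis using gain_le[OF assms(1), of b] by simp
next
  case False
  define t where "t = tnorm S c (vec I w)"
  have t: "0 < t" using False tnorm_nonneg[of "vec I w"] unfolding t_def by linarith
  have v: "vec I (%i. w i / t) = (%k. (1 / t) * vec I w k)" by (auto simp: vec_def sum_distrib_left fun_eq_iff)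
  have "tnorm S c (vec I (%i. w i / t)) <= 1" unfolding v tnorm_scale[OF vec_c00] using t by (simp add: t_def)
  moreover have "intervals p q I en (%i. w i / t)" using assms t by (auto simp: intervals_def)
  ultimately have "(\<Sum>i\<in>I. w i / t * gain b i (en i)) <= weight b p q" by (rule weight_ge[rotated])
  moreover have "(\<Sum>i\<in>I. w i / t * gain b i (en i)) = (\<Sum>i\<in>I. w i * gain b i (en i)) / t"
    by (simp add: sum_divide_distrib)
  ultimately have "(\<Sum>i\<in>I. w i * gain b i (en i)) / t <= weight b p q" by metis
  thus ?thesis using t unfolding t_def[symmetric] by (simp only: pos_divide_le_eq)
qed

lemma weight_attained:
  assumes "p < q"
  shows "EX I en w. intervals p q I en w & tnorm S c (vec I w) <= 1 & weight b p q <= 2 * (\<Sum>i\<in>I. w i * gain b i (en i))"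
proof -
  have "weight b p q / 2 < Sup (gains b p q)" using weight_pos[OF assms, of b] by (simp add: weight_def)
  moreover have "bdd_above (gains b p q)" by (rule bdd_aboveI[OF gains_le])
  ultimately obtain x where x: "x : gains b p q" "weight b p q / 2 < x" using less_cSup_iff[OF gains_nonempty] by blast
  obtain I en w where "x = (\<Sum>i\<in>I. w i * gain b i (en i))" "intervals p q I en w" "tnorm S c (vec I w) <= 1"
    by (rule gainsE[OF x(1)])
  thus ?thesis using x(2) by (intro exI[of _ I] exI[of _ en] exI[of _ w]) simp
qed

text \<open>Near-optimal families of windows, one inside each interval from \<open>ps i\<close> to
  \<open>qs i\<close>, are joined into one family between \<open>p\<close> and \<open>q\<close>. Its
  coefficient vector consists of blocks of norm at most \<open>a i\<close>, the \<open>i\<close>-th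
  starting no earlier than \<open>R i\<close> and ending before the next \<open>R j\<close>. So
  \<open>block_domination\<close> bounds its norm by that of the \<open>a i\<close> placed at
  \<open>R i\<close>. The factor 2 is the loss from near-optimality.\<close>

lemma weight_split:
  fixes G :: "nat set" and ps qs R :: "nat => nat" and a :: "nat => real"
  assumes c': "c < c'" "c' < 1" and G: "finite G"
    and pq: "!!i. i : G ==> p <= ps i & ps i < qs i & qs i <= q"
    and R: "!!i. i : G ==> 1 <= R i & R i <= Q (Suc (ps i))"
    and ord: "!!i j. i : G ==> j : G ==> i < j ==> qs i <= ps j & Q (qs i) < R j"
    and a: "!!i. i : G ==> 0 <= a i"
  shows "(\<Sum>i\<in>G. a i * weight b (ps i) (qs i)) <=
    2 * ((1 + 1 / c') / (1 - c / c')) * weight b p q * tnorm S c' (%k. \<Sum>i\<in>G. a i * unit_vec (R i) k)"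
proof (cases "G = {}")
  case False
  interpret b: tsirelson S c' by standard (use c' c_pos in auto)
  have "p < q" using False pq by (meson all_not_in_conv le_less_trans less_le_trans)
  define fm where "fm i F \<longleftrightarrow> (case F of (I, en, w) => intervals (ps i) (qs i) I en w & tnorm S c (vec I w) <= 1 &
      weight b (ps i) (qs i) <= 2 * (\<Sum>k\<in>I. w k * gain b k (en k)))" for i F
  have "ALL i:G. EX F. fm i F" using weight_attained pq by (simp add: fm_def)
  then obtain F where F: "ALL i:G. fm i (F i)" by (rule bchoice[THEN exE])
  define I where "I i = fst (F i)" for i
  define en where "en i = fst (snd (F i))" for i
  define w where "w i = snd (snd (F i))" for i
  have fam: "intervals (ps i) (qs i) (I i) (en i) (w i)" "tnorm S c (vec (I i) (w i)) <= 1"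
    "weight b (ps i) (qs i) <= 2 * (\<Sum>k\<in>I i. w i k * gain b k (en i k))" if "i : G" for i
    using F that unfolding fm_def I_def en_def w_def by (auto simp: case_prod_beta)
  have Ib: "ps i <= k" "k < en i k" "en i k <= qs i" "0 <= w i k" "finite (I i)" if "i : G" "k : I i" for i k
    using fam(1)[OF that(1)] that(2) by (auto simp: intervals_def)
  have fI: "finite (I i)" if "i : G" for i using fam(1)[OF that] by (simp add: intervals_def)
  have owner: "i = j" if "i : G" "j : G" "k : I i" "k : I j" for i j k
  proof (rule ccontr)
    assume "i ~= j"
    then consider "i < j" | "j < i" by linarith
    thus False
    proof cases
      case 1
      thus ?thesis using ord[OF that(1,2)] Ib[OF that(1,3)] Ib[OF that(2,4)] by linarith
    next
      case 2
      thus ?thesis using ord[OF that(2,1)] Ib[OF that(1,3)] Ib[OF that(2,4)] by linarith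
    qed
  qed
  \<comment> \<open>The index of the family to which window \<open>k\<close> belongs, unique because
    the intervals do not overlap.\<close>
  define \<iota> where "\<iota> k = (SOME i. i : G & k : I i)" for k
  have \<iota>: "\<iota> k = i" if "i : G" "k : I i" for i k
    using someI[of "%i. i : G & k : I i" i] that owner unfolding \<iota>_def by blast
  define U where "U = (\<Union>i\<in>G. I i)"
  define wt where "wt k = a (\<iota> k) * w (\<iota> k) k" for k
  define et where "et k = en (\<iota> k) k" for k
  have sumU: "(\<Sum>k\<in>U. wt k * h k (et k)) = (\<Sum>i\<in>G. a i * (\<Sum>k\<in>I i. w i k * h k (en i k)))" for h :: "nat => nat => real"
  proof -
    have "(\<Sum>k\<in>U. wt k * h k (et k)) = (\<Sum>i\<in>G. \<Sum>k\<in>I i. wt k * h k (et k))"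
      unfolding U_def using G fI owner by (intro sum.UNION_disjoint) blast+
    also have "\<dots> = (\<Sum>i\<in>G. a i * (\<Sum>k\<in>I i. w i k * h k (en i k)))"
      unfolding sum_distrib_left by (intro sum.cong) (auto simp: wt_def et_def \<iota>)
    finally show ?thesis .
  qed
  have "intervals p q U et wt" unfolding intervals_def
  proof (intro conjI ballI impI)
    show "finite U" unfolding U_def using G fI by blast
  next
    fix k assume "k : U"
    then obtain i where i: "i : G" "k : I i" by (auto simp: U_def)
    show "p <= k" "k < et k" "et k <= q" "0 <= wt k"
      using Ib[OF i] pq[OF i(1)] a[OF i(1)] \<iota>[OF i] by (auto simp: et_def wt_def)
  next
    fix k k' assume "k : U" "k' : U" and less: "k < k'"
    then obtain i j where i: "i : G" "k : I i" and j: "j : G" "k' : I j" by (auto simp: U_def)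
    show "et k <= k'"
    proof (cases "i = j")
      case True
      thus ?thesis using fam(1)[OF i(1)] i j less \<iota>[OF i] by (auto simp: intervals_def et_def)
    next
      case False
      have "~ j < i" using ord[OF j(1) i(1)] Ib[OF i] Ib[OF j] less by (meson le_less_trans less_le_trans not_less_iff_gr_or_eq order.trans)
      hence "i < j" using False by simp
      thus ?thesis using ord[OF i(1) j(1)] Ib[OF i] Ib[OF j] \<iota>[OF i] by (simp add: et_def)
    qed
  qed
  hence main: "(\<Sum>i\<in>G. a i * (\<Sum>k\<in>I i. w i k * gain b k (en i k))) <= weight b p q * tnorm S c (vec U wt)"
    unfolding sumU[symmetric] using `p < q` by (rule weight_upper)
  define x where "x = vec U wt"
  have x: "x \<kappa> = (\<Sum>i\<in>G. a i * vec (I i) (w i) \<kappa>)" for \<kappa>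
    unfolding x_def vec_def using sumU[of "%k _. unit_vec (Q (Suc k)) \<kappa>"] .
  have xc: "x : c00" unfolding x_def by (rule vec_c00)
  have loc: "R i <= \<kappa> & \<kappa> <= Q (qs i)" if "i : G" "vec (I i) (w i) \<kappa> ~= 0" for i \<kappa>
  proof -
    from vec_support[OF that(2)] obtain k where k: "k : I i" "\<kappa> = Q (Suc k)" by blast
    have "Q (Suc (ps i)) <= Q (Suc k)" "Q (Suc k) <= Q (qs i)"
      using Ib[OF that(1) k(1)] Q(1) by (simp_all add: strict_mono_less_eq Suc_le_eq)
    thus ?thesis using R[OF that(1)] k by simp
  qed
  have Rless: "R i < R j" if "i : G" "j : G" "i < j" for i j
  proof -
    have "Q (Suc (ps i)) <= Q (qs i)" using pq[OF that(1)] Q(1) by (simp add: strict_mono_less_eq Suc_le_eq)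
    thus ?thesis using R[OF that(1)] ord[OF that] by linarith
  qed
  have Rinj: "i = j" if "i : G" "j : G" "R i = R j" for i j
    using Rless[OF that(1,2)] Rless[OF that(2,1)] that(3) by (metis less_irrefl linorder_neqE_nat)
  have inblk: "\<kappa> : blk (R ` G) (R i)" if "i : G" "vec (I i) (w i) \<kappa> ~= 0" for i \<kappa> unfolding blk_def
  proof (intro CollectI conjI ballI impI)
    show "R i <= \<kappa>" using loc[OF that] by blast
    fix m' assume m': "m' : R ` G" "m' <= \<kappa>"
    then obtain j where j: "j : G" "m' = R j" by blast
    have "~ i < j" using ord[OF that(1) j(1)] loc[OF that] m'(2) j(2) by linarith
    then consider "j < i" | "j = i" by linarith
    thus "m' <= R i" using Rless[OF j(1) that(1)] j(2) by cases auto
  qed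
  have rs: "restr (blk (R ` G) (R i)) x = (%\<kappa>. a i * vec (I i) (w i) \<kappa>)" if i: "i : G" for i
  proof
    fix \<kappa>
    have z: "vec (I j) (w j) \<kappa> = 0" if "j : G" "j ~= i" "\<kappa> : blk (R ` G) (R i)" for j
    proof (rule ccontr)
      assume "vec (I j) (w j) \<kappa> ~= 0"
      hence "\<kappa> : blk (R ` G) (R j)" by (rule inblk[OF that(1)])
      moreover have "R i ~= R j" using Rinj that i by blast
      ultimately show False using blk_disjoint[of "R i" "R ` G" "R j"] that i by blast
    qed
    show "restr (blk (R ` G) (R i)) x \<kappa> = a i * vec (I i) (w i) \<kappa>"
    proof (cases "\<kappa> : blk (R ` G) (R i)")
      case True
      have "x \<kappa> = (\<Sum>j\<in>{i}. a j * vec (I j) (w j) \<kappa>)"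
        unfolding x using G i z[OF _ _ True] by (intro sum.mono_neutral_right) auto
      thus ?thesis using True by (simp add: restr_def)
    next
      case False
      thus ?thesis using inblk[OF i, of \<kappa>] by (auto simp: restr_def)
    qed
  qed
  have vR: "(\<Sum>j\<in>G. a j * unit_vec (R j) (R i)) = a i" if "i : G" for i
    using Rinj by (intro unit_vec_sum_at[OF G _ that]) (auto simp: inj_on_def)
  let ?y = "%u. if u : R ` G then tnorm S c (restr (blk (R ` G) u) x) else 0"
  let ?v = "%k. \<Sum>i\<in>G. a i * unit_vec (R i) k"
  have dom: "tnorm S c x <= (1 + 1 / c') / (1 - c / c') * tnorm S c' ?y"
  proof (rule block_domination[OF c_pos c' xc])
    show "finite (R ` G)" "R ` G \<subseteq> {1..}" using G R by auto
    fix \<kappa> assume "\<kappa> : supp x"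
    hence nz: "x \<kappa> ~= 0" by (simp add: supp_def)
    have "EX i:G. vec (I i) (w i) \<kappa> ~= 0" by (rule ccontr) (use nz in "simp add: x")
    thus "EX u:R ` G. u <= \<kappa>" using loc by blast
  qed
  have ty: "tnorm S c' ?y <= tnorm S c' ?v"
  proof (rule b.tnorm_mono)
    show "?y : c00" by (rule c00I[of "R ` G"]) (use G R in "fastforce+")
    show "?v : c00" using R by (intro sum_c00 scale_c00 unit_vec_c00) auto
    fix \<kappa>
    show "\<bar>?y \<kappa>\<bar> <= \<bar>?v \<kappa>\<bar>"
    proof (cases "\<kappa> : R ` G")
      case True
      then obtain i where i: "i : G" "\<kappa> = R i" by blast
      have "?y \<kappa> = a i * tnorm S c (vec (I i) (w i))" using i a[OF i(1)] by (simp add: rs tnorm_scale[OF vec_c00])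
      also have "\<dots> <= a i" using fam(2)[OF i(1)] a[OF i(1)] by (simp add: mult_left_le)
      finally show ?thesis using i a[OF i(1)] by (simp add: vR)
    qed simp
  qed
  have "0 <= (1 + 1 / c') / (1 - c / c')" using c' c_pos by simp
  note tx = order_trans[OF dom mult_left_mono[OF ty this]]
  have "(\<Sum>i\<in>G. a i * weight b (ps i) (qs i)) <= (\<Sum>i\<in>G. a i * (2 * (\<Sum>k\<in>I i. w i k * gain b k (en i k))))"
    using fam(3) a by (intro sum_mono mult_left_mono) auto
  also have "\<dots> = 2 * (\<Sum>i\<in>G. a i * (\<Sum>k\<in>I i. w i k * gain b k (en i k)))"
    unfolding sum_distrib_left by (intro sum.cong) auto
  also have "\<dots> <= 2 * (weight b p q * tnorm S c x)" using main by (simp add: x_def)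
  also have "\<dots> <= 2 * (weight b p q * ((1 + 1 / c') / (1 - c / c') * tnorm S c' ?v))"
    using tx weight_pos[OF `p < q`, of b] by (intro mult_left_mono) auto
  finally show ?thesis by (simp only: mult_ac)
next
  case True
  interpret b: tsirelson S c' by standard (use c' c_pos in auto)
  show ?thesis using True by simp
qed

end

section \<open>Spaces of jump functions\<close>

lemma bounded_linear_eval: "bounded_linear (%z :: linfty. apply_bcontfun z k)"
proof (rule bounded_linear_intro)
  show "norm (apply_bcontfun z k) <= norm z * 1" for z :: linfty using norm_bounded[of z k] by simp
qed simp_all

text \<open>The elements of \<open>jumps\<close> are the functions \<open>f\<close> of \<open>(n, b)\<close> with \<open>f 0 b = 0\<close> that depend on \<open>n\<close> and
  \<open>key n b\<close> only, normed by the supremum of \<open>\<bar>f q b - f p b\<bar> / W b p q\<close> over \<open>p < q\<close>; \<open>level n b\<close>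
  evaluates \<open>f\<close> at \<open>(n, b)\<close>.\<close>

locale jump_space =
  fixes key :: "nat => nat => 'k" and W :: "nat => nat => nat => real" and Q :: "nat => nat"
  assumes key_finite: "finite (range (key n))"
    and key_refine: "key n b = key n b' ==> m <= n ==> key m b = key m b'"
    and W_lower: "p < q ==> (1 / 2) ^ p <= W b p q" and W_mono: "p < q' ==> q' <= q ==> W b p q' <= W b p q"
    and Q: "strict_mono Q" "1 <= Q 0"
begin

text \<open>A function is stored through its difference quotients, as a bounded sequence. The norm
  of \<open>linfty\<close> is then the intended norm, and completeness is inherited by closed
  subspaces.\<close>

definition coord :: "nat => nat => nat => nat" where
  "coord b p q = prod_encode (b, prod_encode (p, q))"

definition level :: "nat => nat => linfty => real" where
  "level n b z = (if n = 0 then 0 else W b 0 n * apply_bcontfun z (coord b 0 n))"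

definition jumps :: "linfty set" where
  "jumps = {z. (ALL b p q. q <= p --> apply_bcontfun z (coord b p q) = 0) &
     (ALL b p q. p < q --> W b p q * apply_bcontfun z (coord b p q) = level q b z - level p b z) &
     (ALL n b b'. key n b = key n b' --> level n b z = level n b' z)}"

lemma jumpsD:
  assumes "z : jumps"
  shows "q <= p ==> apply_bcontfun z (coord b p q) = 0"
    and "p < q ==> level q b z - level p b z = W b p q * apply_bcontfun z (coord b p q)"
    and "key n b = key n b' ==> level n b z = level n b' z" using assms unfolding jumps_def mem_Collect_eq by metis+

lemma jumpsI:
  assumes "!!b p q. q <= p ==> apply_bcontfun z (coord b p q) = 0"
    and "!!b p q. p < q ==> W b p q * apply_bcontfun z (coord b p q) = level q b z - level p b z"
    and "!!n b b'. key n b = key n b' ==> level n b z = level n b' z"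
  shows "z : jumps" unfolding jumps_def mem_Collect_eq by (intro conjI allI impI assms)

lemma W_pos: "p < q ==> 0 < W b p q"
  using W_lower[of p q b] by (meson half_gt_zero_iff less_le_trans zero_less_one zero_less_power)

lemma bounded_linear_level: "bounded_linear (level n b)"
  unfolding level_def by (cases "n = 0") (auto intro: bounded_linear_const_mult bounded_linear_eval bounded_linear_zero)

lemmas level_linear = bounded_linear.linear[OF bounded_linear_level]

lemma level_0 [simp]: "level 0 b z = 0" by (simp add: level_def)

lemma subspace_jumps: "subspace jumps"
proof -
  have l: "level n b (x + y) = level n b x + level n b y" "level n b (a *\<^sub>R x) = a * level n b x" for n b x y a
    using linear_add[OF level_linear] linear_scale[OF level_linear] by auto
  show ?thesis
  proof (rule subspaceI)
    show "0 : jumps" by (rule jumpsI) (simp_all add: linear_0[OF level_linear])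
  next
    fix x y assume xy: "x : jumps" "y : jumps"
    show "x + y : jumps"
    proof (rule jumpsI, unfold l)
      show "apply_bcontfun (x + y) (coord b p q) = 0" if "q <= p" for b p q
        using jumpsD(1)[OF xy(1) that, of b] jumpsD(1)[OF xy(2) that, of b] by simp
      show "W b p q * apply_bcontfun (x + y) (coord b p q) = level q b x + level q b y - (level p b x + level p b y)"
        if "p < q" for b p q
        using jumpsD(2)[OF xy(1) that, of b] jumpsD(2)[OF xy(2) that, of b] by (simp add: distrib_left)
      show "level n b x + level n b y = level n b' x + level n b' y" if "key n b = key n b'" for n b b'
        using jumpsD(3)[OF xy(1) that] jumpsD(3)[OF xy(2) that] by (rule arg_cong2)
    qed
  next
    fix a x assume x: "x : jumps"
    show "a *\<^sub>R x : jumps"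
    proof (rule jumpsI, unfold l)
      show "apply_bcontfun (a *\<^sub>R x) (coord b p q) = 0" if "q <= p" for b p q using jumpsD(1)[OF x that, of b] by simp
      show "W b p q * apply_bcontfun (a *\<^sub>R x) (coord b p q) = a * level q b x - a * level p b x" if "p < q" for b p q
        using jumpsD(2)[OF x that, of b] by (simp add: right_diff_distrib[symmetric] mult.left_commute)
      show "a * level n b x = a * level n b' x" if "key n b = key n b'" for n b b'
        using jumpsD(3)[OF x that] by (rule arg_cong)
    qed
  qed
qed

lemma closed_jumps: "closed jumps"
proof -
  have c: "continuous_on UNIV (level n b)" "continuous_on UNIV (%z :: linfty. apply_bcontfun z k)" for n b k
    by (simp_all add: linear_continuous_on bounded_linear_level bounded_linear_eval)
  show ?thesis unfolding jumps_def
    by (intro closed_Collect_conj closed_Collect_all closed_Collect_imp open_Collect_const closed_Collect_eq continuous_intros c)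
qed

lemma norm_jumps_le_iff:
  assumes z: "z : jumps" and K: "0 <= K"
  shows "norm z <= K \<longleftrightarrow> (ALL b p q. p < q --> \<bar>level q b z - level p b z\<bar> <= K * W b p q)"
proof -
  have eq: "\<bar>level q b z - level p b z\<bar> = W b p q * \<bar>apply_bcontfun z (coord b p q)\<bar>" if "p < q" for b p q
  proof -
    have "level q b z - level p b z = W b p q * apply_bcontfun z (coord b p q)" by (rule jumpsD(2)[OF z that])
    thus ?thesis using W_pos[OF that, of b] by (simp add: abs_mult)
  qed
  show ?thesis
  proof
    assume *: "norm z <= K"
    show "ALL b p q. p < q --> \<bar>level q b z - level p b z\<bar> <= K * W b p q"
    proof (intro allI impI)
      fix b p q :: nat assume pq: "p < q"
      have "\<bar>apply_bcontfun z (coord b p q)\<bar> <= K" using norm_bounded[of z "coord b p q"] * by simp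
      thus "\<bar>level q b z - level p b z\<bar> <= K * W b p q"
        unfolding eq[OF pq] using W_pos[OF pq, of b] by (simp add: mult.commute[of K] mult_left_mono)
    qed
  next
    assume *: "ALL b p q. p < q --> \<bar>level q b z - level p b z\<bar> <= K * W b p q"
    show "norm z <= K"
    proof (rule norm_bound)
      fix k
      obtain b x where bx: "prod_decode k = (b, x)" by fastforce
      obtain p q where pq: "prod_decode x = (p, q)" by fastforce
      have k: "k = coord b p q" using bx pq unfolding coord_def by (metis prod_decode_inverse)
      show "norm (apply_bcontfun z k) <= K"
      proof (cases "p < q")
        case True
        hence "W b p q * \<bar>apply_bcontfun z k\<bar> <= W b p q * K" using *[rule_format, OF True, of b] eq[OF True, of b] k by (simp add: mult.commute[of K])
        thus ?thesis using W_pos[OF True, of b] by simp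
      next
        case False
        thus ?thesis using jumpsD(1)[OF z, of q p b] K k by simp
      qed
    qed
  qed
qed

lemma level_diff_le: "z : jumps ==> p < q ==> \<bar>level q b z - level p b z\<bar> <= norm z * W b p q"
  using norm_jumps_le_iff[of z "norm z"] by simp

lemma jumps_eqI:
  assumes "z : jumps" "w : jumps" "!!n b. level n b z = level n b w"
  shows "z = w"
proof -
  have d: "z - w : jumps" using subspace_diff[OF subspace_jumps] assms by blast
  have "level n b (z - w) = 0" for n b using assms(3) linear_diff[OF level_linear] by simp
  hence "norm (z - w) <= 0" using norm_jumps_le_iff[OF d, of 0] by simp
  thus ?thesis by simp
qed

lemma jumps_exist:
  assumes f: "!!b. f 0 b = 0" "!!n b b'. key n b = key n b' ==> f n b = f n b'"
    and K: "!!b p q. p < q ==> \<bar>f q b - f p b\<bar> <= K * W b p q"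
  shows "EX z:jumps. ALL n b. level n b z = f n b"
proof -
  define g where "g k = (case prod_decode k of (b, x) => case prod_decode x of (p, q) =>
    if p < q then (f q b - f p b) / W b p q else 0)" for k
  have g: "g (coord b p q) = (if p < q then (f q b - f p b) / W b p q else 0)" for b p q by (simp add: g_def coord_def)
  have "g : bcontfun"
  proof (rule bcontfun_normI)
    show "norm (g k) <= \<bar>K\<bar>" for k
    proof -
      have "\<bar>f q b - f p b\<bar> / W b p q <= \<bar>K\<bar>" if "p < q" for b p q
      proof -
        have "\<bar>f q b - f p b\<bar> <= \<bar>K\<bar> * W b p q"
          using K[OF that, of b] W_pos[OF that, of b] by (meson abs_ge_self less_imp_le mult_right_mono order_trans)
        thus ?thesis using W_pos[OF that, of b] by (simp add: pos_divide_le_eq)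
      qed
      thus ?thesis using W_pos by (auto simp: g_def abs_div_pos split: prod.split)
    qed
  qed (auto intro: continuous_on_discrete)
  hence a: "apply_bcontfun (Bcontfun g) = g" by (rule Bcontfun_inverse)
  have lev: "level n b (Bcontfun g) = f n b" for n b
    using W_pos[of 0 n b] f(1)[of b] by (cases "n = 0") (auto simp: level_def a g)
  show ?thesis
  proof (rule bexI[of _ "Bcontfun g"])
    show "Bcontfun g : jumps"
    proof (rule jumpsI, unfold lev a g)
      show "W b p q * (if p < q then (f q b - f p b) / W b p q else 0) = f q b - f p b" if "p < q" for b p q
        using W_pos[OF that, of b] that by simp
    qed (simp, rule f(2))
  qed (simp add: lev)
qed

text \<open>Stopping at level \<open>n\<close> replaces a window by a shorter one with the same
  start; since \<open>W\<close> grows with the end of the window, truncation does not increase the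
  norm.\<close>

lemma truncated_level_diff_le:
  assumes z: "z : jumps" and pq: "p < q"
  shows "\<bar>level (min q n) b z - level (min p n) b z\<bar> <= norm z * W b p q"
proof (cases "p < n")
  case True
  have "\<bar>level (min q n) b z - level (min p n) b z\<bar> <= norm z * W b p (min q n)"
    using level_diff_le[OF z, of p "min q n" b] True pq by simp
  also have "\<dots> <= norm z * W b p q" by (intro mult_left_mono W_mono) (use True pq in auto)
  finally show ?thesis .
next
  case False
  hence "min q n = n" "min p n = n" using pq by auto
  thus ?thesis using W_pos[OF pq, of b] by simp
qed

definition proj :: "nat => linfty => linfty" where
  "proj n z = (SOME w. w : jumps & (ALL m b. level m b w = level (min m n) b z))"

lemma proj:
  assumes z: "z : jumps"
  shows "proj n z : jumps" "level m b (proj n z) = level (min m n) b z"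
proof -
  have "EX w:jumps. ALL m b. level m b w = level (min m n) b z"
  proof (rule jumps_exist[where K = "norm z"])
    show "level (min m n) b z = level (min m n) b' z" if "key m b = key m b'" for m b b'
      using jumpsD(3)[OF z key_refine[OF that, of "min m n"]] by simp
  qed (auto intro: truncated_level_diff_le[OF z])
  hence "EX w. w : jumps & (ALL m b. level m b w = level (min m n) b z)" by blast
  hence "proj n z : jumps & (ALL m b. level m b (proj n z) = level (min m n) b z)" unfolding proj_def by (rule someI_ex)
  thus "proj n z : jumps" "level m b (proj n z) = level (min m n) b z" by blast+
qed

lemma proj_diff: "z : jumps ==> w : jumps ==> proj n (z - w) = proj n z - proj n w"
  by (rule jumps_eqI) (simp_all add: proj subspace_diff[OF subspace_jumps] linear_diff[OF level_linear])

lemma proj_add: "z : jumps ==> w : jumps ==> proj n (z + w) = proj n z + proj n w"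
  by (rule jumps_eqI) (simp_all add: proj subspace_add[OF subspace_jumps] linear_add[OF level_linear])

lemma proj_scale: "z : jumps ==> proj n (a *\<^sub>R z) = a *\<^sub>R proj n z"
  by (rule jumps_eqI) (simp_all add: proj subspace_scale[OF subspace_jumps] linear_scale[OF level_linear])

lemma norm_proj_le: "z : jumps ==> norm (proj n z) <= norm z"
  using norm_jumps_le_iff[of "proj n z" "norm z"] by (simp add: proj truncated_level_diff_le)

definition jump :: "nat => nat => linfty => real" where
  "jump m b z = level (Suc m) b z - level m b z"

lemma bounded_linear_jump: "bounded_linear (jump m b)"
  unfolding jump_def by (intro bounded_linear_sub bounded_linear_level)

lemmas jump_linear = bounded_linear.linear[OF bounded_linear_jump]

lemma level_diff_eq: "p <= q ==> level q b z - level p b z = (\<Sum>m\<in>{p..<q}. jump m b z)"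
  unfolding jump_def using sum_Suc_diff'[of p q "%m. level m b z"] by simp

lemma level_eq: "level n b z = (\<Sum>m<n. jump m b z)" using level_diff_eq[of 0 n b z] by (simp add: lessThan_atLeast0)

lemma jumps_eqI':
  assumes "z : jumps" "w : jumps" "!!m b. jump m b z = jump m b w"
  shows "z = w" by (rule jumps_eqI[OF assms(1,2)]) (simp add: level_eq assms(3))

lemma jump_proj: "z : jumps ==> jump m b (proj n z) = (if m < n then jump m b z else 0)"
  by (auto simp: jump_def proj min_def not_less le_Suc_eq)

lemma proj_0: "z : jumps ==> proj 0 z = 0"
  by (rule jumps_eqI') (simp_all add: jump_proj proj subspace_0[OF subspace_jumps] linear_0[OF jump_linear])

section \<open>The decomposition into levels\<close>

definition total :: "linfty set" where
  "total = {z : jumps. (%n. proj n z) \<longlonglongrightarrow> z}"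

text \<open>The jump from level \<open>m\<close> to \<open>Suc m\<close> gets the number
  \<open>Q (Suc m)\<close>, so that the support of a vector begins where the Tsirelson coefficient
  has to stand. All other numbers carry the zero space.\<close>

definition part :: "nat => linfty set" where
  "part k = {z : jumps. ALL m b. jump m b z ~= 0 --> Q (Suc m) = k}"

lemma subspace_total: "subspace total"
proof (rule subspaceI)
  show "0 : total" using proj_diff[of 0 0] subspace_0[OF subspace_jumps] by (simp add: total_def)
  show "x + y : total" if "x : total" "y : total" for x y
    using that subspace_add[OF subspace_jumps] unfolding total_def by (auto simp: proj_add intro: tendsto_add)
  show "a *\<^sub>R x : total" if "x : total" for a x
    using that subspace_scale[OF subspace_jumps] unfolding total_def by (auto simp: proj_scale intro: tendsto_scaleR)
qed

lemma closed_total: "closed total" unfolding closed_sequential_limits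
proof (intro allI impI)
  fix zs z assume a: "(ALL n. zs n : total) & zs \<longlonglongrightarrow> z"
  hence zj: "zs n : jumps" for n by (simp add: total_def)
  hence z: "z : jumps" using a closed_jumps unfolding closed_sequential_limits by blast
  have "(%n. proj n z) \<longlonglongrightarrow> z"
  proof (rule LIMSEQ_I)
    fix d :: real assume d: "0 < d"
    obtain k where k: "norm (zs k - z) < d / 3" using LIMSEQ_D[OF conjunct2[OF a], of "d / 3"] d by auto
    have "(%n. proj n (zs k)) \<longlonglongrightarrow> zs k" using a by (simp add: total_def)
    then obtain N where N: "!!n. N <= n ==> norm (proj n (zs k) - zs k) < d / 3" using LIMSEQ_D[of _ "zs k" "d / 3"] d by auto
    have "norm (proj n z - z) < d" if "N <= n" for n
    proof -
      have "proj n z - z = (proj n (zs k) - zs k) + (zs k - z) - proj n (zs k - z)" by (simp add: proj_diff[OF zj z])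
      hence "norm (proj n z - z) = norm ((proj n (zs k) - zs k) + (zs k - z) - proj n (zs k - z))" by (rule arg_cong)
      hence "norm (proj n z - z) <= norm (proj n (zs k) - zs k) + norm (zs k - z) + norm (proj n (zs k - z))"
        using norm_triangle_ineq4[of "(proj n (zs k) - zs k) + (zs k - z)" "proj n (zs k - z)"]
          norm_triangle_ineq[of "proj n (zs k) - zs k" "zs k - z"] by linarith
      moreover have "norm (proj n (zs k - z)) <= norm (zs k - z)"
        by (rule norm_proj_le) (rule subspace_diff[OF subspace_jumps zj z])
      ultimately show ?thesis using N[OF that] k by linarith
    qed
    thus "EX N. ALL n>=N. norm (proj n z - z) < d" by blast
  qed
  thus "z : total" using z by (simp add: total_def)
qed

lemma Q_Suc_gt: "m < Q (Suc m)" using strict_mono_imp_increasing[OF Q(1), of "Suc m"] by simp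

lemma part_subset_total: "part k \<subseteq> total"
proof
  fix z assume z: "z : part k"
  hence zj: "z : jumps" by (simp add: part_def)
  have "proj n z = z" if "k <= n" for n
  proof (rule jumps_eqI')
    fix m b
    have "jump m b z = 0" if "n <= m" using z Q_Suc_gt[of m] `k <= n` that by (fastforce simp: part_def)
    thus "jump m b (proj n z) = jump m b z" using zj by (simp add: jump_proj)
  qed (use zj in "simp_all add: proj")
  hence "(%n. proj n z) \<longlonglongrightarrow> z" by (intro tendsto_eventually) (auto simp: eventually_sequentially)
  thus "z : total" using zj by (simp add: total_def)
qed

lemma subspace_part: "subspace (part k)"
proof (rule subspaceI)
  show "0 : part k" using subspace_0[OF subspace_jumps] by (simp add: part_def linear_0[OF jump_linear])
  show "x + y : part k" if "x : part k" "y : part k" for x y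
    using that subspace_add[OF subspace_jumps] unfolding part_def by (simp add: linear_add[OF jump_linear]) (metis add_0)
  show "a *\<^sub>R x : part k" if "x : part k" for a x
    using that subspace_scale[OF subspace_jumps] unfolding part_def by (auto simp: linear_scale[OF jump_linear])
qed

lemma part_trivial: "k \<notin> range (%m. Q (Suc m)) ==> part k = {0}"
proof -
  assume k: "k \<notin> range (%m. Q (Suc m))"
  have "z = 0" if "z : part k" for z
    by (rule jumps_eqI') (use k that subspace_0[OF subspace_jumps] in "auto simp: part_def linear_0[OF jump_linear]")
  thus ?thesis using subspace_0[OF subspace_part] by blast
qed

text \<open>A function whose only jump is at one level is determined by its values on the finitely
  many keys of that level. The indicator of a key is bounded because a window that sees the jump
  starts before level \<open>n\<close> and so has weight at least
  \<open>(1 / 2) ^ n\<close>.\<close>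

lemma part_finite_dim: "EX B. finite B & part k = span B"
proof (cases "k : range (%m. Q (Suc m))")
  case False
  thus ?thesis using part_trivial[OF False] by (intro exI[of _ "{}"]) simp
next
  case True
  then obtain m0 where k: "k = Q (Suc m0)" by blast
  define n where "n = Suc m0"
  have jump_part: "jump m b z = 0" if "z : part k" "m ~= m0" for m b z
    using that k strict_mono_eq[OF Q(1)] by (fastforce simp: part_def)
  have "EX z:jumps. ALL l b. level l b z = (if n <= l & key n b = w then 1 else 0)" for w
  proof (rule jumps_exist[where K = "2 ^ n"])
    show "(if n <= l & key n b = w then 1 else 0 :: real) = (if n <= l & key n b' = w then 1 else 0)"
      if "key l b = key l b'" for l b b' using key_refine[OF that, of n] by auto
    fix b p q :: nat assume pq: "p < q"
    have "\<bar>(if n <= q & key n b = w then 1 else 0) - (if n <= p & key n b = w then 1 else 0 :: real)\<bar> <= (if p < n then 1 else 0)"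
      using pq by auto
    also have "\<dots> <= 2 ^ n * W b p q"
    proof (cases "p < n")
      case True
      have "(1 / 2) ^ n <= (1 / 2 :: real) ^ p" using True by (intro power_decreasing) auto
      also have "\<dots> <= W b p q" by (rule W_lower[OF pq])
      finally show ?thesis  by (simp add: power_one_over field_simps)
    qed (use W_pos[OF pq, of b] in simp)
    finally show "\<bar>(if n <= q & key n b = w then 1 else 0) - (if n <= p & key n b = w then 1 else 0 :: real)\<bar> <= 2 ^ n * W b p q" .
  qed (simp add: n_def)
  then obtain u where u: "!!w. u w : jumps" "!!w l b. level l b (u w) = (if n <= l & key n b = w then 1 else 0)" by metis
  have upart: "u w : part k" for w using u(1) by (auto simp: part_def jump_def u(2) k n_def not_less_eq_eq le_antisym)
  have "part k = span (u ` range (key n))"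
  proof
    show "span (u ` range (key n)) \<subseteq> part k" by (rule span_minimal[OF _ subspace_part]) (use upart in auto)
    show "part k \<subseteq> span (u ` range (key n))"
    proof
      fix z assume z: "z : part k"
      define v where "v w = level n (inv (key n) w) z" for w
      have zj: "z : jumps" using z by (simp add: part_def)
      have "z = (\<Sum>w\<in>range (key n). v w *\<^sub>R u w)"
      proof (rule jumps_eqI[OF zj])
        show "(\<Sum>w\<in>range (key n). v w *\<^sub>R u w) : jumps"
          by (intro subspace_sum[OF subspace_jumps] subspace_scale[OF subspace_jumps] u)
        fix l b
        have "level l b (\<Sum>w\<in>range (key n). v w *\<^sub>R u w) = (\<Sum>w\<in>range (key n). if w = key n b then (if n <= l then v w else 0) else 0)"
          unfolding linear_sum[OF level_linear] linear_scale[OF level_linear] by (intro sum.cong) (auto simp: u(2))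
        also have "\<dots> = (if n <= l then v (key n b) else 0)" using key_finite[of n] by simp
        also have "v (key n b) = level n b z" unfolding v_def by (rule jumpsD(3)[OF zj]) (simp add: f_inv_into_f)
        also have "(if n <= l then level n b z else 0) = level l b z"
        proof (cases "n <= l")
          case True
          have "level l b z - level n b z = 0"
            unfolding level_diff_eq[OF True] using jump_part[OF z] by (intro sum.neutral) (auto simp: n_def)
          thus ?thesis using True by simp
        next
          case False
          hence "level l b z = 0" unfolding level_eq using jump_part[OF z] by (intro sum.neutral) (auto simp: n_def)
          thus ?thesis using False by simp
        qed
        finally show "level l b z = level l b (\<Sum>w\<in>range (key n). v w *\<^sub>R u w)" by (rule sym)
      qed
      thus "z : span (u ` range (key n))" by (metis (no_types, lifting) span_sum span_scale span_base imageI)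
    qed
  qed
  thus ?thesis using key_finite[of n] by blast
qed

lemma expansion_jump:
  assumes zs: "ALL k. zs k : part k" "zs sums z"
  shows "jump m b (zs k) = (if k = Q (Suc m) then jump m b z else 0)"
proof -
  have 0: "jump m b (zs k) = 0" if "k ~= Q (Suc m)" for k using zs(1) that by (auto simp: part_def)
  have "(%k. jump m b (zs k)) sums jump m b z" by (rule bounded_linear.sums[OF bounded_linear_jump zs(2)])
  moreover have "(%k. jump m b (zs k)) sums (\<Sum>k\<in>{Q (Suc m)}. jump m b (zs k))" by (rule sums_finite) (use 0 in auto)
  ultimately have "jump m b z = jump m b (zs (Q (Suc m)))" using sums_unique2 by fastforce
  thus ?thesis using 0 by simp
qed

lemma expansion_exists:
  assumes z: "z : total"
  shows "EX zs. (ALL k. zs k : part k) & zs sums z"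
proof -
  have zj: "z : jumps" using z by (simp add: total_def)
  define g where "g m = Q (Suc m)" for m
  have g: "strict_mono g" using Q(1) by (auto simp: g_def strict_mono_def)
  hence gi: "inv g (g m) = m" for m by (simp add: strict_mono_imp_inj_on inv_f_f)
  define zs where "zs k = (if k : range g then proj (Suc (inv g k)) z - proj (inv g k) z else 0)" for k
  have "zs k : part k" for k
  proof (cases "k : range g")
    case True
    then obtain m where m: "k = g m" by blast
    have "proj (Suc m) z - proj m z : part k" unfolding part_def using zj subspace_diff[OF subspace_jumps]
      by (auto simp: proj linear_diff[OF jump_linear] jump_proj m g_def less_Suc_eq split: if_splits)
    thus ?thesis by (simp add: zs_def m gi)
  qed (simp add: zs_def subspace_0[OF subspace_part])
  moreover have "zs sums z"
  proof -
    have "(%m. proj (Suc m) z - proj m z) sums (z - proj 0 z)" by (rule telescope_sums) (use z in "simp add: total_def")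
    hence "(%m. zs (g m)) sums z" by (simp add: zs_def gi proj_0[OF zj])
    thus ?thesis by (subst (asm) sums_mono_reindex[OF g]) (auto simp: zs_def)
  qed
  ultimately show ?thesis by blast
qed

lemma part_0: "part 0 = {0}" by (rule part_trivial) (use Q_Suc_gt in "metis imageE not_less0")

lemma fdd_total: "fdd total part" unfolding fdd_def
proof (intro conjI allI ballI part_0 part_subset_total part_finite_dim)
  fix z assume "z : total"
  then obtain zs where zs: "(ALL k. zs k : part k) & zs sums z" using expansion_exists by blast
  show "EX! zs. (ALL k. zs k : part k) & zs sums z"
  proof (rule ex1I[of _ zs], rule zs)
    fix ys assume ys: "(ALL k. ys k : part k) & ys sums z"
    show "ys = zs"
    proof
      fix k
      show "ys k = zs k"
      proof (rule jumps_eqI')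
        show "ys k : jumps" "zs k : jumps" using ys zs by (simp_all add: part_def)
        show "jump m b (ys k) = jump m b (zs k)" for m b
          using expansion_jump[of ys z] expansion_jump[of zs z] ys zs by metis
      qed
    qed
  qed
qed

lemma fdd_supp_part:
  assumes z: "z : total"
  shows "fdd_supp part z = (%m. Q (Suc m)) ` {m. EX b. jump m b z ~= 0}"
proof -
  have ex: "EX! zs. (ALL k. zs k : part k) & zs sums z" using fdd_total z by (simp add: fdd_def)
  define zs where "zs = (THE zs. (ALL k. zs k : part k) & zs sums z)"
  have zs: "ALL k. zs k : part k" "zs sums z" using theI'[OF ex] unfolding zs_def by auto
  have "zs k ~= 0 \<longleftrightarrow> (EX m b. jump m b (zs k) ~= 0)" for k
    using jumps_eqI'[of "zs k" 0] zs(1) subspace_0[OF subspace_jumps] linear_0[OF jump_linear] by (auto simp: part_def)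
  thus ?thesis unfolding fdd_supp_def zs_def[symmetric] by (auto simp: expansion_jump[OF zs])
qed

text \<open>On a window from \<open>p\<close> to \<open>q\<close> the vector \<open>z i\<close>
  changes only between \<open>ps i\<close> and \<open>qs i\<close>, where window and block overlap;
  \<open>G\<close> collects the blocks for which this is a proper window. Each change is at most the
  weight of that overlap, and \<open>split\<close> compares the weighted sum with
  \<open>W b p q\<close>, the unit in which the norm is measured.\<close>

lemma block_sum_le:
  assumes S: "tsirelson S c'" and K: "0 <= K"
    and split: "!!b p q G ps qs R a. finite G ==> (!!i. i : G ==> p <= ps i & ps i < qs i & qs i <= q) ==>
      (!!i. i : G ==> 1 <= R i & R i <= Q (Suc (ps i))) ==>
      (!!i j. i : G ==> j : G ==> i < j ==> qs i <= ps j & Q (qs i) < R j) ==> (!!i. i : G ==> 0 <= a i) ==>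
      (\<Sum>i\<in>(G :: nat set). a i * W b (ps i) (qs i)) <= K * W b p q * tnorm S c' (%k. \<Sum>i\<in>G. a i * unit_vec (R i) k)"
    and F: "finite (F :: nat set)" and z: "!!i. i : F ==> z i : jumps & norm (z i) <= 1"
    and lohi: "!!i m b. i : F ==> jump m b (z i) ~= 0 ==> lo i <= m & m <= hi i"
    and le: "!!i. i : F ==> lo i <= hi i" and ord: "!!i j. i : F ==> j : F ==> i < j ==> hi i < lo j"
  shows "norm (\<Sum>i\<in>F. a i *\<^sub>R z i) <= K * tnorm S c' (%k. \<Sum>i\<in>F. a i * unit_vec (Q (Suc (lo i))) k)"
proof -
  interpret T: tsirelson S c' by (rule S)
  let ?N = "tnorm S c' (%k. \<Sum>i\<in>F. a i * unit_vec (Q (Suc (lo i))) k)"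
  have Q1: "1 <= Q n" for n using Q strict_mono_less_eq[OF Q(1), of 0 n] by simp
  have loinj: "i = j" if "i : F" "j : F" "lo i = lo j" for i j
    using ord[OF that(1,2)] ord[OF that(2,1)] le[OF that(1)] le[OF that(2)] that(3) by linarith
  have wj: "(\<Sum>i\<in>F. a i *\<^sub>R z i) : jumps"
    by (intro subspace_sum[OF subspace_jumps] subspace_scale[OF subspace_jumps]) (use z in blast)
  show ?thesis
  proof (subst norm_jumps_le_iff[OF wj], goal_cases)
    case 2
    show ?case
    proof (intro allI impI)
      fix b p q :: nat assume pq: "p < q"
      define ps where "ps i = max p (lo i)" for i
      define qs where "qs i = min q (Suc (hi i))" for i
      define G where "G = {i\<in>F. ps i < qs i}"
      have diff: "level q b (z i) - level p b (z i) = (\<Sum>m\<in>{ps i..<qs i}. jump m b (z i))" if "i : F" for i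
        unfolding level_diff_eq[OF less_imp_le[OF pq]]
        by (rule sum.mono_neutral_right) (use lohi[OF that] in "force simp: ps_def qs_def")+
      have zle: "\<bar>level q b (z i) - level p b (z i)\<bar> <= (if i : G then W b (ps i) (qs i) else 0)" if "i : F" for i
      proof (cases "i : G")
        case True
        hence lt: "ps i < qs i" by (simp add: G_def)
        have "\<bar>level (qs i) b (z i) - level (ps i) b (z i)\<bar> <= norm (z i) * W b (ps i) (qs i)"
          by (rule level_diff_le) (use z that lt in auto)
        also have "\<dots> <= 1 * W b (ps i) (qs i)" by (rule mult_right_mono) (use z that W_pos[OF lt, of b] in auto)
        finally show ?thesis using True diff[OF that] level_diff_eq[OF less_imp_le[OF lt], of b "z i"] by simp
      qed (use that diff in "simp add: G_def")
      have GF: "G \<subseteq> F" by (auto simp: G_def)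
      have "\<bar>level q b (\<Sum>i\<in>F. a i *\<^sub>R z i) - level p b (\<Sum>i\<in>F. a i *\<^sub>R z i)\<bar> =
          \<bar>\<Sum>i\<in>F. a i * (level q b (z i) - level p b (z i))\<bar>"
        by (simp add: linear_sum[OF level_linear] linear_scale[OF level_linear] right_diff_distrib sum_subtractf)
      also have "\<dots> <= (\<Sum>i\<in>F. \<bar>a i\<bar> * \<bar>level q b (z i) - level p b (z i)\<bar>)"
        by (rule order_trans[OF sum_abs]) (simp add: abs_mult)
      also have "\<dots> <= (\<Sum>i\<in>F. \<bar>a i\<bar> * (if i : G then W b (ps i) (qs i) else 0))"
        by (intro sum_mono mult_left_mono zle) auto
      also have "\<dots> = (\<Sum>i\<in>G. \<bar>a i\<bar> * W b (ps i) (qs i))" by (rule sum.mono_neutral_cong_right) (use F GF in auto)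
      also have "\<dots> <= K * W b p q * tnorm S c' (%k. \<Sum>i\<in>G. \<bar>a i\<bar> * unit_vec (Q (Suc (lo i))) k)"
      proof (rule split)
        show "finite G" using F GF by (rule rev_finite_subset)
        show "p <= ps i & ps i < qs i & qs i <= q" if "i : G" for i using that by (auto simp: G_def ps_def qs_def)
        show "1 <= Q (Suc (lo i)) & Q (Suc (lo i)) <= Q (Suc (ps i))" for i
          using Q1 by (auto simp: strict_mono_less_eq[OF Q(1)] ps_def)
        show "qs i <= ps j & Q (qs i) < Q (Suc (lo j))" if "i : G" "j : G" "i < j" for i j
        proof -
          have "hi i < lo j" using ord that GF by blast
          thus ?thesis by (auto simp: strict_mono_less[OF Q(1)] ps_def qs_def)
        qed
      qed simp
      finally have A: "\<bar>level q b (\<Sum>i\<in>F. a i *\<^sub>R z i) - level p b (\<Sum>i\<in>F. a i *\<^sub>R z i)\<bar> <=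
        K * W b p q * tnorm S c' (%k. \<Sum>i\<in>G. \<bar>a i\<bar> * unit_vec (Q (Suc (lo i))) k)" .
      have B: "tnorm S c' (%k. \<Sum>i\<in>G. \<bar>a i\<bar> * unit_vec (Q (Suc (lo i))) k) <= ?N"
      proof -
        have inj: "inj_on (%i. Q (Suc (lo i))) F" using loinj by (auto simp: inj_on_def strict_mono_eq[OF Q(1)])
        have "(%k. \<Sum>i\<in>G. \<bar>a i\<bar> * unit_vec (Q (Suc (lo i))) k) = (%k. \<Sum>i\<in>F. (if i : G then \<bar>a i\<bar> else 0) * unit_vec (Q (Suc (lo i))) k)"
          using F GF by (intro ext sum.mono_neutral_cong_left) auto
        thus ?thesis using T.tnorm_coefficients_mono[OF F inj, of "%i. if i : G then \<bar>a i\<bar> else 0" a] Q1 by simp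
      qed
      have "0 <= K * W b p q" using K W_pos[OF pq, of b] by simp
      from order_trans[OF A mult_left_mono[OF B this]]
      show "\<bar>level q b (\<Sum>i\<in>F. a i *\<^sub>R z i) - level p b (\<Sum>i\<in>F. a i *\<^sub>R z i)\<bar> <= K * ?N * W b p q" by (simp only: mult_ac)
    qed
  qed (use K in simp)
qed

end

context jump_space
begin

lemma fdd_supp_part_bounds:
  fixes z :: linfty
  defines "M \<equiv> {m. EX b. jump m b z ~= 0}"
  assumes z: "z : total" "z ~= 0" and fin: "finite (fdd_supp part z)"
  shows "finite M" "M ~= {}" "Min (fdd_supp part z) = Q (Suc (Min M))" "Max (fdd_supp part z) = Q (Suc (Max M))"
proof -
  have sup: "fdd_supp part z = (%m. Q (Suc m)) ` M" unfolding M_def by (rule fdd_supp_part[OF z(1)])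
  have sm: "strict_mono (%m. Q (Suc m))" using Q(1) by (auto simp: strict_mono_def)
  show f: "finite M" using fin unfolding sup by (rule finite_imageD) (use sm in "simp add: strict_mono_imp_inj_on inj_on_def strict_mono_eq[OF Q(1)]")
  show ne: "M ~= {}"
  proof
    assume "M = {}"
    hence "jump m b z = jump m b 0" for m b unfolding M_def by (simp add: linear_0[OF jump_linear])
    hence "z = 0" using z(1) subspace_0[OF subspace_jumps] by (intro jumps_eqI') (auto simp: total_def)
    thus False using z(2) by simp
  qed
  have mono: "mono (%m. Q (Suc m))" using sm by (rule strict_mono_mono)
  show "Min (fdd_supp part z) = Q (Suc (Min M))" unfolding sup by (rule mono_Min_commute[OF mono f ne, symmetric])
  show "Max (fdd_supp part z) = Q (Suc (Max M))" unfolding sup by (rule mono_Max_commute[OF mono f ne, symmetric])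
qed

lemma upper_block_estimates_part:
  assumes S: "tsirelson S c'" and K: "0 <= K"
    and split: "!!b p q G ps qs R a. finite G ==> (!!i. i : G ==> p <= ps i & ps i < qs i & qs i <= q) ==>
      (!!i. i : G ==> 1 <= R i & R i <= Q (Suc (ps i))) ==>
      (!!i j. i : G ==> j : G ==> i < j ==> qs i <= ps j & Q (qs i) < R j) ==> (!!i. i : G ==> 0 <= a i) ==>
      (\<Sum>i\<in>(G :: nat set). a i * W b (ps i) (qs i)) <= K * W b p q * tnorm S c' (%k. \<Sum>i\<in>G. a i * unit_vec (R i) k)"
  shows "upper_block_estimates total part (tnorm S c')" unfolding upper_block_estimates_def
proof (intro exI[of _ "max 1 K"] conjI allI impI)
  interpret T: tsirelson S c' by (rule S)
  fix z :: "nat => linfty" assume nb: "normalized_block_sequence total part z"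
  define M where "M i = {m. EX b. jump m b (z i) ~= 0}" for i
  define lo where "lo i = Min (M i)" for i
  define hi where "hi i = Max (M i)" for i
  have b: "z i : total" "norm (z i) = 1" "finite (fdd_supp part (z i))"
    "Max (fdd_supp part (z i)) < Min (fdd_supp part (z (i + 1)))" if "1 <= i" for i
    using nb that unfolding normalized_block_sequence_def by blast+
  have nz: "z i ~= 0" if "1 <= i" for i using b(2)[OF that] by auto
  have M: "finite (M i)" "M i ~= {}" "Min (fdd_supp part (z i)) = Q (Suc (lo i))" "Max (fdd_supp part (z i)) = Q (Suc (hi i))"
    if "1 <= i" for i
    using fdd_supp_part_bounds[OF b(1)[OF that] nz[OF that] b(3)[OF that]] by (simp_all add: M_def lo_def hi_def)
  have lohi: "lo i <= hi i" if "1 <= i" for i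
    unfolding lo_def hi_def by (rule Min_le[OF M(1)[OF that] Max_in[OF M(1)[OF that] M(2)[OF that]]])
  have step: "hi i < lo (Suc i)" if "1 <= i" for i
    using b(4)[OF that] M(3)[of "i + 1"] M(4)[OF that] by (simp add: strict_mono_less[OF Q(1)])
  have ord: "hi i < lo j" if "1 <= i" "i < j" for i j using that(2)
  proof (induction j)
    case (Suc j)
    show ?case
    proof (cases "i = j")
      case True
      thus ?thesis using step[OF that(1)] by simp
    next
      case False
      hence "hi i < lo j" "1 <= j" using Suc that(1) by auto
      thus ?thesis using lohi[of j] step[of j] by simp
    qed
  qed simp
  show "dominated (max 1 K) z (tnorm S c') (%i. unit_vec (Min (fdd_supp part (z i))))" unfolding dominated_def
  proof (intro allI impI)
    fix F :: "nat set" and a :: "nat => real" assume F: "finite F & F \<subseteq> {1..}"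
    hence F1: "1 <= i" if "i : F" for i using that by auto
    have "norm (\<Sum>i\<in>F. a i *\<^sub>R z i) <= K * tnorm S c' (%k. \<Sum>i\<in>F. a i * unit_vec (Q (Suc (lo i))) k)"
    proof (rule block_sum_le[OF S K split])
      show "lo i <= m & m <= hi i" if "i : F" "jump m b (z i) ~= 0" for i m b
      proof -
        have "m : M i" using that(2) by (auto simp: M_def)
        thus ?thesis using Min_le[OF M(1)[OF F1[OF that(1)]]] Max_ge[OF M(1)[OF F1[OF that(1)]]] by (simp add: lo_def hi_def)
      qed
      show "z i : jumps & norm (z i) <= 1" if "i : F" for i using b(1,2)[OF F1[OF that]] by (simp add: total_def)
    qed (use F F1 lohi ord in auto)
    also have "(%k. \<Sum>i\<in>F. a i * unit_vec (Q (Suc (lo i))) k) = (%k. \<Sum>i\<in>F. a i * unit_vec (Min (fdd_supp part (z i))) k)"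
      using M(3)[OF F1] by (intro ext sum.cong) simp_all
    finally show "norm (\<Sum>i\<in>F. a i *\<^sub>R z i) <= max 1 K * tnorm S c' (%k. \<Sum>i\<in>F. a i * unit_vec (Min (fdd_supp part (z i))) k)"
      by (rule order_trans) (simp add: mult_right_mono)
  qed
qed simp

end

section \<open>The embedding\<close>

lemma complete_linfty: "complete (UNIV :: linfty set)" unfolding complete_def
proof (intro allI impI)
  fix f :: "nat => linfty" assume "(ALL n. f n : UNIV) & Cauchy f"
  hence "ALL \<epsilon>>0. EX N. ALL m n x. N <= m & N <= n & True --> dist (f m x) (f n x) < \<epsilon>"
    unfolding Cauchy_def by (metis dist_fun_lt_imp_dist_val_lt)
  then obtain g where "uniform_limit UNIV (%n. apply_bcontfun (f n)) g sequentially"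
    using uniformly_convergent_eq_cauchy[of "%_. True" "%n. apply_bcontfun (f n)"]
    unfolding uniform_limit_sequentially_iff by auto
  thus "EX l:UNIV. f \<longlonglongrightarrow> l" by (rule uniform_limit_bcontfunE[OF _ sequentially_bot]) (rule bexI[OF _ UNIV_I])
qed

text \<open>A vector is sent to its values at all nodes. Differences are bounded by oscillations and
  so by weights; the lower bound holds because the nodes norm \<open>x\<close> and the weights are
  bounded. Convergence of the truncations has to be checked only for the \<open>e j\<close>, whose
  values vary along branches by at most \<open>1 / 4 ^ p\<close> from level \<open>p\<close>
  on.\<close>

lemma branch_system_imp_embeds:
  fixes r :: "nat => nat => 'a::banach dual"
  assumes s: "approximating s" and c: "0 < c" "c < 1" and e: "closure (span (range e)) = UNIV"
    and bs: "branch_system e r" and Q: "strict_mono Q" "1 <= Q 0"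
    and est: "osc_estimate (Schreier s \<alpha>) c Q C r"
  shows "embeds_with_Tsirelson_upper_fdd TYPE('a) TYPE(linfty) s \<alpha>"
proof -
  interpret T: tsirelson "Schreier s \<alpha>" c by (rule tsirelson_Schreier[OF s c])
  interpret B: branch_weights "Schreier s \<alpha>" c Q C r by unfold_locales (use Q est in auto)
  have r0: "r 0 b = 0" and rfin: "finite (range (r n))"
    and rmesh: "1 <= p ==> j <= p ==> p <= q ==> \<bar>(r q b) (e j) - (r p b) (e j)\<bar> <= 1 / 4 ^ p"
    and rnorming: "0 < u ==> EX n b. norm x - u <= (r n b) x" for b n j p q x u
    using bs unfolding branch_system_def by blast+
  \<comment> \<open>The key contains the whole initial segment of a branch, so that equal keys at
    one level imply equal keys at lower levels.\<close>
  define key where "key n b = map (%m. r m b) [0..<Suc n]" for n b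
  have key: "r m b = r m b'" if "key n b = key n b'" "m <= n" for n b b' m
    using that by (auto simp: key_def map_eq_conv simp del: upt_Suc)
  interpret J: jump_space key B.weight Q
  proof
    show "finite (range (key n))" for n
    proof (rule finite_subset)
      show "finite {xs. set xs \<subseteq> (\<Union>m\<le>n. range (r m)) & length xs = Suc n}"
        by (rule finite_lists_length_eq) (use rfin in auto)
      show "range (key n) \<subseteq> {xs. set xs \<subseteq> (\<Union>m\<le>n. range (r m)) & length xs = Suc n}"
        unfolding key_def by (force simp: less_Suc_eq_le simp del: upt_Suc)
    qed
    show "key m b = key m b'" if "key n b = key n b'" "m <= n" for n b b' m
      using key[OF that(1)] that(2) by (simp add: key_def)
    show "(1 / 2) ^ p <= B.weight b p q" if "p < q" for b p q
      using B.weight_ge_gain[OF that, of b] osc_nonneg[of p q r b] that by simp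
    show "B.weight b p q' <= B.weight b p q" if "p < q'" "q' <= q" for b p q q' by (rule B.weight_mono[OF that(2)])
  qed (rule Q)+
  have diff: "\<bar>(r q b) x - (r p b) x\<bar> <= norm x * B.weight b p q" if "p < q" for p q b x
  proof -
    have "\<bar>(r q b - r p b) x\<bar> <= norm (r q b - r p b) * norm x" using norm_blinfun[of "r q b - r p b" x] by simp
    also have "norm (r q b - r p b) <= osc r b p q" by (rule osc_upper) (use that in auto)
    also have "\<dots> <= B.weight b p q" using B.weight_ge_gain[OF that, of b] by (smt (verit) zero_less_power half_gt_zero_iff)
    finally show ?thesis by (simp add: blinfun.diff_left mult.commute mult_right_mono)
  qed
  have "EX z:J.jumps. ALL n b. J.level n b z = (r n b) x" for x
  proof (rule J.jumps_exist[where K = "norm x"])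
    show "(r n b) x = (r n b') x" if "key n b = key n b'" for n b b' using key[OF that, of n] by simp
  qed (auto simp: r0 diff)
  then obtain T where T: "!!x. T x : J.jumps" "!!n b x. J.level n b (T x) = (r n b) x" by metis
  have bl: "bounded_linear T"
  proof (rule bounded_linear_intro)
    show "T (x + y) = T x + T y" for x y
      by (rule J.jumps_eqI) (simp_all add: T subspace_add[OF J.subspace_jumps] linear_add[OF J.level_linear] blinfun.add_right)
    show "T (a *\<^sub>R x) = a *\<^sub>R T x" for a x
      by (rule J.jumps_eqI) (simp_all add: T subspace_scale[OF J.subspace_jumps] linear_scale[OF J.level_linear] blinfun.scaleR_right)
    show "norm (T x) <= norm x * 1" for x using J.norm_jumps_le_iff[OF T(1), of "norm x" x] by (simp add: T(2) diff)
  qed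
  have lower: "norm x <= (\<bar>C\<bar> + 2) * norm (T x)" for x
  proof (rule field_le_epsilon)
    fix u :: real assume "0 < u"
    then obtain n b where nb: "norm x - u <= (r n b) x" using rnorming by blast
    have "(r n b) x <= (\<bar>C\<bar> + 2) * norm (T x)"
    proof (cases "n = 0")
      case False
      have "(r n b) x <= norm (T x) * B.weight b 0 n"
        using J.level_diff_le[OF T(1), of 0 n b x] False by (simp add: T(2) r0)
      also have "\<dots> <= norm (T x) * (\<bar>C\<bar> + 2)" by (intro mult_left_mono B.weight_bound) auto
      finally show ?thesis by (simp add: mult.commute)
    qed (simp add: r0)
    thus "norm x <= (\<bar>C\<bar> + 2) * norm (T x) + u" using nb by linarith
  qed
  have Te: "T (e j) : J.total" for j unfolding J.total_def
  proof (intro CollectI conjI T(1))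
    have near: "norm (J.proj n (T (e j)) - T (e j)) <= (1 / 2) ^ n" if n: "1 <= n" "j <= n" for n
    proof (subst J.norm_jumps_le_iff, goal_cases)
      case 1
      show ?case by (intro subspace_diff[OF J.subspace_jumps] J.proj(1) T(1))
    next
      case 3
      show ?case
      proof (intro allI impI)
        fix b p q :: nat assume pq: "p < q"
        define d where "d m = (r m b) (e j)" for m
        have lev: "J.level m b (J.proj n (T (e j)) - T (e j)) = d (min m n) - d m" for m
          by (simp add: linear_diff[OF J.level_linear] J.proj T d_def)
        have W: "(1 / 2) ^ p <= B.weight b p q" by (rule J.W_lower[OF pq])
        have dd: "\<bar>d q - d m\<bar> <= 1 / 4 ^ m" if "n <= m" "m <= q" for m
          unfolding d_def by (rule rmesh) (use n that in auto)
        \<comment> \<open>One factor is absorbed by the lower bound for the weight, the other gives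
          convergence.\<close>
        have q4: "1 / 4 ^ m = (1 / 2) ^ m * (1 / 2 :: real) ^ m" for m by (simp add: power_mult_distrib[symmetric] power_one_over)
        consider "q <= n" | "p <= n" "n < q" | "n < p" by linarith
        thus "\<bar>J.level q b (J.proj n (T (e j)) - T (e j)) - J.level p b (J.proj n (T (e j)) - T (e j))\<bar> <= (1 / 2) ^ n * B.weight b p q"
        proof cases
          case 1
          thus ?thesis using pq J.W_pos[OF pq, of b] by (simp add: lev min_def)
        next
          case 2
          have "(1 / 2 :: real) ^ n <= (1 / 2) ^ p" using 2 by (intro power_decreasing) auto
          hence "1 / 4 ^ n <= (1 / 2) ^ n * B.weight b p q" unfolding q4 using W by (intro mult_left_mono) (linarith, simp)
          thus ?thesis using dd[of n] 2 by (simp add: lev min_def abs_minus_commute)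
        next
          case 3
          have "(1 / 2 :: real) ^ p <= (1 / 2) ^ n" using 3 by (intro power_decreasing) auto
          hence "1 / 4 ^ p <= (1 / 2) ^ n * B.weight b p q" unfolding q4 using W by (intro mult_mono) auto
          thus ?thesis using dd[of p] 3 pq by (simp add: lev min_def abs_minus_commute)
        qed
      qed
    qed simp
    have "(%n. J.proj n (T (e j)) - T (e j)) \<longlonglongrightarrow> 0"
    proof (rule Lim_null_comparison)
      show "eventually (%n. norm (J.proj n (T (e j)) - T (e j)) <= (1 / 2) ^ n) sequentially"
        unfolding eventually_sequentially by (intro exI[of _ "max 1 j"]) (simp add: near)
      show "(%n. (1 / 2 :: real) ^ n) \<longlonglongrightarrow> 0" by (rule LIMSEQ_power_zero) simp
    qed
    thus "(%n. J.proj n (T (e j))) \<longlonglongrightarrow> T (e j)" by (simp only: LIM_zero_iff)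
  qed
  have rangeT: "range T \<subseteq> J.total"
  proof -
    have "closed (T -` J.total)" by (rule closed_vimage[OF J.closed_total]) (simp add: linear_continuous_on bl)
    moreover have "subspace (T -` J.total)"
      by (rule linear_subspace_vimage[OF bounded_linear.linear[OF bl] J.subspace_total])
    hence "span (range e) \<subseteq> T -` J.total" by (intro span_minimal) (use Te in auto)
    ultimately have "closure (span (range e)) \<subseteq> T -` J.total" by (rule closure_minimal[rotated])
    thus ?thesis using e by auto
  qed
  define c' where "c' = (1 + c) / 2"
  have c': "c < c'" "c' < 1" "0 < c'" using c by (auto simp: c'_def)
  have "upper_block_estimates J.total J.part (tnorm (Schreier s \<alpha>) c')"
  proof (rule J.upper_block_estimates_part[OF tsirelson_Schreier[OF s c'(3,2)], where K = "2 * ((1 + 1 / c') / (1 - c / c'))"])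
    show "0 <= 2 * ((1 + 1 / c') / (1 - c / c'))" using c' by simp
  qed (rule B.weight_split[OF c'(1,2)])
  hence ub: "upper_block_estimates J.total J.part (Tsirelson_norm s \<alpha> c')" using Tsirelson_norm_eq[OF s c'(3,2)] by simp
  have emb: "embeds_into TYPE('a) J.total" unfolding embeds_into_def
  proof (intro exI[of _ T] conjI bl rangeT exI[of _ "1 / (\<bar>C\<bar> + 2)"] allI)
    show "1 / (\<bar>C\<bar> + 2) * norm x <= norm (T x)" for x using lower[of x] by (simp add: pos_divide_le_eq mult.commute)
  qed simp
  have "complete J.total" using complete_closed_subset[OF J.closed_total subset_UNIV complete_linfty] .
  thus ?thesis unfolding embeds_with_Tsirelson_upper_fdd_def using J.subspace_total emb J.fdd_total ub c' by blast
qed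

section \<open>Finite-dimensional decompositions\<close>

text \<open>The distance from \<open>b\<close> to the closed subspace in homogeneous form; it bounds
  the coefficient of \<open>b\<close> by the norm of the sum.\<close>

lemma complete_subspace_gap:
  fixes V :: "'z::real_normed_vector set"
  assumes V: "subspace V" "complete V" and b: "b \<notin> V"
  obtains d where "0 < d" "ALL a. ALL v:V. d * \<bar>a\<bar> <= norm (a *\<^sub>R b + v)"
proof -
  have "open (- V)" using complete_imp_closed[OF V(2)] by (simp add: open_Compl)
  then obtain d where d: "0 < d" "ball b d \<subseteq> - V" using b open_contains_ball by blast
  have "d * \<bar>a\<bar> <= norm (a *\<^sub>R b + v)" if v: "v : V" for a v
  proof (cases "a = 0")
    case False
    have "(- 1 / a) *\<^sub>R v : V" by (rule subspace_scale[OF V(1) v])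
    hence "d <= norm (b - (- 1 / a) *\<^sub>R v)" using d(2) by (force simp: dist_norm not_less[symmetric])
    hence "\<bar>a\<bar> * d <= norm (a *\<^sub>R (b - (- 1 / a) *\<^sub>R v))" by (simp only: norm_scaleR) (rule mult_left_mono, simp_all)
    also have "a *\<^sub>R (b - (- 1 / a) *\<^sub>R v) = a *\<^sub>R b + v" using False by (simp add: scaleR_diff_right scaleR_add_right)
    finally show ?thesis by (simp add: mult.commute)
  qed simp
  thus ?thesis using d(1) by (intro that) auto
qed

lemma complete_span_finite:
  fixes B :: "'z::real_normed_vector set"
  assumes "finite B" shows "complete (span B)" using assms
proof (induction B)
  case empty
  thus ?case by (simp add: compact_imp_complete)
next
  case (insert b B)
  show ?case
  proof (cases "b : span B")
    case True
    thus ?thesis using insert by (simp add: span_redundant)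
  next
    case False
    obtain d where d: "0 < d" "ALL a. ALL v:span B. d * \<bar>a\<bar> <= norm (a *\<^sub>R b + v)"
      by (rule complete_subspace_gap[OF subspace_span insert.IH False])
    show ?thesis unfolding complete_def
    proof (intro allI impI)
      fix f assume f: "(ALL n. f n : span (insert b B)) & Cauchy f"
      hence "ALL n. EX k. f n - k *\<^sub>R b : span B" by (simp add: span_insert)
      then obtain k where k: "!!n. f n - k n *\<^sub>R b : span B" by metis
      have le: "d * \<bar>k m - k n\<bar> <= norm (f m - f n)" for m n
      proof -
        have "(f m - k m *\<^sub>R b) - (f n - k n *\<^sub>R b) : span B" by (rule span_diff[OF k k])
        hence "d * \<bar>k m - k n\<bar> <= norm ((k m - k n) *\<^sub>R b + ((f m - k m *\<^sub>R b) - (f n - k n *\<^sub>R b)))" using d(2) by blast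
        thus ?thesis by (simp add: algebra_simps)
      qed
      have "Cauchy k"
      proof (rule metric_CauchyI)
        fix \<epsilon> :: real assume "0 < \<epsilon>"
        then obtain N where N: "!!m n. N <= m ==> N <= n ==> norm (f m - f n) < d * \<epsilon>"
          using f d(1) unfolding Cauchy_iff by (meson mult_pos_pos)
        have "dist (k m) (k n) < \<epsilon>" if "N <= m" "N <= n" for m n
        proof -
          have "d * \<bar>k m - k n\<bar> < d * \<epsilon>" using le[of m n] N[OF that] by linarith
          thus ?thesis using d(1) by (simp add: dist_real_def)
        qed
        thus "EX N. ALL m>=N. ALL n>=N. dist (k m) (k n) < \<epsilon>" by blast
      qed
      then obtain l where l: "k \<longlonglongrightarrow> l" using Cauchy_convergent convergent_def by blast
      hence kb: "(%n. k n *\<^sub>R b) \<longlonglongrightarrow> l *\<^sub>R b" by (intro tendsto_intros)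
      have "Cauchy (%n. f n - k n *\<^sub>R b)"
      proof (rule CauchyI)
        fix \<epsilon> :: real assume \<epsilon>: "0 < \<epsilon>"
        define K where "K = 1 + norm b / d"
        have K: "0 < K" using d(1) by (simp add: K_def add_pos_nonneg)
        from f \<epsilon> K obtain N where N: "!!m n. N <= m ==> N <= n ==> norm (f m - f n) < \<epsilon> / K"
          unfolding Cauchy_iff by (meson divide_pos_pos)
        have "norm ((f m - k m *\<^sub>R b) - (f n - k n *\<^sub>R b)) < \<epsilon>" if "N <= m" "N <= n" for m n
        proof -
          have eq: "(f m - k m *\<^sub>R b) - (f n - k n *\<^sub>R b) = (f m - f n) - (k m - k n) *\<^sub>R b" by (simp add: algebra_simps)
          have "norm ((f m - k m *\<^sub>R b) - (f n - k n *\<^sub>R b)) <= norm (f m - f n) + \<bar>k m - k n\<bar> * norm b"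
            unfolding eq using norm_triangle_ineq4[of "f m - f n" "(k m - k n) *\<^sub>R b"] by simp
          moreover have "\<bar>k m - k n\<bar> <= norm (f m - f n) / d" using le[of m n] d(1) by (simp add: pos_le_divide_eq mult.commute)
          hence "norm (f m - f n) + \<bar>k m - k n\<bar> * norm b <= K * norm (f m - f n)"
            using mult_right_mono[of "\<bar>k m - k n\<bar>" "norm (f m - f n) / d" "norm b"] by (simp add: K_def distrib_right mult.commute)
          moreover have "K * norm (f m - f n) < K * (\<epsilon> / K)" by (rule mult_strict_left_mono[OF N[OF that] K])
          ultimately show ?thesis using K by simp
        qed
        thus "EX M. ALL m>=M. ALL n>=M. norm ((f m - k m *\<^sub>R b) - (f n - k n *\<^sub>R b)) < \<epsilon>" by blast
      qed
      then obtain v where v: "v : span B" "(%n. f n - k n *\<^sub>R b) \<longlonglongrightarrow> v" using insert.IH k unfolding complete_def by meson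
      have "(%n. (f n - k n *\<^sub>R b) + k n *\<^sub>R b) \<longlonglongrightarrow> v + l *\<^sub>R b" by (intro tendsto_add v kb)
      moreover have "v + l *\<^sub>R b : span (insert b B)" using v(1) by (auto simp: span_insert intro: exI[of _ l])
      ultimately show "EX y:span (insert b B). f \<longlonglongrightarrow> y" by auto
    qed
  qed
qed

text \<open>The spanning vectors are peeled off one at a time. The coefficient at \<open>b\<close>
  is a bounded functional, to which weak nullness applies.\<close>

lemma weakly_null_finite_rank:
  fixes R :: "'a::real_normed_vector => 'z::real_normed_vector"
  assumes "finite B" "bounded_linear R" "range R \<subseteq> span B" "weakly_null x"
  shows "(%k. R (x k)) \<longlonglongrightarrow> 0" using assms(1-3)
proof (induction B arbitrary: R)
  case empty
  hence "R (x k) = 0" for k by auto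
  thus ?case by simp
next
  case (insert b B)
  show ?case
  proof (cases "b : span B")
    case True
    thus ?thesis using insert by (simp add: span_redundant)
  next
    case False
    obtain d where d: "0 < d" "ALL a. ALL v:span B. d * \<bar>a\<bar> <= norm (a *\<^sub>R b + v)"
      by (rule complete_subspace_gap[OF subspace_span complete_span_finite[OF insert.hyps(1)] False])
    have "ALL u. EX k. R u - k *\<^sub>R b : span B" using insert.prems(2) by (auto simp: span_insert)
    then obtain k where k: "!!u. R u - k u *\<^sub>R b : span B" by metis
    have unique: "c = k u" if "R u - c *\<^sub>R b : span B" for c u
    proof -
      have "(R u - k u *\<^sub>R b) - (R u - c *\<^sub>R b) : span B" by (rule span_diff[OF k that])
      hence "d * \<bar>k u - c\<bar> <= norm ((k u - c) *\<^sub>R b + ((R u - k u *\<^sub>R b) - (R u - c *\<^sub>R b)))" using d(2) by blast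
      hence "d * \<bar>k u - c\<bar> <= 0" by (simp add: algebra_simps)
      thus ?thesis using d(1) by (simp add: mult_le_0_iff)
    qed
    interpret R: bounded_linear R by (rule insert.prems(1))
    obtain K where K: "!!u. norm (R u) <= norm u * K" using R.bounded by blast
    have bl: "bounded_linear k"
    proof (rule bounded_linear_intro)
      fix u v :: 'a and a :: real
      show "k (u + v) = k u + k v"
        by (rule unique[symmetric]) (use span_add[OF k[of u] k[of v]] in "simp add: R.add algebra_simps")
      show "k (a *\<^sub>R u) = a *\<^sub>R k u"
        by (rule unique[symmetric]) (use span_scale[OF k[of u], of a] in "simp add: R.scaleR algebra_simps")
      have "d * \<bar>k u\<bar> <= norm (k u *\<^sub>R b + (R u - k u *\<^sub>R b))" using d(2) k by blast
      also have "\<dots> <= norm u * K" using K[of u] by simp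
      finally show "norm (k u) <= norm u * (K / d)" using d(1) by (simp add: field_simps)
    qed
    have "(%j. (Blinfun k) (x j)) \<longlonglongrightarrow> 0" using assms(4) unfolding weakly_null_def by blast
    hence "(%j. k (x j) *\<^sub>R b) \<longlonglongrightarrow> 0 *\<^sub>R b" by (intro tendsto_intros) (simp add: bounded_linear_Blinfun_apply[OF bl])
    moreover have "(%j. R (x j) - k (x j) *\<^sub>R b) \<longlonglongrightarrow> 0"
    proof (rule insert.IH)
      show "bounded_linear (%u. R u - k u *\<^sub>R b)"
        by (intro bounded_linear_sub R.bounded_linear_axioms bounded_linear_scaleR_const bl)
      show "range (%u. R u - k u *\<^sub>R b) \<subseteq> span B" using k by blast
    qed
    ultimately show ?thesis using tendsto_add by fastforce
  qed
qed

text \<open>Baire's theorem relative to a complete subset, as the surrounding space is not assumed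
  complete.\<close>

lemma complete_covering:
  fixes Z :: "'z::real_normed_vector set" and A :: "nat => 'z set"
  assumes Z: "complete Z" "Z ~= {}" and cover: "!!z. z : Z ==> EX n. z : A n"
  shows "EX n. EX z:Z. EX \<delta>>0. Z \<inter> ball z \<delta> \<subseteq> closure (A n)"
proof (rule ccontr)
  assume no: "~ ?thesis"
  define P where "P n s \<longleftrightarrow> fst s : Z & 0 < snd s & snd s <= (1 / 2) ^ n" for n :: nat and s :: "'z \<times> real"
  have "EX f. ALL n. P n (f n) & (cball (fst (f (Suc n))) (snd (f (Suc n))) \<subseteq> cball (fst (f n)) (snd (f n)) &
      cball (fst (f (Suc n))) (snd (f (Suc n))) \<inter> A n = {})"
  proof (rule dependent_nat_choice)
    obtain z where "z : Z" using Z(2) by blast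
    thus "EX s. P 0 s" by (intro exI[of _ "(z, 1)"]) (simp add: P_def)
    fix s n assume s: "P n s"
    hence "~ Z \<inter> ball (fst s) (snd s) \<subseteq> closure (A n)" using no by (auto simp: P_def)
    then obtain y where y: "y : Z" "y : ball (fst s) (snd s)" "y \<notin> closure (A n)" by blast
    have "open (ball (fst s) (snd s) - closure (A n))" by (simp add: open_Diff)
    then obtain h where h: "0 < h" "cball y h \<subseteq> ball (fst s) (snd s) - closure (A n)"
      using y open_contains_cball by blast
    have "cball y (min h ((1 / 2) ^ Suc n)) \<subseteq> cball y h" by auto
    hence "cball y (min h ((1 / 2) ^ Suc n)) \<subseteq> cball (fst s) (snd s) & cball y (min h ((1 / 2) ^ Suc n)) \<inter> A n = {}"
      using h(2) closure_subset[of "A n"] ball_subset_cball[of "fst s" "snd s"] by blast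
    thus "EX s'. P (Suc n) s' & (cball (fst s') (snd s') \<subseteq> cball (fst s) (snd s) & cball (fst s') (snd s') \<inter> A n = {})"
      using y(1) h(1) by (intro exI[of _ "(y, min h ((1 / 2) ^ Suc n))"]) (simp add: P_def)
  qed
  then obtain f where f: "!!n. P n (f n)" "!!n. cball (fst (f (Suc n))) (snd (f (Suc n))) \<subseteq> cball (fst (f n)) (snd (f n))"
    "!!n. cball (fst (f (Suc n))) (snd (f (Suc n))) \<inter> A n = {}" by metis
  define y where "y n = fst (f n)" for n
  have sub: "cball (y m) (snd (f m)) \<subseteq> cball (y n) (snd (f n))" if "n <= m" for m n
    unfolding y_def by (rule lift_Suc_antimono_le[of "%n. cball (fst (f n)) (snd (f n))", OF f(2) that])
  have yin: "y m : cball (y n) (snd (f n))" if "n <= m" for m n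
    by (rule subsetD[OF sub[OF that]]) (use f(1)[of m] in "simp add: P_def less_imp_le")
  have "Cauchy y"
  proof (rule CauchyI')
    fix \<epsilon> :: real assume "0 < \<epsilon>"
    then obtain N where N: "(1 / 2 :: real) ^ N < \<epsilon>" using real_arch_pow_inv[of \<epsilon> "1 / 2"] by auto
    have "dist (y m) (y n) < \<epsilon>" if "N <= m" "m < n" for m n
    proof -
      have "dist (y m) (y n) <= snd (f m)" using yin[of m n] that by simp
      also have "\<dots> <= (1 / 2) ^ m" using f(1)[of m] by (simp add: P_def)
      also have "\<dots> <= (1 / 2) ^ N" using that by (intro power_decreasing) auto
      finally show ?thesis using N by simp
    qed
    thus "EX M. ALL m>=M. ALL n>m. dist (y m) (y n) < \<epsilon>" by blast
  qed
  then obtain z where z: "z : Z" "y \<longlonglongrightarrow> z" using Z(1) f(1) unfolding complete_def P_def y_def by meson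
  have zin: "z : cball (y n) (snd (f n))" for n
    by (rule Lim_in_closed_set[OF closed_cball _ _ z(2)]) (auto simp: eventually_sequentially intro: exI[of _ n] yin[unfolded mem_cball])
  obtain n where "z : A n" using cover z(1) by blast
  thus False using zin[of "Suc n"] f(3)[of n] by (auto simp: y_def)
qed

locale fdd_space =
  fixes Z :: "'z::real_normed_vector set" and E :: "nat => 'z set"
  assumes complete: "complete Z" and subspace: "subspace Z" and fdd: "fdd Z E"
begin

definition component :: "'z => nat => 'z" where
  "component z = (THE zs. (ALL i. zs i : E i) & zs sums z)"

lemma fdd_supp_eq: "fdd_supp E z = {i. component z i ~= 0}" by (simp add: fdd_supp_def component_def)

lemma component:
  assumes "z : Z" shows "component z i : E i" "component z sums z"
proof -
  have "EX! zs. (ALL i. zs i : E i) & zs sums z" using fdd assms by (simp add: fdd_def)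
  from theI'[OF this] show "component z i : E i" "component z sums z" unfolding component_def by blast+
qed

lemma component_eqI: "z : Z ==> (!!i. zs i : E i) ==> zs sums z ==> component z = zs"
  using fdd component unfolding fdd_def by metis

lemma E_span: obtains B where "finite B" "E i = span B" using fdd unfolding fdd_def by metis

lemma subspace_E: "subspace (E i)" using E_span[of i] subspace_span by metis

lemma complete_E: "complete (E i)" using E_span[of i] complete_span_finite by metis

lemma E_subset: "E i \<subseteq> Z" using fdd by (simp add: fdd_def)

lemma component_diff: "z : Z ==> w : Z ==> component (z - w) = (%i. component z i - component w i)"
  by (rule component_eqI) (auto intro: subspace_diff[OF subspace] subspace_diff[OF subspace_E] component sums_diff)

lemma component_add: "z : Z ==> w : Z ==> component (z + w) = (%i. component z i + component w i)"
  by (rule component_eqI) (auto intro: subspace_add[OF subspace] subspace_add[OF subspace_E] component sums_add)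

lemma component_scale: "z : Z ==> component (a *\<^sub>R z) = (%i. a *\<^sub>R component z i)"
  by (rule component_eqI) (auto intro: subspace_scale[OF subspace] subspace_scale[OF subspace_E] component sums_scaleR_right)

definition partial :: "nat => 'z => 'z" where "partial n z = (\<Sum>k<n. component z k)"

lemma partial_tendsto: "z : Z ==> (%n. partial n z) \<longlonglongrightarrow> z" using component(2) unfolding partial_def sums_def .

lemma partial_diff: "z : Z ==> w : Z ==> partial n (z - w) = partial n z - partial n w"
  by (simp add: partial_def component_diff sum_subtractf)

lemma partial_add: "z : Z ==> w : Z ==> partial n (z + w) = partial n z + partial n w"
  by (simp add: partial_def component_add sum.distrib)

lemma partial_scale: "z : Z ==> partial n (a *\<^sub>R z) = a *\<^sub>R partial n z"
  by (simp add: partial_def component_scale scaleR_sum_right)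

text \<open>Baire's theorem finds a ball in the closure of a set on which all partial sums are
  bounded. Differences of members of that set approximate small vectors, and scaling treats the
  rest. Bounds for \<open>z\<close> itself do not follow yet, since the set need not be
  closed.\<close>

lemma partial_approximation:
  obtains K where "0 <= K" "ALL z:Z. ALL h>0. EX w:Z. (ALL n. norm (partial n w) <= K * norm z) & norm (z - w) < h"
proof -
  define A where "A M = {z\<in>Z. ALL n. norm (partial n z) <= real M}" for M :: nat
  have cover: "EX M. z : A M" if zZ: "z : Z" for z
  proof -
    obtain C where C: "!!n. norm (partial n z) <= C"
      using convergent_imp_Bseq[OF convergentI[OF partial_tendsto[OF zZ]]] unfolding Bseq_def by blast
    obtain M :: nat where "C <= real M" using real_arch_simple by blast
    thus ?thesis using C that unfolding A_def by (intro exI[of _ M]) (auto intro: order_trans)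
  qed
  have "Z ~= {}" using subspace_0[OF subspace] by blast
  from complete_covering[OF complete this cover] obtain M z0 d where
    *: "z0 : Z" "0 < d" "Z \<inter> ball z0 d \<subseteq> closure (A M)" by blast
  have small: "EX w:Z. (ALL n. norm (partial n w) <= 2 * real M) & norm (z - w) < h"
    if z: "z : Z" "norm z < d" and h: "0 < h" for z h
  proof -
    have "z0 + z : Z \<inter> ball z0 d" "z0 : Z \<inter> ball z0 d" using * z subspace_add[OF subspace] by (auto simp: dist_norm)
    hence "z0 + z : closure (A M)" "z0 : closure (A M)" using *(3) by blast+
    then obtain u v where u: "u : A M" "dist u (z0 + z) < h / 2" and v: "v : A M" "dist v z0 < h / 2"
      using h half_gt_zero unfolding closure_approachable by metis
    have uv: "u : Z" "v : Z" using u v by (auto simp: A_def)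
    have "norm (partial n (u - v)) <= 2 * real M" for n
    proof -
      have "norm (partial n (u - v)) <= norm (partial n u) + norm (partial n v)"
        unfolding partial_diff[OF uv] by (rule norm_triangle_ineq4)
      also have "\<dots> <= real M + real M" using u(1) v(1) by (intro add_mono) (auto simp: A_def)
      finally show ?thesis by simp
    qed
    moreover have "norm (z - (u - v)) < h"
    proof -
      have "z - (u - v) = (v - z0) - (u - (z0 + z))" by simp
      hence "norm (z - (u - v)) <= norm (v - z0) + norm (u - (z0 + z))" by (metis norm_triangle_ineq4)
      thus ?thesis using u(2) v(2) by (simp add: dist_norm)
    qed
    ultimately show ?thesis using subspace_diff[OF subspace uv] by blast
  qed
  show ?thesis
  proof (rule that[of "4 * real M / d"]; (intro ballI allI impI)?)
    show "0 <= 4 * real M / d" using *(2) by simp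
    fix z and h :: real assume z: "z : Z" and h: "0 < h"
    show "EX w:Z. (ALL n. norm (partial n w) <= 4 * real M / d * norm z) & norm (z - w) < h"
    proof (cases "z = 0")
      case True
      thus ?thesis using h z partial_scale[OF z, of _ 0] by (intro bexI[of _ 0]) simp_all
    next
      case False
      define a where "a = d / (2 * norm z)"
      have a: "0 < a" using False *(2) by (simp add: a_def)
      have "a *\<^sub>R z : Z" "norm (a *\<^sub>R z) < d" using z False *(2) subspace_scale[OF subspace] by (auto simp: a_def)
      from small[OF this, of "a * h"] obtain w where w: "w : Z" "!!n. norm (partial n w) <= 2 * real M" "norm (a *\<^sub>R z - w) < a * h"
        using a h by auto
      show ?thesis
      proof (intro bexI[of _ "(1 / a) *\<^sub>R w"] conjI allI)
        show "(1 / a) *\<^sub>R w : Z" by (rule subspace_scale[OF subspace w(1)])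
        have "norm (partial n ((1 / a) *\<^sub>R w)) = (1 / a) * norm (partial n w)" for n using a by (simp add: partial_scale[OF w(1)])
        moreover have "(1 / a) * norm (partial n w) <= (1 / a) * (2 * real M)" for n using w(2) a by (intro mult_left_mono) auto
        moreover have "(1 / a) * (2 * real M) = 4 * real M / d * norm z" by (simp add: a_def)
        ultimately show "norm (partial n ((1 / a) *\<^sub>R w)) <= 4 * real M / d * norm z" for n by metis
        have "z - (1 / a) *\<^sub>R w = (1 / a) *\<^sub>R (a *\<^sub>R z - w)" using a by (simp add: scaleR_diff_right)
        hence "norm (z - (1 / a) *\<^sub>R w) = norm (a *\<^sub>R z - w) / a" using a by simp
        also have "\<dots> < h" using w(3) a by (simp add: pos_divide_less_eq mult.commute)
        finally show "norm (z - (1 / a) *\<^sub>R w) < h" .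
      qed
    qed
  qed
qed

text \<open>Successive approximation as in the open mapping theorem: \<open>z\<close> is a series of
  approximants with geometrically decreasing bounds on their partial sums. Its components converge
  in the complete spaces \<open>E k\<close> to an expansion of \<open>z\<close>, which by uniqueness
  is the given one.\<close>

lemma partial_bounded:
  obtains K where "0 <= K" "ALL z:Z. ALL n. norm (partial n z) <= K * norm z"
proof -
  obtain K where K: "0 <= K" "ALL z:Z. ALL h>0. EX w:Z. (ALL n. norm (partial n w) <= K * norm z) & norm (z - w) < h"
    by (rule partial_approximation)
  define ap where "ap z h = (SOME w. w : Z & (ALL n. norm (partial n w) <= K * norm z) & norm (z - w) < h)" for z and h :: real
  have ap: "ap z h : Z & (ALL n. norm (partial n (ap z h)) <= K * norm z) & norm (z - ap z h) < h" if "z : Z" "0 < h" for z h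
    unfolding ap_def by (rule someI_ex) (use K(2) that in blast)
  have "norm (partial n z) <= 2 * K * norm z" if z: "z : Z" for z n
  proof (cases "z = 0")
    case True
    thus ?thesis using partial_scale[OF z, of n 0] by simp
  next
    case False
    define q where "q j = norm z * (1 / 2) ^ j" for j
    have q0: "0 < q j" for j using False by (simp add: q_def)
    define t where "t = rec_nat z (%j x. x - ap x (q (Suc j)))"
    have t0: "t 0 = z" and tS: "t (Suc j) = t j - ap (t j) (q (Suc j))" for j by (simp_all add: t_def)
    have tZ: "t j : Z" for j by (induction j) (use z ap q0 subspace_diff[OF subspace] in \<open>simp_all add: t0 tS\<close>)
    have tn: "norm (t j) <= q j" for j
    proof (cases j)
      case (Suc i)
      thus ?thesis using ap[OF tZ[of i] q0[of "Suc i"]] by (simp add: tS less_imp_le)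
    qed (simp add: t0 q_def)
    have step: "norm (partial n (t j) - partial n (t (Suc j))) <= K * q j" for n j
    proof -
      have "partial n (t j) - partial n (t (Suc j)) = partial n (ap (t j) (q (Suc j)))"
        unfolding tS using ap[OF tZ[of j] q0[of "Suc j"]] tZ[of j] by (simp add: partial_diff)
      also have "norm \<dots> <= K * norm (t j)" using ap[OF tZ[of j] q0[of "Suc j"]] by blast
      also have "\<dots> <= K * q j" by (rule mult_left_mono[OF tn K(1)])
      finally show ?thesis .
    qed
    have cau: "norm (partial n (t i) - partial n (t j)) <= 2 * K * q i" if "i <= j" for n i j
    proof -
      have "norm (partial n (t i) - partial n (t j)) <= 2 * K * (q i - q j)" using that
      proof (induction j rule: dec_induct)
        case (step j)
        have "norm (partial n (t i) - partial n (t (Suc j))) <=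
          norm (partial n (t i) - partial n (t j)) + norm (partial n (t j) - partial n (t (Suc j)))"
          using norm_triangle_ineq[of "partial n (t i) - partial n (t j)" "partial n (t j) - partial n (t (Suc j))"] by simp
        also have "\<dots> <= 2 * K * (q i - q j) + K * q j"
          using step.IH `!!n j. norm (partial n (t j) - partial n (t (Suc j))) <= K * q j`[of n j] by linarith
        also have "\<dots> = 2 * K * (q i - q (Suc j))" by (simp add: q_def algebra_simps)
        finally show ?case .
      qed simp
      also have "\<dots> <= 2 * K * q i" using K(1) q0[of j] by (intro mult_left_mono) auto
      finally show ?thesis .
    qed
    have comp: "component x k = partial (Suc k) x - partial k x" for x k by (simp add: partial_def)
    define s where "s j = z - t j" for j
    have sZ: "s j : Z" for j unfolding s_def by (rule subspace_diff[OF subspace z tZ])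
    have ps: "partial n (s j) - partial n (s i) = partial n (t i) - partial n (t j)" for n i j
      by (simp add: s_def partial_diff z tZ)
    have ql: "q \<longlonglongrightarrow> 0" unfolding q_def by (intro tendsto_mult_right_zero LIMSEQ_power_zero) simp
    have "EX y. y : E k & (%j. component (s j) k) \<longlonglongrightarrow> y" for k
    proof -
      have "Cauchy (%j. component (s j) k)"
      proof (rule CauchyI')
        fix \<epsilon> :: real assume \<epsilon>: "0 < \<epsilon>"
        have "(%i. 4 * K * q i) \<longlonglongrightarrow> 0" by (rule tendsto_mult_right_zero[OF ql])
        then obtain M where M: "!!i. M <= i ==> 4 * K * q i < \<epsilon>" using LIMSEQ_D[of _ 0 \<epsilon>] \<epsilon> by fastforce
        have "dist (component (s i) k) (component (s j) k) < \<epsilon>" if "M <= i" "i < j" for i j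
        proof -
          have "component (s j) k - component (s i) k = (partial (Suc k) (t i) - partial (Suc k) (t j)) - (partial k (t i) - partial k (t j))"
            unfolding comp using ps[of "Suc k" j i] ps[of k j i] by (simp add: algebra_simps)
          hence "norm (component (s j) k - component (s i) k) <= 2 * K * q i + 2 * K * q i"
            using norm_triangle_ineq4 cau[of i j "Suc k"] cau[of i j k] that(2) by (smt (verit, best) less_imp_le)
          thus ?thesis using M[OF that(1)] by (simp add: dist_norm norm_minus_commute)
        qed
        thus "EX M. ALL m>=M. ALL n>m. dist (component (s m) k) (component (s n) k) < \<epsilon>" by blast
      qed
      thus ?thesis
        using complete_E[of k, unfolded complete_def, rule_format, of "%j. component (s j) k"] component(1)[OF sZ] by blast
    qed
    then obtain y where y: "!!k. y k : E k" "!!k. (%j. component (s j) k) \<longlonglongrightarrow> y k" by metis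
    have near: "norm (partial n (s i) - (\<Sum>k<n. y k)) <= 2 * K * q i" for n i
    proof (rule LIMSEQ_le_const2)
      show "(%j. norm (partial n (s i) - partial n (s j))) \<longlonglongrightarrow> norm (partial n (s i) - (\<Sum>k<n. y k))"
        unfolding partial_def[of n "s _"] by (intro tendsto_intros y)
      show "EX N. ALL j>=N. norm (partial n (s i) - partial n (s j)) <= 2 * K * q i"
        using cau[of i _ n] by (intro exI[of _ i]) (simp add: ps norm_minus_commute)
    qed
    have "y sums z" unfolding sums_def
    proof (rule LIMSEQ_I)
      fix \<epsilon> :: real assume \<epsilon>: "0 < \<epsilon>"
      have "(%i. (2 * K + 1) * q i) \<longlonglongrightarrow> 0" by (rule tendsto_mult_right_zero[OF ql])
      hence "eventually (%i. (2 * K + 1) * q i < \<epsilon> / 2) sequentially" by (rule order_tendstoD(2)) (use \<epsilon> in simp)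
      then obtain i where i: "(2 * K + 1) * q i < \<epsilon> / 2" using eventually_happens'[OF sequentially_bot] by blast
      obtain N where N: "!!n. N <= n ==> norm (partial n (s i) - s i) < \<epsilon> / 2"
        using LIMSEQ_D[OF partial_tendsto[OF sZ[of i]], of "\<epsilon> / 2"] \<epsilon> by auto
      have "norm ((\<Sum>k<n. y k) - z) < \<epsilon>" if "N <= n" for n
      proof -
        have "(\<Sum>k<n. y k) - z = (partial n (s i) - s i) - (partial n (s i) - (\<Sum>k<n. y k)) - t i" by (simp add: s_def)
        hence "norm ((\<Sum>k<n. y k) - z) = norm ((partial n (s i) - s i) - (partial n (s i) - (\<Sum>k<n. y k)) - t i)" by (rule arg_cong)
        hence "norm ((\<Sum>k<n. y k) - z) <= norm (partial n (s i) - s i) + norm (partial n (s i) - (\<Sum>k<n. y k)) + norm (t i)"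
          using norm_triangle_ineq4[of "(partial n (s i) - s i) - (partial n (s i) - (\<Sum>k<n. y k))" "t i"]
            norm_triangle_ineq4[of "partial n (s i) - s i" "partial n (s i) - (\<Sum>k<n. y k)"] by linarith
        also have "\<dots> < \<epsilon>" using N[OF that] near[of n i] tn[of i] i by (simp add: distrib_right)
        finally show ?thesis .
      qed
      thus "EX N. ALL n>=N. norm ((\<Sum>k<n. y k) - z) < \<epsilon>" by blast
    qed
    hence "component z = y" by (rule component_eqI[OF z y(1)])
    hence "partial n z = (\<Sum>k<n. y k)" by (simp add: partial_def)
    moreover have "partial n (s 0) = 0" using partial_scale[OF z, of n 0] by (simp add: s_def t0)
    ultimately show ?thesis using near[of n 0] by (simp add: q_def)
  qed
  thus ?thesis using K(1) by (intro that[of "2 * K"]) auto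
qed

end

section \<open>Blocks along weakly null trees\<close>

context fdd_space
begin

lemma partial_weakly_null:
  fixes T :: "'a::real_normed_vector => 'z"
  assumes T: "bounded_linear T" "range T \<subseteq> Z" and x: "weakly_null x"
  shows "(%k. partial n (T (x k))) \<longlonglongrightarrow> 0"
proof -
  have "ALL k. EX B. finite B & E k = span B" using E_span by metis
  then obtain B where B: "!!k. finite (B k)" "!!k. E k = span (B k)" by metis
  have TZ: "T u : Z" for u using T(2) by blast
  obtain K where K: "0 <= K" "ALL z:Z. ALL n. norm (partial n z) <= K * norm z" by (rule partial_bounded)
  interpret T: bounded_linear T by (rule T(1))
  obtain D where D: "!!u. norm (T u) <= norm u * D" using T.bounded by blast
  show ?thesis
  proof (rule weakly_null_finite_rank[of "\<Union>k<n. B k", OF _ _ _ x])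
    show "bounded_linear (%u. partial n (T u))"
    proof (rule bounded_linear_intro)
      show "norm (partial n (T u)) <= norm u * (K * D)" for u
      proof -
        have "norm (partial n (T u)) <= K * norm (T u)" using K(2) TZ by blast
        also have "\<dots> <= K * (norm u * D)" by (rule mult_left_mono[OF D K(1)])
        finally show ?thesis by (simp add: mult_ac)
      qed
    qed (simp_all add: T.add T.scaleR partial_add partial_scale TZ)
    show "range (%u. partial n (T u)) \<subseteq> span (\<Union>k<n. B k)"
    proof
      fix y assume "y : range (%u. partial n (T u))"
      then obtain u where y: "y = partial n (T u)" by blast
      have "component (T u) k : span (\<Union>k<n. B k)" if "k < n" for k
        using component(1)[OF TZ, of u k] span_mono[of "B k" "\<Union>k<n. B k"] that unfolding B(2) by blast
      thus "y : span (\<Union>k<n. B k)" unfolding y partial_def by (intro span_sum) simp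
    qed
  qed (use B in blast)
qed

lemma component_finite_sum:
  assumes c: "!!k. c k : E k" "!!k. M <= k ==> c k = 0"
  shows "(\<Sum>k<M. c k) : Z" "component (\<Sum>k<M. c k) = c"
proof -
  show Z: "(\<Sum>k<M. c k) : Z" using c(1) E_subset by (intro subspace_sum[OF subspace]) blast
  show "component (\<Sum>k<M. c k) = c" by (rule component_eqI[OF Z c(1)]) (rule sums_finite, use c(2) in auto)
qed

text \<open>The head of \<open>u\<close> up to \<open>j\<close> is small and is replaced by a short
  nonzero vector of \<open>E j\<close>, so that the support begins exactly at \<open>j\<close>; the
  far tail is cut off.\<close>

lemma block_near:
  assumes u: "u : Z" and j: "E j ~= {0}" and small: "norm (partial (Suc j) u) < h"
  shows "EX w M. w : Z & component w j ~= 0 & (ALL k. component w k ~= 0 --> j <= k & k < M) & norm (u - w) < 3 * h"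
proof -
  have h: "0 < h" using small norm_ge_zero[of "partial (Suc j) u"] by linarith
  obtain y0 where y0: "y0 : E j" "y0 ~= 0" using j subspace_0[OF subspace_E[of j]] by blast
  define y where "y = (h / 2 / norm y0) *\<^sub>R y0"
  have y: "y : E j" "y ~= 0" "norm y = h / 2" unfolding y_def using y0 h subspace_scale[OF subspace_E] by auto
  obtain N where N: "!!n. N <= n ==> norm (partial n u - u) < h" using LIMSEQ_D[OF partial_tendsto[OF u] h] by blast
  define M where "M = max N (Suc j)"
  have jM: "Suc j <= M" by (simp add: M_def)
  define c where "c k = (if k = j then y else if j < k & k < M then component u k else 0)" for k
  have c: "c k : E k" for k using y(1) component(1)[OF u] subspace_0[OF subspace_E] by (auto simp: c_def)
  have c0: "c k = 0" if "M <= k" for k using that jM by (auto simp: c_def)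
  note w = component_finite_sum[OF c c0]
  have "(\<Sum>k<M. c k) = (\<Sum>k<Suc j. c k) + (\<Sum>k\<in>{Suc j..<M}. c k)"
    using sum.atLeastLessThan_concat[of 0 "Suc j" M c] jM by (simp add: lessThan_atLeast0)
  also have "(\<Sum>k<Suc j. c k) = y" by (simp add: c_def)
  also have "(\<Sum>k\<in>{Suc j..<M}. c k) = (\<Sum>k\<in>{Suc j..<M}. component u k)" by (intro sum.cong) (auto simp: c_def)
  also have "\<dots> = partial M u - partial (Suc j) u" unfolding partial_def lessThan_atLeast0
    using sum.atLeastLessThan_concat[of 0 "Suc j" M "component u"] jM by (metis add_diff_cancel_left' le0)
  finally have sum: "u - (\<Sum>k<M. c k) = partial (Suc j) u - (partial M u - u) - y" by simp
  have "norm (u - (\<Sum>k<M. c k)) <= norm (partial (Suc j) u) + norm (partial M u - u) + norm y"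
    unfolding sum using norm_triangle_ineq4[of "partial (Suc j) u - (partial M u - u)" y]
      norm_triangle_ineq4[of "partial (Suc j) u" "partial M u - u"] by linarith
  also have "\<dots> < 3 * h" using small N[of M] y(3) h by (simp add: M_def)
  finally show ?thesis using w y(2) jM by (intro exI[of _ "\<Sum>k<M. c k"] exI[of _ M]) (auto simp: c_def)
qed

text \<open>Otherwise a fixed partial sum would be the identity on \<open>Z\<close>. By
  \<open>partial_weakly_null\<close> the images of a normalized weakly null node would tend to 0,
  against the lower bound for \<open>T\<close>.\<close>

lemma nonzero_summands:
  fixes T :: "'a::real_normed_vector => 'z"
  assumes T: "bounded_linear T" "range T \<subseteq> Z" "0 < d" "!!u. d * norm u <= norm (T u)"
    and x: "weakly_null_even_tree (x :: nat list => 'a)"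
  shows "EX j>=M. E j ~= {0}"
proof (rule ccontr)
  assume no: "~ ?thesis"
  have fin: "partial M z = z" if "z : Z" for z
  proof -
    have "component z k = 0" if "M <= k" for k using no that component(1)[OF `z : Z`, of k] by blast
    hence "component z sums partial M z" unfolding partial_def by (intro sums_finite) auto
    thus ?thesis using component(2)[OF that] sums_unique2 by blast
  qed
  have "weakly_null (%k. x ([1] @ [k]))" using x unfolding weakly_null_even_tree_def by (auto simp del: append.simps)
  from partial_weakly_null[OF T(1,2) this, of M] have "(%k. T (x [1, k])) \<longlonglongrightarrow> 0"
    using fin[OF range_subsetD[OF T(2)]] by simp
  from LIMSEQ_D[OF this T(3)] obtain k0 where k0: "!!k. k0 <= k ==> norm (T (x [1, k])) < d" by auto
  have "[1, k0 + 2] : even_tuples" by (simp add: even_tuples_def increasing_tuple_def)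
  hence "norm (x [1, k0 + 2]) = 1" using x by (simp add: weakly_null_even_tree_def)
  thus False using T(4)[of "x [1, k0 + 2]"] k0[of "k0 + 2"] by simp
qed

text \<open>Position \<open>2 * l - 2\<close> of the list is the entry with number
  \<open>2 * l - 1\<close> of the branch. Nothing is asked of \<open>w\<close> for
  \<open>l = 0\<close>, which lets the recursion start with the empty tuple.\<close>

definition block_at :: "(nat list => 'z) => real => nat => nat list => nat => 'z => bool" where
  "block_at u \<delta> l t M w \<longleftrightarrow> increasing_tuple t & length t = 2 * l & (0 < l --> w : Z & component w (t ! (2 * l - 2)) ~= 0 &
     (ALL k. component w k ~= 0 --> t ! (2 * l - 2) <= k & k < M) & norm (u t - w) <= \<delta> / 2 ^ (l + 1))"

text \<open>The order of choices matters: first the odd entry \<open>p\<close>, beyond all earlier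
  supports and with \<open>E p\<close> nonzero; only then does weak nullness of the node provide a
  \<open>k\<close> for which the head of the vector up to \<open>p\<close> is small.\<close>

lemma block_branch_step:
  fixes T :: "'a::real_normed_vector => 'z"
  assumes T: "bounded_linear T" "range T \<subseteq> Z" "0 < d" "!!u. d * norm u <= norm (T u)"
    and x: "weakly_null_even_tree (x :: nat list => 'a)" and t: "block_at (%t. T (x t)) d l t M w"
  shows "EX p k M' w'. block_at (%t. T (x t)) d (Suc l) (t @ [p, k]) M' w' & M <= p"
proof -
  have t': "increasing_tuple t" "length t = 2 * l" using t by (auto simp: block_at_def)
  from nonzero_summands[OF T x, of "Suc (sum_list t + M)"] obtain p where p: "Suc (sum_list t + M) <= p" "E p ~= {0}"
    by (elim exE conjE)
  have lt: "a < p" if "a : set t" for a using member_le_sum_list[OF that] p(1) by linarith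
  hence tp: "increasing_tuple (t @ [p])" unfolding increasing_tuple_append using t'(1) p(1) by auto
  define h where "h = d / 2 ^ (l + 2) / 3"
  have h: "0 < h" using T(3) by (simp add: h_def)
  have "odd (length (t @ [p]))" using t'(2) by simp
  hence "weakly_null (%k. x ((t @ [p]) @ [k]))" using x tp unfolding weakly_null_even_tree_def by blast
  from LIMSEQ_D[OF partial_weakly_null[OF T(1,2) this, of "Suc p"] h] obtain k0 where
    k0: "!!k. k0 <= k ==> norm (partial (Suc p) (T (x ((t @ [p]) @ [k])))) < h" by auto
  define k where "k = k0 + Suc p"
  have "increasing_tuple ((t @ [p]) @ [k])"
    unfolding increasing_tuple_append[of "t @ [p]"] using tp by (auto simp: k_def dest: lt)
  hence tpk: "increasing_tuple (t @ [p, k])" by simp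
  have "T (x (t @ [p, k])) : Z" "norm (partial (Suc p) (T (x (t @ [p, k])))) < h"
    using T(2) k0[of k] by (auto simp: k_def)
  from block_near[OF this(1) p(2) this(2)] obtain w' M' where w': "w' : Z" "component w' p ~= 0"
    "ALL k. component w' k ~= 0 --> p <= k & k < M'" "norm (T (x (t @ [p, k])) - w') < 3 * h" by blast
  have "block_at (%t. T (x t)) d (Suc l) (t @ [p, k]) M' w'"
    unfolding block_at_def using tpk t'(2) w' by (auto simp: nth_append h_def)
  moreover have "M <= p" using p(1) by simp
  ultimately show ?thesis by blast
qed

lemma block_branch:
  fixes T :: "'a::real_normed_vector => 'z"
  assumes T: "bounded_linear T" "range T \<subseteq> Z" "0 < d" "!!u. d * norm u <= norm (T u)"
    and x: "weakly_null_even_tree (x :: nat list => 'a)"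
  obtains n :: "nat => nat" and M w where "strict_mono_on {1..} n" "1 <= n 1"
    "ALL l>=1. w l : Z & component (w l) (n (2 * l - 1)) ~= 0 & (ALL k. component (w l) k ~= 0 --> n (2 * l - 1) <= k & k < M l)"
    "ALL l>=1. norm (T (x (map n [1..<2 * l + 1])) - w l) <= d / 2 ^ (l + 1)"
    "ALL l>=1. map n [1..<2 * l + 1] : even_tuples" "ALL l. M l <= n (2 * l + 1)"
proof -
  define P where "P l s \<longleftrightarrow> (case s of (t, M, w) => block_at (%t. T (x t)) d l t M w)" for l s
  define R where "R s s' \<longleftrightarrow> (EX p k. fst s' = fst s @ [p, k] & fst (snd s) <= p)"
    for s s' :: "nat list \<times> nat \<times> 'z"
  have "EX f. ALL l. P l (f l) & R (f l) (f (Suc l))"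
  proof (rule dependent_nat_choice)
    show "EX s. P 0 s" by (intro exI[of _ "([], 0, 0)"]) (simp add: P_def block_at_def)
    fix s l assume "P l s"
    then obtain t M w where s: "s = (t, M, w)" and b: "block_at (%t. T (x t)) d l t M w" by (cases s) (auto simp: P_def)
    from block_branch_step[OF T x b] obtain p k M' w' where
      "block_at (%t. T (x t)) d (Suc l) (t @ [p, k]) M' w'" "M <= p" by blast
    thus "EX s'. P (Suc l) s' & R s s'" by (intro exI[of _ "(t @ [p, k], M', w')"]) (simp add: P_def R_def s)
  qed
  then obtain f where f: "!!l. P l (f l)" "!!l. R (f l) (f (Suc l))" by blast
  define t where "t l = fst (f l)" for l
  define M where "M l = fst (snd (f l))" for l
  define w where "w l = snd (snd (f l))" for l
  have b: "block_at (%t. T (x t)) d l (t l) (M l) (w l)" for l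
    using f(1)[of l] by (simp add: P_def t_def M_def w_def case_prod_beta)
  have len: "length (t l) = 2 * l" "increasing_tuple (t l)" for l using b[of l] by (auto simp: block_at_def)
  have stable: "t l' ! i = t l ! i" if "i < 2 * l" "l <= l'" for i l l' using that(2)
  proof (induction l' rule: dec_induct)
    case (step l')
    obtain p k where "t (Suc l') = t l' @ [p, k]" using f(2)[of l'] by (auto simp: R_def t_def)
    thus ?case using step that(1) len(1)[of l'] by (simp add: nth_append)
  qed simp
  define n where "n i = t i ! (i - 1)" for i
  have nt: "n (Suc i) = t l ! i" if "i < 2 * l" for i l
    using stable[of i l "max l (Suc i)"] stable[of i "Suc i" "max l (Suc i)"] that by (simp add: n_def)
  have map: "map n [1..<2 * l + 1] = t l" for l by (rule nth_equalityI) (use nt in "auto simp: len simp del: upt_Suc")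
  have nb: "t l ! (2 * l - 2) = n (2 * l - 1)" if "1 <= l" for l
  proof -
    have "Suc (2 * l - 2) = 2 * l - 1" using that by simp
    thus ?thesis using nt[of "2 * l - 2" l] that by simp
  qed
  show ?thesis
  proof (rule that[of n w M])
    show "strict_mono_on {1..} n"
    proof (rule strict_mono_onI)
      fix a b :: nat assume ab: "a : {1..}" "b : {1..}" "a < b"
      have "t b ! (a - 1) < t b ! (b - 1)"
        using len[of b] ab by (intro sorted_wrt_nth_less[of "(<)"]) (auto simp: increasing_tuple_def)
      thus "n a < n b" using nt[of "a - 1" b] nt[of "b - 1" b] ab by simp
    qed
    have "t 1 ! 0 : set (t 1)" by (rule nth_mem) (simp add: len)
    thus "1 <= n 1" using len(2)[of 1] by (auto simp: n_def increasing_tuple_def)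
    show "ALL l. M l <= n (2 * l + 1)"
    proof
      fix l
      obtain p k where "t (Suc l) = t l @ [p, k]" "M l <= p" using f(2)[of l] by (auto simp: R_def t_def M_def)
      thus "M l <= n (2 * l + 1)" using nt[of "2 * l" "Suc l"] len(1)[of l] by (simp add: nth_append)
    qed
    show "ALL l>=1. map n [1..<2 * l + 1] : even_tuples"
    proof (intro allI impI)
      fix l :: nat assume "1 <= l"
      hence "t l ~= []" using len(1)[of l] by auto
      thus "map n [1..<2 * l + 1] : even_tuples" unfolding map using len[of l] by (simp add: even_tuples_def)
    qed
    show "ALL l>=1. norm (T (x (map n [1..<2 * l + 1])) - w l) <= d / 2 ^ (l + 1)"
      unfolding map using b by (simp add: block_at_def)
    show "ALL l>=1. w l : Z & component (w l) (n (2 * l - 1)) ~= 0 &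
        (ALL k. component (w l) k ~= 0 --> n (2 * l - 1) <= k & k < M l)" using b nb by (simp add: block_at_def)
  qed
qed

text \<open>The perturbation errors \<open>d / 2 ^ (l + 1)\<close> are summable and each coefficient
  is at most the Tsirelson norm of the combination, so they cost only the additive 1 in the
  constant. Unconditionality removes the bounded factors \<open>norm (w l)\<close>.\<close>

lemma tree_estimates_of_blocks:
  fixes T :: "'a::real_normed_vector => 'z"
  assumes S: "tsirelson S c" and ub: "upper_block_estimates Z E (tnorm S c)"
    and T: "bounded_linear T" "range T \<subseteq> Z" "0 < d" "!!u. d * norm u <= norm (T u)"
  shows "upper_tree_estimates TYPE('a) (tnorm S c)"
proof -
  interpret N: tsirelson S c by (rule S)
  interpret T: bounded_linear T by (rule T(1))
  obtain B where B: "0 < B" "!!u. norm (T u) <= norm u * B" using T.pos_bounded by blast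
  obtain D where D: "1 <= D" "!!z. normalized_block_sequence Z E z ==> dominated D z (tnorm S c) (%i. unit_vec (Min (fdd_supp E (z i))))"
    using ub unfolding upper_block_estimates_def by blast
  show ?thesis unfolding upper_tree_estimates_def
  proof (intro exI[of _ "D * (B + d) / d + 1"] conjI allI impI)
    show "1 <= D * (B + d) / d + 1" using D(1) B(1) T(3) by simp
    fix x :: "nat list => 'a" assume x: "weakly_null_even_tree x"
    obtain n :: "nat => nat" and M w where n: "strict_mono_on {1..} n" "1 <= n 1"
      and w: "ALL l>=1. w l : Z & component (w l) (n (2 * l - 1)) ~= 0 & (ALL k. component (w l) k ~= 0 --> n (2 * l - 1) <= k & k < M l)"
      and near: "ALL l>=1. norm (T (x (map n [1..<2 * l + 1])) - w l) <= d / 2 ^ (l + 1)"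
      and ev: "ALL l>=1. map n [1..<2 * l + 1] : even_tuples" and Mn: "ALL l. M l <= n (2 * l + 1)"
      by (rule block_branch[OF T x])
    define m where "m l = n (2 * l - 1)" for l
    note w = w[folded m_def]
    have Mm: "M l <= m (Suc l)" for l using Mn by (simp add: m_def)
    have mless: "m i < m i'" if "1 <= i" "i < i'" for i i'
      unfolding m_def by (rule strict_mono_onD[OF n(1)]) (use that in auto)
    have m1: "1 <= m i" if "1 <= i" for i using mless[of 1 i] n(2) that by (cases "i = 1") (auto simp: m_def)
    define X where "X l = x (map n [1..<2 * l + 1])" for l
    have X1: "norm (X l) = 1" if "1 <= l" for l using x ev that unfolding weakly_null_even_tree_def X_def by blast
    have nearX: "norm (T (X l) - w l) <= d / 2 ^ (l + 1)" if "1 <= l" for l using near that unfolding X_def by blast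
    have pw: "d / 2 ^ (l + 1) <= d / 2" if "1 <= l" for l :: nat
      using T(3) self_le_power[of "2 :: real" "l + 1"] by (intro divide_left_mono) auto
    have wlow: "0 < norm (w l)" if "1 <= l" for l
    proof -
      have "d <= norm (T (X l))" using T(4)[of "X l"] X1[OF that] by simp
      thus ?thesis using nearX[OF that] pw[OF that] T(3) norm_triangle_ineq2[of "T (X l)" "w l"] by linarith
    qed
    have wup: "norm (w l) <= B + d" if "1 <= l" for l
      using B(2)[of "X l"] X1[OF that] nearX[OF that] pw[OF that] T(3) norm_triangle_ineq2[of "w l" "T (X l)"]
      by (simp add: norm_minus_commute)
    define z where "z l = (1 / norm (w l)) *\<^sub>R w l" for l
    have supp: "fdd_supp E (z l) = {i. component (w l) i ~= 0}" if "1 <= l" for l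
      using w that wlow[OF that] by (simp add: fdd_supp_eq z_def component_scale)
    have fin: "finite (fdd_supp E (z l))" if "1 <= l" for l
      unfolding supp[OF that] by (rule finite_subset[of _ "{..<M l}"]) (use w that in auto)
    have Min: "Min (fdd_supp E (z l)) = m l" if "1 <= l" for l using w that by (intro Min_eqI fin) (auto simp: supp)
    have Max: "Max (fdd_supp E (z l)) < M l" if "1 <= l" for l
    proof (subst Max_less_iff[OF fin[OF that]])
      show "fdd_supp E (z l) ~= {}" "ALL a:fdd_supp E (z l). a < M l" using w that by (auto simp: supp)
    qed
    have "normalized_block_sequence Z E z" unfolding normalized_block_sequence_def
    proof (intro allI impI conjI)
      fix i :: nat assume i: "1 <= i"
      show "z i : Z" using w i unfolding z_def by (intro subspace_scale[OF subspace]) blast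
      show "norm (z i) = 1" using wlow[OF i] by (simp add: z_def)
      show "Max (fdd_supp E (z i)) < Min (fdd_supp E (z (i + 1)))" using Max[OF i] Min[of "i + 1"] Mm[of i] by simp
    qed (rule fin)
    note nb = D(2)[OF this, unfolded dominated_def, rule_format]
    have dom: "norm (\<Sum>i\<in>F. a i *\<^sub>R z i) <= D * tnorm S c (%k. \<Sum>i\<in>F. a i * unit_vec (m i) k)"
      if "finite F" "F \<subseteq> {1..}" for F a
    proof -
      have "(%k. \<Sum>i\<in>F. a i * unit_vec (Min (fdd_supp E (z i))) k) = (%k. \<Sum>i\<in>F. a i * unit_vec (m i) k)"
        using that(2) Min by (intro ext sum.cong) auto
      thus ?thesis using nb[of F a] that by simp
    qed
    show "EX n. strict_mono_on {1..} n & 1 <= n 1 &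
        dominated (D * (B + d) / d + 1) (%l. x (map n [1..<2 * l + 1])) (tnorm S c) (%l. unit_vec (n (2 * l - 1)))"
    proof (intro exI[of _ n] conjI n)
      show "dominated (D * (B + d) / d + 1) (%l. x (map n [1..<2 * l + 1])) (tnorm S c) (%l. unit_vec (n (2 * l - 1)))"
        unfolding dominated_def m_def[symmetric] X_def[symmetric]
      proof (intro allI impI)
        fix F :: "nat set" and a :: "nat => real" assume F: "finite F & F \<subseteq> {1..}"
        hence F1: "1 <= i" if "i : F" for i using that by auto
        let ?N = "tnorm S c (%k. \<Sum>i\<in>F. a i * unit_vec (m i) k)"
        have m1: "1 <= m i" if "i : F" for i using m1[OF F1[OF that]] .
        have vc: "(%k. \<Sum>i\<in>F. a i * unit_vec (m i) k) : c00" by (intro sum_c00 scale_c00 unit_vec_c00 m1)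
        have minj: "inj_on m F" using mless F1 by (intro linorder_inj_onI) (auto dest: less_imp_neq)
        have "(\<Sum>i\<in>F. a i *\<^sub>R w i) = (\<Sum>i\<in>F. (a i * norm (w i)) *\<^sub>R z i)"
          using wlow F1 by (intro sum.cong) (auto simp: z_def)
        hence A: "norm (\<Sum>i\<in>F. a i *\<^sub>R w i) <= D * tnorm S c (%k. \<Sum>i\<in>F. (a i * norm (w i)) * unit_vec (m i) k)"
          using dom F by simp
        have "tnorm S c (%k. \<Sum>i\<in>F. (a i * norm (w i)) * unit_vec (m i) k) <= tnorm S c (%k. \<Sum>i\<in>F. ((B + d) * a i) * unit_vec (m i) k)"
        proof (rule N.tnorm_coefficients_mono[OF _ minj m1])
          fix i assume "i : F"
          hence "\<bar>a i\<bar> * norm (w i) <= \<bar>a i\<bar> * (B + d)" using wup F1 by (intro mult_left_mono) auto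
          thus "\<bar>a i * norm (w i)\<bar> <= \<bar>(B + d) * a i\<bar>" using B(1) T(3) by (simp add: abs_mult mult.commute)
        qed (use F in auto)
        also have "(%k. \<Sum>i\<in>F. ((B + d) * a i) * unit_vec (m i) k) = (%k. (B + d) * (\<Sum>i\<in>F. a i * unit_vec (m i) k))"
          by (simp add: sum_distrib_left mult.assoc)
        also have "tnorm S c \<dots> = (B + d) * ?N" using B(1) T(3) by (simp add: N.tnorm_scale[OF vc])
        finally have "tnorm S c (%k. \<Sum>i\<in>F. (a i * norm (w i)) * unit_vec (m i) k) <= (B + d) * ?N" .
        hence 1: "norm (\<Sum>i\<in>F. a i *\<^sub>R w i) <= D * ((B + d) * ?N)"
          using D(1) by (intro order_trans[OF A mult_left_mono]) auto
        have "norm (\<Sum>i\<in>F. a i *\<^sub>R (T (X i) - w i)) <= (\<Sum>i\<in>F. ?N * (d / 2 ^ (i + 1)))"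
        proof (rule sum_norm_le)
          fix i assume i: "i : F"
          have "\<bar>a i\<bar> <= ?N" by (rule N.coefficient_le_tnorm[OF _ minj m1 i]) (use F in auto)
          hence "\<bar>a i\<bar> * norm (T (X i) - w i) <= ?N * (d / 2 ^ (i + 1))"
            using nearX[OF F1[OF i]] by (intro mult_mono) auto
          thus "norm (a i *\<^sub>R (T (X i) - w i)) <= ?N * (d / 2 ^ (i + 1))" by simp
        qed
        also have "\<dots> = ?N * d / 2 * (\<Sum>i\<in>F. (1 / 2) ^ i)" by (simp add: sum_distrib_left power_one_over divide_simps)
        also have "(\<Sum>i\<in>F. (1 / 2 :: real) ^ i) <= (\<Sum>i<Suc (Max F). (1 / 2) ^ i)"
          using F by (intro sum_mono2) (auto simp: less_Suc_eq_le)
        also have "\<dots> <= 2" by (subst sum_gp_strict) simp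
        finally have 2: "norm (\<Sum>i\<in>F. a i *\<^sub>R (T (X i) - w i)) <= ?N * d" using T(3) by (simp add: mult_left_mono)
        have "T (\<Sum>i\<in>F. a i *\<^sub>R X i) = (\<Sum>i\<in>F. a i *\<^sub>R (T (X i) - w i)) + (\<Sum>i\<in>F. a i *\<^sub>R w i)"
          by (simp add: T.sum T.scaleR sum.distrib[symmetric] scaleR_add_right[symmetric])
        hence "d * norm (\<Sum>i\<in>F. a i *\<^sub>R X i) <= ?N * d + D * ((B + d) * ?N)"
          using T(4)[of "\<Sum>i\<in>F. a i *\<^sub>R X i"] 1 2 norm_triangle_ineq[of "\<Sum>i\<in>F. a i *\<^sub>R (T (X i) - w i)" "\<Sum>i\<in>F. a i *\<^sub>R w i"]
          by simp
        thus "norm (\<Sum>i\<in>F. a i *\<^sub>R X i) <= (D * (B + d) / d + 1) * ?N" using T(3) by (simp add: field_simps)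
      qed
    qed
  qed
qed

end

lemma embeds_imp_tree_estimates:
  assumes s: "approximating s" and "embeds_with_Tsirelson_upper_fdd TYPE('a::banach) TYPE('z::real_normed_vector) s \<alpha>"
  shows "Tsirelson_upper_tree_estimates TYPE('a) s \<alpha>"
proof -
  from assms(2) obtain Z :: "'z set" and E c where Z: "complete Z" "subspace Z" "embeds_into TYPE('a) Z" "fdd Z E"
    and c: "0 < c" "c < 1" and ub: "upper_block_estimates Z E (Tsirelson_norm s \<alpha> c)"
    unfolding embeds_with_Tsirelson_upper_fdd_def by blast
  from Z(3) obtain T :: "'a => 'z" and d where T: "bounded_linear T" "range T \<subseteq> Z" "0 < d" "!!x. d * norm x <= norm (T x)"
    unfolding embeds_into_def by blast
  interpret fdd_space Z E by unfold_locales (rule Z)+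
  have "upper_tree_estimates TYPE('a) (Tsirelson_norm s \<alpha> c)" unfolding Tsirelson_norm_eq[OF s c]
    by (rule tree_estimates_of_blocks[OF tsirelson_Schreier[OF s c] ub[unfolded Tsirelson_norm_eq[OF s c]] T])
  thus ?thesis unfolding Tsirelson_upper_tree_estimates_def using c by blast
qed

section \<open>Branch systems of bounded variation\<close>

text \<open>For \<open>\<alpha> = 0\<close> the Szlenk derivations are replaced by a potential on the dual ball: along weak-star
  convergent nets it pays for the norm distance to the limit.\<close>

locale potential =
  fixes e :: "nat => 'a::real_normed_vector" and \<Phi> :: "'a dual => real" and M :: real
  assumes e: "!!j. norm (e j) <= 1" "closure (span (range e)) = UNIV"
    and range: "!!f. f : dual_ball ==> 0 <= \<Phi> f & \<Phi> f <= M"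
    and drop: "!!f \<delta>. f : dual_ball ==> 0 < \<delta> ==>
      EX U. openin weak_star U & f : U & (ALL g:U \<inter> dual_ball. \<Phi> g + norm (g - f) <= \<Phi> f + \<delta>)"
begin

text \<open>The assumption \<open>drop\<close> makes \<Phi> weak-star upper semicontinuous on the
  ball; maxima over closed pieces are attained for this reason.\<close>

lemma closedin_superlevel:
  assumes "closedin weak_star A" "A \<subseteq> dual_ball"
  shows "closedin weak_star {f : A. y <= \<Phi> f}"
proof -
  have "openin weak_star (- {f : A. y <= \<Phi> f})"
  proof (subst openin_subopen, intro ballI)
    fix f assume f: "f : - {f : A. y <= \<Phi> f}"
    show "EX T. openin weak_star T & f : T & T \<subseteq> - {f : A. y <= \<Phi> f}"
    proof (cases "f : A")
      case False
      have "openin weak_star (- A)" using assms(1) by (simp add: closedin_def Compl_eq_Diff_UNIV)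
      thus ?thesis using False by (intro exI[of _ "- A"]) auto
    next
      case True
      hence fb: "f : dual_ball" "\<Phi> f < y" using f assms(2) by auto
      then obtain U where U: "openin weak_star U" "f : U" "ALL g:U \<inter> dual_ball. \<Phi> g + norm (g - f) <= \<Phi> f + (y - \<Phi> f) / 2"
        using drop[OF fb(1), of "(y - \<Phi> f) / 2"] by auto
      have "\<Phi> g < y" if "g : U" "g : A" for g
      proof -
        have "\<Phi> g + norm (g - f) <= \<Phi> f + (y - \<Phi> f) / 2" using U(3) that assms(2) by blast
        moreover have "\<Phi> f + (y - \<Phi> f) / 2 < y" using fb(2) by (simp add: field_simps)
        ultimately show ?thesis using norm_ge_zero[of "g - f"] by linarith
      qed
      thus ?thesis using U by (intro exI[of _ U]) fastforce
    qed
  qed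
  thus ?thesis by (simp add: closedin_def Compl_eq_Diff_UNIV)
qed

lemma maximum_attained:
  assumes A: "closed_piece A"
  shows "EX f:A. ALL g:A. \<Phi> g <= \<Phi> f"
proof -
  have A': "closedin weak_star A" "A \<subseteq> dual_ball" "A ~= {}" using A by (auto simp: closed_piece_def)
  define s where "s = (SUP f\<in>A. \<Phi> f)"
  have bdd: "bdd_above (\<Phi> ` A)" using A'(2) range by (intro bdd_aboveI[of _ M]) auto
  have "(\<Inter>n\<in>UNIV. {f : A. s - 1 / real (Suc n) <= \<Phi> f}) ~= {}"
  proof (rule nested_closed_nonempty)
    show "closedin weak_star {f : A. s - 1 / real (Suc n) <= \<Phi> f}" for n by (rule closedin_superlevel[OF A'(1,2)])
    show "{f : A. s - 1 / real (Suc n) <= \<Phi> f} ~= {}" for n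
    proof -
      have "s - 1 / real (Suc n) < s" by simp
      then obtain f where "f : A" "s - 1 / real (Suc n) < \<Phi> f" unfolding s_def using less_cSUP_iff[OF A'(3) bdd] by blast
      thus ?thesis by (auto simp: less_imp_le)
    qed
    fix i j :: nat
    have "1 / real (Suc i) <= 1 / real (Suc j) \<or> 1 / real (Suc j) <= 1 / real (Suc i)" by linarith
    thus "{f : A. s - 1 / real (Suc i) <= \<Phi> f} \<subseteq> {f : A. s - 1 / real (Suc j) <= \<Phi> f} \<or>
        {f : A. s - 1 / real (Suc j) <= \<Phi> f} \<subseteq> {f : A. s - 1 / real (Suc i) <= \<Phi> f}"
      by (elim disjE) (auto intro: order_trans[rotated])
  qed (use A'(2) in auto)
  then obtain f where f: "f : A" "!!n. s - 1 / real (Suc n) <= \<Phi> f" by auto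
  have "s <= \<Phi> f"
  proof (rule field_le_epsilon)
    fix d :: real assume "0 < d"
    then obtain n where "1 / real (Suc n) < d" using reals_Archimedean by (auto simp: inverse_eq_divide)
    thus "s <= \<Phi> f + d" using f(2)[of n] by linarith
  qed
  moreover have "\<Phi> g <= s" if "g : A" for g unfolding s_def by (rule cSUP_upper[OF that bdd])
  ultimately show ?thesis using f(1) by (meson order_trans)
qed

definition top_rep :: "'a dual set => 'a dual" where
  "top_rep A = (SOME f. f : A & (ALL g:A. \<Phi> g <= \<Phi> f))"

lemma top_rep:
  assumes "closed_piece A"
  shows "top_rep A : A" "!!g. g : A ==> \<Phi> g <= \<Phi> (top_rep A)"
proof -
  have "EX f. f : A & (ALL g:A. \<Phi> g <= \<Phi> f)" using maximum_attained[OF assms] by blast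
  from someI_ex[OF this] show "top_rep A : A" "!!g. g : A ==> \<Phi> g <= \<Phi> (top_rep A)" unfolding top_rep_def by blast+
qed

text \<open>The later drop of \<Phi> is not known when a level is chosen. Rounding it up to
  multiples of \<open>1 / 2 ^ k\<close> leaves finitely many cases to prepare for.\<close>

definition settled :: "nat => 'a dual set => nat => bool" where
  "settled k A m \<longleftrightarrow> (ALL i <= nat \<lceil>M * 2 ^ k\<rceil> + 1. ALL B C t. closed_piece B --> closed_piece C --> C \<subseteq> B --> B \<subseteq> A \<inter> cell e m t -->
     \<Phi> (top_rep A) - real i / 2 ^ k <= \<Phi> (top_rep C) --> norm (top_rep C - top_rep B) <= 4 * ((real i + 1) / 2 ^ k))"

lemma settled_mono: "settled k A m ==> m <= m' ==> settled k A m'"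
  unfolding settled_def using cell_antimono[of m m' e] by (meson le_inf_iff order_trans)

text \<open>Where \<Phi> is within \<open>h\<close> of its maximum, \<open>drop\<close> confines
  points near \<open>f\<close> to distance \<open>2 * h\<close>: one \<open>h\<close> for the height
  of the band, one for the error. Two representatives in one set of the cover are thus within
  \<open>4 * h\<close>.\<close>

lemma settled_exists:
  assumes A: "closed_piece A"
  shows "EX m. settled k A m"
proof -
  have A': "closedin weak_star A" "A \<subseteq> dual_ball" using A by (auto simp: closed_piece_def)
  have "EX m. ALL B C t. closed_piece B --> closed_piece C --> C \<subseteq> B --> B \<subseteq> A \<inter> cell e m t -->
     \<Phi> (top_rep A) - real i / 2 ^ k <= \<Phi> (top_rep C) --> norm (top_rep C - top_rep B) <= 4 * ((real i + 1) / 2 ^ k)" for i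
  proof -
    define h where "h = (real i + 1) / 2 ^ k"
    have h: "0 < h" "real i / 2 ^ k <= h" by (auto simp: h_def divide_right_mono)
    define L where "L = {f : A. \<Phi> (top_rep A) - h <= \<Phi> f}"
    have L: "closedin weak_star L" "L \<subseteq> dual_ball" unfolding L_def using closedin_superlevel[OF A'] A'(2) by auto
    have "EX U. openin weak_star U & f : U & (ALL g:U \<inter> L. norm (g - f) <= 2 * h)" if f: "f : L" for f
    proof -
      have "f : dual_ball" using f L(2) by blast
      from drop[OF this h(1)] obtain U where U: "openin weak_star U" "f : U"
        "ALL g:U \<inter> dual_ball. \<Phi> g + norm (g - f) <= \<Phi> f + h" by blast
      have "norm (g - f) <= 2 * h" if g: "g : U" "g : L" for g
      proof -
        have "\<Phi> g + norm (g - f) <= \<Phi> f + h" using U(3) g L(2) by blast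
        moreover have "\<Phi> f <= \<Phi> (top_rep A)" using top_rep(2)[OF A] f by (simp add: L_def)
        moreover have "\<Phi> (top_rep A) - h <= \<Phi> g" using g(2) by (simp add: L_def)
        ultimately show ?thesis by linarith
      qed
      thus ?thesis using U(1,2) by blast
    qed
    hence cover: "EX U. openin weak_star U & f : U & (EX f. ALL g:U \<inter> L. norm (g - f) <= 2 * h)" if "f : L" for f
      using that by blast
    obtain m where m: "ALL B t. B ~= {} --> B \<subseteq> cell e m t \<inter> L --> (EX U. (EX f. ALL g:U \<inter> L. norm (g - f) <= 2 * h) & B \<subseteq> U)"
      by (rule cell_lebesgue[OF e(2) L cover])
    have "norm (top_rep C - top_rep B) <= 4 * h"
      if a: "closed_piece B" "closed_piece C" "C \<subseteq> B" "B \<subseteq> A \<inter> cell e m t" "\<Phi> (top_rep A) - real i / 2 ^ k <= \<Phi> (top_rep C)" for B C t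
    proof -
      have in_B: "top_rep B : B" "top_rep C : B" using top_rep(1)[OF a(1)] top_rep(1)[OF a(2)] a(3) by auto
      have "\<Phi> (top_rep C) <= \<Phi> (top_rep B)" by (rule top_rep(2)[OF a(1) in_B(2)])
      hence in_L: "top_rep B : L" "top_rep C : L" using in_B a(4,5) h(2) by (auto simp: L_def)
      hence "{top_rep B, top_rep C} \<subseteq> cell e m t \<inter> L" using in_B a(4) by blast
      hence "EX U. (EX f. ALL g:U \<inter> L. norm (g - f) <= 2 * h) & {top_rep B, top_rep C} \<subseteq> U" by (rule m[rule_format, rotated]) simp
      then obtain U f where U: "ALL g:U \<inter> L. norm (g - f) <= 2 * h" "{top_rep B, top_rep C} \<subseteq> U" by (elim exE conjE)
      have "norm (top_rep C - f) <= 2 * h" "norm (top_rep B - f) <= 2 * h" using U in_L by simp_all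
      thus ?thesis using norm_triangle_ineq4[of "top_rep C - f" "top_rep B - f"] by simp
    qed
    thus ?thesis unfolding h_def by blast
  qed
  then obtain m where m: "!!i B C t. closed_piece B ==> closed_piece C ==> C \<subseteq> B ==> B \<subseteq> A \<inter> cell e (m i) t ==>
     \<Phi> (top_rep A) - real i / 2 ^ k <= \<Phi> (top_rep C) ==> norm (top_rep C - top_rep B) <= 4 * ((real i + 1) / 2 ^ k)"
    by metis
  define J where "J = nat \<lceil>M * 2 ^ k\<rceil> + 1"
  have "settled k A (\<Sum>i\<le>J. m i)" unfolding settled_def J_def[symmetric]
  proof (intro allI impI)
    fix i B C t assume i: "i <= J" and a: "closed_piece B" "closed_piece C" "C \<subseteq> B" "B \<subseteq> A \<inter> cell e (\<Sum>i\<le>J. m i) t"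
      "\<Phi> (top_rep A) - real i / 2 ^ k <= \<Phi> (top_rep C)"
    have "m i <= (\<Sum>i\<le>J. m i)" using i by (intro member_le_sum) auto
    hence "B \<subseteq> A \<inter> cell e (m i) t" using a(4) cell_antimono[of "m i" "\<Sum>i\<le>J. m i" e t] by blast
    thus "norm (top_rep C - top_rep B) <= 4 * ((real i + 1) / 2 ^ k)" by (rule m[OF a(1-3) _ a(5)])
  qed
  thus ?thesis by blast
qed

text \<open>A step costs at most four times the fall of \<Phi> over two levels, plus a summable
  rounding error. The falls telescope to at most \<open>2 * M\<close>, the errors sum to at most 16,
  and the step away from the root costs at most 1.\<close>

lemma variation_bound:
  assumes st: "ALL n. ALL t:dual_ball. ALL k <= n. settled k (cell e (\<l> n) t) (\<l> (Suc n))" and \<l>: "strict_mono \<l>"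
    and tb: "tb b : dual_ball"
  shows "(\<Sum>n<K. norm (branch_rep e top_rep \<l> tb (Suc n) b - branch_rep e top_rep \<l> tb n b)) <= 8 * M + 24"
proof -
  define A where "A n = cell e (\<l> n) (tb b)" for n
  have cp: "closed_piece (A m)" for m unfolding A_def by (rule closed_piece_cell[OF tb])
  have sub: "A m' \<subseteq> A m" if "m <= m'" for m m'
    unfolding A_def by (rule cell_antimono) (use that \<l> in "simp add: strict_mono_less_eq")
  have in_ball: "top_rep (A n) : dual_ball" for n
    using top_rep(1)[OF cp[of n]] cp[of n] unfolding closed_piece_def by blast
  define h where "h n = \<Phi> (top_rep (A n))" for n
  have h: "0 <= h n" "h n <= M" for n using range[OF in_ball[of n]] by (auto simp: h_def)
  have hmono: "h n <= h m" if "m <= n" for m n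
    unfolding h_def using top_rep(2)[OF cp[of m]] top_rep(1)[OF cp[of n]] sub[OF that] by blast
  have stp: "norm (top_rep (A (Suc (Suc n))) - top_rep (A (Suc n))) <= 4 * (h n - h (Suc (Suc n))) + 8 / 2 ^ n" for n
  proof -
    define d where "d = h n - h (Suc (Suc n))"
    have d: "0 <= d" "d <= M" using hmono[of n "Suc (Suc n)"] h[of n] h[of "Suc (Suc n)"] by (auto simp: d_def)
    define i where "i = nat \<lceil>d * 2 ^ n\<rceil>"
    have ri: "real i = real_of_int \<lceil>d * 2 ^ n\<rceil>" using d(1) by (simp add: i_def)
    have i: "d * 2 ^ n <= real i" "real i < d * 2 ^ n + 1" unfolding ri  by linarith+
    have "\<lceil>d * 2 ^ n\<rceil> <= \<lceil>M * 2 ^ n\<rceil>" using d(2) by (intro ceiling_mono mult_right_mono) auto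
    hence le: "i <= nat \<lceil>M * 2 ^ n\<rceil> + 1" unfolding i_def using nat_mono by (metis le_add1 order_trans)
    have "settled n (A n) (\<l> (Suc n))" using st tb unfolding A_def by blast
    moreover have "A (Suc n) \<subseteq> A n \<inter> cell e (\<l> (Suc n)) (tb b)" using sub[of n "Suc n"] by (auto simp: A_def)
    moreover have "\<Phi> (top_rep (A n)) - real i / 2 ^ n <= \<Phi> (top_rep (A (Suc (Suc n))))"
    proof -
      have "d <= real i / 2 ^ n" using i(1) by (simp add: pos_le_divide_eq)
      thus ?thesis by (simp add: d_def h_def)
    qed
    ultimately have "norm (top_rep (A (Suc (Suc n))) - top_rep (A (Suc n))) <= 4 * ((real i + 1) / 2 ^ n)"
      unfolding settled_def using le cp sub[of "Suc n" "Suc (Suc n)"] by (meson le_SucI order_refl)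
    also have "\<dots> <= 4 * ((d * 2 ^ n + 2) / 2 ^ n)" using i(2) by (intro mult_left_mono divide_right_mono) auto
    also have "\<dots> = 4 * d + 8 / 2 ^ n" by (simp add: field_simps)
    finally show ?thesis by (simp add: d_def)
  qed
  let ?r = "%n. branch_rep e top_rep \<l> tb n b"
  have r: "?r (Suc n) = top_rep (A (Suc n))" "?r 0 = 0" for n by (simp_all add: branch_rep_def A_def)
  have sumh: "(\<Sum>n<K. h n - h (Suc (Suc n))) <= 2 * M" for K
  proof -
    have "(\<Sum>n<K. h n - h (Suc (Suc n))) = h 0 + h 1 - h K - h (Suc K)" by (induction K) simp_all
    thus ?thesis using h[of 0] h[of 1] h[of K] h[of "Suc K"] by linarith
  qed
  have sum2: "(\<Sum>n<K. 8 / 2 ^ n) <= (16 :: real)" for K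
  proof -
    have "(\<Sum>n<K. 8 / 2 ^ n) = 8 * (\<Sum>n<K. (1 / 2 :: real) ^ n)" by (simp add: sum_distrib_left power_one_over)
    also have "\<dots> <= 8 * 2" by (intro mult_left_mono) (subst sum_gp_strict, simp_all)
    finally show ?thesis by simp
  qed
  have "(\<Sum>n<Suc K. norm (?r (Suc n) - ?r n)) <= 8 * M + 24" for K
  proof -
    have "(\<Sum>n<Suc K. norm (?r (Suc n) - ?r n)) = norm (?r (Suc 0) - ?r 0) + (\<Sum>n<K. norm (?r (Suc (Suc n)) - ?r (Suc n)))"
      by (rule sum.lessThan_Suc_shift)
    also have "norm (?r (Suc 0) - ?r 0) <= 1" unfolding r using in_ball[of "Suc 0"] by simp
    also have "(\<Sum>n<K. norm (?r (Suc (Suc n)) - ?r (Suc n))) <= (\<Sum>n<K. 4 * (h n - h (Suc (Suc n))) + 8 / 2 ^ n)"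
      unfolding r by (intro sum_mono stp)
    also have "\<dots> = 4 * (\<Sum>n<K. h n - h (Suc (Suc n))) + (\<Sum>n<K. 8 / 2 ^ n)" by (simp only: sum.distrib sum_distrib_left)
    also have "\<dots> <= 4 * (2 * M) + 16" by (intro add_mono mult_left_mono sumh sum2) simp
    finally show ?thesis by simp
  qed
  from order_trans[OF sum_mono2 this[of K], of "{..<K}"] show ?thesis by simp
qed

lemma bounded_variation_branches:
  assumes s: "approximating s" and c: "0 < c" "c < 1"
  obtains r C where "branch_system e (r :: nat => nat => 'a dual)" "osc_estimate (Schreier s \<alpha>) c Suc C r"
proof -
  interpret T: tsirelson "Schreier s \<alpha>" c by (rule tsirelson_Schreier[OF s c])
  obtain \<l> where \<l>: "ALL n. 2 * n + 2 <= \<l> n" "strict_mono \<l>"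
    "ALL n. ALL t:dual_ball. ALL k <= n. settled k (cell e (\<l> n) t) (\<l> (Suc n))"
    by (rule thin_levels[OF e(1) settled_mono settled_exists])
  obtain tb :: "nat => 'a dual" where tb: "ALL b. tb b : dual_ball"
    "ALL n. ALL t:dual_ball. EX b. cell e (\<l> n) (tb b) = cell e (\<l> n) t" by (rule representative_branches[OF e(1)])
  let ?r = "branch_rep e top_rep \<l> tb"
  have bs: "branch_system e ?r" by (rule branch_system_branch_rep[OF e top_rep(1) \<l>(1,2) tb])
  have "osc_estimate (Schreier s \<alpha>) c Suc (8 * M + 24) ?r" unfolding osc_estimate_def
  proof (intro allI impI)
    fix b I and en :: "nat => nat" and a :: "nat => real"
    assume I: "finite I" "ALL i:I. i < en i" "ALL i:I. ALL j:I. i < j --> en i <= j" and a: "ALL i:I. 0 <= a i"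
    let ?N = "tnorm (Schreier s \<alpha>) c (%k. \<Sum>i\<in>I. a i * unit_vec (Suc (Suc i)) k)"
    have aN: "a i <= ?N" if "i : I" for i
      using T.coefficient_le_tnorm[OF I(1) _ _ that, of "%i. Suc (Suc i)" a] by (auto simp: inj_on_def)
    let ?v = "%n. norm (?r (Suc n) b - ?r n b)"
    have "(\<Sum>i\<in>I. osc ?r b i (en i)) <= (\<Sum>i\<in>I. \<Sum>n\<in>{i..<en i}. ?v n)"
      using I(2) by (intro sum_mono osc_le_steps) (auto intro: less_imp_le)
    also have "\<dots> = (\<Sum>n\<in>(\<Union>i\<in>I. {i..<en i}). ?v n)"
    proof (rule sum.UNION_disjoint[symmetric])
      show "ALL i:I. ALL j:I. i ~= j --> {i..<en i} \<inter> {j..<en j} = {}"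
      proof (intro ballI impI)
        fix i j assume "i : I" "j : I" "i ~= j"
        hence "en i <= j \<or> en j <= i" using I(3) by (meson linorder_neqE_nat)
        thus "{i..<en i} \<inter> {j..<en j} = {}" by auto
      qed
    qed (use I(1) in auto)
    also have "\<dots> <= (\<Sum>n<Max (insert 0 (en ` I)). ?v n)"
    proof (rule sum_mono2)
      show "(\<Union>i\<in>I. {i..<en i}) \<subseteq> {..<Max (insert 0 (en ` I))}"
      proof
        fix n assume "n : (\<Union>i\<in>I. {i..<en i})"
        then obtain i where i: "i : I" "n < en i" by auto
        hence "en i <= Max (insert 0 (en ` I))" using I(1) by (intro Max_ge) auto
        thus "n : {..<Max (insert 0 (en ` I))}" using i(2) by simp
      qed
    qed auto
    also have "\<dots> <= 8 * M + 24" by (rule variation_bound[OF \<l>(3,2) tb(1)[rule_format]])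
    finally have o: "(\<Sum>i\<in>I. osc ?r b i (en i)) <= 8 * M + 24" .
    have "(\<Sum>i\<in>I. a i * osc ?r b i (en i)) <= (\<Sum>i\<in>I. ?N * osc ?r b i (en i))"
      using aN I(2) by (intro sum_mono mult_right_mono osc_nonneg) (auto intro: less_imp_le)
    also have "\<dots> = ?N * (\<Sum>i\<in>I. osc ?r b i (en i))" by (simp add: sum_distrib_left)
    also have "\<dots> <= ?N * (8 * M + 24)" by (rule mult_left_mono[OF o T.tnorm_nonneg])
    finally show "(\<Sum>i\<in>I. a i * osc ?r b i (en i)) <= (8 * M + 24) * ?N" by (simp only: mult.commute)
  qed
  thus ?thesis using bs that by blast
qed

end

section \<open>The potential for \<alpha> = 0\<close>

lemma tnorm_Schreier_0_le:
  assumes s: "approximating s" and c: "0 < c" "c < 1" and x: "x : c00" "!!k. \<bar>x k\<bar> <= B"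
  shows "tnorm (Schreier s 0) c x <= B"
proof -
  interpret tsirelson "Schreier s 0" c by (rule tsirelson_Schreier[OF s c])
  let ?N = "tnorm (Schreier s 0) c x"
  \<comment> \<open>Only one block is admissible, and it contributes at most \<open>c\<close> times
    the norm; since \<open>c < 1\<close>, the coefficients decide.\<close>
  have "?N <= max B (c * ?N)"
  proof (rule tnorm_upper[OF x(1)])
    show "\<bar>x k\<bar> <= max B (c * ?N)" for k using x(2)[of k] by simp
    fix M assume "M : Schreier s 0" "M ~= {}"
    then obtain n where M: "M = {n}" by (auto simp: Schreier_0)
    have "tnorm (Schreier s 0) c (restr (blk M n) x) <= ?N" by (intro tnorm_mono restr_c00 x(1)) (simp add: restr_def)
    thus "c * (\<Sum>m\<in>M. tnorm (Schreier s 0) c (restr (blk M m) x)) <= max B (c * ?N)"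
      using c(1) unfolding M by (simp add: le_max_iff_disj mult_left_mono)
  qed
  moreover have "?N <= B" if "?N <= c * ?N"
  proof -
    have "(1 - c) * ?N <= 0" using that by (simp add: left_diff_distrib)
    hence "?N <= 0" using c(2) by (simp add: mult_le_0_iff)
    thus ?thesis using x(2)[of 0] by linarith
  qed
  ultimately show ?thesis by (auto simp: le_max_iff_disj)
qed

text \<open>\<open>debt f \<kappa>\<close>: an adversary who moves \<open>f\<close> to weak-star close points can collect norm distances of
  total more than \<open>\<kappa>\<close>.\<close>

inductive debt :: "'a::real_normed_vector dual => real => bool" where
  base: "f : dual_ball ==> \<kappa> < 0 ==> debt f \<kappa>"
| step: "f : dual_ball ==> 0 <= \<eta> ==>
    (!!U. openin weak_star U ==> f : U ==> EX g:U. \<eta> <= norm (g - f) & debt g (\<kappa> - \<eta>)) ==> debt f \<kappa>"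

lemma debt_mono: "debt f k ==> k' <= k ==> debt f k'"
proof (induction arbitrary: k' rule: debt.induct)
  case (base f k)
  thus ?case by (intro debt.base) auto
next
  case (step f h k)
  show ?case
  proof (rule debt.step[OF step.hyps(1,2)])
    fix U :: "'a dual set" assume "openin weak_star U" "f : U"
    from step.IH[OF this] step.prems show "EX g:U. h <= norm (g - f) & debt g (k' - h)" by fastforce
  qed
qed

text \<open>The winning condition asks that the recorded distances sum to more than \<Lambda>.
  Recorded distances are positive, so steps of size 0 become slides.\<close>

lemma debt_adv: "debt f k ==> \<Lambda> <= k + sum_list (map snd t) ==> adv (%t. \<Lambda> < sum_list (map snd t)) t f"
proof (induction arbitrary: t rule: debt.induct)
  case (base f k)
  thus ?case by (intro adv.stop) auto
next
  case (step f h k)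
  show ?case
  proof (cases "h = 0")
    case True
    show ?thesis
    proof (rule adv.slide[OF step.hyps(1)])
      fix U :: "'a dual set" assume "openin weak_star U" "f : U"
      from step.IH[OF this] step.prems show "EX g:U. adv (%t. \<Lambda> < sum_list (map snd t)) t g" using True by fastforce
    qed
  next
    case False
    show ?thesis
    proof (rule adv.jump[OF step.hyps(1)])
      fix n
      have "EX g:U. h <= norm (g - f) & adv (%t. \<Lambda> < sum_list (map snd t)) (t @ [(n, h)]) g" if "openin weak_star U" "f : U" for U
      proof -
        from step.IH[OF that] obtain g where g: "g : U" "h <= norm (g - f)"
          "ALL t. \<Lambda> <= k - h + sum_list (map snd t) --> adv (%t. \<Lambda> < sum_list (map snd t)) t g" by blast
        have "\<Lambda> <= k - h + sum_list (map snd (t @ [(n, h)]))" using step.prems by simp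
        thus ?thesis using g by blast
      qed
      thus "EX h>0. ALL U. openin weak_star U & f : U -->
          (EX g:U. h <= norm (g - f) & adv (%t. \<Lambda> < sum_list (map snd t)) (t @ [(n, h)]) g)"
        using False step.hyps(2) by (intro exI[of _ h]) auto
    qed
  qed
qed

text \<open>The branch is tested with all coefficients equal to 1, a vector of norm at most 1; the
  16 is the constant of the tree game. If there is no normalized weakly null sequence, no step of
  positive size is possible and every debt is negative.\<close>

lemma debt_bounded:
  fixes hs :: "nat => 'a::real_normed_vector dual" and f :: "'a dual"
  assumes s: "approximating s" and c: "0 < c" "c < 1" and hs: "closure (range hs) = UNIV" and C: "1 <= C"
    and est: "!!x :: nat list => 'a. weakly_null_even_tree x ==>
        (EX n :: nat => nat. strict_mono_on {1..} n & 1 <= n 1 &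
           dominated C (%l. x (map n [1..<2 * l + 1])) (tnorm (Schreier s 0) c) (%l. unit_vec (n (2 * l - 1))))"
    and debt: "debt f u"
  shows "u <= 16 * C"
proof (cases "EX w :: nat => 'a. weakly_null w & (ALL k. norm (w k) = 1)")
  case True
  then obtain w :: "nat => 'a" where w: "weakly_null w" "!!k. norm (w k) = 1" by blast
  have adv: "adv (%t. u < sum_list (map snd t)) [] f" by (rule debt_adv[OF debt]) simp
  obtain m :: "nat => nat" and r h where m: "strict_mono m" "1 <= m 0" "u < sum_list (map snd (map (%i. (m i, h i)) [0..<r]))"
    "ALL i<r. 0 < h i"
    "ALL a. (ALL i<r. 0 <= a i) --> (\<Sum>i<r. a i * h i) / 16 <= C * tnorm (Schreier s 0) c (%k. \<Sum>i<r. a i * unit_vec (m i) k)"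
    by (rule adv_upper_tree_estimate[OF hs w est adv])
  have m1: "1 <= m i" for i using m(1,2) strict_mono_less_eq[OF m(1), of 0 i] by simp
  have "tnorm (Schreier s 0) c (%k. \<Sum>i<r. 1 * unit_vec (m i) k) <= 1"
  proof (rule tnorm_Schreier_0_le[OF s c])
    show "(%k. \<Sum>i<r. 1 * unit_vec (m i) k) : c00" by (intro sum_c00 scale_c00 unit_vec_c00 m1)
    fix k
    have "(\<Sum>i<r. 1 * unit_vec (m i) k) = real (card {i. i < r & m i = k})"
      by (simp add: unit_vec_def sum.If_cases Int_def eq_commute[of k])
    moreover have "card {i. i < r & m i = k} <= 1"
    proof -
      have "{i. i < r & m i = k} \<subseteq> {inv m k}" using inv_f_f[OF strict_mono_imp_inj_on[OF m(1)]] by auto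
      from card_mono[OF _ this] show ?thesis by simp
    qed
    ultimately show "\<bar>\<Sum>i<r. 1 * unit_vec (m i) k\<bar> <= 1" by simp
  qed
  hence "C * tnorm (Schreier s 0) c (%k. \<Sum>i<r. 1 * unit_vec (m i) k) <= C * 1" using C by (intro mult_left_mono) auto
  moreover have "(\<Sum>i<r. 1 * h i) / 16 <= C * tnorm (Schreier s 0) c (%k. \<Sum>i<r. 1 * unit_vec (m i) k)"
    using m(5)[rule_format, of "%_. 1"] by simp
  moreover have "sum_list (map snd (map (%i. (m i, h i)) [0..<r])) = (\<Sum>i<r. 1 * h i)"
    by (simp add: comp_def sum_list_distinct_conv_sum_set lessThan_atLeast0)
  ultimately show ?thesis using m(3) by linarith
next
  case False
  have o: "openin weak_star (UNIV :: 'a dual set)" using openin_topspace[of weak_star] by simp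
  from debt have "u < 0"
  proof (induction rule: debt.induct)
    case (step f h u)
    have "h = 0"
    proof (rule ccontr)
      assume "h ~= 0"
      have Q: "EX g:U. h <= norm (g - f) & g : UNIV" if "openin weak_star U" "f : U" for U using step.IH[OF that] by blast
      obtain g x where "!!k. norm (x k) = 1" "weakly_null (x :: nat => 'a)" "!!k. g k : (UNIV :: 'a dual set)"
        by (rule weakly_null_node[OF hs _ Q o]) (use `h ~= 0` step.hyps(2) in auto)
      thus False using `~ (EX w. _ w)` by blast
    qed
    thus ?case using step.IH[OF o UNIV_I] by auto
  qed
  thus ?thesis using C by simp
qed

definition max_debt :: "'a::real_normed_vector dual => real" where
  "max_debt f = Sup {\<kappa>. debt f \<kappa>}"

text \<open>Otherwise every neighbourhood contains a point whose maximal debt plus distance exceeds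
  that of \<open>f\<close> by more than \<open>d\<close>. Rounding the distances down to multiples
  of \<open>d / 2\<close> leaves finitely many values, so a single one works in all neighbourhoods,
  and \<open>debt.step\<close> gives \<open>f\<close> a debt above its supremum.\<close>

lemma max_debt_drop:
  fixes f :: "'a::real_normed_vector dual"
  assumes bdd: "!!(f :: 'a dual) k. debt f k ==> k <= M" and f: "f : dual_ball" and d: "0 < d"
  shows "EX U. openin weak_star U & f : U & (ALL g:U \<inter> dual_ball. max_debt g + norm (g - f) <= max_debt f + d)"
proof (rule ccontr)
  assume no: "~ ?thesis"
  have ba: "bdd_above {k. debt g k}" for g :: "'a dual" using bdd by (intro bdd_aboveI[of _ M]) auto
  have ne: "{k. debt g k} ~= {}" if "g : dual_ball" for g :: "'a dual" using debt.base[OF that, of "- 1"] by auto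
  define h where "h i = real i * (d / 2)" for i :: nat
  define k where "k = max_debt f + d / 2"
  define J where "J = nat \<lceil>4 / d\<rceil>"
  define good where "good U i \<longleftrightarrow> (EX g:U. h i <= norm (g - f) & debt g (k - h i))" for U and i :: nat
  have some_good: "EX i <= J. good U i" if "openin weak_star U" "f : U" for U
  proof -
    have "~ (ALL g:U \<inter> dual_ball. max_debt g + norm (g - f) <= max_debt f + d)" using no that by blast
    then obtain g where g: "g : U" "g : dual_ball" "max_debt f + d < max_debt g + norm (g - f)"
      unfolding Ball_def Int_iff not_all not_imp not_le by blast
    define i where "i = nat \<lfloor>norm (g - f) / (d / 2)\<rfloor>"
    have ri: "real i = of_int \<lfloor>norm (g - f) / (d / 2)\<rfloor>" using d by (simp add: i_def)
    have "real i <= norm (g - f) / (d / 2)" "norm (g - f) / (d / 2) < real i + 1" unfolding ri by linarith+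
    hence i: "h i <= norm (g - f)" "norm (g - f) < h i + d / 2" using d by (simp_all add: h_def field_simps)
    have "norm (g - f) <= 2" using norm_triangle_ineq4[of g f] f g(2) by simp
    hence "norm (g - f) / (d / 2) <= 4 / d" using d by (simp add: field_simps)
    hence "i <= J" unfolding i_def J_def by (intro nat_mono) linarith
    moreover have "k - h i < Sup {k. debt g k}" using g(3) i(2) by (simp add: k_def max_debt_def)
    then obtain k' where "debt g k'" "k - h i < k'" unfolding less_cSup_iff[OF ne[OF g(2)] ba] by auto
    hence "good U i" unfolding good_def using debt_mono[of g k' "k - h i"] g(1) i(1) by (meson less_imp_le)
    ultimately show ?thesis by blast
  qed
  have "EX i <= J. ALL U. openin weak_star U & f : U --> good U i"
  proof (rule ccontr)
    assume "~ ?thesis"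
    then obtain U where U: "!!i. i <= J ==> openin weak_star (U i) & f : U i & ~ good (U i) i" by metis
    have "openin weak_star (\<Inter>i\<in>{..J}. U i)" using U by (intro openin_INT2) auto
    moreover have "f : (\<Inter>i\<in>{..J}. U i)" using U by auto
    ultimately obtain i where "i <= J" "good (\<Inter>i\<in>{..J}. U i) i" using some_good by blast
    moreover from this have "good (U i) i" unfolding good_def by blast
    ultimately show False using U by blast
  qed
  then obtain i where i: "!!U. openin weak_star U ==> f : U ==> good U i" by blast
  have "debt f k" by (rule debt.step[OF f, of "h i"]) (use d i in \<open>auto simp: good_def h_def\<close>)
  hence "k <= max_debt f" unfolding max_debt_def using ba by (intro cSup_upper) auto
  thus False using d by (simp add: k_def)
qed

lemma max_debt_range:
  fixes f :: "'a::real_normed_vector dual"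
  assumes bdd: "!!(f :: 'a dual) k. debt f k ==> k <= M" and f: "f : dual_ball"
  shows "0 <= max_debt f & max_debt f <= M"
proof -
  have ba: "bdd_above {k. debt f k}" using bdd by (intro bdd_aboveI[of _ M]) auto
  have "- d <= max_debt f" if "0 < d" for d
    unfolding max_debt_def by (rule cSup_upper[OF _ ba]) (use debt.base[OF f] that in auto)
  hence "0 <= max_debt f + d" if "0 < d" for d using that by force
  hence "0 <= max_debt f" by (rule field_le_epsilon)
  moreover have "{k. debt f k} ~= {}" using debt.base[OF f, of "- 1"] by auto
  hence "max_debt f <= M" unfolding max_debt_def using bdd by (intro cSup_least) auto
  ultimately show ?thesis ..
qed

lemma tree_estimates_0_imp_embeds:
  assumes s: "approximating s" and sep: "separable_space (euclidean :: 'a::banach dual topology)"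
    and est: "Tsirelson_upper_tree_estimates TYPE('a) s 0"
  shows "embeds_with_Tsirelson_upper_fdd TYPE('a) TYPE(linfty) s 0"
proof -
  from est obtain c where c: "0 < c" "c < 1" and "upper_tree_estimates TYPE('a) (tnorm (Schreier s 0) c)"
    unfolding Tsirelson_upper_tree_estimates_def using Tsirelson_norm_eq[OF s] by metis
  then obtain C where C: "1 <= C" "!!x :: nat list => 'a. weakly_null_even_tree x ==>
        (EX n :: nat => nat. strict_mono_on {1..} n & 1 <= n 1 &
           dominated C (%l. x (map n [1..<2 * l + 1])) (tnorm (Schreier s 0) c) (%l. unit_vec (n (2 * l - 1))))"
    unfolding upper_tree_estimates_def by blast
  obtain h :: "nat => 'a dual" and e :: "nat => 'a" where h: "closure (range h) = UNIV"
    and e: "closure (span (range e)) = UNIV" "!!j. norm (e j) <= 1"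
    by (rule separable_dual_total_sequence[OF sep], rule that) (assumption | simp)+
  have bdd: "k <= 16 * C" if "debt f k" for f :: "'a dual" and k using debt_bounded[OF s c h C that] .
  interpret potential e max_debt "16 * C"
  proof
    fix f :: "'a dual" assume f: "f : dual_ball"
    show "0 <= max_debt f & max_debt f <= 16 * C" by (rule max_debt_range[OF bdd f])
    fix d :: real assume "0 < d"
    show "EX U. openin weak_star U & f : U & (ALL g:U \<inter> dual_ball. max_debt g + norm (g - f) <= max_debt f + d)"
      by (rule max_debt_drop[OF bdd f \<open>0 < d\<close>])
  qed (fact e)+
  obtain r C' where "branch_system e (r :: nat => nat => 'a dual)" "osc_estimate (Schreier s 0) c Suc C' r"
    by (rule bounded_variation_branches[OF s c])
  thus ?thesis using branch_system_imp_embeds[OF s c e(2), of r Suc 0 C'] by (simp add: strict_mono_Suc_iff)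
qed

lemma szlenk_index_imp_embeds:
  assumes s: "approximating s" and sep: "separable_space (euclidean :: 'a::banach dual topology)"
    and index: "szlenk_index_at_most TYPE('a) (wexp (\<alpha> * omega))"
  shows "embeds_with_Tsirelson_upper_fdd TYPE('a) TYPE(linfty) s \<alpha>"
proof -
  obtain h :: "nat => 'a dual" and e :: "nat => 'a" where
    "closure (range h) = UNIV" and e: "closure (span (range e)) = UNIV" "!!j. norm (e j) <= 1"
    by (rule separable_dual_total_sequence[OF sep], rule that) (assumption | simp)+
  have "szlenk_derived (1 / 2) (wexp (\<alpha> * omega)) = ({} :: 'a dual set)"
    by (rule szlenk_index_at_mostD[OF index]) simp
  from szlenk_imp_branch_system[OF s e(2,1) this] obtain c r Q C where
    "0 < c" "c < 1" "branch_system e (r :: nat => nat => 'a dual)" "strict_mono Q" "1 <= Q 0"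
    "osc_estimate (Schreier s \<alpha>) c Q C r" by blast
  thus ?thesis using branch_system_imp_embeds[OF s _ _ e(1)] by blast
qed

theorem theorem1p3:
  fixes s :: "ctbl_ord \<Rightarrow> nat \<Rightarrow> ctbl_ord" and \<alpha> :: ctbl_ord
  assumes "approximating s"
    and "separable_space (euclidean :: ('a::banach \<Rightarrow>\<^sub>L real) topology)"
  shows
    "(szlenk_index_at_most TYPE('a) (oexp omega (\<alpha> * omega))
        \<longrightarrow> Tsirelson_upper_tree_estimates TYPE('a) s \<alpha>) \<and>
     (\<alpha> \<noteq> 0 \<longrightarrow> Tsirelson_upper_tree_estimates TYPE('a) s \<alpha>
        \<longrightarrow> szlenk_index_at_most TYPE('a) (oexp omega (\<alpha> * omega))) \<and>
     (Tsirelson_upper_tree_estimates TYPE('a) s \<alpha>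
        \<longleftrightarrow> embeds_with_Tsirelson_upper_fdd TYPE('a) TYPE(linfty) s \<alpha>) \<and>
     (embeds_with_Tsirelson_upper_fdd TYPE('a) TYPE('z::real_normed_vector) s \<alpha>
        \<longrightarrow> Tsirelson_upper_tree_estimates TYPE('a) s \<alpha>)"
proof -
  note embed = szlenk_index_imp_embeds[OF assms, of \<alpha>]
  note tree = embeds_imp_tree_estimates[OF assms(1), where 'a = 'a and \<alpha> = \<alpha> and 'z = linfty]
    embeds_imp_tree_estimates[OF assms(1), where 'a = 'a and \<alpha> = \<alpha> and 'z = 'z]
  have index: "szlenk_index_at_most TYPE('a) (wexp (\<alpha> * omega))"
    if "\<alpha> ~= 0" "Tsirelson_upper_tree_estimates TYPE('a) s \<alpha>"
    using szlenk_index_at_mostI[OF tree_estimates_imp_derived_empty[OF assms that]] .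
  \<comment> \<open>For nonzero \<alpha> through the Szlenk index, for \<alpha> = 0 through the
    potential.\<close>
  have "embeds_with_Tsirelson_upper_fdd TYPE('a) TYPE(linfty) s \<alpha>" if "Tsirelson_upper_tree_estimates TYPE('a) s \<alpha>"
    using tree_estimates_0_imp_embeds[OF assms] embed[OF index] that by (cases "\<alpha> = 0") auto
  thus ?thesis using embed index tree by blast
qed

end
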